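(* There exists a self-improving sorter whose limiting complexity is $O(n+H(\pi(I)))$ for every input distribution $\mathcal{D}=\prod_{i=1}^n\mathcal{D}_i$ of product type. Its worst-case running time is $O(n\log n)$. No comparison-based algorithm can sort an input drawn from $\mathcal{D}$ with fewer than $H(\pi(I))$ comparisons in expectation. Moreover, for any constant $\varepsilon>0$, the storage can be made $O(n^{1+\varepsilon})$ with an expected limiting running time of $O(\varepsilon^{-1}(n+H(\pi(I))))$. The training phase lasts $O(n^{\varepsilon})$ rounds, and the probability that it fails is at most $1/n$.
   Context: Inputs are sequences $I=(x_1,\dots,x_n)$ of real numbers. The input distribution $\mathcal{D}=\prod_i\mathcal{D}_i$ is of product type: each $x_i$ is drawn independently from an arbitrary, unknown distribution $\mathcal{D}_i$ on $\mathbb{R}$. A self-improving algorithm receives a sequence $I_1,I_2,\dots$ of inputs, each drawn independently from $\mathcal{D}$, and must output the answer for each (here: the sorted order of each input). It first runs a training phase, in which it computes answers while collecting information about $\mathcal{D}$ and building data structures. It then enters a limiting (stationary) phase in which these data structures are fixed. The limiting complexity is the expected running time, over $I\sim\mathcal{D}$, of the algorithm in the limiting phase. The training phase fails if the data structures it builds do not yield the stated limiting guarantee. $\pi(I)$ denotes the permutation induced by the ranks of the $x_i$, with ties broken by index; it is a random variable when $I\sim\mathcal{D}$. $H(X)=\sum_x\Pr[X=x]\log(1/\Pr[X=x])$ is the Shannon entropy. A comparison-based algorithm computing a function $X:\mathcal{U}\to\mathcal{X}$ (for a finite set $\mathcal{X}$) is a rooted binary tree. Each internal node is a test $f(I)\le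 g(I)$ for arbitrary functions $f,g:\mathcal{U}\to\mathbb{R}$, and each leaf is labeled by an output, such that every input $I$ reaches a leaf labeled $X(I)$. Its expected number of comparisons is the expected depth of the leaf reached when $I\sim\mathcal{D}$. *)

theory Defs
  imports "HOL-Probability.Probability"
begin

section \<open>Inputs, ranks and entropy\<close>

text \<open>
  An input of length \<open>n\<close> is a function of type \<open>nat \<Rightarrow> real\<close> read on \<open>{..<n}\<close>.
  The permutation induced by the ranks, ties broken by index, is given as the list
  of the (0-based) ranks of \<open>x\<^sub>0, \<dots>, x\<^sub>n\<^sub>-\<^sub>1\<close>.
\<close>

definition rank_perm :: "nat \<Rightarrow> (nat \<Rightarrow> real) \<Rightarrow> nat list" where
  "rank_perm n x = map (\<lambda>i. card {j. j < n \<and> (x j < x i \<or> x j = x i \<and> j < i)}) [0..<n]"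

definition coordinate_laws :: "nat \<Rightarrow> (nat \<Rightarrow> real measure) \<Rightarrow> bool" where
  "coordinate_laws n D \<longleftrightarrow> (\<forall>i<n. prob_space (D i) \<and> sets (D i) = sets borel)"

definition input_law :: "nat \<Rightarrow> (nat \<Rightarrow> real measure) \<Rightarrow> (nat \<Rightarrow> real) measure" where
  "input_law n D = (\<Pi>\<^sub>M i\<in>{..<n}. D i)"

text \<open>The law of \<open>T\<close> independent inputs.\<close>

definition inputs_law :: "nat \<Rightarrow> nat \<Rightarrow> (nat \<Rightarrow> real measure) \<Rightarrow> (nat \<Rightarrow> nat \<Rightarrow> real) measure" where
  "inputs_law T n D = (\<Pi>\<^sub>M r\<in>{..<T}. input_law n D)"

definition perm_entropy :: "nat \<Rightarrow> (nat \<Rightarrow> real measure) \<Rightarrow> real" where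
  "perm_entropy n D =
     prob_space.entropy (input_law n D) 2
       (count_space (rank_perm n ` space (input_law n D))) (rank_perm n)"

lemma prob_space_input_law:
  assumes "coordinate_laws n D"
  shows "prob_space (input_law n D)"
proof -
  have "input_law n D = (\<Pi>\<^sub>M i\<in>{..<n}. if i < n then D i else return borel 0)"
    unfolding input_law_def by (intro PiM_cong) auto
  moreover have "prob_space (\<Pi>\<^sub>M i\<in>{..<n}. if i < n then D i else return borel 0)"
    by (intro prob_space_PiM)
       (use assms in \<open>auto simp: coordinate_laws_def intro: prob_space_return\<close>)
  ultimately show ?thesis by simp
qed

lemma rank_perm_measurable:
  assumes "coordinate_laws n D"
  shows "rank_perm n \<in> input_law n D \<rightarrow>\<^sub>M count_space UNIV"
proof -
  have comp: "(\<lambda>x. x i) \<in> borel_measurable (input_law n D)" if "i < n" for i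
  proof -
    have "(\<lambda>x. x i) \<in> input_law n D \<rightarrow>\<^sub>M D i"
      unfolding input_law_def using that by (intro measurable_component_singleton) auto
    then show ?thesis
      using assms that by (simp add: coordinate_laws_def cong: measurable_cong_sets)
  qed
  define Q where "Q x = {(i, j). i < n \<and> j < n \<and> (x j < x i \<or> x j = x i \<and> j < i)}"
    for x :: "nat \<Rightarrow> real"
  have fac: "rank_perm n = (\<lambda>q. map (\<lambda>i. card {j. (i, j) \<in> q}) [0..<n]) \<circ> Q"
    by (auto simp: rank_perm_def Q_def fun_eq_iff)
  have "Q \<in> input_law n D \<rightarrow>\<^sub>M count_space (Pow ({..<n} \<times> {..<n}))"
  proof (rule measurable_count_space_eq2[THEN iffD2], goal_cases)
    case 1 then show ?case by simp
  next
    case 2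
    have "Q -` {q} \<inter> space (input_law n D) \<in> sets (input_law n D)" for q
    proof (cases "q \<subseteq> {..<n} \<times> {..<n}")
      case True
      have "Q -` {q} \<inter> space (input_law n D) = {x \<in> space (input_law n D).
        \<forall>i\<in>{..<n}. \<forall>j\<in>{..<n}. (x j < x i \<or> x j = x i \<and> j < i) \<longleftrightarrow> (i, j) \<in> q}"
      proof -
        have "Q x = q \<longleftrightarrow> (\<forall>i\<in>{..<n}. \<forall>j\<in>{..<n}.
            (x j < x i \<or> x j = x i \<and> j < i) \<longleftrightarrow> (i, j) \<in> q)" for x
          using True unfolding Q_def by blast
        then show ?thesis by blast
      qed
      also have "\<dots> \<in> sets (input_law n D)"
      proof (intro sets.sets_Collect_finite_All finite_lessThan)
        fix i j assume "i \<in> {..<n}" "j \<in> {..<n}"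
        then have "(\<lambda>x. x i) \<in> borel_measurable (input_law n D)"
          "(\<lambda>x. x j) \<in> borel_measurable (input_law n D)"
          using comp by auto
        have lt: "{x \<in> space (input_law n D). x j < x i} \<in> sets (input_law n D)"
          by (rule borel_measurable_less) fact+
        have eq: "{x \<in> space (input_law n D). x j = x i} \<in> sets (input_law n D)"
          by (rule borel_measurable_eq) fact+
        show "{x \<in> space (input_law n D).
            (x j < x i \<or> x j = x i \<and> j < i) \<longleftrightarrow> (i, j) \<in> q} \<in> sets (input_law n D)"
          by (cases "j < i"; cases "(i, j) \<in> q")
            (simp_all add: sets.sets_Collect_disj sets.sets_Collect_neg lt eq
              del: de_Morgan_disj)
      qed
      finally show ?thesis .
    next
      case False
      then have "Q -` {q} \<inter> space (input_law n D) = {}" by (auto simp: Q_def)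
      then show ?thesis by simp
    qed
    then show ?case by (auto simp: Q_def)
  qed
  then show ?thesis
    unfolding fac comp_def by (rule measurable_compose) (rule measurable_count_space)
qed

lemma finite_range_rank_perm: "finite (rank_perm n ` X)"
proof (rule finite_subset)
  have "card {j. j < n \<and> (x j < x i \<or> x j = x i \<and> j < i)} \<le> n" for x :: "nat \<Rightarrow> real" and i
    using card_mono[of "{..<n}" "{j. j < n \<and> (x j < x i \<or> x j = x i \<and> j < i)}"] by auto
  then show "rank_perm n ` X \<subseteq> {xs. set xs \<subseteq> {..n} \<and> length xs = n}"
    by (auto simp: rank_perm_def)
qed (rule finite_lists_length_eq, simp)

text \<open>The entropy above is the usual sum over the values of the permutation.\<close>

lemma perm_entropy_eq_sum:
  assumes "coordinate_laws n D"
  defines "M \<equiv> input_law n D"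
  defines "Pr \<equiv> \<lambda>p. measure M (rank_perm n -` {p} \<inter> space M)"
  shows "perm_entropy n D = (\<Sum>p\<in>rank_perm n ` space M. Pr p * log 2 (1 / Pr p))"
proof -
  interpret prob_space M
    unfolding M_def using assms(1) by (rule prob_space_input_law)
  interpret information_space M 2
    by unfold_locales simp
  have "simple_function M (rank_perm n)"
    unfolding simple_function_def
    using finite_range_rank_perm measurable_sets[OF rank_perm_measurable[OF assms(1)]]
    by (simp add: M_def)
  then have "simple_distributed M (rank_perm n) Pr"
    by (rule simple_distributedI) (simp_all add: Pr_def)
  then have "entropy 2 (count_space (rank_perm n ` space M)) (rank_perm n) =
      - (\<Sum>p\<in>rank_perm n ` space M. Pr p * log 2 (Pr p))"
    by (rule entropy_simple_distributed)
  then show ?thesis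
    unfolding perm_entropy_def M_def[symmetric]
    by (simp add: inverse_eq_divide[symmetric] log_inverse sum_negf)
qed


section \<open>Comparison trees\<close>

text \<open>
  Trees may be infinite, as long as every input reaches a leaf.
\<close>

codatatype ('u, 'v) ctree =
    Leaf 'v
  | Test "'u \<Rightarrow> real" "'u \<Rightarrow> real" "('u, 'v) ctree" "('u, 'v) ctree"

inductive reaches :: "('u, 'v) ctree \<Rightarrow> 'u \<Rightarrow> 'v \<Rightarrow> nat \<Rightarrow> bool" where
  "reaches (Leaf v) I v 0"
| "f I \<le> g I \<Longrightarrow> reaches l I v d \<Longrightarrow> reaches (Test f g l r) I v (Suc d)"
| "\<not> f I \<le> g I \<Longrightarrow> reaches r I v d \<Longrightarrow> reaches (Test f g l r) I v (Suc d)"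

definition computes :: "('u, 'v) ctree \<Rightarrow> 'u set \<Rightarrow> ('u \<Rightarrow> 'v) \<Rightarrow> bool" where
  "computes t U X \<longleftrightarrow> (\<forall>I\<in>U. \<exists>d. reaches t I (X I) d)"

definition leaf_depth :: "('u, 'v) ctree \<Rightarrow> 'u \<Rightarrow> nat" where
  "leaf_depth t I = (THE d. \<exists>v. reaches t I v d)"

inductive_cases LeafE: "reaches (Leaf v) I w d"
  and TestE: "reaches (Test f g l r) I w d"

lemma reaches_unique:
  assumes "reaches t I v d" "reaches t I w e"
  shows "v = w \<and> d = e"
  using assms
proof (induction arbitrary: w e rule: reaches.induct)
  case 1
  then show ?case by (rule LeafE) simp
next
  case 2
  from "2.prems" show ?case by (rule TestE) (use "2.hyps" in \<open>auto dest: "2.IH"\<close>)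
next
  case 3
  from "3.prems" show ?case by (rule TestE) (use "3.hyps" in \<open>auto dest: "3.IH"\<close>)
qed

text \<open>
  The tests are arbitrary functions, so the depth need not be measurable. On
  nonmeasurable functions the integral below is the lower integral, which makes a
  lower bound on it only stronger.
\<close>

definition expected_depth :: "'u measure \<Rightarrow> ('u, 'v) ctree \<Rightarrow> ennreal" where
  "expected_depth M t = (\<integral>\<^sup>+ I. of_nat (leaf_depth t I) \<partial>M)"


section \<open>The machine\<close>

text \<open>
  The machine is a word RAM with a separate memory for real numbers, on which only
  copying and comparing is possible. It is programmed in a WHILE language with named
  arrays (finitely many in each program); a scalar variable is cell 0 of an array.
  On inputs of length \<open>n\<close> and with word constant \<open>c\<close>, word arithmetic is modulo
  \<open>(n + 1) ^ c\<close>, i.e. words have \<open>O(log n)\<close> bits.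

  \<open>Persistent\<close> arrays survive from one input to the next; \<open>Scratch\<close> arrays are
  zeroed. \<open>InOut\<close> holds the input in its real part and the output in its word part.
\<close>

datatype arr = InOut | Persistent nat | Scratch nat

datatype wexp =
    Num nat
  | Len
  | WGet arr wexp
  | Plus wexp wexp
  | Minus wexp wexp
  | Times wexp wexp
  | Div wexp wexp

datatype bexp =
    Less wexp wexp
  | RLe arr wexp arr wexp
  | Not bexp
  | And bexp bexp

datatype com =
    Skip
  | WSet arr wexp wexp
  | RCopy arr wexp arr wexp
  | Seq com com
  | If bexp com com
  | While bexp com

record mem =
  words :: "arr \<Rightarrow> nat \<Rightarrow> nat"
  reals :: "arr \<Rightarrow> nat \<Rightarrow> real"

fun wval :: "nat \<Rightarrow> nat \<Rightarrow> mem \<Rightarrow> wexp \<Rightarrow> nat" where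
  "wval n c s (Num k) = k mod (n + 1) ^ c"
| "wval n c s Len = n mod (n + 1) ^ c"
| "wval n c s (WGet a e) = words s a (wval n c s e)"
| "wval n c s (Plus e f) = (wval n c s e + wval n c s f) mod (n + 1) ^ c"
| "wval n c s (Minus e f) = wval n c s e - wval n c s f"
| "wval n c s (Times e f) = (wval n c s e * wval n c s f) mod (n + 1) ^ c"
| "wval n c s (Div e f) = wval n c s e div wval n c s f"

fun bval :: "nat \<Rightarrow> nat \<Rightarrow> mem \<Rightarrow> bexp \<Rightarrow> bool" where
  "bval n c s (Less e f) \<longleftrightarrow> wval n c s e < wval n c s f"
| "bval n c s (RLe a e b f) \<longleftrightarrow> reals s a (wval n c s e) \<le> reals s b (wval n c s f)"
| "bval n c s (Not p) \<longleftrightarrow> \<not> bval n c s p"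
| "bval n c s (And p q) \<longleftrightarrow> bval n c s p \<and> bval n c s q"

fun wcost :: "wexp \<Rightarrow> nat" where
  "wcost (Num k) = 1"
| "wcost Len = 1"
| "wcost (WGet a e) = 1 + wcost e"
| "wcost (Plus e f) = 1 + wcost e + wcost f"
| "wcost (Minus e f) = 1 + wcost e + wcost f"
| "wcost (Times e f) = 1 + wcost e + wcost f"
| "wcost (Div e f) = 1 + wcost e + wcost f"

fun bcost :: "bexp \<Rightarrow> nat" where
  "bcost (Less e f) = 1 + wcost e + wcost f"
| "bcost (RLe a e b f) = 1 + wcost e + wcost f"
| "bcost (Not p) = 1 + bcost p"
| "bcost (And p q) = 1 + bcost p + bcost q"

text \<open>
  \<open>exec n c m P s t s'\<close>: started in \<open>s\<close>, the program \<open>P\<close> terminates in \<open>s'\<close> after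
  \<open>t\<close> steps. Only the cells \<open>0, \<dots>, m - 1\<close> of each array are available: writing to
  another cell aborts the execution (there is then no final state). Cells outside
  this range therefore always contain 0 and need no storage.
\<close>

inductive exec :: "nat \<Rightarrow> nat \<Rightarrow> nat \<Rightarrow> com \<Rightarrow> mem \<Rightarrow> nat \<Rightarrow> mem \<Rightarrow> bool"
  for n c m :: nat where
  Skip: "exec n c m Skip s 1 s"
| WSet: "wval n c s e < m \<Longrightarrow>
    exec n c m (WSet a e f) s (1 + wcost e + wcost f)
      (s\<lparr>words := (words s)(a := (words s a)(wval n c s e := wval n c s f))\<rparr>)"
| RCopy: "wval n c s e < m \<Longrightarrow>
    exec n c m (RCopy a e b f) s (1 + wcost e + wcost f)
      (s\<lparr>reals := (reals s)(a := (reals s a)(wval n c s e := reals s b (wval n c s f)))\<rparr>)"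
| Seq: "exec n c m P s t s' \<Longrightarrow> exec n c m Q s' u s'' \<Longrightarrow>
    exec n c m (Seq P Q) s (t + u) s''"
| IfTrue: "bval n c s b \<Longrightarrow> exec n c m P s t s' \<Longrightarrow>
    exec n c m (If b P Q) s (1 + bcost b + t) s'"
| IfFalse: "\<not> bval n c s b \<Longrightarrow> exec n c m Q s t s' \<Longrightarrow>
    exec n c m (If b P Q) s (1 + bcost b + t) s'"
| WhileFalse: "\<not> bval n c s b \<Longrightarrow>
    exec n c m (While b P) s (1 + bcost b) s"
| WhileTrue: "bval n c s b \<Longrightarrow> exec n c m P s t s' \<Longrightarrow> exec n c m (While b P) s' u s'' \<Longrightarrow>
    exec n c m (While b P) s (1 + bcost b + t + u) s''"

inductive_cases SkipE: "exec n c m Skip s t s'"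
  and WSetE: "exec n c m (WSet a e f) s t s'"
  and RCopyE: "exec n c m (RCopy a e b f) s t s'"
  and SeqE: "exec n c m (Seq P Q) s t s'"
  and IfE: "exec n c m (If b P Q) s t s'"
  and WhileE: "exec n c m (While b P) s t s'"

lemma exec_unique:
  assumes "exec n c m P s t s'" "exec n c m P s u s''"
  shows "t = u \<and> s' = s''"
  using assms
proof (induction arbitrary: u s'' rule: exec.induct)
  case Skip
  then show ?case by (rule SkipE) simp
next
  case WSet
  from WSet.prems show ?case by (rule WSetE) simp
next
  case RCopy
  from RCopy.prems show ?case by (rule RCopyE) simp
next
  case (Seq P s t1 s1 Q t2 s2)
  from Seq.prems show ?case by (rule SeqE) (metis Seq.IH)
next
  case (IfTrue s b P t s' Q)
  from IfTrue.prems show ?case by (rule IfE) (use IfTrue.hyps(1) in \<open>auto dest: IfTrue.IH\<close>)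
next
  case (IfFalse s b Q t s' P)
  from IfFalse.prems show ?case by (rule IfE) (use IfFalse.hyps(1) in \<open>auto dest: IfFalse.IH\<close>)
next
  case (WhileFalse s b P)
  from WhileFalse.prems show ?case by (rule WhileE) (use WhileFalse.hyps in simp_all)
next
  case (WhileTrue s b P t1 s1 t2 s2)
  from WhileTrue.prems WhileTrue.hyps(1) obtain t1' s1' t2'
    where "exec n c m P s t1' s1'" "exec n c m (While b P) s1' t2' s''"
      and u: "u = 1 + bcost b + t1' + t2'"
    by (auto elim: WhileE)
  moreover from this(1) have "t1 = t1' \<and> s1 = s1'" by (rule WhileTrue.IH(1))
  ultimately show ?case using WhileTrue.IH(2) by auto
qed

fun word_targets :: "com \<Rightarrow> arr set" where
  "word_targets Skip = {}"
| "word_targets (WSet a e f) = {a}"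
| "word_targets (RCopy a e b f) = {}"
| "word_targets (Seq P Q) = word_targets P \<union> word_targets Q"
| "word_targets (If b P Q) = word_targets P \<union> word_targets Q"
| "word_targets (While b P) = word_targets P"

fun real_targets :: "com \<Rightarrow> arr set" where
  "real_targets Skip = {}"
| "real_targets (WSet a e f) = {}"
| "real_targets (RCopy a e b f) = {a}"
| "real_targets (Seq P Q) = real_targets P \<union> real_targets Q"
| "real_targets (If b P Q) = real_targets P \<union> real_targets Q"
| "real_targets (While b P) = real_targets P"


section \<open>Algorithms that process a sequence of inputs\<close>

text \<open>
  A single program, the same for all \<open>n\<close>, is run on each input in turn.
\<close>

record algorithm =
  code :: com
  word_const :: nat
  capacity :: "nat \<Rightarrow> nat"

text \<open>
  Number of memory cells, training phase included. Arrays that are never assigned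
  to contain zeros (or the input).
\<close>

definition storage :: "algorithm \<Rightarrow> nat \<Rightarrow> nat" where
  "storage A n =
     capacity A n * (card (word_targets (code A)) + card (real_targets (code A)))"

definition blank :: mem where
  "blank = \<lparr>words = (\<lambda>_ _. 0), reals = (\<lambda>_ _. 0)\<rparr>"

definition load :: "nat \<Rightarrow> (nat \<Rightarrow> real) \<Rightarrow> mem \<Rightarrow> mem" where
  "load n x p = p\<lparr>reals := (reals p)(InOut := (\<lambda>i. if i < n then x i else 0))\<rparr>"

definition retain :: "mem \<Rightarrow> mem" where
  "retain s =
     \<lparr>words = (\<lambda>a. if a \<in> range Persistent then words s a else (\<lambda>_. 0)),
      reals = (\<lambda>a. if a \<in> range Persistent then reals s a else (\<lambda>_. 0))\<rparr>"

definition runs :: "algorithm \<Rightarrow> nat \<Rightarrow> mem \<Rightarrow> (nat \<Rightarrow> real) \<Rightarrow> nat \<Rightarrow> mem \<Rightarrow> bool" where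
  "runs A n p x t s \<longleftrightarrow> exec n (word_const A) (capacity A n) (code A) (load n x p) t s"

definition run_time :: "algorithm \<Rightarrow> nat \<Rightarrow> mem \<Rightarrow> (nat \<Rightarrow> real) \<Rightarrow> nat" where
  "run_time A n p x = (THE t. \<exists>s. runs A n p x t s)"

definition run_result :: "algorithm \<Rightarrow> nat \<Rightarrow> mem \<Rightarrow> (nat \<Rightarrow> real) \<Rightarrow> mem" where
  "run_result A n p x = (THE s. \<exists>t. runs A n p x t s)"

text \<open>\<open>store A n I r\<close>: persistent memory after the inputs \<open>I 0, \<dots>, I (r - 1)\<close>.\<close>

primrec store :: "algorithm \<Rightarrow> nat \<Rightarrow> (nat \<Rightarrow> nat \<Rightarrow> real) \<Rightarrow> nat \<Rightarrow> mem" where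
  "store A n I 0 = blank"
| "store A n I (Suc r) = retain (run_result A n (store A n I r) (I r))"

definition is_sorter :: "algorithm \<Rightarrow> bool" where
  "is_sorter A \<longleftrightarrow>
     (\<forall>n\<ge>1. \<forall>I r. \<exists>t s. runs A n (store A n I r) (I r) t s \<and>
        map (words s InOut) [0..<n] = rank_perm n (I r))"

text \<open>After \<open>T n\<close> rounds the data structures are fixed.\<close>

definition stationary_after :: "algorithm \<Rightarrow> (nat \<Rightarrow> nat) \<Rightarrow> bool" where
  "stationary_after A T \<longleftrightarrow> (\<forall>n\<ge>1. \<forall>I. \<forall>r\<ge>T n. store A n I r = store A n I (T n))"

definition self_improving_sorter :: "algorithm \<Rightarrow> (nat \<Rightarrow> nat) \<Rightarrow> bool" where
  "self_improving_sorter A T \<longleftrightarrow> is_sorter A \<and> stationary_after A T"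

definition worst_case_time_le :: "algorithm \<Rightarrow> nat \<Rightarrow> real \<Rightarrow> bool" where
  "worst_case_time_le A n B \<longleftrightarrow>
     (\<forall>I r. real (run_time A n (store A n I r) (I r)) \<le> B)"

text \<open>
  Expected running time with the data structures \<open>p\<close>. Integrability has to be
  demanded, as the integral of a non-integrable function is 0 by convention.
\<close>

definition limiting_time_le ::
  "algorithm \<Rightarrow> nat \<Rightarrow> (nat \<Rightarrow> real measure) \<Rightarrow> mem \<Rightarrow> real \<Rightarrow> bool" where
  "limiting_time_le A n D p B \<longleftrightarrow>
     integrable (input_law n D) (\<lambda>x. real (run_time A n p x)) \<and>
     (\<integral>x. real (run_time A n p x) \<partial>input_law n D) \<le> B"

text \<open>
  The probability, over \<open>T\<close> training inputs, that the limiting bound \<open>B\<close> is missed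
  is at most \<open>q\<close>. Stated as an outer probability, so that measurability of the
  failure event is not an issue.
\<close>

definition training_failure_le ::
  "algorithm \<Rightarrow> nat \<Rightarrow> nat \<Rightarrow> (nat \<Rightarrow> real measure) \<Rightarrow> real \<Rightarrow> real \<Rightarrow> bool" where
  "training_failure_le A T n D B q \<longleftrightarrow>
     (\<exists>F\<in>sets (inputs_law T n D).
        {J \<in> space (inputs_law T n D). \<not> limiting_time_le A n D (store A n J T) B} \<subseteq> F \<and>
        measure (inputs_law T n D) F \<le> q)"

end

theory Submission imports Defs begin

text \<open>
  The keys of the first \<open>4 lg n\<close> training inputs are merged, and every \<open>4 lg n\<close>-th key of the
  merged list is a boundary between two of \<open>n + 1\<close> buckets. Further training inputs, of which
  there are a small power of \<open>n\<close>, give a sorted sample of bucket numbers for every coordinate. In the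
  limiting phase, the bucket of a coordinate is searched in its sample, at cost \<open>l\<close> for a bucket
  that fills a fraction \<open>2\<^sup>-\<^sup>l\<close> of the sample, falling back on binary search in the bucket list; then
  each bucket is ranked by quadratic comparison. Tournament sort takes over if there are too many
  pairs of keys in common buckets.

  Convex sets of keys with large mass contain one of few quantile cells, so Chernoff bounds for the
  cells and a union bound show that, except with probability \<open>1/n\<close>, all buckets have expected size
  \<open>O(1)\<close> and all samples represent the frequent buckets. The cost of the searches is then the sum
  of the entropies of the buckets of the coordinates. By independence this is the entropy of the
  bucket vector, which is at most \<open>H(\<pi>) + 2 n\<close>: given \<open>\<pi>\<close>, the bucket vector is monotone, so it
  has at most \<open>4\<^sup>n\<close> values. Gibbs' inequality turns this count into the entropy bound, and, with
  Kraft's inequality, also yields the comparison lower bound.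
\<close>

text \<open>Two obstacles shape the proof. Every input, those of the training included, must be
  answered in O(n log n) steps, so no round can afford to sort all samples. Their insertion sort is
  spread over the rounds, which makes the training quadratic in the number of samples: about
  n^(1/(2q)) samples per coordinate give about n^(1/q) rounds. Plain binary search in the sorted
  sample takes the place of a weighted search tree, since a value of multiplicity C among m entries
  is hit within about log(m/C) probes. The other obstacle is that the buckets are computed from the
  training inputs, so that no concentration bound applies to a bucket directly. The bounds are
  proved for cells that the distribution fixes in advance, and a heavy bucket contains one of them.
  Samples do not resolve probabilities below about n^(-1/(4q)). A bucket that rare has
  self-information of order (log n)/q, which pays for a full binary search at the price of a factor
  q, about 1/\<epsilon>.\<close>

datatype key = Key (kval: real) (kidx: nat)

instantiation key :: linorder
begin

definition less_key :: "key \<Rightarrow> key \<Rightarrow> bool" where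
  "less_key a b \<longleftrightarrow> kval a < kval b \<or> kval a = kval b \<and> kidx a < kidx b"

definition less_eq_key :: "key \<Rightarrow> key \<Rightarrow> bool" where
  "less_eq_key a b \<longleftrightarrow> kval a < kval b \<or> kval a = kval b \<and> kidx a \<le> kidx b"

instance
  by standard (auto simp: less_key_def less_eq_key_def key.expand)

end

lemma Key_less: "Key a i < Key b j \<longleftrightarrow> a < b \<or> a = b \<and> i < j"
  and Key_le: "Key a i \<le> Key b j \<longleftrightarrow> a < b \<or> a = b \<and> i \<le> j"
  by (simp_all add: less_key_def less_eq_key_def)

abbreviation xkey :: "(nat \<Rightarrow> real) \<Rightarrow> nat \<Rightarrow> key" where
  "xkey x i \<equiv> Key (x i) i"

text \<open>The index component of a key implements the tie-breaking of \<open>rank_perm\<close>: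
  the keys of one input are pairwise distinct, and equal reals need no separate treatment.\<close>

lemma rank_perm_nth:
  "i < n \<Longrightarrow> rank_perm n x ! i = card {j. j < n \<and> xkey x j < xkey x i}"
  by (simp add: rank_perm_def Key_less)

lemma length_rank_perm [simp]: "length (rank_perm n x) = n"
  by (simp add: rank_perm_def)

section \<open>A program logic with running times\<close>

text \<open>\<open>exec\<close> is deterministic, so the existence of one run is total correctness.
  The postcondition receives the step count, and time bounds are proved together with
  effects.\<close>

definition wp :: "nat \<Rightarrow> nat \<Rightarrow> nat \<Rightarrow> com \<Rightarrow> mem \<Rightarrow> (nat \<Rightarrow> mem \<Rightarrow> bool) \<Rightarrow> bool" where
  "wp n c m P s Q \<longleftrightarrow> (\<exists>t s'. exec n c m P s t s' \<and> Q t s')"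

lemma wp_mono:
  assumes "wp n c m P s Q" "\<And>t s'. Q t s' \<Longrightarrow> R t s'"
  shows "wp n c m P s R"
  using assms unfolding wp_def by blast

lemma wp_Skip [simp]: "wp n c m Skip s Q \<longleftrightarrow> Q 1 s"
  unfolding wp_def by (metis exec.Skip SkipE)

lemma wp_WSet [simp]:
  "wp n c m (WSet a e f) s Q \<longleftrightarrow> wval n c s e < m \<and> Q (1 + wcost e + wcost f)
      (s\<lparr>words := (words s)(a := (words s a)(wval n c s e := wval n c s f))\<rparr>)"
  unfolding wp_def by (metis exec.WSet WSetE)

lemma wp_RCopy [simp]:
  "wp n c m (RCopy a e b f) s Q \<longleftrightarrow> wval n c s e < m \<and> Q (1 + wcost e + wcost f)
      (s\<lparr>reals := (reals s)(a := (reals s a)(wval n c s e := reals s b (wval n c s f)))\<rparr>)"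
  unfolding wp_def by (metis exec.RCopy RCopyE)

lemma wp_Seq [simp]:
  "wp n c m (Seq P R) s Q \<longleftrightarrow> wp n c m P s (\<lambda>t s1. wp n c m R s1 (\<lambda>u s2. Q (t + u) s2))"
  proof
  assume "wp n c m (Seq P R) s Q"
  then obtain t s' where e: "exec n c m (Seq P R) s t s'" and Q: "Q t s'"
    unfolding wp_def by blast
  from e show "wp n c m P s (\<lambda>t s1. wp n c m R s1 (\<lambda>u s2. Q (t + u) s2))"
    by (rule SeqE) (use Q in \<open>auto simp: wp_def\<close>)
next
  assume "wp n c m P s (\<lambda>t s1. wp n c m R s1 (\<lambda>u s2. Q (t + u) s2))"
  then show "wp n c m (Seq P R) s Q"
    unfolding wp_def by (blast intro: exec.Seq)
qed

lemma wp_If [simp]: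
  "wp n c m (If b P R) s Q \<longleftrightarrow> (if bval n c s b then wp n c m P s (\<lambda>t. Q (1 + bcost b + t))
     else wp n c m R s (\<lambda>t. Q (1 + bcost b + t)))"
proof
  assume "wp n c m (If b P R) s Q"
  then obtain t s' where e: "exec n c m (If b P R) s t s'" and Q: "Q t s'"
    unfolding wp_def by blast
  from e show "if bval n c s b then wp n c m P s (\<lambda>t. Q (1 + bcost b + t))
     else wp n c m R s (\<lambda>t. Q (1 + bcost b + t))"
    by (rule IfE) (use Q in \<open>auto simp: wp_def\<close>)
next
  assume *: "if bval n c s b then wp n c m P s (\<lambda>t. Q (1 + bcost b + t))
     else wp n c m R s (\<lambda>t. Q (1 + bcost b + t))"
  show "wp n c m (If b P R) s Q"
  proof (cases "bval n c s b")
    case True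
    with * obtain t s' where "exec n c m P s t s'" "Q (1 + bcost b + t) s'"
      by (auto simp: wp_def)
    with exec.IfTrue[OF True] show ?thesis unfolding wp_def by blast
  next
    case False
    with * obtain t s' where "exec n c m R s t s'" "Q (1 + bcost b + t) s'"
      by (auto simp: wp_def)
    with exec.IfFalse[OF False] show ?thesis unfolding wp_def by blast
  qed
qed

text \<open>What a program cannot change, read off its syntax. Loop invariants then only speak of
  what the body writes, and everything else is carried through by \<open>frame\<close>.\<close>

definition frame :: "com \<Rightarrow> mem \<Rightarrow> mem \<Rightarrow> bool" where
  "frame P s s' \<longleftrightarrow> (\<forall>a. a \<notin> word_targets P \<longrightarrow> words s' a = words s a) \<and>
     (\<forall>a. a \<notin> real_targets P \<longrightarrow> reals s' a = reals s a)"

lemma frame_words: "frame P s s' \<Longrightarrow> a \<notin> word_targets P \<Longrightarrow> words s' a = words s a"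
  and frame_reals: "frame P s s' \<Longrightarrow> a \<notin> real_targets P \<Longrightarrow> reals s' a = reals s a"
  by (auto simp: frame_def)

lemma frame_refl [simp]: "frame P s s"
  by (simp add: frame_def)

lemma frame_trans: "frame P s s1 \<Longrightarrow> frame P s1 s2 \<Longrightarrow> frame P s s2"
  by (simp add: frame_def)

lemma exec_frame: "exec n c m P s t s' \<Longrightarrow> frame P s s'"
  by (induction rule: exec.induct) (auto simp: frame_def)

lemma wp_frame:
  assumes "wp n c m P s Q" "\<And>t s'. frame P s s' \<Longrightarrow> Q t s' \<Longrightarrow> R t s'"
  shows "wp n c m P s R"
  using assms exec_frame unfolding wp_def by blast

text \<open>The bound \<open>B\<close> on the number of iterations also gives termination.\<close>

lemma wp_While:
  assumes init: "I 0 s"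
    and step: "\<And>k s'. I k s' \<Longrightarrow> frame P s s' \<Longrightarrow> bval n c s' b \<Longrightarrow>
      k < B \<and> wp n c m P s' (\<lambda>t s''. t \<le> \<tau> k \<and> I (Suc k) s'')"
    and post: "\<And>k s' t. I k s' \<Longrightarrow> frame P s s' \<Longrightarrow> \<not> bval n c s' b \<Longrightarrow> k \<le> B \<Longrightarrow>
      t \<le> (\<Sum>j<k. \<tau> j + 1 + bcost b) + (1 + bcost b) \<Longrightarrow> Q t s'"
  shows "wp n c m (While b P) s Q"
proof -
  \<comment> \<open>The cost of the \<open>k\<close> iterations already done is added on the left,
    so that the claim for \<open>k\<close> follows from the claim for \<open>Suc k\<close> by the
    cost of one pass.\<close>
  have "\<exists>t s'' k'. exec n c m (While b P) s' t s'' \<and> I k' s'' \<and> frame P s s'' \<and>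
      \<not> bval n c s'' b \<and> k' \<le> B \<and>
      t + (\<Sum>j<k. \<tau> j + 1 + bcost b) \<le> (\<Sum>j<k'. \<tau> j + 1 + bcost b) + (1 + bcost b)"
    if "I k s'" "frame P s s'" "k \<le> B" for k s'
    using that
  proof (induction "B - k" arbitrary: k s' rule: less_induct)
    case less
    show ?case
    proof (cases "bval n c s' b")
      case True
      with step less.prems obtain t s1 where kB: "k < B" and ex: "exec n c m P s' t s1"
        and t: "t \<le> \<tau> k" and I: "I (Suc k) s1"
        unfolding wp_def by blast
      have fr: "frame P s s1"
        using frame_trans less.prems(2) exec_frame[OF ex] by blast
      have "B - Suc k < B - k" "Suc k \<le> B" using kB by simp_all
      from less.hyps[OF this(1) I fr this(2)]
      obtain u s2 k' where u: "exec n c m (While b P) s1 u s2" "I k' s2" "frame P s s2"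
        "\<not> bval n c s2 b" "k' \<le> B"
        "u + (\<Sum>j<Suc k. \<tau> j + 1 + bcost b) \<le> (\<Sum>j<k'. \<tau> j + 1 + bcost b) + (1 + bcost b)"
        by blast
      have "exec n c m (While b P) s' (1 + bcost b + t + u) s2"
        using True ex u(1) by (rule exec.WhileTrue)
      with u t show ?thesis by (intro exI[of _ "1 + bcost b + t + u"] exI[of _ s2] exI[of _ k']) auto
    next
      case False
      then show ?thesis
        using less.prems exec.WhileFalse[OF False]
        by (intro exI[of _ "1 + bcost b"] exI[of _ s'] exI[of _ k]) auto
    qed
  qed
  from this[of 0 s] init show ?thesis
    unfolding wp_def using post by fastforce
qed

lemma wp_While_const:
  assumes init: "I 0 s"
    and step: "\<And>k s'. I k s' \<Longrightarrow> frame P s s' \<Longrightarrow> bval n c s' b \<Longrightarrow>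
      k < B \<and> wp n c m P s' (\<lambda>t s''. t \<le> \<tau> \<and> I (Suc k) s'')"
    and post: "\<And>k s' t. I k s' \<Longrightarrow> frame P s s' \<Longrightarrow> \<not> bval n c s' b \<Longrightarrow> k \<le> B \<Longrightarrow>
      t \<le> B * (\<tau> + 1 + bcost b) + (1 + bcost b) \<Longrightarrow> Q t s'"
  shows "wp n c m (While b P) s Q"
proof (rule wp_While[where I = I and \<tau> = "\<lambda>_. \<tau>" and B = B])
  fix k s' t
  assume *: "I k s'" "frame P s s'" "\<not> bval n c s' b" "k \<le> B"
    "t \<le> (\<Sum>j<k. \<tau> + 1 + bcost b) + (1 + bcost b)"
  have "k * (\<tau> + 1 + bcost b) \<le> B * (\<tau> + 1 + bcost b)"
    using \<open>k \<le> B\<close> by (rule mult_right_mono) simp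
  then have "t \<le> B * (\<tau> + 1 + bcost b) + (1 + bcost b)"
    using *(5) by simp
  with * show "Q t s'" by (intro post) auto
qed (use assms in auto)

section \<open>Programs\<close>

text \<open>
  \<open>LA\<close> is the list of merged training keys; a key consists of a real number and a word, the
  coordinate it comes from. \<open>CN\<close> counts the merged inputs. \<open>SA\<close> is a matrix with one row of sampled
  bucket numbers per coordinate, of which \<open>PN\<close> columns are in use; \<open>QN\<close> is the number of rounds
  still needed to sink the newest column into its sorted place.
\<close>

abbreviation X :: arr where "X \<equiv> InOut"
abbreviation LA :: arr where "LA \<equiv> Persistent 0"
abbreviation CN :: arr where "CN \<equiv> Persistent 1"
abbreviation SA :: arr where "SA \<equiv> Persistent 2"
abbreviation PN :: arr where "PN \<equiv> Persistent 3"
abbreviation QN :: arr where "QN \<equiv> Persistent 4"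

abbreviation Sc :: "nat \<Rightarrow> arr" where "Sc \<equiv> Scratch"
abbreviation get :: "arr \<Rightarrow> wexp" where "get a \<equiv> WGet a (Num 0)"
abbreviation set :: "arr \<Rightarrow> wexp \<Rightarrow> com" where "set a \<equiv> WSet a (Num 0)"
notation Seq (infixr ";;" 60)

section \<open>Machine tests for the order of keys\<close>

definition Or :: "bexp \<Rightarrow> bexp \<Rightarrow> bexp" where
  "Or p q = Not (And (Not p) (Not q))"

lemma Or_simps [simp]:
  "bval n c s (Or p q) \<longleftrightarrow> bval n c s p \<or> bval n c s q"
  "bcost (Or p q) = 4 + bcost p + bcost q"
  by (simp_all add: Or_def)

text \<open>Reals can only be tested with \<le>. The strict lexicographic order is composed of the
  tests in both directions; if both succeed, the coordinate numbers decide.\<close>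

definition XLess :: "wexp \<Rightarrow> wexp \<Rightarrow> bexp" where
  "XLess e f = And (RLe X e X f) (Not (And (RLe X f X e) (Not (Less e f))))"

lemma XLess_simps [simp]:
  "bval n c s (XLess e f) \<longleftrightarrow>
     xkey (reals s X) (wval n c s e) < xkey (reals s X) (wval n c s f)"
  "bcost (XLess e f) = 7 + 3 * wcost e + 3 * wcost f"
  by (auto simp: XLess_def Key_less)

definition lkey :: "mem \<Rightarrow> nat \<Rightarrow> key" where
  "lkey s k = Key (reals s LA k) (words s LA k)"

definition LLe :: "wexp \<Rightarrow> wexp \<Rightarrow> bexp" where
  "LLe a i = And (RLe LA a X i) (Not (And (RLe X i LA a) (Less i (WGet LA a))))"

lemma LLe_simps [simp]:
  "bval n c s (LLe a i) \<longleftrightarrow> lkey s (wval n c s a) \<le> xkey (reals s X) (wval n c s i)"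
  "bcost (LLe a i) = 7 + 3 * wcost a + 3 * wcost i"
  by (auto simp: LLe_def lkey_def Key_le)

text \<open>\<open>W\<close> is the word modulus, \<open>cp\<close> the array capacity and
  \<open>Lg\<close> the binary length of \<open>n\<close>. \<open>B\<close> dominates the products
  that occur in addresses and counters, and the factor 8 leaves room for sums of a few of them, so
  that no computation wraps around. \<open>1000 \<le> B\<close> lets the literals of the programs
  stand for themselves.\<close>

locale ram =
  fixes n c cp lam ms Lg B W :: nat
  assumes W: "Suc n ^ c = W"
    and n: "1 \<le> n"
    and big: "8 * B < W" "1000 \<le> B" "n \<le> B" "Lg \<le> B" "lam \<le> B" "ms \<le> B"
      "n * lam \<le> B" "n * ms \<le> B" "n * n \<le> B"
    and cp: "4 * n + 4 \<le> cp" "n * lam + 4 \<le> cp" "n * ms + 4 \<le> cp"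
    and Lg: "n < 2 ^ Lg" "2 ^ Lg \<le> 2 * n"
begin

abbreviation wv where "wv \<equiv> wval n c"
abbreviation wpr where "wpr \<equiv> wp n c cp"

lemma wval_Num: "k \<le> 1000 \<Longrightarrow> wv s (Num k) = k"
  using big by (simp add: W)

lemma wval_Len: "wv s Len = n"
  using big by (simp add: W)

lemma wval_Plus: "wv s e + wv s f < W \<Longrightarrow> wv s (Plus e f) = wv s e + wv s f"
  and wval_Times: "wv s e * wv s f < W \<Longrightarrow> wv s (Times e f) = wv s e * wv s f"
  by (simp_all add: W)

lemmas wvals = wval_Num wval_Len wval_Plus wval_Times

text \<open>The equations with \<open>mod\<close> give way to the conditional rules
  \<open>wvals\<close>, which yield exact values once overflow is excluded.\<close>

declare wval.simps(1,2,4,6) [simp del]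
declare wvals [simp]

end

section \<open>Tournament sort\<close>

text \<open>In the tournament tree, an index that is at least \<open>n\<close> marks an empty slot.\<close>

definition better :: "wexp \<Rightarrow> wexp \<Rightarrow> bexp" where
  "better a b = And (Less a Len) (Or (Not (Less b Len)) (XLess a b))"

definition replay :: com where
  "replay = If (better (WGet (Sc 6) (Times (Num 2) (get (Sc 7))))
                      (WGet (Sc 6) (Plus (Times (Num 2) (get (Sc 7))) (Num 1))))
     (WSet (Sc 6) (get (Sc 7)) (WGet (Sc 6) (Times (Num 2) (get (Sc 7)))))
     (WSet (Sc 6) (get (Sc 7)) (WGet (Sc 6) (Plus (Times (Num 2) (get (Sc 7))) (Num 1))))"

definition tour_init :: com where
  "tour_init = set (Sc 7) (Num 0) ;;
     While (Less (get (Sc 7)) Len)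
       (WSet (Sc 6) (Plus Len (get (Sc 7))) (get (Sc 7)) ;; set (Sc 7) (Plus (get (Sc 7)) (Num 1)))"

definition tour_build :: com where
  "tour_build = set (Sc 7) Len ;;
     While (Less (Num 1) (get (Sc 7)))
       (set (Sc 7) (Minus (get (Sc 7)) (Num 1)) ;; replay)"

definition tour_path :: com where
  "tour_path =
     While (Less (Num 1) (get (Sc 7))) (set (Sc 7) (Div (get (Sc 7)) (Num 2)) ;; replay)"

definition tour_extract :: com where
  "tour_extract =
     set (Sc 9) (WGet (Sc 6) (Num 1)) ;;
     WSet X (get (Sc 9)) (get (Sc 8)) ;;
     WSet (Sc 10) (get (Sc 8)) (get (Sc 9)) ;;
     set (Sc 7) (Plus Len (get (Sc 9))) ;;
     WSet (Sc 6) (get (Sc 7)) Len ;;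
     tour_path ;;
     set (Sc 8) (Plus (get (Sc 8)) (Num 1))"

definition tour :: com where
  "tour = tour_init ;; tour_build ;; set (Sc 8) (Num 0) ;; While (Less (get (Sc 8)) Len) tour_extract"

context ram
begin

definition win :: "(nat \<Rightarrow> real) \<Rightarrow> nat \<Rightarrow> nat \<Rightarrow> nat" where
  "win x a b = (if a < n \<and> (b < n \<longrightarrow> xkey x a < xkey x b) then a else b)"

text \<open>Heap layout without padding: for any \<open>n\<close>, the inner nodes
  \<open>1..n-1\<close> and the leaves \<open>n..2n-1\<close> form a binary tree, because both
  children of an inner node lie below \<open>2n\<close>.\<close>

definition node :: "mem \<Rightarrow> nat \<Rightarrow> bool" where
  "node s k \<longleftrightarrow> words s (Sc 6) k = win (reals s X) (words s (Sc 6) (2 * k)) (words s (Sc 6) (2 * k + 1))"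

abbreviation upd :: "mem \<Rightarrow> arr \<Rightarrow> nat \<Rightarrow> nat \<Rightarrow> mem" where
  "upd s a i v \<equiv> s\<lparr>words := (words s)(a := (words s a)(i := v))\<rparr>"

lemma wp_replay:
  assumes j: "words s (Sc 7) 0 = j" "1 \<le> j" "j < n"
    and Q: "\<And>t. t \<le> 80 \<Longrightarrow>
      Q t (upd s (Sc 6) j (win (reals s X) (words s (Sc 6) (2*j)) (words s (Sc 6) (2*j+1))))"
  shows "wpr replay s Q"
proof -
  have b: "2 * j + 1 < W" "2 * j < W" "j < cp" using big cp j by simp_all
  have Q1: "Q 76 (upd s (Sc 6) j (win (reals s X) (words s (Sc 6) (2*j)) (words s (Sc 6) (2*j+1))))"
    "Q 74 (upd s (Sc 6) j (win (reals s X) (words s (Sc 6) (2*j)) (words s (Sc 6) (2*j+1))))"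
    by (rule Q, simp)+
  show ?thesis
    unfolding replay_def better_def
    using b j Q1 by (auto simp: win_def)
qed

lemma wp_tour_init:
  "wpr tour_init s (\<lambda>t s'. t \<le> 40 * n + 40 \<and> (\<forall>i<n. words s' (Sc 6) (n + i) = i))"
  unfolding tour_init_def
  using cp n
  apply simp
  apply (rule wp_While_const[where I = "\<lambda>k s'. k \<le> n \<and> words s' (Sc 7) 0 = k \<and>
     (\<forall>i<k. words s' (Sc 6) (n + i) = i)" and B = n and \<tau> = 20])
    apply (use n big in \<open>auto simp: less_Suc_eq\<close>)
  done

text \<open>Writing cell \<open>j\<close> can only disturb the equation of \<open>j\<close> itself
  and that of its parent \<open>j div 2\<close>.\<close>

lemma node_upd [simp]:
  "1 \<le> j \<Longrightarrow>
    node (upd s (Sc 6) j (win (reals s X) (words s (Sc 6) (2 * j)) (words s (Sc 6) (2 * j + 1)))) j"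
  "k \<noteq> j \<Longrightarrow> k \<noteq> j div 2 \<Longrightarrow> node (upd s (Sc 6) j v) k = node s k"
  "a \<noteq> Sc 6 \<Longrightarrow> node (upd s a j v) k = node s k"
  by (auto simp: node_def)

lemma wp_tour_build:
  assumes "\<forall>i<n. words s (Sc 6) (n + i) = i"
  shows "wpr tour_build s (\<lambda>t s'. t \<le> 200 * n + 200 \<and> (\<forall>i<n. words s' (Sc 6) (n + i) = i) \<and>
     (\<forall>k. 1 \<le> k \<longrightarrow> k < n \<longrightarrow> node s' k))"
proof -
  define I where "I k s' \<longleftrightarrow> k < n \<and> words s' (Sc 7) 0 = n - k \<and>
     (\<forall>i<n. words s' (Sc 6) (n + i) = i) \<and> (\<forall>i. n - k \<le> i \<longrightarrow> i < n \<longrightarrow> node s' i)" for k s'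
  have step: "k < n \<and> wpr (set (Sc 7) (Minus (get (Sc 7)) (Num 1)) ;; replay) s'
      (\<lambda>t s''. t \<le> 100 \<and> I (Suc k) s'')"
    if I: "I k s'" and b: "bval n c s' (Less (Num 1) (get (Sc 7)))" for k s'
  proof -
    define s1 where "s1 = upd s' (Sc 7) 0 (n - Suc k)"
    have s1: "node s1 i = node s' i" "words s1 (Sc 6) = words s' (Sc 6)"
      "words s1 (Sc 7) 0 = n - Suc k" for i
      by (simp_all add: s1_def)
    have k: "1 < n - k" "words s' (Sc 7) 0 = n - k" using I b by (auto simp: I_def)
    then have ne: "Suc k < n" "n + i \<noteq> n - Suc k" for i using n by auto
    have "wpr replay s1 (\<lambda>u s2. 6 + u \<le> 100 \<and> I (Suc k) s2)"
    proof (rule wp_replay[where j = "n - Suc k"])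
      fix t :: nat
      assume t: "t \<le> 80"
      let ?s2 = "upd s1 (Sc 6) (n - Suc k)
        (win (reals s1 X) (words s1 (Sc 6) (2 * (n - Suc k))) (words s1 (Sc 6) (2 * (n - Suc k) + 1)))"
      have "node ?s2 i" if i: "n - Suc k \<le> i" "i < n" for i
      proof (cases "i = n - Suc k")
        case True
        then show ?thesis using k by (simp only: node_upd)
      next
        case False
        then have "node s' i" using I i by (simp add: I_def)
        moreover have "i \<noteq> n - Suc k" "i \<noteq> (n - Suc k) div 2" using i False k by auto
        ultimately show ?thesis by (simp only: node_upd s1(1) not_False_eq_True)
      qed
      then show "6 + t \<le> 100 \<and> I (Suc k) ?s2"
        using I t k ne unfolding I_def by (simp add: s1)
    qed (use k in \<open>auto simp: s1\<close>)
    then show ?thesis using k cp n by (simp add: s1_def)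
  qed
  show ?thesis
    unfolding tour_build_def
    using cp n
    apply simp
    apply (rule wp_While_const[where I = I and B = n and \<tau> = 100])
      apply (use n assms in \<open>simp add: I_def\<close>)
     apply (use step in simp)
    apply (use n in \<open>auto simp: I_def\<close>)
    done
qed

text \<open>Repairing one path to the root suffices: after a replay at \<open>j\<close>, the parent
  of \<open>j\<close> is the only node whose equation can fail. The position times
  \<open>2 ^ k\<close> stays below \<open>2 * n\<close>, which limits the path to
  \<open>Lg + 1\<close> steps.\<close>

lemma wp_tour_path:
  assumes j: "1 \<le> words s (Sc 7) 0" "words s (Sc 7) 0 < 2 * n"
    and nodes: "\<forall>k. 1 \<le> k \<longrightarrow> k < n \<longrightarrow> k \<noteq> words s (Sc 7) 0 div 2 \<longrightarrow> node s k"
  shows "wpr tour_path s (\<lambda>t s'. t \<le> 200 * Lg + 200 \<and>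
     (\<forall>i<n. words s' (Sc 6) (n + i) = words s (Sc 6) (n + i)) \<and>
     (\<forall>k. 1 \<le> k \<longrightarrow> k < n \<longrightarrow> node s' k))"
proof -
  define I where "I k s' \<longleftrightarrow> 1 \<le> words s' (Sc 7) 0 \<and>
      words s' (Sc 7) 0 * 2 ^ k < 2 * n \<and>
     (\<forall>i<n. words s' (Sc 6) (n + i) = words s (Sc 6) (n + i)) \<and>
     (\<forall>k. 1 \<le> k \<longrightarrow> k < n \<longrightarrow> k \<noteq> words s' (Sc 7) 0 div 2 \<longrightarrow> node s' k)" for k s'
  have bound: "k < Suc Lg" if "Suc 0 < j" "j * 2 ^ k < 2 * n" for j k
  proof -
    have "2 * 2 ^ k \<le> j * 2 ^ k" using that by (intro mult_right_mono) auto
    then have "2 * 2 ^ k < 2 * (2::nat) ^ Lg" using that Lg by linarith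
    then show ?thesis by simp
  qed
  have half: "j div 2 * (2 * 2 ^ k) < 2 * n" if "j * 2 ^ k < 2 * n" for j k :: nat
  proof -
    have "j div 2 * 2 * 2 ^ k \<le> j * 2 ^ k" by (intro mult_right_mono) auto
    also note that
    finally show ?thesis by (simp only: mult.assoc)
  qed
  have step: "k < Suc Lg \<and> wpr (set (Sc 7) (Div (get (Sc 7)) (Num 2)) ;; replay) s'
      (\<lambda>t s''. t \<le> 100 \<and> I (Suc k) s'')"
    if I: "I k s'" and b: "bval n c s' (Less (Num 1) (get (Sc 7)))" for k s'
  proof -
    define j where "j = words s' (Sc 7) 0"
    define s1 where "s1 = upd s' (Sc 7) 0 (j div 2)"
    have s1: "node s1 i = node s' i" "words s1 (Sc 6) = words s' (Sc 6)"
      "words s1 (Sc 7) 0 = j div 2" for i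
      by (simp_all add: s1_def)
    have j: "1 < j" "j * 2 ^ k < 2 * n" using I b by (auto simp: I_def j_def)
    have "j * 1 \<le> j * 2 ^ k" by (intro mult_left_mono) auto
    then have jn: "j < 2 * n" using j by linarith
    then have ne: "Suc 0 \<le> j div 2" "n + i \<noteq> j div 2" for i using j by auto
    have "wpr replay s1 (\<lambda>u s2. 6 + u \<le> 100 \<and> I (Suc k) s2)"
    proof (rule wp_replay[where j = "j div 2"])
      fix t :: nat
      assume t: "t \<le> 80"
      let ?s2 = "upd s1 (Sc 6) (j div 2)
        (win (reals s1 X) (words s1 (Sc 6) (2 * (j div 2))) (words s1 (Sc 6) (2 * (j div 2) + 1)))"
      have "node ?s2 i" if i: "1 \<le> i" "i < n" "i \<noteq> j div 2 div 2" for i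
      proof (cases "i = j div 2")
        case True
        have "1 \<le> j div 2" using j by simp
        then show ?thesis using True by (simp only: node_upd)
      next
        case False
        then have "node s' i" using I i by (simp add: I_def j_def)
        then show ?thesis using i False by (simp only: node_upd s1(1) not_False_eq_True)
      qed
      then show "6 + t \<le> 100 \<and> I (Suc k) ?s2"
        using I t j ne half[OF j(2)] unfolding I_def by (simp add: s1 j_def)
    qed (use j jn in \<open>auto simp: s1\<close>)
    then show ?thesis using bound[of j k] cp j by (simp add: j_def s1_def)
  qed
  show ?thesis
    unfolding tour_path_def
    apply (rule wp_While_const[where I = I and B = "Suc Lg" and \<tau> = 100])
      apply (use assms in \<open>simp add: I_def\<close>)
     apply (rule step; assumption)
    \<comment> \<open>At exit the position is 1. Its parent 0 is not a node, so the exception in the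
      invariant is void.\<close>
    subgoal for k s'
      by (cases "words s' (Sc 7) 0 = Suc 0") (auto simp: I_def)
    done
qed

definition rk :: "(nat \<Rightarrow> real) \<Rightarrow> nat \<Rightarrow> nat" where
  "rk x i = card {j. j < n \<and> xkey x j < xkey x i}"

end

context ram begin

lemma node_cong:
  assumes "words s (Sc 6) k = words s' (Sc 6) k" "words s (Sc 6) (2 * k) = words s' (Sc 6) (2 * k)"
    "words s (Sc 6) (2 * k + 1) = words s' (Sc 6) (2 * k + 1)" "reals s X = reals s' X"
  shows "node s k = node s' k"
  unfolding node_def assms ..

text \<open>In \<open>le\<close> the marker \<open>n\<close> acts as infinity. Each inner node is
  \<open>le\<close> both of its children, so by induction along parents the root is
  \<open>le\<close> every leaf. Being \<open>le\<close> a live leaf, it cannot be the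
  marker.\<close>

lemma tournament_root:
  assumes A: "A \<subseteq> {..<n}" "A \<noteq> {}"
    and leaf: "\<forall>i<n. words s (Sc 6) (n + i) = (if i \<in> A then i else n)"
    and nodes: "\<forall>k. 1 \<le> k \<longrightarrow> k < n \<longrightarrow> node s k"
  shows "words s (Sc 6) 1 \<in> A"
    "\<forall>a\<in>A. xkey (reals s X) (words s (Sc 6) 1) \<le> xkey (reals s X) a"
proof -
  let ?w = "words s (Sc 6)" and ?x = "reals s X"
  have mem: "?w k \<in> insert n A" if "1 \<le> k" "k < 2 * n" for k
    using that
  proof (induction "2 * n - k" arbitrary: k rule: less_induct)
    case less
    show ?case
    proof (cases "k < n")
      case True
      then have "?w k = win ?x (?w (2 * k)) (?w (2 * k + 1))"
        using nodes less.prems by (simp add: node_def)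
      moreover have "?w (2 * k) \<in> insert n A" "?w (2 * k + 1) \<in> insert n A"
        by (rule less.hyps; use True less.prems in linarith)+
      ultimately show ?thesis using A by (auto simp: win_def split: if_splits)
    next
      case False
      then show ?thesis using leaf[rule_format, of "k - n"] less.prems by simp
    qed
  qed
  define le where "le a b \<longleftrightarrow> b = n \<or> a < n \<and> xkey ?x a \<le> xkey ?x b" for a b
  have le_win: "le (win ?x a b) a" "le (win ?x a b) b" if "a \<le> n" "b \<le> n" for a b
    using that by (auto simp: le_def win_def)
  have le_trans: "le a b \<Longrightarrow> le b d \<Longrightarrow> le a d" for a b d
    by (auto simp: le_def)
  have wn: "?w k \<le> n" if "1 \<le> k" "k < 2 * n" for k
    using mem[OF that] A by auto
  have root: "le (?w 1) (?w k)" if "1 \<le> k" "k < 2 * n" for k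
    using that
  proof (induction k rule: less_induct)
    case (less k)
    show ?case
    proof (cases "k = 1")
      case True
      have "?w 1 \<le> n" using wn n by simp
      then show ?thesis using True by (auto simp: le_def)
    next
      case False
      let ?p = "k div 2"
      have p: "1 \<le> ?p" "?p < n" "?p < k" using False less.prems by auto
      then have "node s ?p" using nodes by simp
      then have "?w ?p = win ?x (?w (2 * ?p)) (?w (2 * ?p + 1))" by (simp add: node_def)
      moreover have "?w (2 * ?p) \<le> n" "?w (2 * ?p + 1) \<le> n"
        by (rule wn; use p in linarith)+
      moreover have "k = 2 * ?p \<or> k = 2 * ?p + 1" by presburger
      ultimately have "le (?w ?p) (?w k)" using le_win by metis
      then show ?thesis using less.IH[of ?p] p less.prems le_trans by simp
    qed
  qed
  have leA: "le (?w 1) a" if "a \<in> A" for a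
    using root[of "n + a"] leaf that A by (auto dest: subsetD)
  obtain a where a: "a \<in> A" using A by blast
  show "?w 1 \<in> A" using leA[OF a] mem[of 1] n a A by (auto simp: le_def)
  show "\<forall>a\<in>A. xkey ?x (?w 1) \<le> xkey ?x a"
    using leA A by (auto simp: le_def)
qed

lemma wp_tour:
  "wpr tour s (\<lambda>t s'. t \<le> 1000 * (n * (Lg + 1)) \<and> frame tour s s' \<and>
     (\<forall>i<n. words s' X i = rk (reals s X) i) \<and>
     (\<forall>k<n. words s' (Sc 10) k < n \<and> rk (reals s X) (words s' (Sc 10) k) = k))"
proof -
  let ?x = "reals s X"
  \<comment> \<open>\<open>D\<close> collects the \<open>k\<close> coordinates extracted so far. It
    is a lower set in the key order, so the next winner has exactly \<open>D\<close> below it and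
    hence rank \<open>k\<close>.\<close>
  define I where "I k s' \<longleftrightarrow> reals s' = reals s \<and> words s' (Sc 8) 0 = k \<and>
    (\<forall>i. 1 \<le> i \<longrightarrow> i < n \<longrightarrow> node s' i) \<and>
    (\<forall>i<k. words s' (Sc 10) i < n \<and> rk ?x (words s' (Sc 10) i) = i) \<and>
    (\<exists>D\<subseteq>{..<n}. card D = k \<and> (\<forall>d\<in>D. \<forall>i<n. i \<notin> D \<longrightarrow> xkey ?x d < xkey ?x i) \<and>
       (\<forall>i\<in>D. words s' X i = rk ?x i) \<and>
       (\<forall>i<n. words s' (Sc 6) (n + i) = (if i \<in> D then n else i)))" for k s'
  have step: "k < n \<and> wpr tour_extract s' (\<lambda>t s''. t \<le> 300 * Lg + 300 \<and> I (Suc k) s'')"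
    if I: "I k s'" and lt: "bval n c s' (Less (get (Sc 8)) Len)" for k s'
  proof -
    from I obtain D where D: "D \<subseteq> {..<n}" "card D = k"
      "\<forall>d\<in>D. \<forall>i<n. i \<notin> D \<longrightarrow> xkey ?x d < xkey ?x i"
      "\<forall>i\<in>D. words s' X i = rk ?x i"
      "\<forall>i<n. words s' (Sc 6) (n + i) = (if i \<in> D then n else i)"
      by (auto simp: I_def)
    have x: "reals s' = reals s" and k: "words s' (Sc 8) 0 = k" "k < n"
      and nodes: "\<forall>i. 1 \<le> i \<longrightarrow> i < n \<longrightarrow> node s' i"
      and perm: "\<forall>i<k. words s' (Sc 10) i < n \<and> rk ?x (words s' (Sc 10) i) = i"
      using I lt by (auto simp: I_def)
    define e where "e = words s' (Sc 6) 1"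
    have e1: "words s' (Sc 6) (Suc 0) = e" by (simp add: e_def)
    have "D \<noteq> {..<n}" using k D by auto
    then have ne: "{..<n} - D \<noteq> {}" using D by auto
    have e: "e \<in> {..<n} - D" "\<forall>a\<in>{..<n} - D. xkey ?x e \<le> xkey ?x a"
      using tournament_root[of "{..<n} - D" s'] ne nodes D x by (auto simp: e_def)
    have "{j. j < n \<and> xkey ?x j < xkey ?x e} = D"
      using e D by (auto simp: not_le[symmetric])
    then have rke: "rk ?x e = k" using D by (simp add: rk_def)
    define s1 where "s1 = upd (upd (upd (upd (upd s' (Sc 9) 0 e) X e k) (Sc 10) k e) (Sc 7) 0 (n + e)) (Sc 6) (n + e) n"
    have "wpr tour_path s1 (\<lambda>t s''. t \<le> 200 * Lg + 200 \<and>
       (\<forall>i<n. words s'' (Sc 6) (n + i) = words s1 (Sc 6) (n + i)) \<and>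
       (\<forall>k. 1 \<le> k \<longrightarrow> k < n \<longrightarrow> node s'' k))"
    proof (rule wp_tour_path)
      show "\<forall>k. 1 \<le> k \<longrightarrow> k < n \<longrightarrow> k \<noteq> words s1 (Sc 7) 0 div 2 \<longrightarrow> node s1 k"
      proof (intro allI impI)
        fix i assume i: "1 \<le> i" "i < n" "i \<noteq> words s1 (Sc 7) 0 div 2"
        have "node s1 i = node s' i"
          by (rule node_cong) (use i in \<open>auto simp: s1_def\<close>)
        then show "node s1 i" using nodes i by simp
      qed
    qed (use n e in \<open>auto simp: s1_def\<close>)
    then have path: "wpr tour_path s1 (\<lambda>t s''. t \<le> 200 * Lg + 200 \<and> frame tour_path s1 s'' \<and>
       (\<forall>i<n. words s'' (Sc 6) (n + i) = words s1 (Sc 6) (n + i)) \<and>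
       (\<forall>k. 1 \<le> k \<longrightarrow> k < n \<longrightarrow> node s'' k))"
      by (rule wp_frame) auto
    have final: "words s2 (Sc 8) 0 = k \<and> I (Suc k) (upd s2 (Sc 8) 0 (Suc k))"
      if fr: "frame tour_path s1 s2" and leaf: "\<forall>i<n. words s2 (Sc 6) (n + i) = words s1 (Sc 6) (n + i)"
        and nodes2: "\<forall>k. 1 \<le> k \<longrightarrow> k < n \<longrightarrow> node s2 k" for s2
    proof
      have w: "words s2 a = words s1 a" if "a \<noteq> Sc 6" "a \<noteq> Sc 7" for a
        using that by (intro frame_words[OF fr]) (simp add: tour_path_def replay_def)
      have r: "reals s2 = reals s"
        using frame_reals[OF fr] by (auto simp: fun_eq_iff tour_path_def replay_def s1_def x)
      show 8: "words s2 (Sc 8) 0 = k" using w[of "Sc 8"] k by (simp add: s1_def)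
      have dd: "insert e D \<subseteq> {..<n}" "card (insert e D) = Suc k"
        using D e finite_subset[OF D(1)] by auto
      have 10: "words s2 (Sc 10) = (words s' (Sc 10))(k := e)"
        and 11: "words s2 X = (words s' X)(e := k)"
        using w by (simp_all add: s1_def)
      have leaf': "words s2 (Sc 6) (n + i) = (if i \<in> insert e D then n else i)" if "i < n" for i
        using leaf that D(5) by (auto simp: s1_def)
      have down: "\<forall>d\<in>insert e D. \<forall>i<n. i \<notin> insert e D \<longrightarrow> xkey ?x d < xkey ?x i"
      proof (intro ballI allI impI)
        fix d i assume d: "d \<in> insert e D" "i < n" "i \<notin> insert e D"
        show "xkey ?x d < xkey ?x i"
        proof (cases "d = e")
          case True
          have "xkey ?x e \<le> xkey ?x i" using e d by auto
          moreover have "xkey ?x e \<noteq> xkey ?x i" using d by auto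
          ultimately show ?thesis using True by (metis order.strict_iff_order)
        qed (use D d in auto)
      qed
      show "I (Suc k) (upd s2 (Sc 8) 0 (Suc k))"
        unfolding I_def
      proof (intro conjI exI[of _ "insert e D"])
        show "\<forall>i\<ge>1. i < n \<longrightarrow> node (upd s2 (Sc 8) 0 (Suc k)) i" using nodes2 by simp
      qed (use r 8 10 11 dd down leaf' perm rke e D in \<open>auto simp: less_Suc_eq\<close>)
    qed
    have e': "e < n" using e by simp
    have "wpr tour_extract s' (\<lambda>t s''. t \<le> 300 * Lg + 300 \<and> I (Suc k) s'')"
      unfolding tour_extract_def
      using k cp big e'
      apply (simp add: e1 s1_def[simplified, symmetric])
      apply (rule wp_mono[OF path])
      using final by auto
    with k show ?thesis by simp
  qed
  have I0: "wpr tour_build s1 (\<lambda>t s2. t \<le> 200 * n + 200 \<and> words (upd s2 (Sc 8) 0 0) = words (upd s2 (Sc 8) 0 0) \<and> I 0 (upd s2 (Sc 8) 0 0))"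
    if "frame tour_init s s1" "\<forall>i<n. words s1 (Sc 6) (n + i) = i" for s1
    by (rule wp_frame[OF wp_tour_build[OF that(2)]])
      (use that in \<open>auto simp: I_def frame_def tour_init_def tour_build_def replay_def node_def\<close>)
  have fin: "k = n \<and> (\<forall>i<n. words s' X i = rk ?x i) \<and>
     (\<forall>k<n. words s' (Sc 10) k < n \<and> rk ?x (words s' (Sc 10) k) = k)"
    if "I k s'" "\<not> bval n c s' (Less (get (Sc 8)) Len)" for k s'
  proof -
    from that obtain D where D: "D \<subseteq> {..<n}" "card D = k" "\<forall>i\<in>D. words s' X i = rk ?x i"
      and k: "n \<le> k" by (auto simp: I_def)
    have "k \<le> n" using card_mono[OF _ D(1)] D(2) by simp
    then have "D = {..<n}" using D k by (intro card_subset_eq) auto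
    then show ?thesis using that D k \<open>k \<le> n\<close> by (auto simp: I_def)
  qed
  show ?thesis
    apply (rule wp_frame[where Q = "\<lambda>t s'. t \<le> 1000 * (n * (Lg + 1)) \<and>
     (\<forall>i<n. words s' X i = rk (reals s X) i) \<and>
     (\<forall>k<n. words s' (Sc 10) k < n \<and> rk (reals s X) (words s' (Sc 10) k) = k)"])
    unfolding tour_def wp_Seq
     apply (rule wp_frame[OF wp_tour_init])
     apply (rule wp_mono[OF I0]; simp)
    using cp apply simp
    apply (rule wp_While_const[where I = I and B = n and \<tau> = "300 * Lg + 300"])
      apply simp
     apply (rule step; assumption)
    apply (frule (1) fin)
    using n apply (simp add: algebra_simps)
    apply blast
    done
qed

end

declare One_nat_def [simp del]

section \<open>Parameters\<close>

text \<open>The result is \<open>lg n\<close> in \<open>Sc 0\<close>, the number of merged inputs in \<open>Sc 2\<close> and the number of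
  samples in \<open>Sc 5\<close>.\<close>

definition params :: "nat \<Rightarrow> com" where
  "params Q =
     set (Sc 0) (Num 0) ;; set (Sc 1) (Num 1) ;;
     While (Not (Less Len (get (Sc 1))))
       (set (Sc 1) (Times (Num 2) (get (Sc 1))) ;; set (Sc 0) (Plus (get (Sc 0)) (Num 1))) ;;
     set (Sc 2) (Times (Num 4) (get (Sc 0))) ;;
     set (Sc 3) (Num 1) ;; set (Sc 4) (Div (get (Sc 0)) (Num Q)) ;;
     While (Less (Num 0) (get (Sc 4)))
       (set (Sc 3) (Times (Num 2) (get (Sc 3))) ;; set (Sc 4) (Minus (get (Sc 4)) (Num 1))) ;;
     set (Sc 5) (Times (Times (Num 32) (get (Sc 3))) (get (Sc 0)))"

context ram
begin

lemma Lg_pos: "1 \<le> Lg"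
  using Lg n by (cases Lg) auto

text \<open>\<open>Scratch\<close> is zeroed before each input, so the parameters are recomputed
  every time, within O(log n). The power of two with exponent \<open>Lg div Q\<close> stands in for
  the root n^(1/Q), which matters only up to a constant factor.\<close>

lemma wp_params:
  assumes Q: "Q < W" and lam: "lam = 4 * Lg" and ms: "ms = 32 * 2 ^ (Lg div Q) * Lg"
  shows "wpr (params Q) s (\<lambda>t s'. t \<le> 200 * Lg + 200 \<and> words s' (Sc 0) 0 = Lg \<and>
     words s' (Sc 2) 0 = lam \<and> words s' (Sc 5) 0 = ms)"
proof -
  \<comment> \<open>\<open>Q\<close> is a literal of the program that grows with 1/\<epsilon> and
    may exceed 1000, so \<open>wval_Num\<close> does not cover it.\<close>
  have Qn: "wv s' (Num Q) = Q" for s' using Q by (simp add: wval.simps(1) W flip: Suc_eq_plus1)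
  have M: "32 * 2 ^ (Lg div Q) \<le> ms" using Lg_pos by (simp add: ms)
  have c0: "0 < cp" using cp by simp
  have lessLg: "k < Lg" if "2 ^ k \<le> n" for k :: nat
  proof -
    have "(2::nat) ^ k < 2 ^ Lg" using that Lg by linarith
    then show ?thesis by simp
  qed
  have eqLg: "k = Lg" if "n < 2 ^ k" "k \<le> Lg" for k
  proof (rule ccontr)
    assume "k \<noteq> Lg"
    then have "Suc k \<le> Lg" using that by simp
    then have "(2::nat) ^ Suc k \<le> 2 ^ Lg" by (rule power_increasing) simp
    then show False using that Lg by simp
  qed
  have second: "wpr (While (Less (Num 0) (get (Sc 4)))
       (set (Sc 3) (Times (Num 2) (get (Sc 3))) ;; set (Sc 4) (Minus (get (Sc 4)) (Num 1)))) s1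
       (\<lambda>t s'. t \<le> 40 * Lg + 40 \<and> words s' (Sc 3) 0 = 2 ^ (Lg div Q) \<and> words s' (Sc 0) = words s1 (Sc 0) \<and>
          words s' (Sc 2) = words s1 (Sc 2))"
    if s1: "words s1 (Sc 3) 0 = 1" "words s1 (Sc 4) 0 = Lg div Q" for s1
  proof (rule wp_While_const[where B = "Lg div Q" and \<tau> = 30 and
      I = "\<lambda>k s'. k \<le> Lg div Q \<and> words s' (Sc 3) 0 = 2 ^ k \<and> words s' (Sc 4) 0 = Lg div Q - k"], goal_cases)
    case (2 k s')
    have "2 ^ Suc k \<le> (2::nat) ^ (Lg div Q)" by (rule power_increasing) (use 2 in auto)
    then have "2 * 2 ^ k < W" using M big by simp
    then show ?case using 2 c0 by auto
  next
    case (3 k s' t)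
    have "k = Lg div Q" using 3 by simp
    moreover have "35 * (Lg div Q) + 5 \<le> 40 * Lg + 40" using div_le_dividend[of Lg Q] by linarith
    moreover have "t \<le> 35 * (Lg div Q) + 5" using 3(5) by simp
    ultimately show ?case using 3(1) frame_words[OF 3(2)] by auto
  qed (use s1 in simp)
  have first: "wpr (While (Not (Less Len (get (Sc 1))))
       (set (Sc 1) (Times (Num 2) (get (Sc 1))) ;; set (Sc 0) (Plus (get (Sc 0)) (Num 1)))) s1
       (\<lambda>t s'. t \<le> 40 * Lg + 40 \<and> words s' (Sc 0) 0 = Lg)"
    if s1: "words s1 (Sc 1) 0 = 1" "words s1 (Sc 0) 0 = 0" for s1
  proof (rule wp_While_const[where B = "Lg" and \<tau> = 30 and
      I = "\<lambda>k s'. k \<le> Lg \<and> words s' (Sc 1) 0 = 2 ^ k \<and> words s' (Sc 0) 0 = k"], goal_cases)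
    case (2 k s')
    then have k: "k < Lg" "2 ^ k \<le> n" using lessLg[of k] by auto
    then have "2 * 2 ^ k < W" "k + 1 < W" using big by linarith+
    then show ?case using 2 c0 k by auto
  next
    case (3 k s' t)
    then show ?case using eqLg[of k] by auto
  qed (use s1 in simp)
  have b4: "4 * Lg < W" "32 * 2 ^ (Lg div Q) < W" "32 * 2 ^ (Lg div Q) * Lg < W"
    using big M by (simp_all only: lam[symmetric] ms[symmetric])
  show ?thesis
    unfolding params_def
    using c0
    apply simp
    apply (rule wp_mono[OF first])
      apply simp
     apply simp
    using b4 apply (simp add: Qn)
    apply (rule wp_mono[OF second])
      apply simp
     apply simp
    using b4 apply (simp add: lam ms)
    done
qed

end

section \<open>Merging the sorted input into the sorted list of all training keys\<close>

text \<open>Merging from the large end works in place: as long as an input key is left, the write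
  position \<open>ma + mb - 1\<close> lies above all unread list cells. Once the input keys are used
  up, the remaining list cells already are where they belong.\<close>

definition merge_step :: com where
  "merge_step =
     If (And (Less (Num 0) (get (Sc 11)))
          (Not (LLe (Minus (get (Sc 11)) (Num 1)) (WGet (Sc 10) (Minus (get (Sc 12)) (Num 1))))))
       (WSet LA (Minus (Plus (get (Sc 11)) (get (Sc 12))) (Num 1)) (WGet LA (Minus (get (Sc 11)) (Num 1))) ;;
        RCopy LA (Minus (Plus (get (Sc 11)) (get (Sc 12))) (Num 1)) LA (Minus (get (Sc 11)) (Num 1)) ;;
        set (Sc 11) (Minus (get (Sc 11)) (Num 1)))
       (WSet LA (Minus (Plus (get (Sc 11)) (get (Sc 12))) (Num 1)) (WGet (Sc 10) (Minus (get (Sc 12)) (Num 1))) ;;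
        RCopy LA (Minus (Plus (get (Sc 11)) (get (Sc 12))) (Num 1)) X (WGet (Sc 10) (Minus (get (Sc 12)) (Num 1))) ;;
        set (Sc 12) (Minus (get (Sc 12)) (Num 1)))"

definition merge :: com where
  "merge = set (Sc 11) (Times (get CN) Len) ;; set (Sc 12) Len ;;
     While (Less (Num 0) (get (Sc 12))) merge_step ;;
     set CN (Plus (get CN) (Num 1))"

context ram
begin

lemma wp_merge_step:
  assumes ma: "words s (Sc 11) 0 = ma" and mb: "words s (Sc 12) 0 = mb" "1 \<le> mb" "mb \<le> n"
    and sum: "ma + mb \<le> n * lam"
  shows "wpr merge_step s (\<lambda>t s'. t \<le> 100 \<and> words s' (Sc 10) = words s (Sc 10) \<and>
    (if 1 \<le> ma \<and> xkey (reals s X) (words s (Sc 10) (mb - 1)) < lkey s (ma - 1)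
     then words s' (Sc 11) 0 = ma - 1 \<and> words s' (Sc 12) 0 = mb \<and>
       lkey s' = (lkey s)(ma + mb - 1 := lkey s (ma - 1))
     else words s' (Sc 11) 0 = ma \<and> words s' (Sc 12) 0 = mb - 1 \<and>
       lkey s' = (lkey s)(ma + mb - 1 := xkey (reals s X) (words s (Sc 10) (mb - 1)))))"
proof -
  have c: "ma + mb - 1 < cp" "0 < cp" "ma + mb < W" using cp sum mb big by linarith+
  show ?thesis
    unfolding merge_step_def
    using c ma mb
    by (auto simp: not_le lkey_def fun_eq_iff)
qed

text \<open>Equality of multisets is expressed by equal sums of every function \<open>f\<close> of
  keys. In this form it composes over rounds by addition, and taking an indicator for
  \<open>f\<close> later yields counts.\<close>

lemma wp_merge:
  fixes y :: "nat \<Rightarrow> key"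
  assumes a: "words s CN 0 = a" "a < lam"
    and y: "\<And>t. t < n \<Longrightarrow> xkey (reals s X) (words s (Sc 10) t) = y t"
    and ysort: "\<And>t u. t < u \<Longrightarrow> u < n \<Longrightarrow> y t \<le> y u"
    and lsort: "\<And>t u. t < u \<Longrightarrow> u < a * n \<Longrightarrow> lkey s t \<le> lkey s u"
  shows "wpr merge s (\<lambda>t s'. t \<le> 200 * (n * lam) + 200 \<and> words s' CN 0 = Suc a \<and>
     (\<forall>t u. t < u \<longrightarrow> u < Suc a * n \<longrightarrow> lkey s' t \<le> lkey s' u) \<and>
     (\<forall>f :: key \<Rightarrow> nat. (\<Sum>t<Suc a * n. f (lkey s' t)) =
        (\<Sum>t<a * n. f (lkey s t)) + (\<Sum>t<n. f (y t))))"
proof -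
  have tot: "Suc a * n \<le> n * lam" using a by (subst mult.commute) (rule mult_left_mono, auto)
  have totB: "a * n + n \<le> n * lam" using tot by (simp add: algebra_simps)
  let ?N = "a * n + n"
  define s1 where "s1 = upd (upd s (Sc 11) 0 (a * n)) (Sc 12) 0 n"
  have lk1: "lkey s1 = lkey s" by (simp add: s1_def lkey_def fun_eq_iff)
  \<comment> \<open>Cells below \<open>ma\<close> are the unread list, \<open>mb\<close> input keys
    are unread, and the cells from \<open>ma + mb\<close> on hold the merged upper part, which
    dominates everything unread.\<close>
  define I where "I k s' \<longleftrightarrow> (\<exists>ma mb. words s' (Sc 11) 0 = ma \<and> words s' (Sc 12) 0 = mb \<and>
      ma \<le> a * n \<and> mb \<le> n \<and> ma + mb + k = ?N \<and> words s' (Sc 10) = words s (Sc 10) \<and>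
      (\<forall>i<ma. lkey s' i = lkey s i) \<and>
      (\<forall>i j. ma + mb \<le> i \<longrightarrow> i < j \<longrightarrow> j < ?N \<longrightarrow> lkey s' i \<le> lkey s' j) \<and>
      (\<forall>j. ma + mb \<le> j \<longrightarrow> j < ?N \<longrightarrow> (\<forall>i<ma. lkey s i \<le> lkey s' j) \<and> (\<forall>t<mb. y t \<le> lkey s' j)) \<and>
      (\<forall>f :: key \<Rightarrow> nat. (\<Sum>j\<in>{ma + mb..<?N}. f (lkey s' j)) + (\<Sum>t<ma. f (lkey s t)) + (\<Sum>t<mb. f (y t)) =
         (\<Sum>t<a * n. f (lkey s t)) + (\<Sum>t<n. f (y t))))" for k s'
  have step: "k < n * lam \<and> wpr merge_step s' (\<lambda>t s''. t \<le> 100 \<and> I (Suc k) s'')"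
    if I: "I k s'" and fr: "frame merge_step s1 s'"
      and b: "bval n c s' (Less (Num 0) (get (Sc 12)))" for k s'
  proof -
    from I obtain ma mb where m: "words s' (Sc 11) 0 = ma" "words s' (Sc 12) 0 = mb"
      "ma \<le> a * n" "mb \<le> n" "ma + mb + k = ?N" and p: "words s' (Sc 10) = words s (Sc 10)"
      and low: "\<And>i. i < ma \<Longrightarrow> lkey s' i = lkey s i"
      and srt: "\<And>i j. ma + mb \<le> i \<Longrightarrow> i < j \<Longrightarrow> j < ?N \<Longrightarrow> lkey s' i \<le> lkey s' j"
      and ub: "\<And>i j. ma + mb \<le> j \<Longrightarrow> j < ?N \<Longrightarrow> i < ma \<Longrightarrow> lkey s i \<le> lkey s' j"
        "\<And>t j. ma + mb \<le> j \<Longrightarrow> j < ?N \<Longrightarrow> t < mb \<Longrightarrow> y t \<le> lkey s' j"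
      and cnt: "\<And>f :: key \<Rightarrow> nat. (\<Sum>j\<in>{ma + mb..<?N}. f (lkey s' j)) + (\<Sum>t<ma. f (lkey s t)) + (\<Sum>t<mb. f (y t)) =
         (\<Sum>t<a * n. f (lkey s t)) + (\<Sum>t<n. f (y t))"
      unfolding I_def by blast
    have mb1: "1 \<le> mb" using b m by simp
    have x: "reals s' X = reals s X"
      using frame_reals[OF fr, of X] by (simp add: merge_step_def s1_def)
    have ymb: "xkey (reals s' X) (words s' (Sc 10) (mb - 1)) = y (mb - 1)"
      using y[of "mb - 1"] m mb1 p x by simp
    have mbS: "mb = Suc (mb - 1)" using mb1 by simp
    have I': "I (Suc k) s''" if p'': "words s'' (Sc 10) = words s' (Sc 10)" and
      s'': "if 1 \<le> ma \<and> y (mb - 1) < lkey s' (ma - 1)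
     then words s'' (Sc 11) 0 = ma - 1 \<and> words s'' (Sc 12) 0 = mb \<and>
       lkey s'' = (lkey s')(ma + mb - 1 := lkey s' (ma - 1))
     else words s'' (Sc 11) 0 = ma \<and> words s'' (Sc 12) 0 = mb - 1 \<and>
       lkey s'' = (lkey s')(ma + mb - 1 := y (mb - 1))" for s''
    proof (cases "1 \<le> ma \<and> y (mb - 1) < lkey s' (ma - 1)")
      case True
      then have w: "words s'' (Sc 11) 0 = ma - 1" "words s'' (Sc 12) 0 = mb"
        and l: "lkey s'' = (lkey s')(ma + mb - 1 := lkey s (ma - 1))"
        using s'' low[of "ma - 1"] by auto
      have lt: "y (mb - 1) < lkey s (ma - 1)" and maS: "ma = Suc (ma - 1)"
        using True low[of "ma - 1"] by auto
      have lo1: "lkey s i \<le> lkey s (ma - 1)" if "i < ma" for i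
        using lsort[of i "ma - 1"] that m maS by (cases "i = ma - 1") auto
      have yo1: "y t \<le> lkey s (ma - 1)" if "t < mb" for t
        using ysort[of t "mb - 1"] that m lt by (cases "t = mb - 1") fastforce+
      have set: "{ma - 1 + mb..<?N} = insert (ma + mb - 1) {ma + mb..<?N}"
        using m maS by auto
      have nin: "ma + mb - 1 \<notin> {ma + mb..<?N}" using maS by auto
      have "(\<Sum>j\<in>{ma - 1 + mb..<?N}. f (lkey s'' j)) + (\<Sum>t<ma - 1. f (lkey s t)) =
         (\<Sum>j\<in>{ma + mb..<?N}. f (lkey s' j)) + (\<Sum>t<ma. f (lkey s t))" for f :: "key \<Rightarrow> nat"
      proof -
        have h3: "(\<Sum>j\<in>{ma + mb..<?N}. f (lkey s'' j)) = (\<Sum>j\<in>{ma + mb..<?N}. f (lkey s' j))"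
          by (rule sum.cong) (use maS in \<open>auto simp: l\<close>)
        have h1: "(\<Sum>j\<in>{ma - 1 + mb..<?N}. f (lkey s'' j)) =
            f (lkey s'' (ma + mb - 1)) + (\<Sum>j\<in>{ma + mb..<?N}. f (lkey s'' j))"
          unfolding set using nin by (subst sum.insert) auto
        have h2: "lkey s'' (ma + mb - 1) = lkey s (ma - 1)" by (simp add: l)
        have h4: "(\<Sum>t<ma. f (lkey s t)) = (\<Sum>t<ma - 1. f (lkey s t)) + f (lkey s (ma - 1))"
          by (subst maS) simp
        show ?thesis by (simp only: h1 h2 h3 h4)
      qed
      note cnt' = this
      have cnt2: "\<forall>f :: key \<Rightarrow> nat. (\<Sum>j\<in>{ma - 1 + mb..<?N}. f (lkey s'' j)) + (\<Sum>t<ma - 1. f (lkey s t)) + (\<Sum>t<mb. f (y t)) =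
         (\<Sum>t<a * n. f (lkey s t)) + (\<Sum>t<n. f (y t))"
      proof
        fix f :: "key \<Rightarrow> nat"
        show "(\<Sum>j\<in>{ma - 1 + mb..<?N}. f (lkey s'' j)) + (\<Sum>t<ma - 1. f (lkey s t)) + (\<Sum>t<mb. f (y t)) =
         (\<Sum>t<a * n. f (lkey s t)) + (\<Sum>t<n. f (y t))"
          using cnt'[of f] cnt[of f] by linarith
      qed
      have low': "\<forall>i<ma - 1. lkey s'' i = lkey s i" using maS low by (auto simp: l)
      have srt': "\<forall>i j. ma - 1 + mb \<le> i \<longrightarrow> i < j \<longrightarrow> j < ?N \<longrightarrow> lkey s'' i \<le> lkey s'' j"
      proof (intro allI impI)
        fix i j assume ij: "ma - 1 + mb \<le> i" "i < j" "j < ?N"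
        then have "ma + mb \<le> j" "j \<noteq> ma + mb - 1" using maS by linarith+
        then show "lkey s'' i \<le> lkey s'' j"
          using ij ub(1)[of j "ma - 1"] srt[of i j] maS by (cases "i = ma + mb - 1") (auto simp: l)
      qed
      have ub': "\<forall>j. ma - 1 + mb \<le> j \<longrightarrow> j < ?N \<longrightarrow>
         (\<forall>i<ma - 1. lkey s i \<le> lkey s'' j) \<and> (\<forall>t<mb. y t \<le> lkey s'' j)"
      proof (intro allI impI)
        fix j assume j: "ma - 1 + mb \<le> j" "j < ?N"
        show "(\<forall>i<ma - 1. lkey s i \<le> lkey s'' j) \<and> (\<forall>t<mb. y t \<le> lkey s'' j)"
        proof (cases "j = ma + mb - 1")
          case True
          then show ?thesis using lo1 yo1 by (auto simp: l)
        next
          case False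
          then have "ma + mb \<le> j" using j maS by linarith
          then show ?thesis using ub[of j] j False maS by (auto simp: l)
        qed
      qed
      have "ma - 1 \<le> a * n" "ma - 1 + mb + Suc k = ?N" "words s'' (Sc 10) = words s (Sc 10)"
        using m maS p p'' by auto
      note this m(4) w low' srt' ub' cnt2
      then show ?thesis unfolding I_def by blast
    next
      case False
      then have w: "words s'' (Sc 11) 0 = ma" "words s'' (Sc 12) 0 = mb - 1"
        and l: "lkey s'' = (lkey s')(ma + mb - 1 := y (mb - 1))"
        using s'' by (auto split: if_splits)
      have le: "lkey s (ma - 1) \<le> y (mb - 1)" if "1 \<le> ma"
        using False low[of "ma - 1"] that by auto
      have lo1: "lkey s i \<le> y (mb - 1)" if "i < ma" for i
      proof -
        have "lkey s i \<le> lkey s (ma - 1)"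
          using lsort[of i "ma - 1"] that m by (cases "i = ma - 1") auto
        also have "\<dots> \<le> y (mb - 1)" using le that by simp
        finally show ?thesis .
      qed
      have yo1: "y t \<le> y (mb - 1)" if "t < mb" for t
        using ysort[of t "mb - 1"] that m by (cases "t = mb - 1") fastforce+
      have set: "{ma + (mb - 1)..<?N} = insert (ma + mb - 1) {ma + mb..<?N}"
        using m mbS by auto
      have nin: "ma + mb - 1 \<notin> {ma + mb..<?N}" using mbS by auto
      have "(\<Sum>j\<in>{ma + (mb - 1)..<?N}. f (lkey s'' j)) + (\<Sum>t<mb - 1. f (y t)) =
         (\<Sum>j\<in>{ma + mb..<?N}. f (lkey s' j)) + (\<Sum>t<mb. f (y t))" for f :: "key \<Rightarrow> nat"
      proof -
        have h3: "(\<Sum>j\<in>{ma + mb..<?N}. f (lkey s'' j)) = (\<Sum>j\<in>{ma + mb..<?N}. f (lkey s' j))"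
          by (rule sum.cong) (use mbS in \<open>auto simp: l\<close>)
        have h1: "(\<Sum>j\<in>{ma + (mb - 1)..<?N}. f (lkey s'' j)) =
            f (lkey s'' (ma + mb - 1)) + (\<Sum>j\<in>{ma + mb..<?N}. f (lkey s'' j))"
          unfolding set using nin by (subst sum.insert) auto
        have h2: "lkey s'' (ma + mb - 1) = y (mb - 1)" by (simp add: l)
        have h4: "(\<Sum>t<mb. f (y t)) = (\<Sum>t<mb - 1. f (y t)) + f (y (mb - 1))"
          by (subst mbS) simp
        show ?thesis by (simp only: h1 h2 h3 h4)
      qed
      note cnt' = this
      have cnt2: "(\<Sum>j\<in>{ma + (mb - 1)..<?N}. f (lkey s'' j)) + (\<Sum>t<ma. f (lkey s t)) + (\<Sum>t<mb - 1. f (y t)) =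
         (\<Sum>t<a * n. f (lkey s t)) + (\<Sum>t<n. f (y t))" for f :: "key \<Rightarrow> nat"
        using cnt'[of f] cnt[of f] by linarith
      have srt': "\<forall>i j. ma + (mb - 1) \<le> i \<longrightarrow> i < j \<longrightarrow> j < ?N \<longrightarrow> lkey s'' i \<le> lkey s'' j"
      proof (intro allI impI)
        fix i j assume ij: "ma + (mb - 1) \<le> i" "i < j" "j < ?N"
        then have "ma + mb \<le> j" "j \<noteq> ma + mb - 1" using mbS by linarith+
        then show "lkey s'' i \<le> lkey s'' j"
          using ij ub(2)[of j "mb - 1"] srt[of i j] mbS by (cases "i = ma + mb - 1") (auto simp: l)
      qed
      have ub': "\<forall>j. ma + (mb - 1) \<le> j \<longrightarrow> j < ?N \<longrightarrow>
         (\<forall>i<ma. lkey s i \<le> lkey s'' j) \<and> (\<forall>t<mb - 1. y t \<le> lkey s'' j)"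
      proof (intro allI impI)
        fix j assume j: "ma + (mb - 1) \<le> j" "j < ?N"
        show "(\<forall>i<ma. lkey s i \<le> lkey s'' j) \<and> (\<forall>t<mb - 1. y t \<le> lkey s'' j)"
        proof (cases "j = ma + mb - 1")
          case True
          then show ?thesis using lo1 yo1 by (auto simp: l)
        next
          case False
          then have "ma + mb \<le> j" using j mbS by linarith
          then show ?thesis using ub[of j] j False mbS by (auto simp: l)
        qed
      qed
      have low': "\<forall>i<ma. lkey s'' i = lkey s i" using mbS low by (auto simp: l)
      have cnt3: "\<forall>f :: key \<Rightarrow> nat. (\<Sum>j\<in>{ma + (mb - 1)..<?N}. f (lkey s'' j)) + (\<Sum>t<ma. f (lkey s t)) + (\<Sum>t<mb - 1. f (y t)) =
         (\<Sum>t<a * n. f (lkey s t)) + (\<Sum>t<n. f (y t))"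
        using cnt2 by blast
      have "mb - 1 \<le> n" "ma + (mb - 1) + Suc k = ?N" "words s'' (Sc 10) = words s (Sc 10)"
        using m mbS p p'' by auto
      note this m(3) w low' srt' ub' cnt3
      then show ?thesis unfolding I_def by blast
    qed
    have "ma + mb \<le> n * lam" using m totB by simp
    from wp_merge_step[OF m(1,2) mb1 m(4) this]
    have "wpr merge_step s' (\<lambda>t s''. t \<le> 100 \<and> I (Suc k) s'')"
      by (rule wp_mono) (simp only: ymb, blast intro: I')
    moreover have "k < n * lam" using m mb1 totB by linarith
    ultimately show ?thesis by simp
  qed
  have I0: "I 0 s1"
    unfolding I_def by (auto simp: s1_def lkey_def)
  have an: "a * n < W" "0 < cp" "a < W" "Suc a < W" using totB big cp n a by linarith+
  have loop: "wpr (While (Less (Num 0) (get (Sc 12))) merge_step) s1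
     (\<lambda>t s'. t \<le> 150 * (n * lam) + 100 \<and> words s' CN 0 = a \<and>
     (\<forall>t u. t < u \<longrightarrow> u < Suc a * n \<longrightarrow> lkey s' t \<le> lkey s' u) \<and>
     (\<forall>f :: key \<Rightarrow> nat. (\<Sum>t<Suc a * n. f (lkey s' t)) =
        (\<Sum>t<a * n. f (lkey s t)) + (\<Sum>t<n. f (y t))))"
  proof (rule wp_While_const[where I = I and B = "n * lam" and \<tau> = 100], rule I0)
    fix k s' t
    assume I: "I k s'" and fr: "frame merge_step s1 s'"
      and b: "\<not> bval n c s' (Less (Num 0) (get (Sc 12)))"
      and t: "t \<le> n * lam * (100 + 1 + bcost (Less (Num 0) (get (Sc 12)))) +
          (1 + bcost (Less (Num 0) (get (Sc 12))))"
    have "words s' (Sc 12) 0 = 0" using b by simp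
    with I obtain ma where m: "ma \<le> a * n"
      and low: "\<And>i. i < ma \<Longrightarrow> lkey s' i = lkey s i"
      and srt: "\<And>i j. ma \<le> i \<Longrightarrow> i < j \<Longrightarrow> j < ?N \<Longrightarrow> lkey s' i \<le> lkey s' j"
      and ub: "\<And>i j. ma \<le> j \<Longrightarrow> j < ?N \<Longrightarrow> i < ma \<Longrightarrow> lkey s i \<le> lkey s' j"
      and cnt: "\<And>f :: key \<Rightarrow> nat. (\<Sum>j\<in>{ma..<?N}. f (lkey s' j)) + (\<Sum>t<ma. f (lkey s t)) =
         (\<Sum>t<a * n. f (lkey s t)) + (\<Sum>t<n. f (y t))"
      unfolding I_def by auto
    have N: "Suc a * n = ?N" by simp
    have "lkey s' t \<le> lkey s' u" if "t < u" "u < ?N" for t u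
    proof (cases "u < ma")
      case True
      then show ?thesis using that low lsort m by simp
    next
      case False
      then show ?thesis using that low[of t] srt[of t u] ub[of u t] by (cases "t < ma") auto
    qed
    moreover have "(\<Sum>t<?N. f (lkey s' t)) = (\<Sum>t<a * n. f (lkey s t)) + (\<Sum>t<n. f (y t))"
      for f :: "key \<Rightarrow> nat"
    proof -
      have "ma \<le> ?N" using m by linarith
      then have "(\<Sum>t<?N. f (lkey s' t)) = (\<Sum>t<ma. f (lkey s' t)) + (\<Sum>t\<in>{ma..<?N}. f (lkey s' t))"
        using sum.atLeastLessThan_concat[of 0 ma ?N "\<lambda>t. f (lkey s' t)"]
        by (simp only: lessThan_atLeast0 le0)
      moreover have "(\<Sum>t<ma. f (lkey s' t)) = (\<Sum>t<ma. f (lkey s t))"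
        using low by (intro sum.cong) auto
      ultimately show ?thesis using cnt[of f] by linarith
    qed
    moreover have "words s' CN 0 = a"
      using frame_words[OF fr, of CN] a by (simp add: merge_step_def s1_def)
    ultimately show "t \<le> 150 * (n * lam) + 100 \<and> words s' CN 0 = a \<and>
     (\<forall>t u. t < u \<longrightarrow> u < Suc a * n \<longrightarrow> lkey s' t \<le> lkey s' u) \<and>
     (\<forall>f :: key \<Rightarrow> nat. (\<Sum>t<Suc a * n. f (lkey s' t)) =
        (\<Sum>t<a * n. f (lkey s t)) + (\<Sum>t<n. f (y t)))"
      using t unfolding N by auto
  qed (rule step)
  show ?thesis
    unfolding merge_def
    using an a
    apply (simp add: s1_def[simplified, symmetric])
    apply (rule wp_mono[OF loop])
    apply (simp add: lkey_def)
    done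
qed

end

section \<open>Searching\<close>

definition findV_step :: com where
  "findV_step =
      set (Sc 16) (Div (Plus (get (Sc 14)) (get (Sc 15))) (Num 2)) ;;
      If (LLe (Times (get (Sc 16)) (get (Sc 2))) (get (Sc 13)))
        (set (Sc 14) (Plus (get (Sc 16)) (Num 1)))
        (set (Sc 15) (get (Sc 16)))"

definition findV :: com where
  "findV = set (Sc 14) (Num 0) ;; set (Sc 15) Len ;;
     While (Less (get (Sc 14)) (get (Sc 15))) findV_step ;;
     set (Sc 17) (get (Sc 14))"

text \<open>A sample entry is a bucket number, while the bucket of the key is still unknown.
  Comparing the key with the two boundaries of the probed bucket tells whether its own bucket is
  smaller, larger or the same; buckets 0 and \<open>n\<close> lack one boundary. A hit empties the
  interval, which ends the loop.\<close>

definition findS_test :: com where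
  "findS_test =
      If (And (Less (Num 0) (get (Sc 18)))
            (Not (LLe (Times (Minus (get (Sc 18)) (Num 1)) (get (Sc 2))) (get (Sc 13)))))
        (set (Sc 15) (get (Sc 16)))
        (If (And (Less (get (Sc 18)) Len) (LLe (Times (get (Sc 18)) (get (Sc 2))) (get (Sc 13))))
          (set (Sc 14) (Plus (get (Sc 16)) (Num 1)))
          (set (Sc 17) (get (Sc 18)) ;; set (Sc 14) (get (Sc 15))))"

definition findS_step :: com where
  "findS_step =
      set (Sc 16) (Div (Plus (get (Sc 14)) (get (Sc 15))) (Num 2)) ;;
      set (Sc 18) (WGet SA (Plus (Times (get (Sc 13)) (get (Sc 5))) (get (Sc 16)))) ;;
      findS_test"

definition findS_loop :: com where
  "findS_loop = While (Less (get (Sc 14)) (get (Sc 15))) findS_step ;;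
     If (Less Len (get (Sc 17))) findV Skip"

text \<open>\<open>n + 1\<close> is not a bucket number and marks a search that has not
  succeeded.\<close>

definition findS :: com where
  "findS = set (Sc 17) (Plus Len (Num 1)) ;; set (Sc 14) (Num 0) ;; set (Sc 15) (get (Sc 5)) ;; findS_loop"

lemma lkey_words: "w LA = words s LA \<Longrightarrow> lkey (s\<lparr>words := w\<rparr>) = lkey s"
  by (simp add: lkey_def fun_eq_iff)

context ram
begin

text \<open>Boundaries are not stored separately: boundary \<open>j\<close> is entry
  \<open>j * lam\<close> of the merged list. The \<open>n\<close> boundaries cut the keys into the
  buckets \<open>0..n\<close>.\<close>

definition bk :: "(nat \<Rightarrow> key) \<Rightarrow> key \<Rightarrow> nat" where
  "bk L y = card {j. j < n \<and> L (j * lam) \<le> y}"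

lemma bk_le: "bk L y \<le> n"
  using card_mono[of "{..<n}" "{j. j < n \<and> L (j * lam) \<le> y}"] by (auto simp: bk_def)

definition vsorted :: "(nat \<Rightarrow> key) \<Rightarrow> bool" where
  "vsorted L \<longleftrightarrow> (\<forall>i j. i \<le> j \<longrightarrow> j < n \<longrightarrow> L (i * lam) \<le> L (j * lam))"

text \<open>By sortedness the boundaries at or below \<open>y\<close> form an initial segment, whose
  length is \<open>bk L y\<close>.\<close>

lemma bk_iff:
  assumes "vsorted L" "j < n"
  shows "L (j * lam) \<le> y \<longleftrightarrow> j < bk L y"
proof
  assume *: "L (j * lam) \<le> y"
  have "i < n \<and> L (i * lam) \<le> y" if "i \<le> j" for i
    using that assms * by (auto simp: vsorted_def intro: order_trans)
  then have "{..j} \<subseteq> {i. i < n \<and> L (i * lam) \<le> y}" by auto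
  then have "card {..j} \<le> bk L y" unfolding bk_def by (rule card_mono[rotated]) simp
  then show "j < bk L y" by simp
next
  assume *: "j < bk L y"
  show "L (j * lam) \<le> y"
  proof (rule ccontr)
    assume n: "\<not> L (j * lam) \<le> y"
    have "i < j" if "i < n" "L (i * lam) \<le> y" for i
    proof (rule ccontr)
      assume "\<not> i < j"
      then have "L (j * lam) \<le> L (i * lam)" using assms(1) that by (simp add: vsorted_def)
      then show False using n that by simp
    qed
    then have "{i. i < n \<and> L (i * lam) \<le> y} \<subseteq> {..<j}" by auto
    then have "bk L y \<le> card {..<j}" unfolding bk_def by (rule card_mono[rotated]) simp
    then show False using * by simp
  qed
qed

lemma halve:
  assumes "w * 2 ^ k \<le> (N::nat)" "w' \<le> w div 2"
  shows "w' * 2 ^ Suc k \<le> N"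
proof -
  have "w' * 2 * 2 ^ k \<le> w * 2 ^ k" using assms(2) by (intro mult_right_mono) auto
  also note assms(1)
  finally show ?thesis by (simp only: mult.assoc power_Suc)
qed

lemma wp_findV:
  assumes i: "words s (Sc 13) 0 = i" and l: "words s (Sc 2) 0 = lam"
    and srt: "vsorted (lkey s)"
  shows "wpr findV s (\<lambda>t s'. t \<le> 100 * Lg + 100 \<and> words s' (Sc 17) 0 = bk (lkey s) (xkey (reals s X) i))"
proof -
  let ?y = "xkey (reals s X) i" and ?L = "lkey s"
  define s1 where "s1 = upd (upd s (Sc 14) 0 0) (Sc 15) 0 n"
  have lk1: "lkey s1 = lkey s" by (simp add: s1_def lkey_def fun_eq_iff)
  define I where "I k s' \<longleftrightarrow> (\<exists>lo hi. words s' (Sc 14) 0 = lo \<and> words s' (Sc 15) 0 = hi \<and>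
    lo \<le> bk ?L ?y \<and> bk ?L ?y \<le> hi \<and> hi \<le> n \<and> (hi - lo) * 2 ^ k \<le> n)" for k and s' :: mem
  have c: "0 < cp" "n + n < W" using cp big n by linarith+
  have step: "k < Lg \<and> wpr findV_step s' (\<lambda>t s''. t \<le> 60 \<and> I (Suc k) s'')"
    if I: "I k s'" and fr: "frame findV_step s1 s'"
      and b: "bval n c s' (Less (get (Sc 14)) (get (Sc 15)))" for k and s' :: mem
  proof -
    from I obtain lo hi where m: "words s' (Sc 14) 0 = lo" "words s' (Sc 15) 0 = hi"
      "lo \<le> bk ?L ?y" "bk ?L ?y \<le> hi" "hi \<le> n" "(hi - lo) * 2 ^ k \<le> n"
      by (auto simp: I_def)
    have lt: "lo < hi" using b m by simp
    define mid where "mid = (lo + hi) div 2"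
    have mid: "lo \<le> mid" "mid < hi" "mid < n" "hi - (mid + 1) \<le> (hi - lo) div 2"
      "mid - lo \<le> (hi - lo) div 2"
      using lt m unfolding mid_def by linarith+
    have fs: "words s' (Sc 13) 0 = i" "words s' (Sc 2) 0 = lam" "lkey s' = ?L" "reals s' X = reals s X"
      using frame_words[OF fr] frame_reals[OF fr] i l
      by (simp_all add: findV_step_def s1_def lkey_def fun_eq_iff)
    have ml: "mid * lam \<le> n * lam" using mid by (intro mult_right_mono) auto
    have cs: "lo + hi < W" "mid + 1 < W" "mid * lam < W" "mid < cp"
      using mid m lt big cp ml by linarith+
    have "1 * 2 ^ k \<le> (hi - lo) * 2 ^ k" using lt by (intro mult_right_mono) auto
    then have "(2::nat) ^ k < 2 ^ Lg" using m Lg by linarith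
    then have k: "k < Lg" by simp
    have "I (Suc k) (upd (upd s' (Sc 16) 0 mid) (Sc 14) 0 (mid + 1))" if "?L (mid * lam) \<le> ?y"
      unfolding I_def using m mid that halve[OF m(6) mid(4)] bk_iff[OF srt \<open>mid < n\<close>, of ?y] by auto
    moreover have "I (Suc k) (upd (upd s' (Sc 16) 0 mid) (Sc 15) 0 mid)" if "\<not> ?L (mid * lam) \<le> ?y"
      unfolding I_def using m mid that halve[OF m(6) mid(5)] bk_iff[OF srt \<open>mid < n\<close>, of ?y] by auto
    ultimately have "wpr findV_step s' (\<lambda>t s''. t \<le> 60 \<and> I (Suc k) s'')"
      unfolding findV_step_def using c cs fs m by (simp add: mid_def[symmetric] lkey_words)
    with k show ?thesis by simp
  qed
  have loop: "wpr (While (Less (get (Sc 14)) (get (Sc 15))) findV_step) s1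
     (\<lambda>t s'. t \<le> 70 * Lg + 50 \<and> words s' (Sc 14) 0 = bk ?L ?y)"
  proof (rule wp_While_const[where I = I and B = Lg and \<tau> = 60])
    show "I 0 s1" by (auto simp: I_def s1_def bk_le)
  qed (use step in \<open>auto simp: I_def\<close>)
  show ?thesis
    unfolding findV_def
    using c
    apply (simp add: s1_def[simplified, symmetric])
    apply (rule wp_mono[OF loop])
    apply simp
    done
qed

text \<open>The occurrences of \<open>b\<close> in the sorted row form a block of \<open>C\<close>
  cells that stays inside the current interval until it is hit. Interval widths halve, so this
  happens within \<open>d\<close> probes if \<open>ms < C * 2 ^ d\<close>, that is, after about
  log(ms / C). For \<open>C = 0\<close> the interval shrinks to nothing, which
  \<open>max 1 C\<close> accounts for, and the search among the boundaries follows.\<close>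

lemma wp_findS:
  assumes i: "words s (Sc 13) 0 = i" "i < n" and l: "words s (Sc 2) 0 = lam" and w5: "words s (Sc 5) 0 = ms"
    and srt: "vsorted (lkey s)"
    and S: "\<And>a. a < ms \<Longrightarrow> words s SA (i * ms + a) \<le> n"
    and Ssrt: "\<And>a b. a < b \<Longrightarrow> b < ms \<Longrightarrow> words s SA (i * ms + a) \<le> words s SA (i * ms + b)"
    and bdef: "b = bk (lkey s) (xkey (reals s X) i)"
    and Cdef: "C = card {a. a < ms \<and> words s SA (i * ms + a) = b}"
    and d: "ms < max 1 C * 2 ^ d"
  shows "wpr findS s (\<lambda>t s'. words s' (Sc 17) 0 = b \<and>
     t \<le> 150 * d + 100 + (if C = 0 then 100 * Lg + 100 else 0))"
proof -
  let ?y = "xkey (reals s X) i" and ?L = "lkey s" and ?S = "\<lambda>a. words s SA (i * ms + a)"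
  define s1 where "s1 = upd (upd (upd s (Sc 17) 0 (n + 1)) (Sc 14) 0 0) (Sc 15) 0 ms"
  have bn: "b \<le> n" unfolding bdef by (rule bk_le)
  \<comment> \<open>Either the search goes on and all entries outside \<open>[lo, hi)\<close> differ
    from \<open>b\<close>, or it has succeeded and \<open>lo = hi\<close> stops the loop.\<close>
  define I where "I k s' \<longleftrightarrow> (\<exists>lo hi. words s' (Sc 14) 0 = lo \<and> words s' (Sc 15) 0 = hi \<and> hi \<le> ms \<and>
    (words s' (Sc 17) 0 = n + 1 \<and> lo \<le> hi \<and> (\<forall>a<lo. ?S a < b) \<and> (\<forall>a. hi \<le> a \<longrightarrow> a < ms \<longrightarrow> b < ?S a) \<and>
       (hi - lo) * 2 ^ k \<le> ms \<or>
     words s' (Sc 17) 0 = b \<and> lo = hi \<and> k \<le> d \<and> C \<noteq> 0))" for k and s' :: mem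
  have c: "0 < cp" "n + n < W" "n + 1 < W" using cp big n by linarith+
  have Csub: "C \<le> hi - lo" if "\<forall>a<lo. ?S a < b" "\<forall>a. hi \<le> a \<longrightarrow> a < ms \<longrightarrow> b < ?S a" for lo hi
  proof -
    have "{a. a < ms \<and> ?S a = b} \<subseteq> {lo..<hi}"
    proof
      fix a assume "a \<in> {a. a < ms \<and> ?S a = b}"
      then have a: "a < ms" "?S a = b" by auto
      then have "\<not> a < lo" using that(1) by fastforce
      moreover have "\<not> hi \<le> a" using that(2) a by fastforce
      ultimately show "a \<in> {lo..<hi}" by simp
    qed
    then have "C \<le> card {lo..<hi}" unfolding Cdef by (rule card_mono[rotated]) simp
    then show ?thesis by simp
  qed
  have step: "k < d \<and> wpr findS_step s' (\<lambda>t s''. t \<le> 120 \<and> I (Suc k) s'')"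
    if I: "I k s'" and fr: "frame findS_step s1 s'"
      and b: "bval n c s' (Less (get (Sc 14)) (get (Sc 15)))" for k and s' :: mem
  proof -
    from I b obtain lo hi where m: "words s' (Sc 14) 0 = lo" "words s' (Sc 15) 0 = hi" "lo < hi"
      "hi \<le> ms" "words s' (Sc 17) 0 = n + 1"
      and lo: "\<forall>a<lo. ?S a < b" and hi: "\<forall>a. hi \<le> a \<longrightarrow> a < ms \<longrightarrow> b < ?S a"
      and w: "(hi - lo) * 2 ^ k \<le> ms"
      by (auto simp: I_def)
    define mid where "mid = (lo + hi) div 2"
    have mid: "lo \<le> mid" "mid < hi" "mid < ms" "hi - (mid + 1) \<le> (hi - lo) div 2"
      "mid - lo \<le> (hi - lo) div 2"
      using m unfolding mid_def by linarith+
    define K where "K = ?S mid"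
    have K: "K \<le> n" using S mid by (simp add: K_def)
    have fs: "words s' (Sc 13) 0 = i" "words s' (Sc 2) 0 = lam" "lkey s' = ?L" "reals s' X = reals s X"
      "words s' (Sc 5) 0 = ms" "words s' SA (i * ms + mid) = K"
      using frame_words[OF fr] frame_reals[OF fr] i l w5
      by (simp_all add: findS_step_def findS_test_def s1_def lkey_def fun_eq_iff K_def)
    have "max 1 C \<le> hi - lo" using Csub[OF lo hi] m by simp
    then have "max 1 C * 2 ^ k \<le> (hi - lo) * 2 ^ k" by (rule mult_right_mono) simp
    then have "max 1 C * 2 ^ k < max 1 C * 2 ^ d" using w d by linarith
    then have k: "k < d" by simp
    have "(K - 1) * lam \<le> n * lam" "K * lam \<le> n * lam" using K by (auto intro!: mult_right_mono)
    moreover have "i * ms + mid \<le> i * ms + ms" using mid by simp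
    moreover have "i * ms + ms \<le> n * ms" using i mult_right_mono[of "Suc i" n ms] by simp
    ultimately have cs: "lo + hi < W" "mid + 1 < W" "(K - 1) * lam < W" "K * lam < W"
       "i * ms < W" "i * ms + mid < W" "mid < cp"
      using mid m big cp by linarith+
    have SmL: "?S a \<le> K" if "a \<le> mid" for a
      using Ssrt[of a mid] that mid by (cases "a = mid") (auto simp: K_def)
    have SmG: "K \<le> ?S a" if "mid \<le> a" "a < ms" for a
      using Ssrt[of mid a] that mid by (cases "a = mid") (auto simp: K_def)
    let ?s = "upd (upd s' (Sc 16) 0 mid) (Sc 18) 0 K"
    have 1: "I (Suc k) (upd ?s (Sc 15) 0 mid)" if K0: "0 < K" "\<not> ?L ((K - 1) * lam) \<le> ?y"
    proof -
      have "K - 1 < n" using K0 K by linarith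
      then have "\<not> K - 1 < b" using bk_iff[OF srt] K0 by (simp add: bdef)
      then have "b < K" using K0 by linarith
      then have "\<forall>a. mid \<le> a \<longrightarrow> a < ms \<longrightarrow> b < ?S a" using SmG by (auto intro: less_le_trans)
      then show ?thesis
        unfolding I_def using m mid lo halve[OF w mid(5)] by auto
    qed
    have 2: "I (Suc k) (upd ?s (Sc 14) 0 (mid + 1))" if K0: "K < n" "?L (K * lam) \<le> ?y"
    proof -
      have "K < b" using bk_iff[OF srt, of K ?y] K0 K by (simp add: bdef)
      then have "\<forall>a<mid + 1. ?S a < b" by (auto intro!: le_less_trans[OF SmL])
      then show ?thesis
        unfolding I_def using m mid hi halve[OF w mid(4)] by auto
    qed
    have 3: "I (Suc k) (upd (upd ?s (Sc 17) 0 K) (Sc 14) 0 hi)"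
      if "\<not> (0 < K \<and> \<not> ?L ((K - 1) * lam) \<le> ?y)" "\<not> (K < n \<and> ?L (K * lam) \<le> ?y)"
    proof -
      have "K \<le> b"
      proof (cases "0 < K")
        case True
        then have "?L ((K - 1) * lam) \<le> ?y" using that by simp
        moreover have "K - 1 < n" using True K by linarith
        ultimately have "K - 1 < b" using bk_iff[OF srt] by (simp add: bdef)
        then show ?thesis by linarith
      qed simp
      moreover have "b \<le> K"
      proof (cases "K < n")
        case True
        then have "\<not> ?L (K * lam) \<le> ?y" using that by simp
        then show ?thesis using bk_iff[OF srt, of K ?y] True by (simp add: bdef)
      qed (use K bn in simp)
      ultimately have Kb: "K = b" by simp
      then have "mid \<in> {a. a < ms \<and> ?S a = b}" using mid by (simp add: K_def)
      then have "C \<noteq> 0" unfolding Cdef by (subst card_0_eq) auto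
      then show ?thesis unfolding I_def using m k Kb by auto
    qed
    have sim: "bval n c ?s (And (Less (Num 0) (get (Sc 18)))
            (Not (LLe (Times (Minus (get (Sc 18)) (Num 1)) (get (Sc 2))) (get (Sc 13))))) \<longleftrightarrow>
          0 < K \<and> \<not> ?L ((K - 1) * lam) \<le> ?y"
        "bval n c ?s (And (Less (get (Sc 18)) Len) (LLe (Times (get (Sc 18)) (get (Sc 2))) (get (Sc 13)))) \<longleftrightarrow>
          K < n \<and> ?L (K * lam) \<le> ?y"
      using cs fs by (simp_all add: lkey_words)
    have wv: "wv (upd s' (Sc 16) 0 mid) (Plus (Times (get (Sc 13)) (get (Sc 5))) (get (Sc 16))) = i * ms + mid"
      "wv s' (Div (Plus (get (Sc 14)) (get (Sc 15))) (Num 2)) = mid"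
      using cs fs m by (simp_all add: mid_def)
    have body: "wpr findS_test ?s
        (\<lambda>t s''. 20 + t \<le> 120 \<and> I (Suc k) s'')"
    proof (cases "0 < K \<and> \<not> ?L ((K - 1) * lam) \<le> ?y")
      case True
      with 1 have "I (Suc k) (upd ?s (Sc 15) 0 mid)" by blast
      then show ?thesis unfolding findS_test_def wp_If sim if_P[OF True] using c cs m by simp
    next
      case f1: False
      show ?thesis
      proof (cases "K < n \<and> ?L (K * lam) \<le> ?y")
        case True
        with 2 have "I (Suc k) (upd ?s (Sc 14) 0 (mid + 1))" by blast
        then show ?thesis unfolding findS_test_def wp_If sim if_not_P[OF f1] if_P[OF True] using c cs m by simp
      next
        case False
        from 3[OF f1 False] show ?thesis
          unfolding findS_test_def wp_If sim if_not_P[OF f1] if_not_P[OF False] using c cs m by simp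
      qed
    qed
    have "wpr findS_step s' (\<lambda>t s''. t \<le> 120 \<and> I (Suc k) s'')"
      unfolding findS_step_def using c cs fs m body
      by (simp add: mid_def[symmetric])
    with k show ?thesis by simp
  qed
  have loop: "wpr (While (Less (get (Sc 14)) (get (Sc 15))) findS_step) s1
     (\<lambda>t s'. t \<le> 130 * d + 50 \<and> (words s' (Sc 17) 0 = b \<and> C \<noteq> 0 \<or> words s' (Sc 17) 0 = n + 1 \<and> C = 0))"
  proof (rule wp_While_const[where I = I and B = d and \<tau> = 120])
    show "I 0 s1" by (auto simp: I_def s1_def)
  next
    fix k s' t
    assume I: "I k s'" and nb: "\<not> bval n c s' (Less (get (Sc 14)) (get (Sc 15)))"
     and t: "t \<le> d * (120 + 1 + bcost (Less (get (Sc 14)) (get (Sc 15)))) +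
          (1 + bcost (Less (get (Sc 14)) (get (Sc 15))))"
    from I obtain lo hi where m: "words s' (Sc 14) 0 = lo" "words s' (Sc 15) 0 = hi"
      and disj: "words s' (Sc 17) 0 = n + 1 \<and> lo \<le> hi \<and> (\<forall>a<lo. ?S a < b) \<and>
         (\<forall>a. hi \<le> a \<longrightarrow> a < ms \<longrightarrow> b < ?S a) \<and> (hi - lo) * 2 ^ k \<le> ms \<or>
       words s' (Sc 17) 0 = b \<and> lo = hi \<and> k \<le> d \<and> C \<noteq> 0"
      unfolding I_def by blast
    have "hi - lo = 0" using nb m by simp
    then have "words s' (Sc 17) 0 = b \<and> C \<noteq> 0 \<or> words s' (Sc 17) 0 = n + 1 \<and> C = 0"
      using disj Csub[of lo hi] by (metis le_zero_eq)
    with t show "t \<le> 130 * d + 50 \<and> (words s' (Sc 17) 0 = b \<and> C \<noteq> 0 \<or> words s' (Sc 17) 0 = n + 1 \<and> C = 0)"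
      by simp
  qed (rule step)
  have fin: "wpr (If (Less Len (get (Sc 17))) findV Skip) s2 (\<lambda>u s'. words s' (Sc 17) 0 = b \<and>
     20 + (t + u) \<le> 150 * d + 100 + (if C = 0 then 100 * Lg + 100 else 0))"
    if fr: "frame findS_step s1 s2" and t: "t \<le> 130 * d + 50"
      and s2: "words s2 (Sc 17) 0 = b \<and> C \<noteq> 0 \<or> words s2 (Sc 17) 0 = n + 1 \<and> C = 0" for s2 t
  proof -
    have fs: "words s2 (Sc 13) 0 = i" "words s2 (Sc 2) 0 = lam" "lkey s2 = ?L" "reals s2 X = reals s X"
      using frame_words[OF fr] frame_reals[OF fr] i l w5
      by (simp_all add: findS_step_def findS_test_def s1_def lkey_def fun_eq_iff)
    have "wpr findV s2 (\<lambda>t s'. t \<le> 100 * Lg + 100 \<and> words s' (Sc 17) 0 = b)"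
      using wp_findV[OF fs(1,2)] fs srt by (simp add: bdef)
    then have "wpr findV s2 (\<lambda>u s'. words s' (Sc 17) 0 = b \<and> 20 + (t + (5 + u)) \<le> 150 * d + 100 + (100 * Lg + 100))"
      by (rule wp_mono) (use t in auto)
    then show ?thesis using s2 bn t by auto
  qed
  have main: "wpr findS_loop s1 (\<lambda>t s'. words s' (Sc 17) 0 = b \<and>
     20 + t \<le> 150 * d + 100 + (if C = 0 then 100 * Lg + 100 else 0))"
    unfolding findS_loop_def wp_Seq
    by (rule wp_frame[OF loop]) (rule fin, simp_all add: frame_def)
  show ?thesis
    unfolding findS_def
    using c w5
    by (cases "C = 0") (simp add: s1_def[simplified, symmetric], rule wp_mono[OF main], simp)+
qed

end

section \<open>Training the search trees\<close>

text \<open>A single comparison of an insertion sort. Complete insertions into all \<open>n\<close>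
  rows could take \<open>n * ms\<close> steps, more than the O(n log n) allowed for one round, so
  each round moves the newest sample of every row by at most one place.\<close>

definition sink :: com where
  "sink = set (Sc 16) (Plus (Times (get (Sc 13)) (get (Sc 5))) (get QN)) ;;
    set (Sc 18) (WGet SA (get (Sc 16))) ;;
    set (Sc 17) (WGet SA (Minus (get (Sc 16)) (Num 1))) ;;
    If (Less (get (Sc 18)) (get (Sc 17)))
      (WSet SA (get (Sc 16)) (get (Sc 17)) ;; WSet SA (Minus (get (Sc 16)) (Num 1)) (get (Sc 18)))
      Skip"

definition sample :: com where
  "sample = findV ;; WSet SA (Plus (Times (get (Sc 13)) (get (Sc 5))) (get PN)) (get (Sc 17))"

definition train_one :: com where
  "train_one = If (Less (Num 0) (get QN)) sink sample ;; set (Sc 13) (Plus (get (Sc 13)) (Num 1))"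

definition train_count :: com where
  "train_count = If (Less (Num 0) (get QN))
     (set QN (Minus (get QN) (Num 1)))
     (set QN (get PN) ;; set PN (Plus (get PN) (Num 1)))"

definition train :: com where
  "train = set (Sc 13) (Num 0) ;; While (Less (get (Sc 13)) Len) train_one ;; train_count"

text \<open>Functional model of one training round on one row, through which sortedness and
  multisets can be treated apart from the machine.\<close>

definition rowstep :: "nat \<Rightarrow> nat \<Rightarrow> nat \<Rightarrow> (nat \<Rightarrow> nat) \<Rightarrow> nat \<Rightarrow> nat" where
  "rowstep p q b f = (if q = 0 then f(p := b)
     else f(q - 1 := min (f (q - 1)) (f q), q := max (f (q - 1)) (f q)))"

lemma rowstep_cong:
  assumes "\<And>a. a < m \<Longrightarrow> f a = g a" "q < m" "a < m"
  shows "rowstep p q b f a = rowstep p q b g a"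
proof -
  have "q - 1 < m" using assms by linarith
  then show ?thesis using assms by (simp add: rowstep_def)
qed

lemma row_inj:
  assumes "i * m + a = j * m + b" "a < (m::nat)" "b < m"
  shows "i = j \<and> a = b"
proof -
  have "(i * m + a) div m = i" "(i * m + a) mod m = a" using assms(2) by simp_all
  moreover have "(j * m + b) div m = j" "(j * m + b) mod m = b" using assms(3) by simp_all
  ultimately show ?thesis using assms(1) by metis
qed

context ram
begin

lemma row_bound: "i < n \<Longrightarrow> a < ms \<Longrightarrow> i * ms + a < n * ms"
proof -
  assume a: "i < n" "a < ms"
  then have "i * ms + ms \<le> n * ms" using mult_right_mono[of "Suc i" n ms] by simp
  then show ?thesis using a by linarith
qed

abbreviation row :: "mem \<Rightarrow> nat \<Rightarrow> nat \<Rightarrow> nat" where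
  "row s i a \<equiv> words s SA (i * ms + a)"

lemma wp_sink:
  assumes i: "words s (Sc 13) 0 = i" "i < n" and w5: "words s (Sc 5) 0 = ms"
    and q: "words s QN 0 = q" "1 \<le> q" "q < ms"
  shows "wpr sink s (\<lambda>t s'. t \<le> 100 \<and> words s' (Sc 13) 0 = i \<and>
     (\<forall>a<ms. row s' i a = rowstep p q b (row s i) a) \<and>
     (\<forall>j a. j \<noteq> i \<longrightarrow> a < ms \<longrightarrow> row s' j a = row s j a))"
proof -
  define pos where "pos = i * ms + q"
  have pos: "pos < n * ms" "1 \<le> pos" "pos - 1 = i * ms + (q - 1)"
    using row_bound[OF i(2) q(3)] q by (simp_all add: pos_def)
  have c: "0 < cp" "pos < cp" "pos - 1 < cp" "pos < W" "i * ms < W"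
    using cp pos big by (linarith | simp add: pos_def)+
  have inj: "j * ms + a = pos \<longleftrightarrow> j = i \<and> a = q" "j * ms + a = pos - 1 \<longleftrightarrow> j = i \<and> a = q - 1"
    if "a < ms" for j a
    using row_inj[of j ms a i q] row_inj[of j ms a i "q - 1"] that q unfolding pos(3) pos_def by auto
  have q1: "q - 1 \<noteq> q" "q - 1 < ms" using q by auto
  have ne: "pos \<noteq> pos - 1" using pos by simp
  show ?thesis
  proof (cases "words s SA pos < words s SA (pos - 1)")
    case True
    have 1: "row s i q < row s i (q - 1)" using True unfolding pos(3) by (simp add: pos_def)
    have "wpr sink s (\<lambda>t s'. t \<le> 100 \<and> words s' (Sc 13) 0 = i \<and>
        words s' SA = (words s SA)(pos := words s SA (pos - 1), pos - 1 := words s SA pos))"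
      unfolding sink_def using c i w5 q True ne by (simp add: pos_def[symmetric])
    then show ?thesis
    proof (rule wp_mono)
      fix t :: nat and s' :: mem
      assume *: "t \<le> 100 \<and> words s' (Sc 13) 0 = i \<and>
        words s' SA = (words s SA)(pos := words s SA (pos - 1), pos - 1 := words s SA pos)"
      have row': "row s' j a = (if j = i \<and> a = q - 1 then row s i q
          else if j = i \<and> a = q then row s i (q - 1) else row s j a)" if "a < ms" for j a
      proof -
        have "row s' j a = (if j * ms + a = pos - 1 then words s SA pos
          else if j * ms + a = pos then words s SA (pos - 1) else row s j a)"
          using * by simp
        moreover have "words s SA pos = row s i q" by (simp only: pos_def)
        moreover have "words s SA (pos - 1) = row s i (q - 1)" by (simp only: pos(3))
        ultimately show ?thesis by (simp only: inj[OF that])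
      qed
      show "t \<le> 100 \<and> words s' (Sc 13) 0 = i \<and> (\<forall>a<ms. row s' i a = rowstep p q b (row s i) a) \<and>
        (\<forall>j a. j \<noteq> i \<longrightarrow> a < ms \<longrightarrow> row s' j a = row s j a)"
        using * row' 1 q1 q by (simp add: rowstep_def)
    qed
  next
    case False
    have 1: "\<not> row s i q < row s i (q - 1)" using False unfolding pos(3) by (simp add: pos_def)
    have "wpr sink s (\<lambda>t s'. t \<le> 100 \<and> words s' (Sc 13) 0 = i \<and> words s' SA = words s SA)"
      unfolding sink_def using c i w5 q False ne by (simp add: pos_def[symmetric])
    then show ?thesis
      by (rule wp_mono) (use 1 q1 q in \<open>simp add: rowstep_def\<close>)
  qed
qed

lemma wp_sample:
  assumes i: "words s (Sc 13) 0 = i" "i < n" and w5: "words s (Sc 5) 0 = ms"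
    and l: "words s (Sc 2) 0 = lam" and srt: "vsorted (lkey s)"
    and p: "words s PN 0 = p" "p < ms"
  shows "wpr sample s (\<lambda>t s'. t \<le> 100 * Lg + 200 \<and> words s' (Sc 13) 0 = i \<and>
     (\<forall>a<ms. row s' i a = rowstep p 0 (bk (lkey s) (xkey (reals s X) i)) (row s i) a) \<and>
     (\<forall>j a. j \<noteq> i \<longrightarrow> a < ms \<longrightarrow> row s' j a = row s j a))"
proof -
  let ?b = "bk (lkey s) (xkey (reals s X) i)"
  have pos: "i * ms + p < n * ms" using row_bound[OF i(2) p(2)] .
  have c: "i * ms + p < cp" "i * ms + p < W" "i * ms < W"
    using cp pos big by linarith+
  have inj: "j * ms + a = i * ms + p \<longleftrightarrow> j = i \<and> a = p" if "a < ms" for j a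
    using row_inj[of j ms a i p] that p by auto
  have "wpr sample s (\<lambda>t s'. t \<le> 100 * Lg + 200 \<and> words s' (Sc 13) 0 = i \<and>
        words s' SA = (words s SA)(i * ms + p := ?b))"
    unfolding sample_def wp_Seq
  proof (rule wp_frame[OF wp_findV[OF i(1) l srt]])
    fix t :: nat and s' :: mem
    assume fr: "frame findV s s'" and t: "t \<le> 100 * Lg + 100 \<and> words s' (Sc 17) 0 = ?b"
    have "words s' (Sc 13) 0 = i" "words s' (Sc 5) 0 = ms" "words s' PN 0 = p" "words s' SA = words s SA"
      using frame_words[OF fr] i w5 p by (simp_all add: findV_def findV_step_def)
    then show "wpr (WSet SA (Plus (Times (get (Sc 13)) (get (Sc 5))) (get PN)) (get (Sc 17))) s'
        (\<lambda>u s2. t + u \<le> 100 * Lg + 200 \<and> words s2 (Sc 13) 0 = i \<and>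
        words s2 SA = (words s SA)(i * ms + p := ?b))"
      using t c by simp
  qed
  then show ?thesis
    by (rule wp_mono) (use p in \<open>auto simp: inj rowstep_def\<close>)
qed

lemma wp_train_one:
  assumes i: "words s (Sc 13) 0 = i" "i < n" and w5: "words s (Sc 5) 0 = ms"
    and l: "words s (Sc 2) 0 = lam" and srt: "vsorted (lkey s)"
    and p: "words s PN 0 = p" "q = 0 \<Longrightarrow> p < ms" and q: "words s QN 0 = q" "q < ms"
  shows "wpr train_one s (\<lambda>t s'. t \<le> 100 * Lg + 250 \<and> words s' (Sc 13) 0 = i + 1 \<and>
     (\<forall>a<ms. row s' i a = rowstep p q (bk (lkey s) (xkey (reals s X) i)) (row s i) a) \<and>
     (\<forall>j a. j \<noteq> i \<longrightarrow> a < ms \<longrightarrow> row s' j a = row s j a))"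
proof -
  let ?b = "bk (lkey s) (xkey (reals s X) i)"
  have c: "0 < cp" "i + 1 < W" using cp big i by linarith+
  have "wpr (If (Less (Num 0) (get QN)) sink sample) s (\<lambda>t s'. t \<le> 100 * Lg + 220 \<and> words s' (Sc 13) 0 = i \<and>
     (\<forall>a<ms. row s' i a = rowstep p q ?b (row s i) a) \<and>
     (\<forall>j a. j \<noteq> i \<longrightarrow> a < ms \<longrightarrow> row s' j a = row s j a))"
  proof (cases "q = 0")
    case True
    have "wpr sample s (\<lambda>t s'. 1 + bcost (Less (Num 0) (get QN)) + t \<le> 100 * Lg + 220 \<and> words s' (Sc 13) 0 = i \<and>
       (\<forall>a<ms. row s' i a = rowstep p q ?b (row s i) a) \<and>
       (\<forall>j a. j \<noteq> i \<longrightarrow> a < ms \<longrightarrow> row s' j a = row s j a))"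
      by (rule wp_mono[OF wp_sample[OF i w5 l srt p(1) p(2)[OF True]]]) (use True in auto)
    moreover have "\<not> bval n c s (Less (Num 0) (get QN))" using True q by simp
    ultimately show ?thesis by (simp only: wp_If if_False)
  next
    case False
    have "wpr sink s (\<lambda>t s'. 1 + bcost (Less (Num 0) (get QN)) + t \<le> 100 * Lg + 220 \<and> words s' (Sc 13) 0 = i \<and>
       (\<forall>a<ms. row s' i a = rowstep p q ?b (row s i) a) \<and>
       (\<forall>j a. j \<noteq> i \<longrightarrow> a < ms \<longrightarrow> row s' j a = row s j a))"
      by (rule wp_mono[OF wp_sink[OF i w5 q(1) _ q(2), where p = p and b = "?b"]]) (use False in auto)
    moreover have "bval n c s (Less (Num 0) (get QN))" using False q by simp
    ultimately show ?thesis by (simp only: wp_If if_True)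
  qed
  then show ?thesis
    unfolding train_one_def wp_Seq
    by (rule wp_mono) (use c in simp)
qed

lemma word_targets_train_one:
  "word_targets train_one = {SA, Sc 13, Sc 14, Sc 15, Sc 16, Sc 17, Sc 18}" "real_targets train_one = {}"
  by (auto simp: train_one_def sink_def sample_def findV_def findV_step_def)

lemma wp_train:
  assumes w5: "words s (Sc 5) 0 = ms"
    and l: "words s (Sc 2) 0 = lam" and srt: "vsorted (lkey s)"
    and p: "words s PN 0 = p" "q = 0 \<Longrightarrow> p < ms" and q: "words s QN 0 = q" "q < ms"
  shows "wpr train s (\<lambda>t s'. t \<le> n * (100 * Lg + 300) + 100 \<and>
     (\<forall>i<n. \<forall>a<ms. row s' i a = rowstep p q (bk (lkey s) (xkey (reals s X) i)) (row s i) a) \<and>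
     words s' PN 0 = (if q = 0 then p + 1 else p) \<and> words s' QN 0 = (if q = 0 then p else q - 1))"
proof -
  let ?b = "\<lambda>i. bk (lkey s) (xkey (reals s X) i)"
  define s1 where "s1 = upd s (Sc 13) 0 0"
  define I where "I k s' \<longleftrightarrow> words s' (Sc 13) 0 = k \<and> k \<le> n \<and>
     (\<forall>i<k. \<forall>a<ms. row s' i a = rowstep p q (?b i) (row s i) a) \<and>
     (\<forall>i. k \<le> i \<longrightarrow> i < n \<longrightarrow> (\<forall>a<ms. row s' i a = row s i a))" for k and s' :: mem
  have c: "0 < cp" using cp by linarith
  have same: "words s' (Sc 5) 0 = ms" "words s' (Sc 2) 0 = lam" "lkey s' = lkey s" "reals s' X = reals s X"
      "words s' PN 0 = p" "words s' QN 0 = q" if fr: "frame train_one s1 s'" for s'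
    using frame_words[OF fr] frame_reals[OF fr] w5 l p q
    by (simp_all add: word_targets_train_one s1_def lkey_def fun_eq_iff)
  have step: "k < n \<and> wpr train_one s' (\<lambda>t s''. t \<le> 100 * Lg + 250 \<and> I (Suc k) s'')"
    if I: "I k s'" and fr: "frame train_one s1 s'" and b: "bval n c s' (Less (get (Sc 13)) Len)" for k s'
  proof -
    note sm = same[OF fr]
    have k: "words s' (Sc 13) 0 = k" "k < n" using I b by (auto simp: I_def)
    have srt': "vsorted (lkey s')" using srt by (simp add: sm)
    have rows: "rowstep p q (?b k) (row s' k) a = rowstep p q (?b k) (row s k) a" if "a < ms" for a
      by (rule rowstep_cong[OF _ q(2) that]) (use I k in \<open>unfold I_def, blast\<close>)
    have "wpr train_one s' (\<lambda>t s''. t \<le> 100 * Lg + 250 \<and> I (Suc k) s'')"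
    proof (rule wp_mono[OF wp_train_one[OF k sm(1,2) srt' sm(5) p(2) sm(6) q(2)]])
      fix t :: nat and s'' :: mem
      assume *: "t \<le> 100 * Lg + 250 \<and> words s'' (Sc 13) 0 = k + 1 \<and>
        (\<forall>a<ms. row s'' k a = rowstep p q (bk (lkey s') (xkey (reals s' X) k)) (row s' k) a) \<and>
        (\<forall>j a. j \<noteq> k \<longrightarrow> a < ms \<longrightarrow> row s'' j a = row s' j a)"
      have "row s'' i a = rowstep p q (?b i) (row s i) a" if "i < Suc k" "a < ms" for i a
      proof (cases "i = k")
        case True
        then show ?thesis using * rows that by (simp add: sm)
      next
        case False
        then have "row s'' i a = row s' i a" using * that by blast
        then show ?thesis using I False that by (simp add: I_def)
      qed
      moreover have "row s'' i a = row s i a" if "Suc k \<le> i" "i < n" "a < ms" for i a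
      proof -
        have "row s'' i a = row s' i a" using * that by auto
        then show ?thesis using I that by (simp add: I_def)
      qed
      ultimately show "t \<le> 100 * Lg + 250 \<and> I (Suc k) s''"
        using * k unfolding I_def by simp
    qed
    with k show ?thesis by simp
  qed
  have loop: "wpr (While (Less (get (Sc 13)) Len) train_one) s1 (\<lambda>t s'. t \<le> n * (100 * Lg + 300) + 50 \<and>
     (\<forall>i<n. \<forall>a<ms. row s' i a = rowstep p q (?b i) (row s i) a) \<and>
     words s' PN 0 = p \<and> words s' QN 0 = q)"
  proof (rule wp_While_const[where I = I and B = n and \<tau> = "100 * Lg + 250"])
    show "I 0 s1" by (simp add: I_def s1_def)
  next
    fix k t :: nat and s' :: mem
    assume I: "I k s'" and fr: "frame train_one s1 s'" and nb: "\<not> bval n c s' (Less (get (Sc 13)) Len)"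
     and t: "t \<le> n * (100 * Lg + 250 + 1 + bcost (Less (get (Sc 13)) Len)) + (1 + bcost (Less (get (Sc 13)) Len))"
    have "k = n" using I nb by (simp add: I_def)
    moreover have "t \<le> n * (100 * Lg + 300) + 50"
    proof -
      have "n * (255 + 100 * Lg) \<le> n * (100 * Lg + 300)" by (rule mult_left_mono) auto
      moreover have "t \<le> n * (255 + 100 * Lg) + 5" using t by simp
      ultimately show ?thesis by linarith
    qed
    ultimately show "t \<le> n * (100 * Lg + 300) + 50 \<and>
     (\<forall>i<n. \<forall>a<ms. row s' i a = rowstep p q (?b i) (row s i) a) \<and>
     words s' PN 0 = p \<and> words s' QN 0 = q"
      using I same[OF fr] unfolding I_def by simp
  qed (rule step)
  have count: "wpr train_count s' (\<lambda>t s''. t \<le> 40 \<and> words s'' SA = words s' SA \<and>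
      words s'' PN 0 = (if q = 0 then p + 1 else p) \<and> words s'' QN 0 = (if q = 0 then p else q - 1))"
    if "words s' PN 0 = p" "words s' QN 0 = q" for s'
  proof -
    have "q = 0 \<Longrightarrow> p + 1 < W" using p big by linarith
    then show ?thesis unfolding train_count_def using that c by (cases "q = 0") simp_all
  qed
  have main: "wpr (While (Less (get (Sc 13)) Len) train_one ;; train_count) s1 
   (\<lambda>t s'. t \<le> n * (100 * Lg + 300) + 90 \<and>
     (\<forall>i<n. \<forall>a<ms. row s' i a = rowstep p q (?b i) (row s i) a) \<and>
     words s' PN 0 = (if q = 0 then p + 1 else p) \<and> words s' QN 0 = (if q = 0 then p else q - 1))"
    unfolding wp_Seq
    by (rule wp_mono[OF loop], rule wp_mono[OF count]) auto
  have wv0: "wv s (Num 0) = 0" by simp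
  show ?thesis
    unfolding train_def wp_Seq[of n c cp "set (Sc 13) (Num 0)"] wp_WSet wv0 s1_def[symmetric]
    using c by (intro conjI wp_mono[OF main]) auto
qed

end

section \<open>The stationary phase\<close>

text \<open>The coordinates in bucket \<open>b\<close> form a linked list through \<open>Sc 22\<close> with head \<open>Sc 21\<close> at \<open>b\<close>;
  links are shifted by one, so that 0 ends the list.\<close>

definition bucket_one :: com where
  "bucket_one =
     WSet (Sc 19) (get (Sc 13)) (get (Sc 17)) ;;
     WSet (Sc 22) (get (Sc 13)) (WGet (Sc 21) (get (Sc 17))) ;;
     WSet (Sc 21) (get (Sc 17)) (Plus (get (Sc 13)) (Num 1)) ;;
     WSet (Sc 20) (get (Sc 17)) (Plus (WGet (Sc 20) (get (Sc 17))) (Num 1)) ;;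
     set (Sc 13) (Plus (get (Sc 13)) (Num 1))"

definition search :: com where
  "search = set (Sc 13) (Num 0) ;; While (Less (get (Sc 13)) Len) (findS ;; bucket_one)"

definition prefix_one :: com where
  "prefix_one =
     WSet (Sc 23) (get (Sc 18)) (get (Sc 25)) ;;
     set (Sc 25) (Plus (get (Sc 25)) (WGet (Sc 20) (get (Sc 18)))) ;;
     set (Sc 24) (Plus (get (Sc 24)) (Times (WGet (Sc 20) (get (Sc 18))) (WGet (Sc 20) (get (Sc 18))))) ;;
     set (Sc 18) (Plus (get (Sc 18)) (Num 1))"

definition prefix :: com where
  "prefix = set (Sc 18) (Num 0) ;; set (Sc 25) (Num 0) ;; set (Sc 24) (Num 0) ;;
     While (Less (get (Sc 18)) (Plus Len (Num 1))) prefix_one"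

definition compare :: com where
  "compare =
     If (XLess (Minus (get (Sc 26)) (Num 1)) (get (Sc 13))) (set (Sc 25) (Plus (get (Sc 25)) (Num 1))) Skip ;;
     set (Sc 26) (WGet (Sc 22) (Minus (get (Sc 26)) (Num 1)))"

definition rank_one :: com where
  "rank_one =
     set (Sc 25) (WGet (Sc 23) (WGet (Sc 19) (get (Sc 13)))) ;;
     set (Sc 26) (WGet (Sc 21) (WGet (Sc 19) (get (Sc 13)))) ;;
     While (Less (Num 0) (get (Sc 26))) compare ;;
     WSet X (get (Sc 13)) (get (Sc 25)) ;;
     set (Sc 13) (Plus (get (Sc 13)) (Num 1))"

definition rank :: com where
  "rank = set (Sc 13) (Num 0) ;; While (Less (get (Sc 13)) Len) rank_one"

section \<open>Bucket sizes and bucket lists as functions\<close>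

text \<open>\<open>ct f k v\<close> counts the \<open>j < k\<close> with \<open>f j = v\<close>; \<open>pv f k v\<close> is the successor
  of the last such \<open>j\<close>, or 0 if there is none.\<close>

definition ct :: "(nat \<Rightarrow> nat) \<Rightarrow> nat \<Rightarrow> nat \<Rightarrow> nat" where
  "ct f k v = card {j. j < k \<and> f j = v}"

primrec pv :: "(nat \<Rightarrow> nat) \<Rightarrow> nat \<Rightarrow> nat \<Rightarrow> nat" where
  "pv f 0 v = 0"
| "pv f (Suc k) v = (if f k = v then Suc k else pv f k v)"

lemma ct_0 [simp]: "ct f 0 v = 0"
  by (simp add: ct_def)

lemma ct_Suc: "ct f (Suc k) v = ct f k v + (if f k = v then 1 else 0)"
proof -
  have "{j. j < Suc k \<and> f j = v} = (if f k = v then insert k {j. j < k \<and> f j = v} else {j. j < k \<and> f j = v})"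
    by (auto simp: less_Suc_eq)
  then show ?thesis by (simp add: ct_def)
qed

lemma ct_le: "ct f k v \<le> k"
  using card_mono[of "{..<k}" "{j. j < k \<and> f j = v}"] by (auto simp: ct_def)

lemma sum_ct: "(\<Sum>v<N. ct f k v) = card {j. j < k \<and> f j < N}"
proof (induction N)
  case (Suc N)
  have "{j. j < k \<and> f j < Suc N} = {j. j < k \<and> f j < N} \<union> {j. j < k \<and> f j = N}"
    by (auto simp: less_Suc_eq)
  then have "card {j. j < k \<and> f j < Suc N} = card {j. j < k \<and> f j < N} + card {j. j < k \<and> f j = N}"
    by (simp only:) (rule card_Un_disjoint, auto)
  then show ?case using Suc by (simp add: ct_def)
qed simp

text \<open>The sum of the squared bucket sizes, which the program accumulates, is the number of
  pairs of coordinates in a common bucket and thus the number of comparisons of the quadratic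
  ranking.\<close>

lemma sum_ct_sq:
  assumes "\<And>j. j < k \<Longrightarrow> f j < N"
  shows "(\<Sum>v<N. ct f k v * ct f k v) = (\<Sum>j<k. ct f k (f j))"
proof -
  have "(\<Sum>v<N. \<Sum>j\<in>{j\<in>{..<k}. f j = v}. ct f k (f j)) = (\<Sum>j<k. ct f k (f j))"
    by (rule sum.group) (use assms in auto)
  moreover have "(\<Sum>j\<in>{j\<in>{..<k}. f j = v}. ct f k (f j)) = ct f k v * ct f k v" for v
  proof -
    have "(\<Sum>j\<in>{j\<in>{..<k}. f j = v}. ct f k (f j)) = (\<Sum>j\<in>{j\<in>{..<k}. f j = v}. ct f k v)"
      by (rule sum.cong) auto
    then show ?thesis by (simp add: ct_def)
  qed
  ultimately show ?thesis by (simp only:)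
qed

lemma pv_props:
  "pv f k v \<le> k"
  "j < k \<Longrightarrow> pv f k v \<le> j \<Longrightarrow> f j \<noteq> v"
  "0 < pv f k v \<Longrightarrow> f (pv f k v - 1) = v"
  by (induction k) (auto simp: less_Suc_eq split: if_splits)

context ram
begin

lemma wp_search:
  assumes w5: "words s (Sc 5) 0 = ms" and l: "words s (Sc 2) 0 = lam"
    and srt: "vsorted (lkey s)"
    and S: "\<And>i a. i < n \<Longrightarrow> a < ms \<Longrightarrow> words s SA (i * ms + a) \<le> n"
    and Ssrt: "\<And>i a b. i < n \<Longrightarrow> a < b \<Longrightarrow> b < ms \<Longrightarrow> words s SA (i * ms + a) \<le> words s SA (i * ms + b)"
    and fdef: "\<And>i. f i = bk (lkey s) (xkey (reals s X) i)"
    and Cdef: "\<And>i. i < n \<Longrightarrow> C i = card {a. a < ms \<and> words s SA (i * ms + a) = f i}"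
    and d: "\<And>i. i < n \<Longrightarrow> ms < max 1 (C i) * 2 ^ (d i)"
    and zero: "words s (Sc 20) = (\<lambda>_. 0)" "words s (Sc 21) = (\<lambda>_. 0)"
  shows "wpr search s (\<lambda>t s'. t \<le> (\<Sum>i<n. 150 * d i + 200 + (if C i = 0 then 100 * Lg + 100 else 0)) + 10 \<and>
     (\<forall>i<n. words s' (Sc 19) i = f i \<and> words s' (Sc 22) i = pv f i (f i)) \<and>
     words s' (Sc 20) = ct f n \<and> words s' (Sc 21) = pv f n)"
proof -
  define s1 where "s1 = upd s (Sc 13) 0 0"
  let ?P = "findS ;; bucket_one"
  let ?\<tau> = "\<lambda>i. 150 * d i + 180 + (if C i = 0 then 100 * Lg + 100 else 0)"
  define I where "I k s' \<longleftrightarrow> words s' (Sc 13) 0 = k \<and> k \<le> n \<and>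
     (\<forall>i<k. words s' (Sc 19) i = f i \<and> words s' (Sc 22) i = pv f i (f i)) \<and>
     words s' (Sc 20) = ct f k \<and> words s' (Sc 21) = pv f k" for k and s' :: mem
  have c: "0 < cp" using cp by linarith
  have fn: "f i \<le> n" for i unfolding fdef by (rule bk_le)
  have step: "k < n \<and> wpr ?P s' (\<lambda>t s''. t \<le> ?\<tau> k \<and> I (Suc k) s'')"
    if I: "I k s'" and fr: "frame ?P s1 s'" and b: "bval n c s' (Less (get (Sc 13)) Len)" for k s'
  proof -
    have k: "words s' (Sc 13) 0 = k" "k < n" using I b by (auto simp: I_def)
    have sm: "words s' (Sc 5) 0 = ms" "words s' (Sc 2) 0 = lam" "lkey s' = lkey s" "reals s' X = reals s X"
      "words s' SA = words s SA"
      using frame_words[OF fr] frame_reals[OF fr] w5 l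
      by (simp_all add: s1_def lkey_def fun_eq_iff findS_def findS_loop_def findS_step_def findS_test_def
          findV_def findV_step_def bucket_one_def)
    have "wpr findS s' (\<lambda>t s''. words s'' (Sc 17) 0 = f k \<and>
       t \<le> 150 * d k + 100 + (if C k = 0 then 100 * Lg + 100 else 0))"
      by (rule wp_findS[OF k sm(2,1), where C = "C k" and d = "d k" and b = "f k"])
        (simp_all only: sm srt S k Ssrt fdef[symmetric] Cdef[OF k(2)] d[OF k(2), unfolded Cdef[OF k(2)]])
    then have "wpr findS s' (\<lambda>t s''. wpr bucket_one s'' (\<lambda>u s2. t + u \<le> ?\<tau> k \<and> I (Suc k) s2))"
    proof (rule wp_frame)
      fix t :: nat and s'' :: mem
      assume fr2: "frame findS s' s''" and t: "words s'' (Sc 17) 0 = f k \<and>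
       t \<le> 150 * d k + 100 + (if C k = 0 then 100 * Lg + 100 else 0)"
      have w: "words s'' (Sc 13) 0 = k" "words s'' (Sc 19) = words s' (Sc 19)" "words s'' (Sc 22) = words s' (Sc 22)"
        "words s'' (Sc 20) = ct f k" "words s'' (Sc 21) = pv f k"
        using frame_words[OF fr2] k I
        by (simp_all add: I_def findS_def findS_loop_def findS_step_def findS_test_def findV_def findV_step_def)
      have cs: "k < cp" "f k < cp" "k + 1 < W" "ct f k (f k) + 1 < W"
        using k fn[of k] cp big ct_le[of f k "f k"] by linarith+
      define s3 where "s3 = upd (upd (upd (upd (upd s'' (Sc 19) k (f k)) (Sc 22) k (pv f k (f k)))
         (Sc 21) (f k) (k + 1)) (Sc 20) (f k) (ct f k (f k) + 1)) (Sc 13) 0 (k + 1)"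
      have "I (Suc k) s3"
        unfolding I_def
      proof (intro conjI)
        show "words s3 (Sc 20) = ct f (Suc k)" using w by (auto simp: s3_def fun_eq_iff ct_Suc)
        show "words s3 (Sc 21) = pv f (Suc k)" using w by (auto simp: s3_def fun_eq_iff)
        show "\<forall>i<Suc k. words s3 (Sc 19) i = f i \<and> words s3 (Sc 22) i = pv f i (f i)"
          using w I by (simp add: s3_def I_def less_Suc_eq)
      qed (use k in \<open>simp_all add: s3_def\<close>)
      then have "I (Suc k) (upd (upd (upd (upd (upd s'' (Sc 19) k (f k)) (Sc 22) k (pv f k (f k)))
         (Sc 21) (f k) (k + 1)) (Sc 20) (f k) (ct f k (f k) + 1)) (Sc 13) 0 (k + 1))"
        by (simp only: s3_def)
      then show "wpr bucket_one s'' (\<lambda>u s2. t + u \<le> ?\<tau> k \<and> I (Suc k) s2)"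
        unfolding bucket_one_def using w cs t c by simp
    qed
    with k show ?thesis by simp
  qed
  have loop: "wpr (While (Less (get (Sc 13)) Len) ?P) s1 (\<lambda>t s'.
     t \<le> (\<Sum>i<n. 150 * d i + 200 + (if C i = 0 then 100 * Lg + 100 else 0)) + 5 \<and> I n s')"
  proof (rule wp_While[where I = I and B = n and \<tau> = ?\<tau>])
    show "I 0 s1" using zero by (auto simp: I_def s1_def fun_eq_iff)
  next
    fix k t :: nat and s' :: mem
    assume I: "I k s'" and nb: "\<not> bval n c s' (Less (get (Sc 13)) Len)"
     and t: "t \<le> (\<Sum>j<k. ?\<tau> j + 1 + bcost (Less (get (Sc 13)) Len)) + (1 + bcost (Less (get (Sc 13)) Len))"
    have k: "k = n" using I nb by (simp add: I_def)
    have "(\<Sum>j<k. ?\<tau> j + 1 + bcost (Less (get (Sc 13)) Len)) \<le>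
      (\<Sum>i<n. 150 * d i + 200 + (if C i = 0 then 100 * Lg + 100 else 0))"
      unfolding k by (rule sum_mono) simp
    then show "t \<le> (\<Sum>i<n. 150 * d i + 200 + (if C i = 0 then 100 * Lg + 100 else 0)) + 5 \<and> I n s'"
      using t I k by simp
  qed (rule step)
  have wv0: "wv s (Num 0) = 0" by simp
  show ?thesis
    unfolding search_def wp_Seq[of n c cp "set (Sc 13) (Num 0)"] wp_WSet wv0 s1_def[symmetric]
    using c by (intro conjI wp_mono[OF loop]) (auto simp: I_def)
qed

lemma wp_prefix:
  assumes f: "\<And>i. f i \<le> n" and ct: "words s (Sc 20) = ct f n"
  shows "wpr prefix s (\<lambda>t s'. t \<le> 100 * n + 200 \<and>
     (\<forall>v\<le>n. words s' (Sc 23) v = card {j. j < n \<and> f j < v}) \<and>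
     words s' (Sc 24) 0 = (\<Sum>j<n. ct f n (f j)))"
proof -
  define s1 where "s1 = upd (upd (upd s (Sc 18) 0 0) (Sc 25) 0 0) (Sc 24) 0 0"
  define I where "I k s' \<longleftrightarrow> words s' (Sc 18) 0 = k \<and> k \<le> n + 1 \<and> words s' (Sc 25) 0 = (\<Sum>v<k. ct f n v) \<and>
     words s' (Sc 24) 0 = (\<Sum>v<k. ct f n v * ct f n v) \<and>
     (\<forall>v<k. words s' (Sc 23) v = (\<Sum>v<v. ct f n v))" for k and s' :: mem
  have c: "0 < cp" "n + 1 < W" using cp big by linarith+
  have b1: "(\<Sum>v<k. ct f n v) \<le> n" for k
    unfolding sum_ct using card_mono[of "{..<n}" "{j. j < n \<and> f j < k}"] by auto
  \<comment> \<open>Every partial sum of squares is at most \<open>n * n\<close>, so this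
    accumulator cannot overflow.\<close>
  have b2: "(\<Sum>v<k. ct f n v * ct f n v) \<le> n * n" for k
  proof -
    have "(\<Sum>v<k. ct f n v * ct f n v) \<le> (\<Sum>v<k. n * ct f n v)"
      by (intro sum_mono mult_right_mono ct_le) simp
    also have "\<dots> = n * (\<Sum>v<k. ct f n v)" by (simp add: sum_distrib_left)
    also have "\<dots> \<le> n * n" by (intro mult_left_mono b1) simp
    finally show ?thesis .
  qed
  have step: "k < n + 1 \<and> wpr prefix_one s' (\<lambda>t s''. t \<le> 80 \<and> I (Suc k) s'')"
    if I: "I k s'" and fr: "frame prefix_one s1 s'"
      and b: "bval n c s' (Less (get (Sc 18)) (Plus Len (Num 1)))" for k s'
  proof -
    have w: "words s' (Sc 18) 0 = k" "k < n + 1" "words s' (Sc 25) 0 = (\<Sum>v<k. ct f n v)"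
      "words s' (Sc 24) 0 = (\<Sum>v<k. ct f n v * ct f n v)"
      and w23: "\<And>v. v < k \<Longrightarrow> words s' (Sc 23) v = (\<Sum>v<v. ct f n v)"
      using I b c by (auto simp: I_def)
    have w20: "words s' (Sc 20) = ct f n"
      using frame_words[OF fr, of "Sc 20"] ct by (simp add: prefix_one_def s1_def)
    define a where "a = (\<Sum>v<k. ct f n v)"
    define q where "q = (\<Sum>v<k. ct f n v * ct f n v)"
    define e where "e = ct f n k"
    have aq: "a + e \<le> n" "q + e * e \<le> n * n"
      using b1[of "Suc k"] b2[of "Suc k"] by (simp_all add: a_def q_def e_def)
    have cs: "k < cp" "k + 1 < W" "a + e < W" "q + e * e < W" "e * e < W"
      using w aq cp big by linarith+
    define s3 where "s3 = upd (upd (upd (upd s' (Sc 23) k a) (Sc 25) 0 (a + e)) (Sc 24) 0 (q + e * e)) (Sc 18) 0 (k + 1)"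
    have "I (Suc k) s3"
      unfolding I_def using w w23 by (simp add: s3_def a_def q_def e_def less_Suc_eq)
    then have "I (Suc k) (upd (upd (upd (upd s' (Sc 23) k a) (Sc 25) 0 (a + e)) (Sc 24) 0 (q + e * e)) (Sc 18) 0 (k + 1))"
      by (simp only: s3_def)
    then have "wpr prefix_one s' (\<lambda>t s''. t \<le> 80 \<and> I (Suc k) s'')"
      unfolding prefix_one_def using w(1) w(3,4)[folded a_def q_def] w20 e_def[symmetric] cs c by simp
    with w show ?thesis by simp
  qed
  have loop: "wpr (While (Less (get (Sc 18)) (Plus Len (Num 1))) prefix_one) s1 (\<lambda>t s'.
     t \<le> 100 * n + 150 \<and> I (n + 1) s')"
  proof (rule wp_While_const[where I = I and B = "n + 1" and \<tau> = 80])
    show "I 0 s1" by (simp add: I_def s1_def)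
  next
    fix k t :: nat and s' :: mem
    assume I: "I k s'" and nb: "\<not> bval n c s' (Less (get (Sc 18)) (Plus Len (Num 1)))"
     and t: "t \<le> (n + 1) * (80 + 1 + bcost (Less (get (Sc 18)) (Plus Len (Num 1)))) +
        (1 + bcost (Less (get (Sc 18)) (Plus Len (Num 1))))"
    have k: "k = n + 1" using I nb c by (simp add: I_def)
    then show "t \<le> 100 * n + 150 \<and> I (n + 1) s'" using t I by simp
  qed (rule step)
  have fin: "(\<forall>v\<le>n. words s' (Sc 23) v = card {j. j < n \<and> f j < v}) \<and>
     words s' (Sc 24) 0 = (\<Sum>j<n. ct f n (f j))" if "I (n + 1) s'" for s'
  proof -
    have "f j < n + 1" for j using f[of j] by simp
    then show ?thesis using that sum_ct_sq[of n f "n + 1"] by (auto simp: I_def sum_ct)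
  qed
  show ?thesis
    unfolding prefix_def
    using c
    apply (simp add: s1_def[simplified, symmetric])
    apply (rule wp_mono[OF loop])
    using fin apply simp
    done
qed

lemma wp_rank_one:
  assumes i: "words s (Sc 13) 0 = i" "i < n"
    and w19: "\<And>j. j < n \<Longrightarrow> words s (Sc 19) j = f j"
    and w22: "\<And>j. j < n \<Longrightarrow> words s (Sc 22) j = pv f j (f j)"
    and w21: "words s (Sc 21) = pv f n"
    and w23: "words s (Sc 23) (f i) = card {j. j < n \<and> f j < f i}"
    and mono: "\<And>j k. j < n \<Longrightarrow> k < n \<Longrightarrow> f j < f k \<Longrightarrow> xkey (reals s X) j < xkey (reals s X) k"
  shows "wpr rank_one s (\<lambda>t s'. t \<le> 100 * ct f n (f i) + 100 \<and> words s' (Sc 13) 0 = i + 1 \<and>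
     words s' X = (words s X)(i := rk (reals s X) i))"
proof -
  let ?x = "reals s X" and ?b = "f i" and ?st = "card {j. j < n \<and> f j < f i}"
  define s1 where "s1 = upd (upd s (Sc 25) 0 ?st) (Sc 26) 0 (pv f n ?b)"
  \<comment> \<open>The list of a bucket is traversed by descending coordinate. At the shifted link
    \<open>p\<close> the coordinates from \<open>p\<close> on are done, and \<open>R p\<close> are
    those of the bucket among them whose keys are smaller than that of \<open>i\<close>.\<close>
  define R where "R p = {j. p \<le> j \<and> j < n \<and> f j = ?b \<and> xkey ?x j < xkey ?x i}" for p
  define I where "I k s' \<longleftrightarrow> (\<exists>p\<le>n. words s' (Sc 26) 0 = p \<and> k + ct f p ?b = ct f n ?b \<and> (0 < p \<longrightarrow> f (p - 1) = ?b) \<and>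
     words s' (Sc 25) 0 = ?st + card (R p))" for k and s' :: mem
  have c: "0 < cp" using cp by linarith
  have split: "{j. j < n \<and> f j < ?b} \<union> R p \<subseteq> {..<n}" "{j. j < n \<and> f j < ?b} \<inter> R p = {}" for p
    by (auto simp: R_def)
  have finR: "finite (R p)" for p by (rule finite_subset[of _ "{..<n}"]) (auto simp: R_def)
  have Rb: "?st + card (R p) \<le> n" for p
    using card_mono[OF _ split(1)[of p]] card_Un_disjoint[OF _ finR split(2)] by simp
  \<comment> \<open>Following a link skips only coordinates of other buckets. Neither the number of
    bucket members still to be visited nor, in \<open>Rpv\<close>, the set of smaller keys already
    found changes by the skip.\<close>
  have ctpv: "ct f q ?b = ct f (pv f q ?b) ?b" for q
  proof -
    have "{j. j < q \<and> f j = ?b} = {j. j < pv f q ?b \<and> f j = ?b}"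
      using pv_props(1,2)[where f = f and k = q and v = ?b] by (auto simp: not_le[symmetric] intro: less_le_trans)
    then show ?thesis by (simp add: ct_def)
  qed
  have Rpv: "R q = R (pv f q ?b)" if "q \<le> n" for q
  proof (rule set_eqI)
    fix j
    show "j \<in> R q \<longleftrightarrow> j \<in> R (pv f q ?b)"
      using pv_props(1)[where f = f and k = q and v = ?b]
        pv_props(2)[where f = f and k = q and v = ?b and j = j]
      by (cases "j < q") (auto simp: R_def)
  qed
  have step: "k < ct f n ?b \<and> wpr compare s' (\<lambda>t s''. t \<le> 60 \<and> I (Suc k) s'')"
    if I: "I k s'" and fr: "frame compare s1 s'" and b: "bval n c s' (Less (Num 0) (get (Sc 26)))" for k s'
  proof -
    from I obtain p where p: "p \<le> n" "words s' (Sc 26) 0 = p" "k + ct f p ?b = ct f n ?b"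
      "0 < p \<longrightarrow> f (p - 1) = ?b" "words s' (Sc 25) 0 = ?st + card (R p)"
      unfolding I_def by (elim exE conjE) (rule that)
    have p0: "0 < p" using b p by simp
    have pS: "p = Suc (p - 1)" using p0 by simp
    have fp: "f (p - 1) = ?b" using p p0 by simp
    have ctp: "ct f p ?b = Suc (ct f (p - 1) ?b)" by (subst pS) (simp add: ct_Suc fp)
    have sm: "words s' (Sc 13) 0 = i" "reals s' X = ?x" "words s' (Sc 22) (p - 1) = pv f (p - 1) ?b"
      using frame_words[OF fr] frame_reals[OF fr] i w22[of "p - 1"] p p0 fp
      by (simp_all add: compare_def s1_def)
    let ?q = "pv f (p - 1) ?b"
    have q: "?q \<le> n" "0 < ?q \<longrightarrow> f (?q - 1) = ?b"
      using pv_props(1,3)[of f "p - 1" ?b] p by auto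
    have ctq: "Suc k + ct f ?q ?b = ct f n ?b" using p ctp ctpv[of "p - 1"] by simp
    have Rq: "card (R ?q) = card (R p) + (if xkey ?x (p - 1) < xkey ?x i then 1 else 0)"
    proof -
      have "R ?q = R (p - 1)" using Rpv[of "p - 1"] p by simp
      also have "R (p - 1) = (if xkey ?x (p - 1) < xkey ?x i then insert (p - 1) (R p) else R p)"
        using p p0 fp by (auto simp: R_def) (metis le_antisym not_less_eq_eq pS)+
      finally have e: "R ?q = (if xkey ?x (p - 1) < xkey ?x i then insert (p - 1) (R p) else R p)" .
      have "p - 1 \<notin> R p"
      proof
        assume "p - 1 \<in> R p"
        then have "p \<le> p - 1" unfolding R_def by blast
        then show False using p0 by linarith
      qed
      then show ?thesis unfolding e using finR[of p] by simp
    qed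
    have cs: "?st + card (R p) + 1 < W" using Rb[of p] big by linarith
    have res: "I (Suc k) s''" if "words s'' (Sc 26) 0 = ?q"
      "words s'' (Sc 25) 0 = ?st + card (R p) + (if xkey ?x (p - 1) < xkey ?x i then 1 else 0)" for s'' :: mem
      unfolding I_def using that q ctq Rq by auto
    have "wpr compare s' (\<lambda>t s''. t \<le> 60 \<and> words s'' (Sc 26) 0 = ?q \<and>
      words s'' (Sc 25) 0 = ?st + card (R p) + (if xkey ?x (p - 1) < xkey ?x i then 1 else 0))"
      unfolding compare_def using c sm p cs by simp
    then have "wpr compare s' (\<lambda>t s''. t \<le> 60 \<and> I (Suc k) s'')"
      by (rule wp_mono) (use res in blast)
    then show ?thesis using p ctp by simp
  qed
  have rk: "rk ?x i = ?st + card (R 0)"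
  proof -
    have "{j. j < n \<and> xkey ?x j < xkey ?x i} = {j. j < n \<and> f j < ?b} \<union> R 0"
    proof (rule set_eqI)
      fix j
      show "j \<in> {j. j < n \<and> xkey ?x j < xkey ?x i} \<longleftrightarrow> j \<in> {j. j < n \<and> f j < ?b} \<union> R 0"
        using mono[of j i] mono[of i j] i by (cases "f j" ?b rule: linorder_cases) (auto simp: R_def)
    qed
    then show ?thesis using card_Un_disjoint[OF _ finR split(2), of 0] by (simp add: rk_def)
  qed
  have loop: "wpr (While (Less (Num 0) (get (Sc 26))) compare) s1 (\<lambda>t s'.
     t \<le> 80 * ct f n ?b + 10 \<and> words s' (Sc 25) 0 = rk ?x i \<and> words s' (Sc 13) 0 = i \<and> words s' X = words s X)"
  proof (rule wp_While_const[where I = I and B = "ct f n ?b" and \<tau> = 60])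
    have "ct f n ?b = ct f (pv f n ?b) ?b" by (rule ctpv)
    then have ct0: "0 + ct f (pv f n ?b) ?b = ct f n ?b" by linarith
    have "R n = {}" unfolding R_def by auto
    then have "R (pv f n ?b) = {}" using Rpv[of n, OF order_refl] by (simp only:)
    then have R0: "?st = ?st + card (R (pv f n ?b))" by simp
    have "words s1 (Sc 26) 0 = pv f n ?b" "words s1 (Sc 25) 0 = ?st + card (R (pv f n ?b))"
      using R0 by (simp_all add: s1_def)
    moreover have "0 < pv f n ?b \<longrightarrow> f (pv f n ?b - 1) = ?b"
      by (rule impI) (rule pv_props(3))
    ultimately show "I 0 s1"
      unfolding I_def using pv_props(1)[of f n ?b] ct0
      by (intro exI[of _ "pv f n ?b"] conjI)
  next
    fix k t :: nat and s' :: mem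
    assume I: "I k s'" and fr: "frame compare s1 s'" and nb: "\<not> bval n c s' (Less (Num 0) (get (Sc 26)))"
     and t: "t \<le> ct f n ?b * (60 + 1 + bcost (Less (Num 0) (get (Sc 26)))) +
        (1 + bcost (Less (Num 0) (get (Sc 26))))"
    have "words s' (Sc 25) 0 = rk ?x i" using I nb rk by (auto simp: I_def)
    moreover have "words s' (Sc 13) 0 = i" "words s' X = words s X"
      using frame_words[OF fr] i by (simp_all add: compare_def s1_def)
    ultimately show "t \<le> 80 * ct f n ?b + 10 \<and> words s' (Sc 25) 0 = rk ?x i \<and> words s' (Sc 13) 0 = i \<and> words s' X = words s X"
      using t by simp
  qed (rule step)
  have cs: "i < cp" "i + 1 < W" "0 < cp" using i cp big by linarith+
  show ?thesis
    unfolding rank_one_def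
    using cs i w19[OF i(2)] w21 w23
    apply (simp add: s1_def[simplified, symmetric])
    apply (rule wp_mono[OF loop])
    apply simp
    done
qed

lemma wp_rank:
  assumes w19: "\<And>j. j < n \<Longrightarrow> words s (Sc 19) j = f j"
    and w22: "\<And>j. j < n \<Longrightarrow> words s (Sc 22) j = pv f j (f j)"
    and w21: "words s (Sc 21) = pv f n" and f: "\<And>i. f i \<le> n"
    and w23: "\<And>v. v \<le> n \<Longrightarrow> words s (Sc 23) v = card {j. j < n \<and> f j < v}"
    and mono: "\<And>j k. j < n \<Longrightarrow> k < n \<Longrightarrow> f j < f k \<Longrightarrow> xkey (reals s X) j < xkey (reals s X) k"
  shows "wpr rank s (\<lambda>t s'. t \<le> 100 * (\<Sum>i<n. ct f n (f i)) + 150 * n + 50 \<and>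
     (\<forall>i<n. words s' X i = rk (reals s X) i))"
proof -
  define s1 where "s1 = upd s (Sc 13) 0 0"
  let ?\<tau> = "\<lambda>i. 100 * ct f n (f i) + 100"
  define I where "I k s' \<longleftrightarrow> words s' (Sc 13) 0 = k \<and> k \<le> n \<and>
     (\<forall>i<k. words s' X i = rk (reals s X) i)" for k and s' :: mem
  have c: "0 < cp" using cp by linarith
  have step: "k < n \<and> wpr rank_one s' (\<lambda>t s''. t \<le> ?\<tau> k \<and> I (Suc k) s'')"
    if I: "I k s'" and fr: "frame rank_one s1 s'" and b: "bval n c s' (Less (get (Sc 13)) Len)" for k s'
  proof -
    have k: "words s' (Sc 13) 0 = k" "k < n" using I b by (auto simp: I_def)
    have sm: "reals s' X = reals s X" "words s' (Sc 19) = words s (Sc 19)" "words s' (Sc 22) = words s (Sc 22)"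
      "words s' (Sc 21) = words s (Sc 21)" "words s' (Sc 23) = words s (Sc 23)"
      using frame_words[OF fr] frame_reals[OF fr] by (simp_all add: s1_def rank_one_def compare_def)
    have "wpr rank_one s' (\<lambda>t s''. t \<le> 100 * ct f n (f k) + 100 \<and> words s'' (Sc 13) 0 = k + 1 \<and>
     words s'' X = (words s' X)(k := rk (reals s' X) k))"
      by (rule wp_rank_one[OF k, of f]) (simp_all only: sm w19 w22 w21 w23 f mono)
    then have "wpr rank_one s' (\<lambda>t s''. t \<le> ?\<tau> k \<and> I (Suc k) s'')"
      by (rule wp_mono) (use I k sm in \<open>auto simp: I_def less_Suc_eq\<close>)
    with k show ?thesis by simp
  qed
  have loop: "wpr (While (Less (get (Sc 13)) Len) rank_one) s1 (\<lambda>t s'.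
     t \<le> 100 * (\<Sum>i<n. ct f n (f i)) + 150 * n + 10 \<and> I n s')"
  proof (rule wp_While[where I = I and B = n and \<tau> = ?\<tau>])
    show "I 0 s1" by (simp add: I_def s1_def)
  next
    fix k t :: nat and s' :: mem
    assume I: "I k s'" and nb: "\<not> bval n c s' (Less (get (Sc 13)) Len)"
     and t: "t \<le> (\<Sum>j<k. ?\<tau> j + 1 + bcost (Less (get (Sc 13)) Len)) + (1 + bcost (Less (get (Sc 13)) Len))"
    have k: "k = n" using I nb by (simp add: I_def)
    have "(\<Sum>j<k. ?\<tau> j + 1 + bcost (Less (get (Sc 13)) Len)) = 100 * (\<Sum>i<n. ct f n (f i)) + 105 * n"
      unfolding k by (simp add: sum.distrib sum_distrib_left)
    then show "t \<le> 100 * (\<Sum>i<n. ct f n (f i)) + 150 * n + 10 \<and> I n s'"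
      using t I k by simp
  qed (rule step)
  have wv0: "wv s (Num 0) = 0" by simp
  show ?thesis
    unfolding rank_def wp_Seq[of n c cp "set (Sc 13) (Num 0)"] wp_WSet wv0 s1_def[symmetric]
    using c by (intro conjI wp_mono[OF loop]) (auto simp: I_def)
qed

end

section \<open>The algorithm on one input\<close>

definition stationary :: com where
  "stationary = search ;; prefix ;;
     If (Less (get (Sc 24)) (Plus (Times Len (get (Sc 0))) (Num 1))) rank tour"

text \<open>Counters in persistent memory select the phase. During the training the output comes
  from the tournament, whose sorted order in \<open>Sc 10\<close> also feeds
  \<open>merge\<close>.\<close>

definition sorter :: "nat \<Rightarrow> com" where
  "sorter Q = params Q ;;
     If (Less (get CN) (get (Sc 2))) (tour ;; merge)
       (If (Or (Less (get PN) (get (Sc 5))) (Less (Num 0) (get QN))) (tour ;; train) stationary)"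

lemma targets_params: "word_targets (params Q) = {Sc 0, Sc 1, Sc 2, Sc 3, Sc 4, Sc 5}" "real_targets (params Q) = {}"
  and targets_tour: "word_targets tour = {X, Sc 6, Sc 7, Sc 8, Sc 9, Sc 10}" "real_targets tour = {}"
  and targets_merge: "word_targets merge = {LA, CN, Sc 11, Sc 12}" "real_targets merge = {LA}"
  and targets_train: "word_targets train = {SA, PN, QN, Sc 13, Sc 14, Sc 15, Sc 16, Sc 17, Sc 18}" "real_targets train = {}"
  and targets_search: "word_targets search = {Sc 13, Sc 14, Sc 15, Sc 16, Sc 17, Sc 18, Sc 19, Sc 20, Sc 21, Sc 22}" "real_targets search = {}"
  and targets_prefix: "word_targets prefix = {Sc 18, Sc 23, Sc 24, Sc 25}" "real_targets prefix = {}"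
  and targets_rank: "word_targets rank = {X, Sc 13, Sc 25, Sc 26}" "real_targets rank = {}"
  by (auto simp: params_def tour_def tour_init_def tour_build_def tour_extract_def tour_path_def replay_def
      merge_def merge_step_def train_def train_one_def sink_def sample_def train_count_def
      search_def findS_def findS_loop_def findS_step_def findS_test_def findV_def findV_step_def bucket_one_def
      prefix_def prefix_one_def rank_def rank_one_def compare_def)

lemmas targets = targets_params targets_tour targets_merge targets_train targets_search targets_prefix targets_rank

text \<open>The factors 4 and 32 are dictated by the failure bound. For cells of mass 4 in the
  merged inputs, and of mass \<open>2^-l\<close> with \<open>l \<le> Lg div Q\<close> in the
  samples, they make the Chernoff exponents \<open>4 * Lg\<close> and at least
  \<open>8 * Lg\<close>, enough for the union bounds.\<close>

locale alg = ram +
  fixes Q :: nat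
  assumes Q: "Q < W" and lam: "lam = 4 * Lg" and ms: "ms = 32 * 2 ^ (Lg div Q) * Lg"
begin

lemma Lg_le_n: "Lg \<le> n"
proof -
  have "2 ^ (Lg - 1) * 2 = (2::nat) ^ Lg" using Lg_pos by (cases Lg) auto
  then have "2 ^ (Lg - 1) \<le> n" using Lg by linarith
  moreover have "Lg - 1 < 2 ^ (Lg - 1)" by (rule less_exp)
  ultimately show ?thesis by linarith
qed

lemma ms_pos: "0 < ms"
  using Lg_pos by (simp add: ms)

lemma ms_less: "ms < 2 ^ (2 * Lg + 6)"
proof -
  have "Lg < 2 ^ Lg" by (rule less_exp)
  moreover have "(2::nat) ^ (Lg div Q) \<le> 2 ^ Lg" by (rule power_increasing) auto
  ultimately have "2 ^ (Lg div Q) * Lg < 2 ^ Lg * 2 ^ Lg"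
    by (intro mult_le_less_imp_less) auto
  moreover have "(2::nat) ^ (2 * Lg + 6) = 2 ^ Lg * 2 ^ Lg * 2 ^ 6"
    by (simp only: mult_2 power_add)
  moreover have "ms = 32 * (2 ^ (Lg div Q) * Lg)" by (simp only: ms mult.assoc)
  moreover have "32 * a < p" if "a < b" "p = b * 2 ^ 6" for a b p :: nat
    using that by simp
  ultimately show ?thesis by presburger
qed

lemma rk_mono:
  assumes "rk x a < rk x b"
  shows "xkey x a < xkey x b"
proof (rule ccontr)
  assume "\<not> xkey x a < xkey x b"
  then have "{j. j < n \<and> xkey x j < xkey x b} \<subseteq> {j. j < n \<and> xkey x j < xkey x a}" by auto
  then have "rk x b \<le> rk x a" unfolding rk_def by (rule card_mono[rotated]) simp
  with assms show False by simp
qed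

lemma sum_sorted:
  assumes "\<forall>k<n. \<pi> k < n \<and> rk x (\<pi> k) = k"
  shows "(\<Sum>t<n. (f :: key \<Rightarrow> nat) (xkey x (\<pi> t))) = (\<Sum>i<n. f (xkey x i))"
proof -
  have inj: "inj_on \<pi> {..<n}" using assms by (intro inj_onI) (metis lessThan_iff)
  have "\<pi> ` {..<n} = {..<n}"
    by (rule card_subset_eq) (use assms card_image[OF inj] in auto)
  then have "bij_betw \<pi> {..<n} {..<n}" using inj by (simp add: bij_betw_def)
  then show ?thesis using sum.reindex_bij_betw[of \<pi> "{..<n}" "{..<n}" "\<lambda>i. f (xkey x i)"] by simp
qed

lemma wp_sorter_merge:
  assumes a: "words s CN 0 = a" "a < lam"
    and lsort: "\<And>t u. t < u \<Longrightarrow> u < a * n \<Longrightarrow> lkey s t \<le> lkey s u"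
  shows "wpr (sorter Q) s (\<lambda>t s'. t \<le> 4000 * (n * (Lg + 1)) \<and>
     (\<forall>i<n. words s' X i = rk (reals s X) i) \<and>
     (\<forall>a. a \<in> {SA, PN, QN} \<longrightarrow> words s' a = words s a) \<and> words s' CN 0 = Suc a \<and>
     (\<forall>t u. t < u \<longrightarrow> u < Suc a * n \<longrightarrow> lkey s' t \<le> lkey s' u) \<and>
     (\<forall>f :: key \<Rightarrow> nat. (\<Sum>t<Suc a * n. f (lkey s' t)) =
        (\<Sum>t<a * n. f (lkey s t)) + (\<Sum>i<n. f (xkey (reals s X) i))))"
    (is "wpr _ _ ?Post")
proof -
  let ?x = "reals s X"
  have m: "wpr merge s2 (\<lambda>v s'. 30 + (t + (u + v)) \<le> 4000 * (n * (Lg + 1)) \<and> ?Post 0 s')"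
    if t: "t \<le> 200 * Lg + 200" and fr: "frame (params Q) s s1" and
      u: "u \<le> 1000 * (n * (Lg + 1)) \<and> frame tour s1 s2 \<and>
     (\<forall>i<n. words s2 X i = rk (reals s1 X) i) \<and>
     (\<forall>k<n. words s2 (Sc 10) k < n \<and> rk (reals s1 X) (words s2 (Sc 10) k) = k)" for t u s1 s2
  proof -
    have fr2: "frame tour s1 s2" using u by blast
    have x1: "reals s1 X = ?x" using frame_reals[OF fr] by (simp add: targets)
    have sm: "reals s2 X = ?x" "lkey s2 = lkey s" "words s2 CN 0 = a" "words s2 SA = words s SA"
       "words s2 PN = words s PN" "words s2 QN = words s QN"
      using frame_words[OF fr] frame_reals[OF fr] frame_words[OF fr2] frame_reals[OF fr2] a
      by (simp_all add: targets lkey_def fun_eq_iff)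
    define y where "y t = xkey ?x (words s2 (Sc 10) t)" for t
    have perm: "\<forall>k<n. words s2 (Sc 10) k < n \<and> rk ?x (words s2 (Sc 10) k) = k" using u x1 by simp
    have ysort: "y t \<le> y u" if "t < u" "u < n" for t u
      unfolding y_def using perm that by (intro less_imp_le rk_mono) simp
    have "wpr merge s2 (\<lambda>t s'. t \<le> 200 * (n * lam) + 200 \<and> words s' CN 0 = Suc a \<and>
       (\<forall>t u. t < u \<longrightarrow> u < Suc a * n \<longrightarrow> lkey s' t \<le> lkey s' u) \<and>
       (\<forall>f :: key \<Rightarrow> nat. (\<Sum>t<Suc a * n. f (lkey s' t)) =
        (\<Sum>t<a * n. f (lkey s2 t)) + (\<Sum>t<n. f (y t))))"
      by (rule wp_merge[OF sm(3) a(2) _ ysort]) (use lsort in \<open>simp_all add: sm y_def\<close>)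
    then show ?thesis
    proof (rule wp_frame)
      fix v :: nat and s' :: mem
      assume fr3: "frame merge s2 s'" and *: "v \<le> 200 * (n * lam) + 200 \<and> words s' CN 0 = Suc a \<and>
       (\<forall>t u. t < u \<longrightarrow> u < Suc a * n \<longrightarrow> lkey s' t \<le> lkey s' u) \<and>
       (\<forall>f :: key \<Rightarrow> nat. (\<Sum>t<Suc a * n. f (lkey s' t)) =
        (\<Sum>t<a * n. f (lkey s2 t)) + (\<Sum>t<n. f (y t)))"
      have "words s' X = words s2 X" "words s' SA = words s SA"
       "words s' PN = words s PN" "words s' QN = words s QN"
        using frame_words[OF fr3] sm by (simp_all add: targets)
      moreover have "\<forall>i<n. words s2 X i = rk ?x i" using u x1 by simp
      moreover have "(\<Sum>t<n. f (y t)) = (\<Sum>i<n. f (xkey ?x i))" for f :: "key \<Rightarrow> nat"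
        unfolding y_def by (rule sum_sorted[OF perm])
      moreover have "30 + (t + (u + v)) \<le> 4000 * (n * (Lg + 1))"
      proof -
        have nL: "Lg \<le> n * Lg" "1 \<le> n" using n by simp_all
        have "v \<le> 800 * (n * Lg) + 200" using * by (simp add: lam)
        moreover have "u \<le> 1000 * (n * Lg) + 1000 * n" using u by (simp add: algebra_simps)
        moreover have "4000 * (n * (Lg + 1)) = 4000 * (n * Lg) + 4000 * n" by (simp add: algebra_simps)
        ultimately show ?thesis using t nL by linarith
      qed
      ultimately show "30 + (t + (u + v)) \<le> 4000 * (n * (Lg + 1)) \<and> ?Post 0 s'"
        using * by (simp add: sm)
    qed
  qed
  have br: "wpr (If (Less (get CN) (get (Sc 2))) (tour ;; merge)
       (If (Or (Less (get PN) (get (Sc 5))) (Less (Num 0) (get QN))) (tour ;; train) stationary)) s1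
       (\<lambda>u s2. ?Post (t + u) s2)"
    if fr: "frame (params Q) s s1" and p: "t \<le> 200 * Lg + 200 \<and> words s1 (Sc 0) 0 = Lg \<and>
     words s1 (Sc 2) 0 = lam \<and> words s1 (Sc 5) 0 = ms" for t s1
  proof -
    have "words s1 CN 0 = a" using frame_words[OF fr] a by (simp add: targets)
    then have c: "bval n c s1 (Less (get CN) (get (Sc 2)))" using p a by simp
    have "wpr (tour ;; merge) s1 (\<lambda>u s2. 30 + (t + u) \<le> 4000 * (n * (Lg + 1)) \<and> ?Post 0 s2)"
      unfolding wp_Seq
      by (rule wp_mono[OF wp_tour], rule wp_mono[OF m]) (use p fr in auto)
    then have "wpr (tour ;; merge) s1 (\<lambda>u. ?Post (t + (1 + bcost (Less (get CN) (get (Sc 2))) + u)))"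
      by (rule wp_mono) auto
    then show ?thesis by (simp only: wp_If c if_True)
  qed
  show ?thesis
    unfolding sorter_def wp_Seq[of n c cp "params Q"]
    by (rule wp_frame[OF wp_params[OF Q lam ms]]) (rule br)
qed

lemma wp_sorter_train:
  assumes a: "words s CN 0 = lam" and srt: "vsorted (lkey s)"
    and p: "words s PN 0 = p" "q = 0 \<Longrightarrow> p < ms" and q: "words s QN 0 = q" "q < ms" "p < ms \<or> 0 < q"
  shows "wpr (sorter Q) s (\<lambda>t s'. t \<le> 4000 * (n * (Lg + 1)) \<and>
     (\<forall>i<n. words s' X i = rk (reals s X) i) \<and>
     words s' CN 0 = lam \<and> lkey s' = lkey s \<and>
     (\<forall>i<n. \<forall>a<ms. row s' i a = rowstep p q (bk (lkey s) (xkey (reals s X) i)) (row s i) a) \<and>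
     words s' PN 0 = (if q = 0 then p + 1 else p) \<and> words s' QN 0 = (if q = 0 then p else q - 1))"
    (is "wpr _ _ ?Post")
proof -
  let ?x = "reals s X"
  have m: "wpr train s2 (\<lambda>v s'. 30 + (t + (u + v)) \<le> 4000 * (n * (Lg + 1)) \<and> ?Post 0 s')"
    if t: "t \<le> 200 * Lg + 200 \<and> words s1 (Sc 0) 0 = Lg \<and>
     words s1 (Sc 2) 0 = lam \<and> words s1 (Sc 5) 0 = ms" and fr: "frame (params Q) s s1" and
      u: "u \<le> 1000 * (n * (Lg + 1)) \<and> frame tour s1 s2 \<and>
     (\<forall>i<n. words s2 X i = rk (reals s1 X) i) \<and>
     (\<forall>k<n. words s2 (Sc 10) k < n \<and> rk (reals s1 X) (words s2 (Sc 10) k) = k)" for t u s1 s2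
  proof -
    have fr2: "frame tour s1 s2" using u by blast
    have x1: "reals s1 X = ?x" using frame_reals[OF fr] by (simp add: targets)
    have sm: "reals s2 X = ?x" "lkey s2 = lkey s" "words s2 CN 0 = lam" "words s2 SA = words s SA"
       "words s2 PN 0 = p" "words s2 QN 0 = q" "words s2 (Sc 5) 0 = ms" "words s2 (Sc 2) 0 = lam"
      using frame_words[OF fr] frame_reals[OF fr] frame_words[OF fr2] frame_reals[OF fr2] a p q t
      by (simp_all add: targets lkey_def fun_eq_iff)
    have srt2: "vsorted (lkey s2)" using srt by (simp only: sm)
    show ?thesis
    proof (rule wp_frame[OF wp_train[OF sm(7,8) srt2 sm(5) p(2) sm(6) q(2)]])
      fix v :: nat and s' :: mem
      assume fr3: "frame train s2 s'" and *: "v \<le> n * (100 * Lg + 300) + 100 \<and>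
     (\<forall>i<n. \<forall>a<ms. row s' i a = rowstep p q (bk (lkey s2) (xkey (reals s2 X) i)) (row s2 i) a) \<and>
     words s' PN 0 = (if q = 0 then p + 1 else p) \<and> words s' QN 0 = (if q = 0 then p else q - 1)"
      have "words s' X = words s2 X" "lkey s' = lkey s" "words s' CN 0 = lam"
        using frame_words[OF fr3] frame_reals[OF fr3] sm by (simp_all add: targets lkey_def fun_eq_iff)
      moreover have "\<forall>i<n. words s2 X i = rk ?x i" using u x1 by simp
      moreover have "30 + (t + (u + v)) \<le> 4000 * (n * (Lg + 1))"
      proof -
        have nL: "Lg \<le> n * Lg" "1 \<le> n" using n by simp_all
        have "v \<le> 100 * (n * Lg) + 300 * n + 100" using * by (simp add: algebra_simps)
        moreover have "u \<le> 1000 * (n * Lg) + 1000 * n" using u by (simp add: algebra_simps)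
        moreover have "4000 * (n * (Lg + 1)) = 4000 * (n * Lg) + 4000 * n" by (simp add: algebra_simps)
        ultimately show ?thesis using t nL by linarith
      qed
      ultimately show "30 + (t + (u + v)) \<le> 4000 * (n * (Lg + 1)) \<and> ?Post 0 s'"
        using * by (simp add: sm)
    qed
  qed
  let ?b1 = "Less (get CN) (get (Sc 2))" and ?b2 = "Or (Less (get PN) (get (Sc 5))) (Less (Num 0) (get QN))"
  have br: "wpr (If ?b1 (tour ;; merge) (If ?b2 (tour ;; train) stationary)) s1 (\<lambda>u s2. ?Post (t + u) s2)"
    if fr: "frame (params Q) s s1" and pp: "t \<le> 200 * Lg + 200 \<and> words s1 (Sc 0) 0 = Lg \<and>
     words s1 (Sc 2) 0 = lam \<and> words s1 (Sc 5) 0 = ms" for t s1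
  proof -
    have "words s1 CN 0 = lam" "words s1 PN 0 = p" "words s1 QN 0 = q"
      using frame_words[OF fr] a p q by (simp_all add: targets)
    then have c: "\<not> bval n c s1 ?b1" "bval n c s1 ?b2" using pp q by auto
    have "wpr (tour ;; train) s1 (\<lambda>u s2. 30 + (t + u) \<le> 4000 * (n * (Lg + 1)) \<and> ?Post 0 s2)"
      unfolding wp_Seq
      by (rule wp_mono[OF wp_tour], rule wp_mono[OF m]) (use pp fr in auto)
    then have "wpr (tour ;; train) s1 (\<lambda>u. ?Post (t + (1 + bcost ?b1 + (1 + bcost ?b2 + u))))"
      by (rule wp_mono) auto
    then show ?thesis by (simp only: wp_If c if_True if_False)
  qed
  show ?thesis
    unfolding sorter_def wp_Seq[of n c cp "params Q"]
    by (rule wp_frame[OF wp_params[OF Q lam ms]]) (rule br)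
qed

text \<open>About log2 of \<open>ms / C\<close>: the self-information of a bucket that fills the
  fraction \<open>C / ms\<close> of the sample. The maximum with 1 gives a finite value for absent
  buckets.\<close>

definition search_depth :: "nat \<Rightarrow> nat" where
  "search_depth C = (LEAST d. ms < max 1 C * 2 ^ d)"

lemma search_depth: "ms < max 1 C * 2 ^ search_depth C"
  and search_depth_le: "search_depth C \<le> 2 * Lg + 6"
proof -
  have "1 * 2 ^ (2 * Lg + 6) \<le> max 1 C * (2::nat) ^ (2 * Lg + 6)" by (rule mult_right_mono) auto
  then have *: "ms < max 1 C * 2 ^ (2 * Lg + 6)" using ms_less by linarith
  show "ms < max 1 C * 2 ^ search_depth C" unfolding search_depth_def by (rule LeastI) (rule *)
  show "search_depth C \<le> 2 * Lg + 6" unfolding search_depth_def by (rule Least_le) (rule *)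
qed

lemma wp_stationary:
  assumes w: "words s (Sc 0) 0 = Lg" "words s (Sc 5) 0 = ms" and l: "words s (Sc 2) 0 = lam"
    and srt: "vsorted (lkey s)"
    and S: "\<And>i a. i < n \<Longrightarrow> a < ms \<Longrightarrow> row s i a \<le> n"
    and Ssrt: "\<And>i a b. i < n \<Longrightarrow> a < b \<Longrightarrow> b < ms \<Longrightarrow> row s i a \<le> row s i b"
    and fdef: "\<And>i. f i = bk (lkey s) (xkey (reals s X) i)"
    and Cdef: "\<And>i. i < n \<Longrightarrow> C i = card {a. a < ms \<and> row s i a = f i}"
    and zero: "words s (Sc 20) = (\<lambda>_. 0)" "words s (Sc 21) = (\<lambda>_. 0)"
  shows "wpr stationary s (\<lambda>t s'. t \<le> 1500 * n +
       (\<Sum>i<n. 150 * search_depth (C i) + (if C i = 0 then 100 * Lg + 100 else 0)) +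
       2000 * min (\<Sum>i<n. ct f n (f i)) (n * Lg) \<and>
     (\<forall>i<n. words s' X i = rk (reals s X) i))"
    (is "wpr _ _ ?Post")
proof -
  let ?x = "reals s X" and ?b = "Less (get (Sc 24)) (Plus (Times Len (get (Sc 0))) (Num 1))"
  let ?V = "\<Sum>i<n. 150 * search_depth (C i) + (if C i = 0 then 100 * Lg + 100 else 0)"
  let ?q = "\<Sum>i<n. ct f n (f i)"
  have fn: "f i \<le> n" for i unfolding fdef by (rule bk_le)
  \<comment> \<open>Keys of different buckets are separated by the boundary \<open>f j\<close>.
    Hence the rank inside the bucket, added to the number of keys in lower buckets, is the true
    rank.\<close>
  have mono: "xkey ?x j < xkey ?x k" if "j < n" "k < n" "f j < f k" for j k
  proof -
    have "f j < n" using that fn[of k] by linarith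
    then have "\<not> lkey s (f j * lam) \<le> xkey ?x j" "lkey s (f j * lam) \<le> xkey ?x k"
      using bk_iff[OF srt, of "f j"] that by (simp_all add: fdef[symmetric])
    then show ?thesis by simp
  qed
  have Wb: "n * Lg + 1 < W" "n * Lg < W"
  proof -
    have "n * Lg \<le> n * lam" by (simp add: lam)
    then show "n * Lg + 1 < W" "n * Lg < W" using big by linarith+
  qed
  have last: "wpr (If ?b rank tour) s2 (\<lambda>v s'. t + (u + v) \<le> 1500 * n + ?V + 2000 * min ?q (n * Lg) \<and>
      (\<forall>i<n. words s' X i = rk ?x i))"
    if fr1: "frame search s s1" and t: "t \<le> (\<Sum>i<n. 150 * search_depth (C i) + 200 + (if C i = 0 then 100 * Lg + 100 else 0)) + 10 \<and>
     (\<forall>i<n. words s1 (Sc 19) i = f i \<and> words s1 (Sc 22) i = pv f i (f i)) \<and>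
     words s1 (Sc 20) = ct f n \<and> words s1 (Sc 21) = pv f n"
     and fr2: "frame prefix s1 s2" and u: "u \<le> 100 * n + 200 \<and>
     (\<forall>v\<le>n. words s2 (Sc 23) v = card {j. j < n \<and> f j < v}) \<and>
     words s2 (Sc 24) 0 = ?q" for t u s1 s2
  proof -
    have sm: "words s2 (Sc 0) 0 = Lg" "reals s2 X = ?x" "words s2 (Sc 19) = words s1 (Sc 19)"
      "words s2 (Sc 22) = words s1 (Sc 22)" "words s2 (Sc 21) = pv f n"
      using frame_words[OF fr1] frame_words[OF fr2] frame_reals[OF fr1] frame_reals[OF fr2] w t
      by (simp_all add: targets)
    have tV: "t \<le> ?V + 200 * n + 10"
    proof -
      have "(\<Sum>i<n. 150 * search_depth (C i) + 200 + (if C i = 0 then 100 * Lg + 100 else 0)) =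
        (\<Sum>i<n. (150 * search_depth (C i) + (if C i = 0 then 100 * Lg + 100 else 0)) + 200)"
        by (rule sum.cong) auto
      also have "\<dots> = ?V + 200 * n" by (subst sum.distrib) simp
      finally show ?thesis using t by linarith
    qed
    have n1: "1 \<le> n" by (rule n)
    have bv: "bval n c s2 ?b \<longleftrightarrow> ?q \<le> n * Lg"
      using u Wb sm by (auto simp: less_Suc_eq_le simp flip: Suc_eq_plus1)
    show ?thesis
    proof (cases "?q \<le> n * Lg")
      case True
      have "wpr rank s2 (\<lambda>t s'. t \<le> 100 * ?q + 150 * n + 50 \<and> (\<forall>i<n. words s' X i = rk (reals s2 X) i))"
        by (rule wp_rank) (use t u mono fn in \<open>simp_all add: sm\<close>)
      then have "wpr rank s2 (\<lambda>v s'. t + (u + (1 + bcost ?b + v)) \<le> 1500 * n + ?V + 2000 * min ?q (n * Lg) \<and>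
         (\<forall>i<n. words s' X i = rk ?x i))"
      proof (rule wp_mono)
        fix v s'
        assume *: "v \<le> 100 * ?q + 150 * n + 50 \<and> (\<forall>i<n. words s' X i = rk (reals s2 X) i)"
        have "bcost ?b = 9" by simp
        moreover have "min ?q (n * Lg) = ?q" using True by simp
        ultimately have "t + (u + (1 + bcost ?b + v)) \<le> 1500 * n + ?V + 2000 * min ?q (n * Lg)"
          using * u tV n1 by linarith
        with * sm show "t + (u + (1 + bcost ?b + v)) \<le> 1500 * n + ?V + 2000 * min ?q (n * Lg) \<and>
         (\<forall>i<n. words s' X i = rk ?x i)" by simp
      qed
      with True bv show ?thesis by (simp only: wp_If if_True)
    next
      case False
      have "wpr tour s2 (\<lambda>v s'. t + (u + (1 + bcost ?b + v)) \<le> 1500 * n + ?V + 2000 * min ?q (n * Lg) \<and>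
         (\<forall>i<n. words s' X i = rk ?x i))"
      proof (rule wp_mono[OF wp_tour])
        fix v s'
        assume *: "v \<le> 1000 * (n * (Lg + 1)) \<and> frame tour s2 s' \<and>
          (\<forall>i<n. words s' X i = rk (reals s2 X) i) \<and>
          (\<forall>k<n. words s' (Sc 10) k < n \<and> rk (reals s2 X) (words s' (Sc 10) k) = k)"
        have "bcost ?b = 9" by simp
        moreover have "min ?q (n * Lg) = n * Lg" using False by simp
        moreover have "1000 * (n * (Lg + 1)) = 1000 * (n * Lg) + 1000 * n" by (simp add: algebra_simps)
        ultimately have "t + (u + (1 + bcost ?b + v)) \<le> 1500 * n + ?V + 2000 * min ?q (n * Lg)"
          using * u tV n1 mult_le_mono2[OF Lg_pos, of n] by linarith
        with * sm show "t + (u + (1 + bcost ?b + v)) \<le> 1500 * n + ?V + 2000 * min ?q (n * Lg) \<and>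
         (\<forall>i<n. words s' X i = rk ?x i)" by simp
      qed
      with False bv show ?thesis by (simp only: wp_If if_False)
    qed
  qed
  show ?thesis
    unfolding stationary_def wp_Seq
  proof (rule wp_frame[OF wp_search[where f = f and C = C and d = "\<lambda>i. search_depth (C i)"]])
    fix t s1
    assume *: "frame search s s1" "t \<le> (\<Sum>i<n. 150 * search_depth (C i) + 200 + (if C i = 0 then 100 * Lg + 100 else 0)) + 10 \<and>
     (\<forall>i<n. words s1 (Sc 19) i = f i \<and> words s1 (Sc 22) i = pv f i (f i)) \<and>
     words s1 (Sc 20) = ct f n \<and> words s1 (Sc 21) = pv f n"
    then have ct: "words s1 (Sc 20) = ct f n" by blast
    show "wpr prefix s1 (\<lambda>u s2. wpr (If ?b rank tour) s2 (\<lambda>v s'. ?Post (t + (u + v)) s'))"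
      by (rule wp_frame[OF wp_prefix[OF fn ct]]) (rule last[OF *])
  qed (use w l srt S Ssrt fdef Cdef zero search_depth in \<open>simp_all only:\<close>)
qed

lemma wp_sorter_stationary:
  assumes a: "words s CN 0 = lam" and p: "words s PN 0 = ms" and q: "words s QN 0 = 0"
    and srt: "vsorted (lkey s)"
    and S: "\<And>i a. i < n \<Longrightarrow> a < ms \<Longrightarrow> row s i a \<le> n"
    and Ssrt: "\<And>i a b. i < n \<Longrightarrow> a < b \<Longrightarrow> b < ms \<Longrightarrow> row s i a \<le> row s i b"
    and fdef: "\<And>i. f i = bk (lkey s) (xkey (reals s X) i)"
    and Cdef: "\<And>i. i < n \<Longrightarrow> C i = card {a. a < ms \<and> row s i a = f i}"
    and zero: "words s (Sc 20) = (\<lambda>_. 0)" "words s (Sc 21) = (\<lambda>_. 0)"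
  shows "wpr (sorter Q) s (\<lambda>t s'. t \<le> 2000 * n +
       (\<Sum>i<n. 150 * search_depth (C i) + (if C i = 0 then 100 * Lg + 100 else 0)) +
       2000 * min (\<Sum>i<n. ct f n (f i)) (n * Lg) \<and>
     (\<forall>i<n. words s' X i = rk (reals s X) i) \<and>
     (\<forall>k. words s' (Persistent k) = words s (Persistent k) \<and> reals s' (Persistent k) = reals s (Persistent k)))"
    (is "wpr _ _ ?Post")
proof -
  let ?V = "\<Sum>i<n. 150 * search_depth (C i) + (if C i = 0 then 100 * Lg + 100 else 0)"
  let ?q = "\<Sum>i<n. ct f n (f i)"
  let ?b1 = "Less (get CN) (get (Sc 2))" and ?b2 = "Or (Less (get PN) (get (Sc 5))) (Less (Num 0) (get QN))"
  have br: "wpr (If ?b1 (tour ;; merge) (If ?b2 (tour ;; train) stationary)) s1 (\<lambda>u s2. ?Post (t + u) s2)"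
    if fr: "frame (params Q) s s1" and pp: "t \<le> 200 * Lg + 200 \<and> words s1 (Sc 0) 0 = Lg \<and>
     words s1 (Sc 2) 0 = lam \<and> words s1 (Sc 5) 0 = ms" for t s1
  proof -
    have sm: "words s1 CN 0 = lam" "words s1 PN 0 = ms" "words s1 QN 0 = 0" "words s1 SA = words s SA"
      "lkey s1 = lkey s" "reals s1 X = reals s X" "words s1 (Sc 20) = (\<lambda>_. 0)" "words s1 (Sc 21) = (\<lambda>_. 0)"
      "\<And>k. words s1 (Persistent k) = words s (Persistent k)" "\<And>k. reals s1 (Persistent k) = reals s (Persistent k)"
      using frame_words[OF fr] frame_reals[OF fr] a p q zero by (simp_all add: targets lkey_def fun_eq_iff)
    have c: "\<not> bval n c s1 ?b1" "\<not> bval n c s1 ?b2" using pp sm by auto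
    have "wpr stationary s1 (\<lambda>t s'. t \<le> 1500 * n + ?V + 2000 * min ?q (n * Lg) \<and>
       (\<forall>i<n. words s' X i = rk (reals s1 X) i))"
      by (rule wp_stationary) (use pp srt S Ssrt in \<open>simp_all only: sm fdef Cdef\<close>)
    then have "wpr stationary s1 (\<lambda>u. ?Post (t + (1 + bcost ?b1 + (1 + bcost ?b2 + u))))"
    proof (rule wp_frame)
      fix u :: nat and s' :: mem
      assume fr3: "frame stationary s1 s'" and *: "u \<le> 1500 * n + ?V + 2000 * min ?q (n * Lg) \<and>
       (\<forall>i<n. words s' X i = rk (reals s1 X) i)"
      have "words s' (Persistent k) = words s (Persistent k) \<and> reals s' (Persistent k) = reals s (Persistent k)" for k
        using frame_words[OF fr3] frame_reals[OF fr3] sm by (simp add: stationary_def targets)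
      moreover have "t + (1 + bcost ?b1 + (1 + bcost ?b2 + u)) \<le> 2000 * n + ?V + 2000 * min ?q (n * Lg)"
      proof -
        have "1 + bcost ?b1 + (1 + bcost ?b2 + u) = 20 + u" by simp
        then show ?thesis using * pp Lg_le_n n by linarith
      qed
      ultimately show "?Post (t + (1 + bcost ?b1 + (1 + bcost ?b2 + u))) s'"
        using * sm by simp
    qed
    then show ?thesis by (simp only: wp_If c if_False)
  qed
  show ?thesis
    unfolding sorter_def wp_Seq[of n c cp "params Q"]
    by (rule wp_frame[OF wp_params[OF Q lam ms]]) (rule br)
qed

end

section \<open>Processing the sequence of inputs\<close>

text \<open>A step of insertion sort: the one position that may violate the order moves from
  \<open>q\<close> to \<open>q - 1\<close>. The larger of the two neighbours, left at
  \<open>q\<close>, is in order because all other entries already were.\<close>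

lemma rowstep_sorted:
  assumes srt: "\<And>a b. a < b \<Longrightarrow> b < p \<Longrightarrow> b \<noteq> q \<Longrightarrow> f a \<le> f b" and q: "0 < q" "q < p"
    and ab: "a < b" "b < p" "b \<noteq> q - 1"
  shows "rowstep p q v f a \<le> rowstep p q v f b"
proof -
  have q1: "q - 1 < q" "q - 1 \<noteq> q" using q by auto
  have r: "rowstep p q v f c = (if c = q then max (f (q - 1)) (f q) else if c = q - 1 then min (f (q - 1)) (f q) else f c)" for c
    using q by (simp add: rowstep_def)
  consider "b = q" "a = q - 1" | "b = q" "a < q - 1" | "b < q - 1" | "q < b" "a \<noteq> q" "a \<noteq> q - 1" | "q < b" "a = q" | "q < b" "a = q - 1"
    using ab q by linarith
  then show ?thesis
  proof cases
    case 2
    then show ?thesis using srt[of a "q - 1"] q q1 by (simp add: r le_max_iff_disj)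
  next
    case 3
    then have "b \<noteq> q" "a \<noteq> q" "a \<noteq> q - 1" using ab by linarith+
    then show ?thesis using srt[of a b] ab by (simp add: r)
  next
    case 4
    then show ?thesis using srt[of a b] ab by (simp add: r)
  next
    case 5
    then have "b \<noteq> q" "q - 1 < b" by linarith+
    then show ?thesis using 5 srt[of q b] srt[of "q - 1" b] ab by (simp add: r)
  next
    case 6
    then have "b \<noteq> q" "q - 1 < b" by linarith+
    then show ?thesis using 6 srt[of "q - 1" b] ab q1 by (simp add: r min_le_iff_disj)
  qed (use q1 in \<open>simp add: r\<close>)
qed

lemma rowstep_sum:
  assumes q: "0 < q" "q < p"
  shows "(\<Sum>a<p. g (rowstep p q v f a)) = (\<Sum>a<p. g (f a) :: nat)"
proof -
  have q1: "q - 1 \<noteq> q" "q - 1 < p" using q by auto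
  have s: "(\<Sum>a<p. h a) = h q + (h (q - 1) + (\<Sum>a\<in>{..<p} - {q} - {q - 1}. h a))" for h :: "nat \<Rightarrow> nat"
    using q q1 by (subst sum.remove[of _ q], simp, simp, subst sum.remove[of _ "q - 1"]) auto
  have "(\<Sum>a\<in>{..<p} - {q} - {q - 1}. g (rowstep p q v f a)) = (\<Sum>a\<in>{..<p} - {q} - {q - 1}. g (f a))"
    by (rule sum.cong) (use q in \<open>auto simp: rowstep_def\<close>)
  moreover have "g (rowstep p q v f q) + g (rowstep p q v f (q - 1)) = g (f q) + g (f (q - 1))"
    using q q1 by (simp add: rowstep_def max_def min_def)
  ultimately show ?thesis unfolding s[of "\<lambda>a. g (rowstep p q v f a)"] s[of "\<lambda>a. g (f a)"] by linarith
qed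

definition clean :: "mem \<Rightarrow> bool" where
  "clean p \<longleftrightarrow> (\<forall>a. a \<notin> range Persistent \<longrightarrow> words p a = (\<lambda>_. 0) \<and> reals p a = (\<lambda>_. 0))"

lemma retain_simps [simp]:
  "words (retain s) (Persistent k) = words s (Persistent k)"
  "reals (retain s) (Persistent k) = reals s (Persistent k)"
  by (simp_all add: retain_def)

lemma clean_retain: "clean (retain s)"
  by (simp add: clean_def retain_def)

lemma clean_blank: "clean blank"
  by (simp add: clean_def blank_def)

text \<open>Stationarity asks for equality of whole memories. In a clean memory only the persistent
  arrays can be nonzero, so agreement on these is enough.\<close>

lemma retain_eq:
  assumes "clean p" "\<And>k. words s (Persistent k) = words p (Persistent k)"
    "\<And>k. reals s (Persistent k) = reals p (Persistent k)"
  shows "retain s = p"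
proof -
  have "words (retain s) = words p" "reals (retain s) = reals p"
    using assms by (force simp: clean_def retain_def fun_eq_iff)+
  then show ?thesis by simp
qed

lemma load_simps [simp]:
  "words (load n x p) = words p" "reals (load n x p) (Persistent k) = reals p (Persistent k)"
  "reals (load n x p) X = (\<lambda>i. if i < n then x i else 0)"
  by (simp_all add: load_def)

lemma lkey_load [simp]: "lkey (load n x p) = lkey p" "lkey (retain s) = lkey s"
  by (simp_all add: lkey_def fun_eq_iff)

context alg
begin

lemma rk_cong: "(\<And>j. j < n \<Longrightarrow> x j = y j) \<Longrightarrow> i < n \<Longrightarrow> rk x i = rk y i"
  unfolding rk_def by (rule arg_cong[where f = card]) auto

lemma map_rank:
  assumes "\<forall>i<n. w i = rk (\<lambda>i. if i < n then x i else 0) i"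
  shows "map w [0..<n] = rank_perm n x"
proof (rule nth_equalityI)
  fix i assume "i < length (map w [0..<n])"
  then have i: "i < n" by simp
  have "rk (\<lambda>i. if i < n then x i else 0) i = rk x i" by (rule rk_cong) (use i in auto)
  then show "map w [0..<n] ! i = rank_perm n x ! i"
    using assms i by (simp add: rank_perm_nth rk_def)
qed simp

text \<open>One round moves the newest sample by at most one place, so sample \<open>t\<close> occupies \<open>t + 1\<close> rounds.\<close>

definition sample_round :: "nat \<Rightarrow> nat" where
  "sample_round t = lam + t * (t + 1) div 2"

definition merged :: "(nat \<Rightarrow> nat \<Rightarrow> real) \<Rightarrow> nat \<Rightarrow> mem \<Rightarrow> bool" where
  "merged I a p \<longleftrightarrow> (\<forall>t u. t < u \<longrightarrow> u < a * n \<longrightarrow> lkey p t \<le> lkey p u) \<and>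
     (\<forall>f :: key \<Rightarrow> nat. (\<Sum>t<a * n. f (lkey p t)) = (\<Sum>r<a. \<Sum>i<n. f (xkey (I r) i)))"

text \<open>For \<open>q = 0\<close> the exception \<open>b \<noteq> q\<close> excludes nothing,
  since \<open>a < b\<close>, and the row is completely sorted. The sums over all \<open>f\<close>
  again stand for equality of multisets.\<close>

definition sampled :: "(nat \<Rightarrow> nat \<Rightarrow> real) \<Rightarrow> nat \<Rightarrow> nat \<Rightarrow> mem \<Rightarrow> bool" where
  "sampled I m q p \<longleftrightarrow> (\<forall>i<n. (\<forall>a b. a < b \<longrightarrow> b < m \<longrightarrow> b \<noteq> q \<longrightarrow> row p i a \<le> row p i b) \<and>
     (\<forall>f :: nat \<Rightarrow> nat. (\<Sum>a<m. f (row p i a)) = (\<Sum>t<m. f (bk (lkey p) (xkey (I (sample_round t)) i)))))"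

text \<open>After \<open>lam\<close> rounds of merging, \<open>m\<close> samples, the last of which
  has \<open>q\<close> places left to sink, have taken \<open>r = lam + m(m+1)/2 - q\<close> rounds
  altogether; the equation is doubled to avoid division and subtraction. The last disjunct covers
  the rounds after the training.\<close>

definition inv :: "(nat \<Rightarrow> nat \<Rightarrow> real) \<Rightarrow> nat \<Rightarrow> mem \<Rightarrow> bool" where
  "inv I r p \<longleftrightarrow> clean p \<and> (\<exists>a m q. words p CN 0 = a \<and> words p PN 0 = m \<and> words p QN 0 = q \<and>
     merged I a p \<and> sampled I m q p \<and> m \<le> ms \<and> (q = 0 \<or> q < m) \<and>
     (a < lam \<and> m = 0 \<and> q = 0 \<and> r = a \<or>
      a = lam \<and> (2 * r + 2 * q = 2 * lam + m * (m + 1) \<or> m = ms \<and> q = 0 \<and> 2 * lam + ms * (ms + 1) \<le> 2 * r)))"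

definition finished :: "mem \<Rightarrow> bool" where
  "finished p \<longleftrightarrow> words p CN 0 = lam \<and> words p PN 0 = ms \<and> words p QN 0 = 0"

definition stationary_time :: "mem \<Rightarrow> (nat \<Rightarrow> real) \<Rightarrow> nat" where
  "stationary_time p x = 2000 * n +
     (\<Sum>i<n. 150 * search_depth (card {a. a < ms \<and> row p i a = bk (lkey p) (xkey x i)}) +
        (if card {a. a < ms \<and> row p i a = bk (lkey p) (xkey x i)} = 0 then 100 * Lg + 100 else 0)) +
     2000 * min (\<Sum>i<n. ct (\<lambda>i. bk (lkey p) (xkey x i)) n (bk (lkey p) (xkey x i))) (n * Lg)"

lemma merged_vsorted:
  assumes "merged I lam p"
  shows "vsorted (lkey p)"
  unfolding vsorted_def
proof (intro allI impI)
  fix i j assume ij: "i \<le> j" "j < n"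
  have "j * lam < lam * n" using ij Lg_pos by (simp add: lam)
  moreover have "i * lam < j * lam" if "i \<noteq> j" using ij that Lg_pos by (simp add: lam)
  ultimately show "lkey p (i * lam) \<le> lkey p (j * lam)"
    using assms unfolding merged_def by (cases "i = j") auto
qed

lemma sampled_sum:
  assumes "sampled I m q p" "i < n"
  shows "(\<Sum>a<m. (f :: nat \<Rightarrow> nat) (row p i a)) = (\<Sum>t<m. f (bk (lkey p) (xkey (I (sample_round t)) i)))"
  by (rule assms(1)[unfolded sampled_def, THEN spec, THEN mp, OF assms(2), THEN conjunct2, THEN spec])

lemma sampled_sorted:
  assumes "sampled I m q p" "i < n" "a < b" "b < m" "b \<noteq> q"
  shows "row p i a \<le> row p i b"
  using assms(1)[unfolded sampled_def, THEN spec, THEN mp, OF assms(2), THEN conjunct1] assms(3-5) by simp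

text \<open>Multiset equality with the indicator of values above \<open>n\<close> for
  \<open>f\<close>: its sum over the bucket numbers of the samples is 0, hence so is its sum over
  the row.\<close>

lemma sampled_le:
  assumes "sampled I m q p" "i < n" "a < m"
  shows "row p i a \<le> n"
proof -
  let ?f = "\<lambda>v. if v \<le> n then 0 else 1 :: nat"
  have "(\<Sum>a<m. ?f (row p i a)) = (\<Sum>t<m. ?f (bk (lkey p) (xkey (I (sample_round t)) i)))"
    by (rule sampled_sum[OF assms(1,2)])
  also have "\<dots> = 0" by (simp add: bk_le)
  finally have "?f (row p i a) = 0" using assms(3) by (subst (asm) sum_eq_0_iff) auto
  then show ?thesis by (simp split: if_splits)
qed

lemma step_merge:
  assumes inv: "inv I r p" and a: "words p CN 0 < lam"
  shows "\<exists>t s'. exec n c cp (sorter Q) (load n (I r) p) t s' \<and> t \<le> 4000 * (n * (Lg + 1)) \<and>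
    map (words s' X) [0..<n] = rank_perm n (I r) \<and> inv I (Suc r) (retain s')"
proof -
  let ?s = "load n (I r) p"
  define a where "a = words p CN 0"
  have A: "clean p" "words p PN 0 = 0" "words p QN 0 = 0" "merged I a p" "r = a" "a < lam"
    using inv a unfolding inv_def a_def by auto
  have "wpr (sorter Q) ?s (\<lambda>t s'. t \<le> 4000 * (n * (Lg + 1)) \<and>
     (\<forall>i<n. words s' X i = rk (reals ?s X) i) \<and>
     (\<forall>a. a \<in> {SA, PN, QN} \<longrightarrow> words s' a = words ?s a) \<and> words s' CN 0 = Suc a \<and>
     (\<forall>t u. t < u \<longrightarrow> u < Suc a * n \<longrightarrow> lkey s' t \<le> lkey s' u) \<and>
     (\<forall>f :: key \<Rightarrow> nat. (\<Sum>t<Suc a * n. f (lkey s' t)) =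
        (\<Sum>t<a * n. f (lkey ?s t)) + (\<Sum>i<n. f (xkey (reals ?s X) i))))"
    by (rule wp_sorter_merge) (use A in \<open>auto simp: a_def merged_def\<close>)
  then obtain t s' where ex: "exec n c cp (sorter Q) ?s t s'" "t \<le> 4000 * (n * (Lg + 1))"
    and rank: "\<forall>i<n. words s' X i = rk (reals ?s X) i"
    and same: "\<forall>a. a \<in> {SA, PN, QN} \<longrightarrow> words s' a = words ?s a" and CN: "words s' CN 0 = Suc a"
    and srt: "\<forall>t u. t < u \<longrightarrow> u < Suc a * n \<longrightarrow> lkey s' t \<le> lkey s' u"
    and cnt: "\<And>f :: key \<Rightarrow> nat. (\<Sum>t<Suc a * n. f (lkey s' t)) =
        (\<Sum>t<a * n. f (lkey p t)) + (\<Sum>i<n. f (xkey (reals ?s X) i))"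
    unfolding wp_def lkey_load by blast
  have "(\<Sum>t<Suc a * n. f (lkey s' t)) = (\<Sum>r<Suc a. \<Sum>i<n. f (xkey (I r) i))" for f :: "key \<Rightarrow> nat"
  proof -
    have "(\<Sum>i<n. f (xkey (reals ?s X) i)) = (\<Sum>i<n. f (xkey (I r) i))" by (rule sum.cong) auto
    then show ?thesis using cnt[of f] A(4,5) unfolding merged_def by simp
  qed
  then have "merged I (Suc a) (retain s')" using srt unfolding merged_def lkey_load by blast
  moreover have "sampled I 0 0 (retain s')" by (simp add: sampled_def)
  moreover have "words (retain s') CN 0 = Suc a" "words (retain s') PN 0 = 0" "words (retain s') QN 0 = 0"
    using CN same A by simp_all
  moreover have "Suc a < lam \<or> Suc a = lam" using A by linarith
  ultimately have "inv I (Suc r) (retain s')"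
    unfolding inv_def using A clean_retain by auto
  moreover have "map (words s' X) [0..<n] = rank_perm n (I r)"
    by (rule map_rank) (use rank in simp)
  ultimately show ?thesis using ex by blast
qed

lemma sample_round_eq: "2 * r = 2 * lam + m * (m + 1) \<Longrightarrow> sample_round m = r"
  unfolding sample_round_def by linarith

lemma step_train:
  assumes inv: "inv I r p" and a: "words p CN 0 = lam" and nf: "\<not> finished p"
  shows "\<exists>t s'. exec n c cp (sorter Q) (load n (I r) p) t s' \<and> t \<le> 4000 * (n * (Lg + 1)) \<and>
    map (words s' X) [0..<n] = rank_perm n (I r) \<and> inv I (Suc r) (retain s')"
proof -
  let ?s = "load n (I r) p"
  define m where "m = words p PN 0"
  define q where "q = words p QN 0"
  have A: "clean p" "merged I lam p" "sampled I m q p" "m \<le> ms" "q = 0 \<or> q < m"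
    and nf': "\<not> (m = ms \<and> q = 0)"
    using inv a nf unfolding inv_def m_def q_def finished_def by auto
  have r: "2 * r + 2 * q = 2 * lam + m * (m + 1)"
    using inv a nf' unfolding inv_def m_def[symmetric] q_def[symmetric] by auto
  have mq: "q = 0 \<Longrightarrow> m < ms" "q < ms" "m < ms \<or> 0 < q" using A nf' ms_pos by auto
  let ?b = "\<lambda>i. bk (lkey p) (xkey (I r) i)"
  have xk: "xkey (reals ?s X) i = xkey (I r) i" if "i < n" for i using that by simp
  have "wpr (sorter Q) ?s (\<lambda>t s'. t \<le> 4000 * (n * (Lg + 1)) \<and>
     (\<forall>i<n. words s' X i = rk (reals ?s X) i) \<and>
     words s' CN 0 = lam \<and> lkey s' = lkey ?s \<and>
     (\<forall>i<n. \<forall>a<ms. row s' i a = rowstep m q (bk (lkey ?s) (xkey (reals ?s X) i)) (row ?s i) a) \<and>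
     words s' PN 0 = (if q = 0 then m + 1 else m) \<and> words s' QN 0 = (if q = 0 then m else q - 1))"
    by (rule wp_sorter_train) (use a merged_vsorted[OF A(2)] mq in \<open>auto simp: m_def q_def\<close>)
  then obtain t s' where ex: "exec n c cp (sorter Q) ?s t s'" "t \<le> 4000 * (n * (Lg + 1))"
    and rank: "\<forall>i<n. words s' X i = rk (reals ?s X) i"
    and CN: "words s' CN 0 = lam" and L: "lkey s' = lkey p"
    and rows: "\<forall>i<n. \<forall>a<ms. row s' i a = rowstep m q (bk (lkey ?s) (xkey (reals ?s X) i)) (row ?s i) a"
    and PN: "words s' PN 0 = (if q = 0 then m + 1 else m)" and QN: "words s' QN 0 = (if q = 0 then m else q - 1)"
    unfolding wp_def lkey_load by blast
  have rows': "row s' i a = rowstep m q (?b i) (row p i) a" if "i < n" "a < ms" for i a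
    using rows that by simp
  have "sampled I (if q = 0 then m + 1 else m) (if q = 0 then m else q - 1) (retain s')"
  proof (cases "q = 0")
    case True
    \<comment> \<open>By the round count in \<open>inv\<close>, the present input is the one
      assigned to sample \<open>m\<close>.\<close>
    have sr: "sample_round m = r" using r True by (intro sample_round_eq) simp
    have mm: "m < ms" using mq True by simp
    have row1: "row s' i a = (if a = m then ?b i else row p i a)" if "i < n" "a < m + 1" for i a
      using rows'[of i a] that mm True by (simp add: rowstep_def)
    show ?thesis
      unfolding sampled_def
    proof (intro allI impI conjI)
      fix i a b assume i: "i < n" and ab: "a < b" "b < (if q = 0 then m + 1 else m)" "b \<noteq> (if q = 0 then m else q - 1)"
      have "b < m" "0 < b" using ab True by auto
      then show "row (retain s') i a \<le> row (retain s') i b"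
        using sampled_sorted[OF A(3) i, of a b] ab True i row1[of i a] row1[of i b] by simp
    next
      fix i and f :: "nat \<Rightarrow> nat" assume i: "i < n"
      have "(\<Sum>a<m + 1. f (row s' i a)) = (\<Sum>a<m. f (row s' i a)) + f (row s' i m)"
        by (simp flip: Suc_eq_plus1)
      also have "(\<Sum>a<m. f (row s' i a)) = (\<Sum>a<m. f (row p i a))"
        by (rule sum.cong) (use row1 i in auto)
      also have "row s' i m = ?b i" using row1 i by simp
      also have "(\<Sum>a<m. f (row p i a)) = (\<Sum>t<m. f (bk (lkey p) (xkey (I (sample_round t)) i)))"
        by (rule sampled_sum[OF A(3) i])
      also have "\<dots> + f (?b i) = (\<Sum>t<m + 1. f (bk (lkey p) (xkey (I (sample_round t)) i)))"
        by (simp add: sr flip: Suc_eq_plus1)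
      finally show "(\<Sum>a<(if q = 0 then m + 1 else m). f (row (retain s') i a)) =
          (\<Sum>t<(if q = 0 then m + 1 else m). f (bk (lkey (retain s')) (xkey (I (sample_round t)) i)))"
        using True by (simp add: L)
    qed
  next
    case False
    then have q: "0 < q" "q < m" using A by auto
    have row1: "row s' i a = rowstep m q (?b i) (row p i) a" if "i < n" "a < m" for i a
      using rows'[of i a] that A by simp
    show ?thesis
      unfolding sampled_def
    proof (intro allI impI conjI)
      fix i a b assume i: "i < n" and ab: "a < b" "b < (if q = 0 then m + 1 else m)" "b \<noteq> (if q = 0 then m else q - 1)"
      have b: "b < m" "b \<noteq> q - 1" "a < m" using ab False by auto
      have "rowstep m q (?b i) (row p i) a \<le> rowstep m q (?b i) (row p i) b"
        by (rule rowstep_sorted[OF _ q ab(1) b(1,2)]) (rule sampled_sorted[OF A(3) i])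
      then show "row (retain s') i a \<le> row (retain s') i b"
        using row1[OF i b(3)] row1[OF i b(1)] by simp
    next
      fix i and f :: "nat \<Rightarrow> nat" assume i: "i < n"
      have "(\<Sum>a<m. f (row s' i a)) = (\<Sum>a<m. f (rowstep m q (?b i) (row p i) a))"
        by (rule sum.cong) (use row1 i in auto)
      also have "\<dots> = (\<Sum>a<m. f (row p i a))" by (rule rowstep_sum[OF q])
      also have "\<dots> = (\<Sum>t<m. f (bk (lkey p) (xkey (I (sample_round t)) i)))"
        by (rule sampled_sum[OF A(3) i])
      finally show "(\<Sum>a<(if q = 0 then m + 1 else m). f (row (retain s') i a)) =
          (\<Sum>t<(if q = 0 then m + 1 else m). f (bk (lkey (retain s')) (xkey (I (sample_round t)) i)))"
        using False by (simp add: L)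
    qed
  qed
  moreover have "merged I lam (retain s')" using A(2) unfolding merged_def lkey_load L .
  moreover have "2 * Suc r + 2 * (if q = 0 then m else q - 1) =
     2 * lam + (if q = 0 then m + 1 else m) * ((if q = 0 then m + 1 else m) + 1)"
  proof (cases "q = 0")
    case True
    have "(m + 1) * (m + 1 + 1) = m * (m + 1) + 2 * m + 2" by (simp add: algebra_simps)
    then show ?thesis using r True by simp
  next
    case False
    then have "2 * (q - 1) + 2 = 2 * q" by simp
    then show ?thesis using r False by simp
  qed
  moreover have "(if q = 0 then m + 1 else m) \<le> ms" using mq A by auto
  moreover have "(if q = 0 then m else q - 1) = 0 \<or> (if q = 0 then m else q - 1) < (if q = 0 then m + 1 else m)"
    using A by auto
  ultimately have "inv I (Suc r) (retain s')"
    unfolding inv_def using clean_retain CN PN QN by simp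
  moreover have "map (words s' X) [0..<n] = rank_perm n (I r)"
    by (rule map_rank) (use rank in simp)
  ultimately show ?thesis using ex by blast
qed

lemma step_stationary:
  assumes clean: "clean p" and fin: "finished p" and mg: "merged I lam p" and sa: "sampled I ms 0 p"
  shows "\<exists>t s'. exec n c cp (sorter Q) (load n x p) t s' \<and> t \<le> stationary_time p x \<and>
    map (words s' X) [0..<n] = rank_perm n x \<and> retain s' = p"
proof -
  let ?s = "load n x p"
  have xk: "xkey (reals ?s X) i = xkey x i" if "i < n" for i using that by simp
  let ?f = "\<lambda>i. bk (lkey ?s) (xkey (reals ?s X) i)"
  let ?C = "\<lambda>i. card {a. a < ms \<and> row ?s i a = ?f i}"
  have Ss: "row p i a \<le> row p i b" if "i < n" "a < b" "b < ms" for i a b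
    by (rule sampled_sorted[OF sa]) (use that in auto)
  have fin': "words p CN 0 = lam" "words p PN 0 = ms" "words p QN 0 = 0"
    using fin by (simp_all add: finished_def)
  have z: "words p (Sc 20) = (\<lambda>_. 0)" "words p (Sc 21) = (\<lambda>_. 0)"
    using clean by (auto simp: clean_def)
  have "wpr (sorter Q) ?s (\<lambda>t s'. t \<le> 2000 * n +
       (\<Sum>i<n. 150 * search_depth (?C i) + (if ?C i = 0 then 100 * Lg + 100 else 0)) +
       2000 * min (\<Sum>i<n. ct ?f n (?f i)) (n * Lg) \<and>
     (\<forall>i<n. words s' X i = rk (reals ?s X) i) \<and>
     (\<forall>k. words s' (Persistent k) = words ?s (Persistent k) \<and> reals s' (Persistent k) = reals ?s (Persistent k)))"
    by (rule wp_sorter_stationary) (use fin' merged_vsorted[OF mg] sampled_le[OF sa] Ss z in simp_all)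
  then obtain t s' where ex: "exec n c cp (sorter Q) ?s t s'"
    and t: "t \<le> 2000 * n +
       (\<Sum>i<n. 150 * search_depth (?C i) + (if ?C i = 0 then 100 * Lg + 100 else 0)) +
       2000 * min (\<Sum>i<n. ct ?f n (?f i)) (n * Lg)"
    and rank: "\<forall>i<n. words s' X i = rk (reals ?s X) i"
    and same: "\<forall>k. words s' (Persistent k) = words ?s (Persistent k) \<and> reals s' (Persistent k) = reals ?s (Persistent k)"
    unfolding wp_def by blast
  have "ct ?f n v = ct (\<lambda>i. bk (lkey p) (xkey x i)) n v" for v
    unfolding ct_def by (rule arg_cong[where f = card]) auto
  then have "t \<le> stationary_time p x" using t unfolding stationary_time_def by simp
  moreover have "map (words s' X) [0..<n] = rank_perm n x"
    by (rule map_rank) (use rank in simp)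
  moreover have "retain s' = p"
    by (rule retain_eq[OF clean]) (use same in auto)
  ultimately show ?thesis using ex by blast
qed

lemma stationary_time_le: "stationary_time p x \<le> 4000 * (n * (Lg + 1))"
proof -
  let ?C = "\<lambda>i. card {a. a < ms \<and> row p i a = bk (lkey p) (xkey x i)}"
  have "(\<Sum>i<n. 150 * search_depth (?C i) + (if ?C i = 0 then 100 * Lg + 100 else 0)) \<le> (\<Sum>i<n. 400 * Lg + 1000)"
  proof (rule sum_mono)
    fix i
    show "150 * search_depth (?C i) + (if ?C i = 0 then 100 * Lg + 100 else 0) \<le> 400 * Lg + 1000"
      using search_depth_le[of "?C i"] by (simp split: if_splits)
  qed
  also have "\<dots> = 400 * (n * Lg) + 1000 * n" by (simp add: algebra_simps)
  moreover have "4000 * (n * (Lg + 1)) = 4000 * (n * Lg) + 4000 * n" by (simp add: algebra_simps)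
  ultimately show ?thesis
    unfolding stationary_time_def
    using min.cobounded2[of "(\<Sum>i<n. ct (\<lambda>i. bk (lkey p) (xkey x i)) n (bk (lkey p) (xkey x i)))" "n * Lg"]
    by linarith
qed

lemma step:
  assumes inv: "inv I r p"
  shows "\<exists>t s'. exec n c cp (sorter Q) (load n (I r) p) t s' \<and> t \<le> 4000 * (n * (Lg + 1)) \<and>
    map (words s' X) [0..<n] = rank_perm n (I r) \<and> inv I (Suc r) (retain s') \<and> (finished p \<longrightarrow> retain s' = p)"
proof -
  consider "words p CN 0 < lam" | "words p CN 0 = lam" "\<not> finished p" | "finished p"
    using inv unfolding inv_def by blast
  then show ?thesis
  proof cases
    case 1
    then have "\<not> finished p" by (simp add: finished_def)
    then show ?thesis using step_merge[OF inv 1] by blast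
  next
    case 2
    then show ?thesis using step_train[OF inv 2] by blast
  next
    case 3
    then have A: "clean p" "merged I lam p" "sampled I ms 0 p"
      and r: "2 * r + 2 * 0 = 2 * lam + ms * (ms + 1) \<or> 2 * lam + ms * (ms + 1) \<le> 2 * r"
      using inv unfolding inv_def finished_def by auto
    have "inv I (Suc r) p"
      unfolding inv_def using A r 3 ms_pos by (auto simp: finished_def)
    moreover obtain t s' where "exec n c cp (sorter Q) (load n (I r) p) t s'" "t \<le> stationary_time p (I r)"
      "map (words s' X) [0..<n] = rank_perm n (I r)" "retain s' = p"
      using step_stationary[OF A(1) 3 A(2,3)] by blast
    moreover from this(2) have "t \<le> 4000 * (n * (Lg + 1))" using stationary_time_le le_trans by blast
    ultimately show ?thesis by (intro exI[of _ t] exI[of _ s'] conjI) simp_all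
  qed
qed

lemma inv_blank: "inv I 0 blank"
proof -
  have "merged I 0 blank" "sampled I 0 0 blank" by (simp_all add: merged_def sampled_def)
  then show ?thesis
    unfolding inv_def using clean_blank Lg_pos by (auto simp: blank_def lam)
qed

text \<open>As \<open>m(m+1)\<close> is strictly increasing, the round count in \<open>inv\<close>
  leaves only \<open>m = ms\<close> and \<open>q = 0\<close> from this round on.\<close>

lemma inv_finished:
  assumes "inv I r p" "2 * lam + ms * (ms + 1) \<le> 2 * r"
  shows "finished p" "clean p" "merged I lam p" "sampled I ms 0 p"
proof -
  from assms(1) obtain a m q where A: "clean p" "words p CN 0 = a" "words p PN 0 = m" "words p QN 0 = q"
     "merged I a p" "sampled I m q p" "m \<le> ms" "q = 0 \<or> q < m"
     "a < lam \<and> m = 0 \<and> q = 0 \<and> r = a \<or>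
      a = lam \<and> (2 * r + 2 * q = 2 * lam + m * (m + 1) \<or> m = ms \<and> q = 0 \<and> 2 * lam + ms * (ms + 1) \<le> 2 * r)"
    unfolding inv_def by blast
  have "a = lam" using A(9) assms(2) by linarith
  moreover have "m = ms \<and> q = 0"
  proof (cases "2 * r + 2 * q = 2 * lam + m * (m + 1)")
    case True
    then have *: "ms * (ms + 1) + 2 * q \<le> m * (m + 1)" using assms(2) by linarith
    have "m = ms"
    proof (rule ccontr)
      assume "m \<noteq> ms"
      then have "m < ms" using A by simp
      then have "m * (m + 1) < ms * (ms + 1)" by (intro mult_strict_mono) auto
      then show False using * by linarith
    qed
    then show ?thesis using * by simp
  qed (use A \<open>a = lam\<close> in auto)
  ultimately show "finished p" "clean p" "merged I lam p" "sampled I ms 0 p"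
    using A by (auto simp: finished_def)
qed

end

section \<open>The self-improving sorter\<close>

text \<open>The binary length of \<open>n\<close>, that is, floor(log2 n) + 1 for positive
  \<open>n\<close>.\<close>

definition lg :: "nat \<Rightarrow> nat" where
  "lg n = (LEAST k. n < 2 ^ k)"

lemma lg: "n < 2 ^ lg n"
  unfolding lg_def by (rule LeastI[of _ n]) (rule less_exp)

lemma lg_le: "1 \<le> n \<Longrightarrow> 2 ^ lg n \<le> 2 * n"
proof -
  assume n: "1 \<le> n"
  then have "lg n \<noteq> 0" using lg[of n] by (metis One_nat_def linorder_not_less power_0)
  then obtain k where k: "lg n = Suc k" by (cases "lg n") auto
  then have "\<not> n < 2 ^ k" using not_less_Least[of k "\<lambda>k. n < 2 ^ k"] by (simp add: lg_def)
  then show ?thesis by (simp add: k)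
qed

definition batch :: "nat \<Rightarrow> nat" where
  "batch n = 4 * lg n"

text \<open>Let x = n^(1/(4q)). For fixed \<open>q\<close> both the power of two and
  \<open>lg n\<close> are O(x), so there are O(x^2) samples per coordinate. Sorting them takes a
  quadratic number of rounds, O(x^4) = O(n^(1/q)), which explains the divisor
  \<open>4 * q\<close>.\<close>

definition samples :: "nat \<Rightarrow> nat \<Rightarrow> nat" where
  "samples q n = 32 * 2 ^ (lg n div (4 * q)) * lg n"

definition training :: "nat \<Rightarrow> nat \<Rightarrow> nat" where
  "training q n = batch n + samples q n * (samples q n + 1) div 2"

text \<open>The word size (n+1)^(4q+60) covers the literal \<open>4 * q\<close>, which is below
  2^(4q), and the address arithmetic, for which (n+1)^17 would do.\<close>

definition self_sorter :: "nat \<Rightarrow> algorithm" where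
  "self_sorter q = \<lparr>code = sorter (4 * q), word_const = 4 * q + 60,
     capacity = (\<lambda>n. n * batch n + n * samples q n + 4 * n + 4)\<rparr>"

definition bound :: "nat \<Rightarrow> nat \<Rightarrow> nat" where
  "bound q n = n * batch n + n * samples q n + n * n + samples q n + batch n + lg n + n + 1000"

lemma alg_self_sorter:
  assumes n: "1 \<le> n"
  shows "alg n (4 * q + 60) (capacity (self_sorter q) n) (batch n) (samples q n) (lg n)
     (bound q n) (Suc n ^ (4 * q + 60)) (4 * q)"
proof -
  let ?N = "n + 1"
  have lgn: "lg n \<le> n"
  proof -
    have "(2::nat) ^ lg n < 2 ^ (n + 1)" using lg_le[OF n] less_exp[of n]
      unfolding power_add power_one_right by linarith
    then show ?thesis by simp
  qed
  have "(2::nat) ^ (lg n div (4 * q)) \<le> 2 ^ lg n" by (rule power_increasing) auto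
  also have "\<dots> \<le> 2 * ?N" using lg_le[OF n] by simp
  finally have M: "2 ^ (lg n div (4 * q)) \<le> 2 * ?N" .
  have "samples q n \<le> 32 * (2 * ?N) * ?N"
    unfolding samples_def by (intro mult_mono) (use M lgn in auto)
  then have s: "samples q n \<le> 64 * (?N * ?N)" by (simp add: algebra_simps)
  have N1: "1 \<le> ?N" by simp
  have N2: "?N \<le> ?N ^ 3" "?N * ?N \<le> ?N ^ 3" "1 \<le> ?N ^ 3"
    using power_increasing[of 1 3 ?N] power_increasing[of 2 3 ?N] by (simp_all add: power2_eq_square)
  have "n * lg n \<le> ?N * ?N" by (rule mult_mono) (use lgn in auto)
  then have "n * batch n \<le> 4 * (?N * ?N)" "batch n \<le> 4 * ?N"
    using lgn by (simp_all add: batch_def)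
  moreover have "n * samples q n \<le> 64 * ?N ^ 3"
    using mult_mono[of n ?N "samples q n" "64 * (?N * ?N)"] s by (simp add: power3_eq_cube algebra_simps)
  moreover have "n * n \<le> ?N * ?N" by (rule mult_mono) auto
  moreover have "a + b + d + e + f + g + h + 1000 \<le> 2000 * z"
    if "a \<le> 4 * w" "f \<le> 4 * k" "b \<le> 64 * z" "d \<le> w" "e \<le> 64 * w" "k \<le> z" "w \<le> z" "1 \<le> z" "g \<le> h" "h \<le> k"
    for a b d e f g h z w k :: nat
    using that by linarith
  ultimately have "bound q n \<le> 2000 * ?N ^ 3"
    unfolding bound_def using s N2 lgn by (meson le_add1)
  then have "8 * bound q n \<le> 16000 * ?N ^ 3" by simp
  \<comment> \<open>\<open>n + 1\<close> is at least 2, so the constant 2^14 is absorbed by a power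
    of \<open>n + 1\<close>.\<close>
  also have "\<dots> < 2 ^ 14 * ?N ^ 3" using N2(3) by simp
  also have "\<dots> \<le> ?N ^ 14 * ?N ^ 3" using n by (intro mult_right_mono power_mono) auto
  also have "\<dots> = ?N ^ 17" by (simp flip: power_add)
  also have "\<dots> \<le> ?N ^ (4 * q + 60)" by (rule power_increasing) auto
  finally have big: "8 * bound q n < Suc n ^ (4 * q + 60)" by (simp only: Suc_eq_plus1)
  have "4 * q < 2 ^ (4 * q)" by (rule less_exp)
  also have "\<dots> \<le> ?N ^ (4 * q)" using n by (intro power_mono) auto
  also have "\<dots> \<le> ?N ^ (4 * q + 60)" by (rule power_increasing) auto
  finally have Q: "4 * q < Suc n ^ (4 * q + 60)" by (simp only: Suc_eq_plus1)
  show ?thesis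
    by unfold_locales
      (use n big Q lg lg_le[OF n] in \<open>auto simp: self_sorter_def batch_def samples_def bound_def\<close>)
qed

lemma runs_eqs:
  assumes "exec n (word_const A) (capacity A n) (code A) (load n x p) t s"
  shows "run_time A n p x = t" "run_result A n p x = s" "runs A n p x t s"
proof -
  show r: "runs A n p x t s" using assms by (simp add: runs_def)
  show "run_time A n p x = t"
    unfolding run_time_def by (rule the_equality) (use r in \<open>auto simp: runs_def dest: exec_unique\<close>)
  show "run_result A n p x = s"
    unfolding run_result_def by (rule the_equality) (use r in \<open>auto simp: runs_def dest: exec_unique\<close>)
qed

context
  fixes q n :: nat
  assumes n: "1 \<le> n"
begin

interpretation alg n "4 * q + 60" "capacity (self_sorter q) n" "batch n" "samples q n" "lg n"
   "bound q n" "Suc n ^ (4 * q + 60)" "4 * q"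
  by (rule alg_self_sorter[OF n])

lemma self_sorter_inv: "inv I r (store (self_sorter q) n I r)"
proof (induction r)
  case 0
  then show ?case using inv_blank by simp
next
  case (Suc r)
  from step[OF Suc] obtain t s' where
    e: "exec n (4 * q + 60) (capacity (self_sorter q) n) (sorter (4 * q)) (load n (I r) (store (self_sorter q) n I r)) t s'"
    and i: "inv I (Suc r) (retain s')" by blast
  have "run_result (self_sorter q) n (store (self_sorter q) n I r) (I r) = s'"
    by (rule runs_eqs) (use e in \<open>simp add: self_sorter_def\<close>)
  then show ?case using i by simp
qed

lemma self_sorter_run:
  shows "\<exists>s. runs (self_sorter q) n (store (self_sorter q) n I r) (I r)
      (run_time (self_sorter q) n (store (self_sorter q) n I r) (I r)) s \<and>
     map (words s InOut) [0..<n] = rank_perm n (I r)" (is ?A)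
    and "run_time (self_sorter q) n (store (self_sorter q) n I r) (I r) \<le> 4000 * (n * (lg n + 1))" (is ?B)
    and "training q n \<le> r \<Longrightarrow> store (self_sorter q) n I (Suc r) = store (self_sorter q) n I r" (is "_ \<Longrightarrow> ?C")
proof -
  let ?p = "store (self_sorter q) n I r"
  from step[OF self_sorter_inv[of I r]] obtain t s' where
    e: "exec n (4 * q + 60) (capacity (self_sorter q) n) (sorter (4 * q)) (load n (I r) ?p) t s'"
    and p: "t \<le> 4000 * (n * (lg n + 1))" "map (words s' InOut) [0..<n] = rank_perm n (I r)"
      "finished ?p \<longrightarrow> retain s' = ?p" by blast
  have e': "exec n (word_const (self_sorter q)) (capacity (self_sorter q) n) (code (self_sorter q)) (load n (I r) ?p) t s'"
    using e by (simp add: self_sorter_def)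
  note r = runs_eqs[OF e']
  show ?A ?B using p r by auto
  assume T: "training q n \<le> r"
  have "2 * batch n + samples q n * (samples q n + 1) = 2 * training q n"
    unfolding training_def by simp
  then have "finished ?p" using T by (intro inv_finished[OF self_sorter_inv[of I r]]) simp
  then show ?C using p r by simp
qed

lemma self_sorter_trained:
  fixes J
  defines "p \<equiv> store (self_sorter q) n J (training q n)"
  shows "merged J (batch n) p" "sampled J (samples q n) 0 p"
    "run_time (self_sorter q) n p x \<le> stationary_time p x"
    "\<exists>s. runs (self_sorter q) n p x (run_time (self_sorter q) n p x) s"
proof -
  have T: "2 * batch n + samples q n * (samples q n + 1) \<le> 2 * training q n"
    unfolding training_def by simp
  note fin = inv_finished[OF self_sorter_inv T, of J, folded p_def]
  show "merged J (batch n) p" "sampled J (samples q n) 0 p" by (rule fin)+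
  from step_stationary[OF fin(2,1,3,4), of x] obtain t s' where
    e: "exec n (4 * q + 60) (capacity (self_sorter q) n) (sorter (4 * q)) (load n x p) t s'"
    and t: "t \<le> stationary_time p x" by blast
  have e': "exec n (word_const (self_sorter q)) (capacity (self_sorter q) n) (code (self_sorter q)) (load n x p) t s'"
    using e by (simp add: self_sorter_def)
  note r = runs_eqs[OF e']
  show "run_time (self_sorter q) n p x \<le> stationary_time p x"
    "\<exists>s. runs (self_sorter q) n p x (run_time (self_sorter q) n p x) s" using r t by auto
qed

end

lemma self_improving: "self_improving_sorter (self_sorter q) (training q)"
  unfolding self_improving_sorter_def is_sorter_def stationary_after_def
proof (intro conjI allI impI)
  fix n I r assume n: "1 \<le> (n::nat)"
  show "\<exists>t s. runs (self_sorter q) n (store (self_sorter q) n I r) (I r) t s \<and>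
        map (words s InOut) [0..<n] = rank_perm n (I r)"
    using self_sorter_run(1)[OF n] by blast
next
  fix n I r assume n: "1 \<le> (n::nat)" and r: "training q n \<le> r"
  from r show "store (self_sorter q) n I r = store (self_sorter q) n I (training q n)"
  proof (induction r rule: dec_induct)
    case (step r)
    then show ?case using self_sorter_run(3)[OF n, of q r I] by simp
  qed simp
qed

section \<open>Growth of the time, the training length and the storage\<close>

lemma lg_le_log: "1 \<le> n \<Longrightarrow> real (lg n) \<le> 1 + log 2 (real n)"
proof -
  assume n: "1 \<le> n"
  have "real (2 ^ lg n) \<le> real (2 * n)" using lg_le[OF n] by (rule of_nat_mono)
  then have "log 2 (2 ^ lg n) \<le> log 2 (2 * real n)" using n by (subst log_le_cancel_iff) auto
  then show ?thesis using n by (simp add: log_mult)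
qed

lemma worst_case:
  assumes n: "2 \<le> n" and K: "12000 \<le> K"
  shows "worst_case_time_le (self_sorter q) n (K * (real n * log 2 (real n)))"
  unfolding worst_case_time_le_def
proof (intro allI)
  fix I r
  have n1: "1 \<le> n" using n by simp
  have l: "1 \<le> log 2 (real n)" using n by (simp add: le_log_iff)
  have "real (run_time (self_sorter q) n (store (self_sorter q) n I r) (I r)) \<le> real (4000 * (n * (lg n + 1)))"
    using self_sorter_run(2)[OF n1] by (rule of_nat_mono)
  also have "\<dots> = 4000 * (real n * (real (lg n) + 1))" by simp
  also have "\<dots> \<le> 4000 * (real n * (3 * log 2 (real n)))"
    using lg_le_log[OF n1] l by (intro mult_left_mono) auto
  also have "\<dots> = 12000 * (real n * log 2 (real n))" by simp
  also have "\<dots> \<le> K * (real n * log 2 (real n))" using K l n by (intro mult_right_mono) auto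
  finally show "real (run_time (self_sorter q) n (store (self_sorter q) n I r) (I r)) \<le> K * (real n * log 2 (real n))" .
qed

lemma samples_le:
  assumes n: "1 \<le> n" and q: "1 \<le> q"
  defines "\<delta> \<equiv> 1 / (4 * real q)"
  shows "real (lg n) \<le> (1 + 8 * real q) * real n powr \<delta>"
    "real (samples q n) \<le> 64 * (1 + 8 * real q) * real n powr (2 * \<delta>)"
proof -
  let ?d = "real n powr \<delta>"
  have \<delta>: "0 < \<delta>" "\<delta> \<le> 1" using q by (auto simp: \<delta>_def divide_simps)
  have d1: "1 \<le> ?d" using n \<delta> by (simp add: ge_one_powr_ge_zero)
  \<comment> \<open>The inequality \<open>ln x \<le> x - 1\<close> at
    \<open>x = n powr \<delta>\<close> trades the logarithm for the power at the cost of a factor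
    1/\<delta>, which is O(q).\<close>
  have "\<delta> * ln (real n) = ln ?d" using n by (simp add: ln_powr)
  also have "\<dots> \<le> ?d - 1" using d1 n by (intro ln_le_minus_one) simp
  finally have "ln (real n) \<le> ?d / \<delta>" using \<delta> by (simp add: pos_le_divide_eq mult.commute)
  then have "2 * ln (real n) \<le> 2 * (?d / \<delta>)" by simp
  moreover have "log 2 (real n) \<le> 2 * ln (real n)"
  proof -
    have "1 / 2 \<le> ln (2::real)" using ln2_ge_two_thirds by simp
    then have "ln (real n) / ln 2 \<le> ln (real n) / (1 / 2)"
      using n by (intro divide_left_mono) auto
    then show ?thesis by (simp add: log_def)
  qed
  ultimately have "log 2 (real n) \<le> 2 * (?d / \<delta>)" by linarith
  also have "\<dots> = 8 * real q * ?d" by (simp add: \<delta>_def)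
  finally have "real (lg n) \<le> 1 + 8 * real q * ?d" using lg_le_log[OF n] by simp
  also have "\<dots> \<le> (1 + 8 * real q) * ?d" using d1 by (simp add: algebra_simps)
  finally show lgb: "real (lg n) \<le> (1 + 8 * real q) * ?d" .
  have "real (2 ^ (lg n div (4 * q))) = 2 powr real (lg n div (4 * q))" by (simp add: powr_realpow)
  also have "\<dots> \<le> 2 powr (real (lg n) * \<delta>)"
    using of_nat_div_le_of_nat[of "lg n" "4 * q", where 'a = real] by (intro powr_mono) (auto simp: \<delta>_def)
  also have "\<dots> = real (2 ^ lg n) powr \<delta>" by (simp add: powr_powr[symmetric] powr_realpow)
  also have "\<dots> \<le> real (2 * n) powr \<delta>" by (rule powr_mono2[OF _ _ of_nat_mono[OF lg_le[OF n]]]) (use \<delta> in auto)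
  also have "\<dots> = 2 powr \<delta> * ?d" by (simp add: powr_mult)
  also have "\<dots> \<le> 2 * ?d" using powr_mono[of \<delta> 1 2] \<delta> by (intro mult_right_mono) auto
  finally have M: "real (2 ^ (lg n div (4 * q))) \<le> 2 * ?d" .
  have "real (samples q n) = 32 * real (2 ^ (lg n div (4 * q))) * real (lg n)" by (simp add: samples_def)
  also have "\<dots> \<le> 32 * (2 * ?d) * ((1 + 8 * real q) * ?d)"
    using M lgb by (intro mult_mono) auto
  also have "\<dots> = 64 * (1 + 8 * real q) * (?d * ?d)" by simp
  also have "?d * ?d = real n powr (2 * \<delta>)" by (simp flip: powr_add)
  finally show "real (samples q n) \<le> 64 * (1 + 8 * real q) * real n powr (2 * \<delta>)" .
qed

lemma training_le:
  assumes n: "1 \<le> n" and q: "1 \<le> q"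
  shows "real (training q n) \<le> (4 * (1 + 8 * real q) + (64 * (1 + 8 * real q))\<^sup>2) * real n powr (1 / real q)"
proof -
  let ?c = "1 + 8 * real q" and ?s = "samples q n"
  let ?d = "1 / (4 * real q)"
  have ds: "?d \<le> 1 / real q" "2 * ?d + 2 * ?d = 1 / real q" using q by (auto simp: field_simps)
  have "training q n \<le> batch n + ?s * ?s"
  proof (cases "?s = 0")
    case False
    then have "?s * (?s + 1) \<le> 2 * (?s * ?s)" by simp
    then have "?s * (?s + 1) div 2 \<le> 2 * (?s * ?s) div 2" by (rule div_le_mono)
    then show ?thesis by (simp add: training_def)
  qed (simp add: training_def)
  then have "real (training q n) \<le> real (batch n + ?s * ?s)" by (rule of_nat_mono)
  also have "\<dots> = 4 * real (lg n) + real ?s * real ?s" by (simp add: batch_def)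
  also have "\<dots> \<le> 4 * (?c * real n powr ?d) + (64 * ?c * real n powr (2 * ?d)) * (64 * ?c * real n powr (2 * ?d))"
    using samples_le[OF n q] by (intro add_mono mult_mono mult_left_mono) auto
  also have "4 * (?c * real n powr ?d) \<le> 4 * (?c * real n powr (1 / real q))"
    using n ds by (intro mult_left_mono powr_mono) auto
  also have "(64 * ?c * real n powr (2 * ?d)) * (64 * ?c * real n powr (2 * ?d)) =
      (64 * ?c)\<^sup>2 * (real n powr (2 * ?d) * real n powr (2 * ?d))"
    by (simp only: power2_eq_square ac_simps)
  also have "real n powr (2 * ?d) * real n powr (2 * ?d) = real n powr (1 / real q)"
    by (simp only: ds(2) flip: powr_add)
  finally show ?thesis by (simp only: distrib_right mult.assoc add_le_cancel_left)
qed

lemma storage_le: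
  assumes n: "1 \<le> n" and q: "1 \<le> q"
  shows "real (storage (self_sorter q) n) \<le> 40 * (70 * (1 + 8 * real q) + 8) * real n powr (1 + 1 / real q)"
proof -
  let ?c = "1 + 8 * real q" and ?s = "samples q n"
  let ?d = "1 / (4 * real q)" and ?e = "real n powr (1 / real q)"
  have ds: "?d \<le> 1 / real q" "2 * ?d \<le> 1 / real q" using q by (auto simp: field_simps)
  have e1: "1 \<le> ?e" using n by (simp add: ge_one_powr_ge_zero)
  have "word_targets (sorter (4 * q)) \<subseteq> {X, LA, CN, SA, PN, QN} \<union> Sc ` {..<30}"
    unfolding sorter_def stationary_def by (simp add: targets)
  then have "card (word_targets (sorter (4 * q))) \<le> card ({X, LA, CN, SA, PN, QN} \<union> Sc ` {..<30})"
    by (rule card_mono[rotated]) simp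
  also have "\<dots> \<le> card {X, LA, CN, SA, PN, QN} + card (Sc ` {..<30})" by (rule card_Un_le)
  also have "\<dots> \<le> 6 + 30"
    by (intro add_mono order_trans[OF card_image_le]) (auto simp: card_insert_if)
  finally have 1: "card (word_targets (sorter (4 * q))) \<le> 36" by simp
  have "real_targets (sorter (4 * q)) = {LA}"
    unfolding sorter_def stationary_def by (simp add: targets)
  then have "storage (self_sorter q) n \<le> capacity (self_sorter q) n * 40"
    unfolding storage_def using 1 by (intro mult_left_mono) (simp_all add: self_sorter_def)
  then have "real (storage (self_sorter q) n) \<le> real (capacity (self_sorter q) n * 40)" by (rule of_nat_mono)
  also have "\<dots> = 40 * (real n * (4 * real (lg n)) + real n * real ?s + 4 * real n + 4)"
    by (simp add: self_sorter_def batch_def)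
  also have "\<dots> \<le> 40 * (real n * (4 * (?c * ?e)) + real n * (64 * ?c * ?e) + 4 * (real n * ?e) + 4 * (real n * ?e))"
  proof (intro mult_left_mono add_mono)
    have "real n powr ?d \<le> ?e" using n ds by (intro powr_mono) auto
    then have "?c * real n powr ?d \<le> ?c * ?e" by (rule mult_left_mono) simp
    then show "real (lg n) \<le> ?c * ?e" using samples_le(1)[OF n q] by linarith
    have "real n powr (2 * ?d) \<le> ?e" using n ds by (intro powr_mono) auto
    then have "64 * ?c * real n powr (2 * ?d) \<le> 64 * ?c * ?e" by (rule mult_left_mono) simp
    then show "real ?s \<le> 64 * ?c * ?e" using samples_le(2)[OF n q] by linarith
    show "real n \<le> real n * ?e" using e1 n by simp
    then show "4 \<le> 4 * (real n * ?e)" using n by linarith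
  qed auto
  also have "\<dots> = 40 * (68 * ?c + 8) * (real n * ?e)" by (simp add: algebra_simps)
  also have "real n * ?e = real n powr (1 + 1 / real q)" using n by (simp add: powr_add)
  also have "40 * (68 * ?c + 8) * real n powr (1 + 1 / real q) \<le> 40 * (70 * ?c + 8) * real n powr (1 + 1 / real q)"
    by (intro mult_right_mono) auto
  finally show ?thesis .
qed

section \<open>Measurability of the running time\<close>

text \<open>A run depends on the real numbers in memory only through their comparisons.\<close>

lemma exec_order:
  assumes "exec n c m P s t s'"
    and R: "\<And>a b c d. (a, b) \<in> R \<Longrightarrow> (c, d) \<in> R \<Longrightarrow> a \<le> c \<longleftrightarrow> b \<le> d"
    and "words u = words s" "\<And>a i. (reals s a i, reals u a i) \<in> R"
  shows "\<exists>u'. exec n c m P u t u' \<and> words u' = words s' \<and> (\<forall>a i. (reals s' a i, reals u' a i) \<in> R)"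
proof -
  have wv: "wval n c u e = wval n c s e" if "words u = words s" for u s :: mem and e
    using that by (induction e) auto
  have bv: "bval n c u b \<longleftrightarrow> bval n c s b"
    if "words u = words s" "\<And>a i. (reals s a i, reals u a i) \<in> R" for u s :: mem and b
  proof (induction b)
    case (RLe a e b f)
    show ?case using R[OF that(2)[of a "wval n c s e"] that(2)[of b "wval n c s f"]] by (simp add: wv[OF that(1)])
  qed (simp_all add: wv[OF that(1)])
  show ?thesis
    using assms(1,3,4)
  proof (induction arbitrary: u rule: exec.induct)
    case (Skip s)
    then show ?case by (blast intro: exec.Skip)
  next
    case (WSet s e a f)
    let ?u = "u\<lparr>words := (words u)(a := (words u a)(wval n c u e := wval n c u f))\<rparr>"
    note w = wv[OF WSet.prems(1)]
    have "exec n c m (WSet a e f) u (1 + wcost e + wcost f) ?u"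
      by (rule exec.WSet) (simp add: w WSet.hyps)
    moreover have "words ?u = (words s)(a := (words s a)(wval n c s e := wval n c s f))"
      by (simp add: w WSet.prems(1))
    ultimately show ?case using WSet.prems(2) by (intro exI[of _ ?u]) simp
  next
    case (RCopy s e a b f)
    let ?u = "u\<lparr>reals := (reals u)(a := (reals u a)(wval n c u e := reals u b (wval n c u f)))\<rparr>"
    note w = wv[OF RCopy.prems(1)]
    have "exec n c m (RCopy a e b f) u (1 + wcost e + wcost f) ?u"
      by (rule exec.RCopy) (simp add: w RCopy.hyps)
    moreover have "(reals (s\<lparr>reals := (reals s)(a := (reals s a)(wval n c s e := reals s b (wval n c s f)))\<rparr>) a' i,
        reals ?u a' i) \<in> R" for a' i
      using RCopy.prems(2) by (simp add: w)
    ultimately show ?case using RCopy.prems(1) by (intro exI[of _ ?u]) simp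
  next
    case (Seq P s t s' Q v s'')
    from Seq.IH(1)[OF Seq.prems] obtain u' where u': "exec n c m P u t u'" "words u' = words s'"
      "\<And>a i. (reals s' a i, reals u' a i) \<in> R" by blast
    from Seq.IH(2)[OF u'(2,3)] obtain u'' where "exec n c m Q u' v u''" "words u'' = words s''"
      "\<forall>a i. (reals s'' a i, reals u'' a i) \<in> R" by blast
    with exec.Seq[OF u'(1)] show ?case by blast
  next
    case (IfTrue s b P t s' Q)
    have "bval n c u b" using IfTrue.hyps(1) bv[OF IfTrue.prems] by simp
    then show ?case using IfTrue.IH[OF IfTrue.prems] exec.IfTrue by blast
  next
    case (IfFalse s b Q t s' P)
    have "\<not> bval n c u b" using IfFalse.hyps(1) bv[OF IfFalse.prems] by simp
    then show ?case using IfFalse.IH[OF IfFalse.prems] exec.IfFalse by blast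
  next
    case (WhileFalse s b P)
    have "\<not> bval n c u b" using WhileFalse.hyps(1) bv[OF WhileFalse.prems] by simp
    then show ?case using WhileFalse.prems by (blast intro: exec.WhileFalse)
  next
    case (WhileTrue s b P t s' v s'')
    have "bval n c u b" using WhileTrue.hyps(1) bv[OF WhileTrue.prems] by simp
    moreover obtain u' where u': "exec n c m P u t u'" "words u' = words s'" "\<And>a i. (reals s' a i, reals u' a i) \<in> R"
      using WhileTrue.IH(1)[OF WhileTrue.prems] by blast
    moreover obtain u'' where "exec n c m (While b P) u' v u''" "words u'' = words s''"
      "\<forall>a i. (reals s'' a i, reals u'' a i) \<in> R"
      using WhileTrue.IH(2)[OF u'(2,3)] by blast
    ultimately show ?case using exec.WhileTrue by blast
  qed
qed

text \<open>Reals are copied and never computed. Hence the persistent memory contains only finitely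
  many of them, each 0 or taken from an earlier input.\<close>

lemma exec_reals: "exec n c m P s t s' \<Longrightarrow> \<exists>b j. reals s' a i = reals s b j"
proof (induction arbitrary: a i rule: exec.induct)
  case (RCopy s e a' b f)
  show ?case
  proof (cases "a = a' \<and> i = wval n c s e")
    case True
    then have "reals (s\<lparr>reals := (reals s)(a' := (reals s a')(wval n c s e := reals s b (wval n c s f)))\<rparr>) a i =
      reals s b (wval n c s f)" by simp
    then show ?thesis by blast
  next
    case False
    then have "reals (s\<lparr>reals := (reals s)(a' := (reals s a')(wval n c s e := reals s b (wval n c s f)))\<rparr>) a i =
      reals s a i" by auto
    then show ?thesis by blast
  qed
next
  case (Seq P s t s' Q u s'')
  then show ?case by metis
next
  case (WhileTrue s b P t s' u s'')
  then show ?case by metis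
qed auto

text \<open>The truth values of the predicates cut the space into finitely many measurable atoms
  \<open>E q\<close>, and \<open>f\<close> is constant on each.\<close>

lemma measurable_finite_predicates:
  assumes K: "finite K" and P: "\<And>k. k \<in> K \<Longrightarrow> {x \<in> space M. P k x} \<in> sets M"
    and f: "\<And>x y. x \<in> space M \<Longrightarrow> y \<in> space M \<Longrightarrow> (\<And>k. k \<in> K \<Longrightarrow> P k x = P k y) \<Longrightarrow> f x = f y"
  shows "f \<in> M \<rightarrow>\<^sub>M count_space UNIV"
proof -
  define E where "E q = {x \<in> space M. \<forall>k\<in>K. P k x \<longleftrightarrow> k \<in> q}" for q
  have E: "E q \<in> sets M" for q
    unfolding E_def
  proof (rule sets.sets_Collect_finite_All[OF _ K])
    fix k assume k: "k \<in> K"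
    show "{x \<in> space M. P k x \<longleftrightarrow> k \<in> q} \<in> sets M"
      using P[OF k] sets.sets_Collect_neg[OF P[OF k]] by (cases "k \<in> q") simp_all
  qed
  have "f -` A \<inter> space M \<in> sets M" for A
  proof -
    have "f -` A \<inter> space M = (\<Union>q\<in>{q. q \<subseteq> K \<and> (\<exists>x\<in>E q. f x \<in> A)}. E q)" (is "?l = ?r")
    proof (rule equalityI; rule subsetI)
      fix x assume x: "x \<in> ?l"
      have "x \<in> E {k \<in> K. P k x}" using x by (simp add: E_def)
      moreover from this x have "{k \<in> K. P k x} \<in> {q. q \<subseteq> K \<and> (\<exists>x\<in>E q. f x \<in> A)}" by auto
      ultimately show "x \<in> ?r" by (rule UN_I[rotated])
    next
      fix x assume "x \<in> ?r"
      then obtain q y where q: "x \<in> E q" "y \<in> E q" "f y \<in> A" by blast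
      have "f x = f y" by (rule f) (use q in \<open>simp_all add: E_def\<close>)
      then show "x \<in> ?l" using q by (simp add: E_def)
    qed
    also have "\<dots> \<in> sets M" by (rule sets.finite_UN) (use K E in auto)
    finally show ?thesis .
  qed
  then show ?thesis by (intro measurableI) auto
qed

lemma component_measurable:
  assumes "coordinate_laws n D" "i < n"
  shows "(\<lambda>x. x i) \<in> borel_measurable (input_law n D)"
proof -
  have "(\<lambda>x. x i) \<in> input_law n D \<rightarrow>\<^sub>M D i"
    unfolding input_law_def using assms(2) by (intro measurable_component_singleton) auto
  then show ?thesis
    using assms by (simp add: coordinate_laws_def cong: measurable_cong_sets)
qed

text \<open>By \<open>exec_order\<close>, a run depends on \<open>x\<close> only through the
  comparisons among its entries and the finitely many reals in \<open>p\<close>. \<open>Z\<close> is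
  a finite set of names for these values, and every comparison of two of them is a measurable
  predicate.\<close>

lemma run_time_measurable:
  assumes D: "coordinate_laws n D" and fin: "finite (\<Union>a. range (reals p a))"
    and runs: "\<And>x. \<exists>s. runs A n p x (run_time A n p x) s"
  shows "run_time A n p \<in> input_law n D \<rightarrow>\<^sub>M count_space UNIV"
proof -
  define V where "V = insert 0 (\<Union>a. range (reals p a))"
  define Z where "Z = Inl ` {..<n} \<union> Inr ` V"
  define ev where "ev x z = (case z of Inl i \<Rightarrow> x i | Inr v \<Rightarrow> v)" for x :: "nat \<Rightarrow> real" and z :: "nat + real"
  have ev: "(\<lambda>x. ev x z) \<in> borel_measurable (input_law n D)" if "z \<in> Z" for z
    using that component_measurable[OF D] by (auto simp: Z_def ev_def)
  show ?thesis
  proof (rule measurable_finite_predicates[where K = "Z \<times> Z" and P = "\<lambda>(z, w) x. ev x z \<le> ev x w"])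
    show "finite (Z \<times> Z)" using fin by (simp add: Z_def V_def)
  next
    fix k assume "k \<in> Z \<times> Z"
    then show "{x \<in> space (input_law n D). (\<lambda>(z, w) x. ev x z \<le> ev x w) k x} \<in> sets (input_law n D)"
      using ev by (auto intro!: borel_measurable_le)
  next
    fix x y :: "nat \<Rightarrow> real"
    assume eq: "\<And>k. k \<in> Z \<times> Z \<Longrightarrow> (\<lambda>(z, w) x. ev x z \<le> ev x w) k x = (\<lambda>(z, w) x. ev x z \<le> ev x w) k y"
    define R where "R = (\<lambda>z. (ev x z, ev y z)) ` Z"
    obtain s where s: "runs A n p x (run_time A n p x) s" using runs by blast
    have mem: "(reals (load n x p) a i, reals (load n y p) a i) \<in> R" for a i
    proof -
      have "0 \<in> V" "reals p a i \<in> V" by (auto simp: V_def)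
      then have "Inr 0 \<in> Z" "Inr (reals p a i) \<in> Z" "i < n \<Longrightarrow> Inl i \<in> Z" by (auto simp: Z_def)
      then have "(ev x (Inr 0), ev y (Inr 0)) \<in> R" "(ev x (Inr (reals p a i)), ev y (Inr (reals p a i))) \<in> R"
         "i < n \<Longrightarrow> (ev x (Inl i), ev y (Inl i)) \<in> R" unfolding R_def by blast+
      then show ?thesis by (simp add: load_def ev_def)
    qed
    have "\<exists>u'. exec n (word_const A) (capacity A n) (code A) (load n y p) (run_time A n p x) u' \<and>
       words u' = words s \<and> (\<forall>a i. (reals s a i, reals u' a i) \<in> R)"
    proof (rule exec_order)
      show "exec n (word_const A) (capacity A n) (code A) (load n x p) (run_time A n p x) s"
        using s by (simp add: runs_def)
      show "a \<le> c \<longleftrightarrow> b \<le> d" if "(a, b) \<in> R" "(c, d) \<in> R" for a b c d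
        using that eq unfolding R_def by fastforce
    qed (use mem in simp_all)
    then show "run_time A n p x = run_time A n p y" using runs_eqs(1) by metis
  qed
qed

lemma finite_reals_store:
  assumes n: "1 \<le> n"
  shows "finite (\<Union>a. range (reals (store (self_sorter q) n I r) a))"
proof -
  have "(\<Union>a. range (reals (store (self_sorter q) n I r) a)) \<subseteq> insert 0 ((\<lambda>(r, i). I r i) ` ({..<r} \<times> {..<n}))"
  proof (induction r)
    case 0
    then show ?case by (auto simp: blank_def)
  next
    case (Suc r)
    let ?p = "store (self_sorter q) n I r"
    obtain s where s: "runs (self_sorter q) n ?p (I r) (run_time (self_sorter q) n ?p (I r)) s"
      using self_sorter_run(1)[OF n] by blast
    then have e: "exec n (word_const (self_sorter q)) (capacity (self_sorter q) n) (code (self_sorter q))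
      (load n (I r) ?p) (run_time (self_sorter q) n ?p (I r)) s" by (simp add: runs_def)
    have "run_result (self_sorter q) n ?p (I r) = s" by (rule runs_eqs(2)[OF e])
    then have st: "store (self_sorter q) n I (Suc r) = retain s" by simp
    show ?case
      unfolding st
    proof (rule subsetI)
      fix v assume "v \<in> (\<Union>a. range (reals (retain s) a))"
      then obtain a i where v: "v = reals (retain s) a i" by blast
      show "v \<in> insert 0 ((\<lambda>(r, i). I r i) ` ({..<Suc r} \<times> {..<n}))"
      proof (cases "a \<in> range Persistent")
        case True
        then have "v = reals s a i" using v by auto
        then obtain b j where v': "v = reals (load n (I r) ?p) b j" using exec_reals[OF e] by metis
        show ?thesis
        proof (cases "b = X")
          case True
          then show ?thesis using v' by auto
        next
          case False
          then have "v = reals ?p b j" using v' by (simp add: load_def)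
          then have "v \<in> insert 0 ((\<lambda>(r, i). I r i) ` ({..<r} \<times> {..<n}))" using Suc by blast
          then show ?thesis by auto
        qed
      qed (use v in \<open>simp add: retain_def\<close>)
    qed
  qed
  then show ?thesis by (rule finite_subset) simp
qed

section \<open>Quantiles\<close>

text \<open>The expected number of coordinates in \<open>I\<close> whose key lies in
  \<open>A\<close>. The total is \<open>card I\<close>, not 1.\<close>

definition mass :: "(nat \<Rightarrow> real measure) \<Rightarrow> nat set \<Rightarrow> key set \<Rightarrow> real" where
  "mass D I A = (\<Sum>i\<in>I. measure (D i) {v. Key v i \<in> A})"

definition key_measurable :: "key set \<Rightarrow> bool" where
  "key_measurable A \<longleftrightarrow> (\<forall>i. {v. Key v i \<in> A} \<in> sets borel)"

lemma key_measurable_intros [simp, intro]: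
  "key_measurable {..k}" "key_measurable {..<k}" "key_measurable {k..}" "key_measurable {k<..}"
  "key_measurable {k..l}" "key_measurable {k<..<l}" "key_measurable {k..<l}" "key_measurable UNIV"
  "key_measurable A \<Longrightarrow> key_measurable B \<Longrightarrow> key_measurable (A \<inter> B)"
proof -
  have le: "{v. Key v i \<le> k} \<in> sets borel" for i k
  proof -
    have "{v. Key v i \<le> k} = (if i \<le> kidx k then {..kval k} else {..<kval k})"
      by (cases k) (auto simp: Key_le)
    then show ?thesis by simp
  qed
  have lt: "{v. Key v i < k} \<in> sets borel" for i k
  proof -
    have "{v. Key v i < k} = (if i < kidx k then {..kval k} else {..<kval k})"
      by (cases k) (auto simp: Key_less)
    then show ?thesis by simp
  qed
  have ge: "{v. k \<le> Key v i} \<in> sets borel" for i k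
  proof -
    have "{v. k \<le> Key v i} = - {v. Key v i < k}" by auto
    then show ?thesis using lt by simp
  qed
  have gt: "{v. k < Key v i} \<in> sets borel" for i k
  proof -
    have "{v. k < Key v i} = - {v. Key v i \<le> k}" by auto
    then show ?thesis using le by simp
  qed
  have b: "key_measurable {..k}" "key_measurable {..<k}" "key_measurable {k..}" "key_measurable {k<..}"
    "key_measurable UNIV" for k
    using le lt ge gt by (simp_all add: key_measurable_def)
  show Int: "key_measurable (A \<inter> B)" if "key_measurable A" "key_measurable B" for A B
  proof -
    have "{v. Key v i \<in> A \<inter> B} = {v. Key v i \<in> A} \<inter> {v. Key v i \<in> B}" for i by auto
    then show ?thesis using that by (simp add: key_measurable_def)
  qed
  have "{k..l} = {k..} \<inter> {..l}" "{k<..<l} = {k<..} \<inter> {..<l}" "{k..<l} = {k..} \<inter> {..<l}" by auto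
  then show "key_measurable {k..l}" "key_measurable {k<..<l}" "key_measurable {k..<l}"
    by (simp_all only: Int b)
  show "key_measurable {..k}" "key_measurable {..<k}" "key_measurable {k..}" "key_measurable {k<..}"
    "key_measurable UNIV" by (rule b)+
qed

context
  fixes D :: "nat \<Rightarrow> real measure" and I :: "nat set"
  assumes I: "finite I" and D: "\<And>i. i \<in> I \<Longrightarrow> prob_space (D i)" "\<And>i. i \<in> I \<Longrightarrow> sets (D i) = sets borel"
begin

lemma real_dist: "i \<in> I \<Longrightarrow> real_distribution (D i)"
  using D by (simp add: real_distribution_def real_distribution_axioms_def sets_eq_imp_space_eq)

lemma mass_mono: "A \<subseteq> B \<Longrightarrow> key_measurable B \<Longrightarrow> mass D I A \<le> mass D I B"
  unfolding mass_def
proof (rule sum_mono)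
  fix i assume i: "i \<in> I" and AB: "A \<subseteq> B" "key_measurable B"
  interpret prob_space "D i" using D i by simp
  show "measure (D i) {v. Key v i \<in> A} \<le> measure (D i) {v. Key v i \<in> B}"
    by (rule finite_measure_mono) (use AB i D in \<open>auto simp: key_measurable_def\<close>)
qed

lemma mass_Un:
  assumes "A \<inter> B = {}" "key_measurable A" "key_measurable B"
  shows "mass D I (A \<union> B) = mass D I A + mass D I B"
proof -
  have "measure (D i) {v. Key v i \<in> A \<union> B} = measure (D i) {v. Key v i \<in> A} + measure (D i) {v. Key v i \<in> B}"
    if i: "i \<in> I" for i
  proof -
    interpret prob_space "D i" using D i by simp
    have "{v. Key v i \<in> A \<union> B} = {v. Key v i \<in> A} \<union> {v. Key v i \<in> B}" by auto
    then show ?thesis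
      by (simp only:) (rule finite_measure_Union, use assms i D in \<open>auto simp: key_measurable_def\<close>)
  qed
  then show ?thesis by (simp add: mass_def sum.distrib)
qed

lemma mass_UNIV: "mass D I UNIV = real (card I)"
proof -
  have "measure (D i) UNIV = 1" if "i \<in> I" for i
    using prob_space.prob_space[OF D(1)[OF that]] sets_eq_imp_space_eq[OF D(2)[OF that]] by simp
  then show ?thesis by (simp add: mass_def)
qed

lemma mass_interval:
  assumes "k \<le> l"
  shows "mass D I {k..l} = mass D I {..l} - mass D I {..<k}"
proof -
  have "{..l} = {..<k} \<union> {k..l}" using assms by auto
  then show ?thesis using mass_Un[of "{..<k}" "{k..l}"] by (simp add: ivl_disj_int)
qed

text \<open>Keys lack infima in general: those with positive real part are bounded below without a
  greatest lower bound. The quantile is found in two stages, first the real \<open>w\<close> from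
  the sum of the distribution functions, then the least index \<open>j\<close> at which the level is
  reached over \<open>w\<close>.\<close>

lemma quantile:
  assumes t: "0 < t" "t < real (card I)"
  shows "\<exists>k. t \<le> mass D I {..k} \<and> mass D I {..<k} \<le> t"
proof -
  define G where "G v = (\<Sum>i\<in>I. cdf (D i) v)" for v
  have G: "G v = (\<Sum>i\<in>I. measure (D i) {..v})" for v by (simp add: G_def cdf_def)
  define X where "X = {v. t \<le> G v}"
  have top: "(G \<longlongrightarrow> real (card I)) at_top"
  proof -
    have "(G \<longlongrightarrow> (\<Sum>i\<in>I. 1)) at_top"
      unfolding G_def by (intro tendsto_sum real_distribution.cdf_lim_at_top_prob real_dist)
    then show ?thesis by simp
  qed
  have bot: "(G \<longlongrightarrow> 0) at_bot"
  proof -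
    have "(G \<longlongrightarrow> (\<Sum>i\<in>I. 0)) at_bot"
      unfolding G_def
      by (intro tendsto_sum finite_borel_measure.cdf_lim_at_bot real_distribution.finite_borel_measure_M real_dist)
    then show ?thesis by simp
  qed
  have mono: "G v \<le> G w" if "v \<le> w" for v w
    unfolding G_def
    by (intro sum_mono finite_borel_measure.cdf_nondecreasing real_distribution.finite_borel_measure_M real_dist that)
  have "eventually (\<lambda>v. t < G v) at_top" by (rule order_tendstoD(1)[OF top t(2)])
  then have ne: "X \<noteq> {}" unfolding X_def by (auto simp: eventually_at_top_linorder intro: less_imp_le)
  have "eventually (\<lambda>v. G v < t) at_bot" by (rule order_tendstoD(2)[OF bot t(1)])
  then obtain b where b: "\<And>v. v \<le> b \<Longrightarrow> G v < t" by (auto simp: eventually_at_bot_linorder)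
  have bdd: "bdd_below X"
  proof (rule bdd_belowI)
    fix v assume "v \<in> X"
    then show "b \<le> v" using b[of v] by (force simp: X_def)
  qed
  define w where "w = Inf X"
  have above: "t \<le> G v" if "w < v" for v
  proof -
    have "Inf X < v" using that by (simp add: w_def)
    then obtain u where "u \<in> X" "u < v" using cInf_lessD[OF ne] by blast
    then show ?thesis using mono[of u v] by (simp add: X_def)
  qed
  have below: "G v < t" if "v < w" for v
  proof (rule ccontr)
    assume "\<not> G v < t"
    then have "w \<le> v" unfolding w_def by (intro cInf_lower bdd) (simp add: X_def)
    then show False using that by simp
  qed
  have Gw: "t \<le> G w"
  proof (rule tendsto_lowerbound)
    show "(G \<longlongrightarrow> G w) (at_right w)"
      unfolding G_def
      by (intro tendsto_sum finite_borel_measure.cdf_is_right_cont[unfolded continuous_within]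
          real_distribution.finite_borel_measure_M real_dist)
    show "eventually (\<lambda>v. t \<le> G v) (at_right w)"
      using above by (auto simp: eventually_at_right_field intro!: exI[of _ "w + 1"])
  qed simp
  have Gl: "(\<Sum>i\<in>I. measure (D i) {..<w}) \<le> t"
  proof (rule tendsto_upperbound)
    show "(G \<longlongrightarrow> (\<Sum>i\<in>I. measure (D i) {..<w})) (at_left w)"
      unfolding G_def
      by (intro tendsto_sum finite_borel_measure.cdf_at_left real_distribution.finite_borel_measure_M real_dist)
    show "eventually (\<lambda>v. G v \<le> t) (at_left w)"
      using below by (auto simp: eventually_at_left_field intro!: exI[of _ "w - 1"] less_imp_le)
  qed simp
  define P where "P j \<longleftrightarrow> t \<le> mass D I {..Key w j}" for j
  have "\<exists>j. P j"
  proof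
    \<comment> \<open>An index at or beyond all of \<open>I\<close> admits the atom at
      \<open>w\<close> for every coordinate.\<close>
    have "{v. Key v i \<in> {..Key w (Max (insert 0 I))}} = {..w}" if "i \<in> I" for i
      using that I by (auto simp: Key_le)
    then show "P (Max (insert 0 I))" unfolding P_def mass_def using Gw by (simp add: G)
  qed
  then have j: "P (LEAST j. P j)" by (rule LeastI_ex)
  define j where "j = (LEAST j. P j)"
  have "mass D I {..<Key w j} \<le> t"
  proof (cases j)
    case 0
    have "{v. Key v i \<in> {..<Key w 0}} = {..<w}" for i by (auto simp: Key_less)
    then show ?thesis unfolding mass_def 0 using Gl by simp
  next
    case (Suc l)
    have "{..<Key w j} \<subseteq> {..Key w l} \<union> {k. \<exists>v. k = Key v (kidx k) \<and> False}"
    proof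
      fix k assume "k \<in> {..<Key w j}"
      then show "k \<in> {..Key w l} \<union> {k. \<exists>v. k = Key v (kidx k) \<and> False}"
        by (cases k) (auto simp: Key_less Key_le Suc)
    qed
    then have "{..<Key w j} \<subseteq> {..Key w l}" by simp
    then have "mass D I {..<Key w j} \<le> mass D I {..Key w l}" by (rule mass_mono) simp
    moreover have "\<not> P l" by (rule not_less_Least) (use Suc in \<open>simp add: j_def\<close>)
    ultimately show ?thesis by (simp add: P_def)
  qed
  moreover have "t \<le> mass D I {..Key w j}" using j by (simp add: P_def j_def)
  ultimately show ?thesis by (intro exI[of _ "Key w j"] conjI)
qed

text \<open>Between consecutive multiples of \<open>\<delta>\<close>, two quantiles enclose mass at least \<open>\<delta>\<close>;
  the cells are closed, so atoms need no special treatment.\<close>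

lemma cells:
  assumes \<delta>: "0 < \<delta>"
  shows "\<exists>(N :: nat) lo hi. real N * \<delta> \<le> real (card I) \<and>
     (\<forall>j<N. lo j \<le> hi j \<and> \<delta> \<le> mass D I {lo j..hi j}) \<and>
     (\<forall>A. key_measurable A \<longrightarrow> (\<forall>a b c. a \<in> A \<longrightarrow> c \<in> A \<longrightarrow> a \<le> b \<longrightarrow> b \<le> c \<longrightarrow> b \<in> A) \<longrightarrow>
        3 * \<delta> \<le> mass D I A \<longrightarrow> (\<exists>j<N. {lo j..hi j} \<subseteq> A))"
proof -
  let ?W = "real (card I)"
  define Q where "Q j = (SOME k. real j * \<delta> \<le> mass D I {..k} \<and> mass D I {..<k} \<le> real j * \<delta>)" for j :: nat
  have Q: "real j * \<delta> \<le> mass D I {..Q j}" "mass D I {..<Q j} \<le> real j * \<delta>"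
    if "0 < j" "real j * \<delta> < ?W" for j
    using someI_ex[OF quantile[of "real j * \<delta>"]] that \<delta> by (simp_all add: Q_def)
  \<comment> \<open>Cell \<open>j\<close> lies between the quantiles \<open>j + 1\<close> and
    \<open>j + 2\<close>. Quantiles exist for levels strictly between 0 and the total mass, so
    \<open>j + 2\<close> has to stay below \<open>?W / \<delta>\<close>. If
    \<open>?W < 3 * \<delta>\<close>, there is no set to cover.\<close>
  define N where "N = (if ?W < 3 * \<delta> then 0 else nat \<lceil>?W / \<delta>\<rceil> - 2)"
  have N: "real (Suc (Suc j)) * \<delta> < ?W" if "j < N" for j
  proof -
    have "Suc (Suc j) < nat \<lceil>?W / \<delta>\<rceil>" using that by (simp add: N_def split: if_splits)
    then have "real (Suc (Suc j)) < ?W / \<delta>" by linarith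
    then show ?thesis using \<delta> by (simp add: pos_less_divide_eq)
  qed
  have N': "?W \<le> real (j + 2) * \<delta>" if "N \<le> j" "3 * \<delta> \<le> ?W" for j
  proof -
    have "nat \<lceil>?W / \<delta>\<rceil> - 2 \<le> j" using that by (simp add: N_def)
    then have "nat \<lceil>?W / \<delta>\<rceil> \<le> j + 2" by linarith
    then have "real (nat \<lceil>?W / \<delta>\<rceil>) \<le> real (j + 2)" by (rule of_nat_mono)
    then have "?W / \<delta> \<le> real (j + 2)" using real_nat_ceiling_ge[of "?W / \<delta>"] by linarith
    then show ?thesis using \<delta> by (simp add: pos_divide_le_eq)
  qed
  have QQ: "Q (Suc j) \<le> Q (Suc (Suc j)) \<and> \<delta> \<le> mass D I {Q (Suc j)..Q (Suc (Suc j))}" if "j < N" for j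
  proof -
    have w: "real (Suc (Suc j)) * \<delta> < ?W" by (rule N[OF that])
    have w1: "real (Suc j) * \<delta> < real (Suc (Suc j)) * \<delta>" using \<delta> by (intro mult_strict_right_mono) auto
    have 1: "real (Suc (Suc j)) * \<delta> \<le> mass D I {..Q (Suc (Suc j))}" using Q w by blast
    have 2: "mass D I {..<Q (Suc j)} \<le> real (Suc j) * \<delta>" using Q[of "Suc j"] w w1 by simp
    have le: "Q (Suc j) \<le> Q (Suc (Suc j))"
    proof (rule ccontr)
      assume "\<not> Q (Suc j) \<le> Q (Suc (Suc j))"
      then have "mass D I {..Q (Suc (Suc j))} \<le> mass D I {..<Q (Suc j)}" by (intro mass_mono) auto
      then show False using 1 2 w1 by linarith
    qed
    have "\<delta> \<le> mass D I {Q (Suc j)..Q (Suc (Suc j))}"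
      unfolding mass_interval[OF le] using 1 2 by (simp add: algebra_simps)
    with le show ?thesis by simp
  qed
  have cover: "\<exists>j<N. {Q (Suc j)..Q (Suc (Suc j))} \<subseteq> A"
    if A: "key_measurable A" "\<And>a b c. a \<in> A \<Longrightarrow> c \<in> A \<Longrightarrow> a \<le> b \<Longrightarrow> b \<le> c \<Longrightarrow> b \<in> A" "3 * \<delta> \<le> mass D I A" for A
  proof -
    have W3: "3 * \<delta> \<le> ?W" using A(3) mass_mono[of A UNIV] mass_UNIV by simp
    have out: "a < Q j" if "j \<noteq> 0" "a \<in> A" "b \<in> A" "b < Q j" "Q j \<notin> A" for a b j
      using A(2)[of b a "Q j"] A(2)[of b "Q j" a] that by (meson leI less_imp_le)
    \<comment> \<open>\<open>Q k\<close> will be the last quantile strictly below \<open>A\<close>,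
      with 0 in place of minus infinity. If \<open>Q (k + 1)\<close> or \<open>Q (k + 2)\<close>
      were outside the convex set \<open>A\<close>, then \<open>A\<close> would lie between
      \<open>Q k\<close> and that quantile and have mass at most
      \<open>2 * \<delta>\<close>.\<close>
    define below where "below j \<longleftrightarrow> j = 0 \<or> (j \<le> N + 1 \<and> (\<forall>a\<in>A. Q j < a))" for j
    define k where "k = Max {j. below j}"
    have fin: "finite {j. below j}" by (rule finite_subset[of _ "{..N + 1}"]) (auto simp: below_def)
    have "k \<in> {j. below j}" unfolding k_def by (rule Max_in[OF fin]) (auto simp: below_def)
    then have k: "below k" by simp
    have kmax: "\<not> below j" if "k < j" for j using Max_ge[OF fin, of j] that by (auto simp: k_def)
    have lowA: "mass D I A \<le> u - real k * \<delta>" if "A \<subseteq> B" "key_measurable B" "mass D I B \<le> u" "B = {..<Q j} \<or> B = UNIV" for B u j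
    proof (cases "k = 0")
      case True
      then show ?thesis using mass_mono[OF that(1,2)] that(3) by simp
    next
      case False
      then have kb: "k \<le> N + 1" "\<forall>a\<in>A. Q k < a" using k by (auto simp: below_def)
      have "real k * \<delta> < ?W"
      proof (cases "N = 0")
        case True
        then have "k \<le> 1" using kb by simp
        then have "real k * \<delta> \<le> 1 * \<delta>" using \<delta> by (intro mult_right_mono) auto
        then show ?thesis using W3 \<delta> by linarith
      next
        case False
        then have "real (Suc (Suc (N - 1))) * \<delta> < ?W" by (intro N) simp
        moreover have "real k * \<delta> \<le> real (Suc (Suc (N - 1))) * \<delta>" using kb False \<delta> by (intro mult_right_mono) auto
        ultimately show ?thesis by linarith
      qed
      then have "real k * \<delta> \<le> mass D I {..Q k}" using Q False by simp
      moreover have "mass D I ({..Q k} \<union> A) = mass D I {..Q k} + mass D I A"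
        using kb A(1) by (intro mass_Un) force+
      moreover have "{..Q k} \<union> A \<subseteq> B"
      proof -
        obtain a where a: "a \<in> A"
        proof (cases "A = {}")
          case True
          then have "mass D I A = 0" by (simp add: mass_def)
          then show ?thesis using A(3) \<delta> by simp
        qed auto
        then have "Q k < a" "a \<in> B" using kb that(1) by auto
        then show ?thesis using that(1,4) by auto
      qed
      ultimately show ?thesis using mass_mono[OF _ that(2), of "{..Q k} \<union> A"] that(3) by linarith
    qed
    have kN: "k < N"
    proof (rule ccontr)
      assume "\<not> k < N"
      then have "?W \<le> real (k + 2) * \<delta>" using W3 by (intro N') auto
      then have "mass D I UNIV \<le> real (k + 2) * \<delta>" by (simp add: mass_UNIV)
      then have "mass D I A \<le> real (k + 2) * \<delta> - real k * \<delta>" by (intro lowA[of UNIV]) auto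
      then show False using A(3) \<delta> by (simp add: algebra_simps)
    qed
    have inA: "Q (k + l) \<in> A" if l: "l = 1 \<or> l = 2" for l
    proof (rule ccontr)
      assume nA: "Q (k + l) \<notin> A"
      have "\<not> below (k + l)" using kmax l by auto
      moreover have "k + l \<le> N + 1" using kN l by auto
      ultimately obtain b where "b \<in> A" "\<not> Q (k + l) < b" using l by (auto simp: below_def)
      then have b: "b \<in> A" "b < Q (k + l)" using nA by (auto simp: not_less order.order_iff_strict)
      have sub: "A \<subseteq> {..<Q (k + l)}" using out[OF _ _ b nA] l by auto
      have "real (Suc (Suc k)) * \<delta> < ?W" by (rule N[OF kN])
      moreover have le2: "real (k + l) * \<delta> \<le> real (k + 2) * \<delta>" using l \<delta> by (intro mult_right_mono) auto
      ultimately have "mass D I {..<Q (k + l)} \<le> real (k + l) * \<delta>" using l by (intro Q) auto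
      then have "mass D I A \<le> real (k + l) * \<delta> - real k * \<delta>" using sub by (intro lowA) auto
      moreover have "real (k + 2) * \<delta> - real k * \<delta> = 2 * \<delta>" by (simp add: algebra_simps)
      ultimately show False using A(3) \<delta> le2 by linarith
    qed
    have "Q (Suc k) \<in> A" "Q (Suc (Suc k)) \<in> A"
      using inA[of 1] inA[of 2] by (simp_all only: numeral_2_eq_2 One_nat_def add_Suc_right add_0_right simp_thms)
    then have "{Q (Suc k)..Q (Suc (Suc k))} \<subseteq> A"
      by (intro subsetI) (rule A(2)[of "Q (Suc k)" "Q (Suc (Suc k))"], simp_all)
    then show ?thesis using kN by blast
  qed
  have "real N * \<delta> \<le> ?W"
  proof (cases "N = 0")
    case False
    then have "real (Suc (Suc (N - 1))) * \<delta> < ?W" by (intro N) simp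
    moreover have "real N * \<delta> \<le> real (Suc (Suc (N - 1))) * \<delta>" using False \<delta> by (intro mult_right_mono) auto
    ultimately show ?thesis by linarith
  qed simp
  then have 1: "real N * \<delta> \<le> ?W" .
  have 2: "Q (Suc j) \<le> Q (Suc (Suc j))" "\<delta> \<le> mass D I {Q (Suc j)..Q (Suc (Suc j))}" if "j < N" for j
    using QQ[OF that] by simp_all
  have 3: "\<exists>j<N. {Q (Suc j)..Q (Suc (Suc j))} \<subseteq> A" if "key_measurable A"
    "\<forall>a b c. a \<in> A \<longrightarrow> c \<in> A \<longrightarrow> a \<le> b \<longrightarrow> b \<le> c \<longrightarrow> b \<in> A" "3 * \<delta> \<le> mass D I A" for A
    by (rule cover[OF that(1) that(2)[rule_format] that(3)])
  show ?thesis
  proof (rule exI[of _ N], rule exI[of _ "\<lambda>j. Q (Suc j)"], rule exI[of _ "\<lambda>j. Q (Suc (Suc j))"], intro conjI allI impI)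
  qed (rule 1 2 3; assumption)+
qed

end

declare One_nat_def [simp]

section \<open>The entropy lower bound\<close>

text \<open>The sum of \<open>ln x \<le> x - 1\<close> at \<open>x = Q / P\<close>, weighted by
  \<open>P\<close>. Only \<open>sum Q \<le> sum P\<close> is asked for, because both applications,
  Kraft weights and a reweighted joint law, have total weight at most 1.\<close>

lemma gibbs:
  fixes P Q :: "'a \<Rightarrow> real"
  assumes P: "\<And>x. x \<in> S \<Longrightarrow> 0 \<le> P x" and Q: "\<And>x. x \<in> S \<Longrightarrow> 0 \<le> Q x"
    and pos: "\<And>x. x \<in> S \<Longrightarrow> 0 < P x \<Longrightarrow> 0 < Q x" and le: "sum Q S \<le> sum P S"
  shows "(\<Sum>x\<in>S. P x * log 2 (Q x / P x)) \<le> 0"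
proof -
  have "(\<Sum>x\<in>S. P x * log 2 (Q x / P x)) \<le> (\<Sum>x\<in>S. (Q x - P x) / ln 2)"
  proof (rule sum_mono)
    fix x assume x: "x \<in> S"
    show "P x * log 2 (Q x / P x) \<le> (Q x - P x) / ln 2"
    proof (cases "P x = 0")
      case True
      then show ?thesis using Q[OF x] by simp
    next
      case False
      then have p: "0 < P x" "0 < Q x" using P[OF x] pos[OF x] by auto
      then have "P x * ln (Q x / P x) \<le> P x * (Q x / P x - 1)"
        by (intro mult_left_mono ln_le_minus_one) auto
      also have "\<dots> = Q x - P x" using p by (simp add: field_simps)
      finally show ?thesis by (simp add: log_def divide_right_mono)
    qed
  qed
  also have "\<dots> = (sum Q S - sum P S) / ln 2"
    by (simp add: sum_subtractf sum_divide_distrib[symmetric])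
  also have "\<dots> \<le> 0" using le by (simp add: divide_le_0_iff)
  finally show ?thesis .
qed

text \<open>Trees may be infinite and labels may repeat, so one witness input \<open>I v\<close> is
  fixed for each value, and the induction is on a common bound of the witness depths. At the root
  the witnesses split between the two subtrees, where every depth is smaller by one.\<close>

lemma kraft:
  assumes "finite S" "\<And>v. v \<in> S \<Longrightarrow> reaches t (I v) v (d v)"
  shows "(\<Sum>v\<in>S. (1 / 2 :: real) ^ d v) \<le> 1"
proof -
  obtain N where "\<And>v. v \<in> S \<Longrightarrow> d v \<le> N"
    using assms(1) by (meson Max_ge finite_imageI image_eqI)
  with assms show ?thesis
  proof (induction N arbitrary: S t d)
    case (0 S t d)
    show ?case
    proof (cases t)
      case (Leaf w)
      have "S \<subseteq> {w}" using 0 Leaf by (auto elim: LeafE)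
      then show ?thesis using 0 by (cases "S = {}") (auto simp: subset_singleton_iff)
    next
      case (Test f g l r)
      have "S = {}" using 0 Test by (force elim: TestE)
      then show ?thesis by simp
    qed
  next
    case (Suc N S t d)
    show ?case
    proof (cases t)
      case (Leaf w)
      have "S \<subseteq> {w}" "\<And>v. v \<in> S \<Longrightarrow> d v = 0" using Suc.prems Leaf by (auto elim: LeafE)
      then show ?thesis by (cases "S = {}") (auto simp: subset_singleton_iff)
    next
      case (Test f g l r)
      define Sl where "Sl = {v \<in> S. f (I v) \<le> g (I v)}"
      define Sr where "Sr = {v \<in> S. \<not> f (I v) \<le> g (I v)}"
      have l: "reaches l (I v) v (d v - 1) \<and> 0 < d v" if "v \<in> Sl" for v
        using Suc.prems(2)[of v] that unfolding Test Sl_def by (auto elim: TestE)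
      have r: "reaches r (I v) v (d v - 1) \<and> 0 < d v" if "v \<in> Sr" for v
        using Suc.prems(2)[of v] that unfolding Test Sr_def by (auto elim: TestE)
      have half: "(1 / 2 :: real) ^ d v = (1 / 2) ^ (d v - 1) / 2" if "v \<in> Sl \<or> v \<in> Sr" for v
        using l[of v] r[of v] that by (cases "d v") auto
      have "(\<Sum>v\<in>Sl. (1 / 2 :: real) ^ (d v - 1)) \<le> 1"
        by (rule Suc.IH) (use Suc.prems l in \<open>auto simp: Sl_def le_diff_conv\<close>)
      moreover have "(\<Sum>v\<in>Sr. (1 / 2 :: real) ^ (d v - 1)) \<le> 1"
        by (rule Suc.IH) (use Suc.prems r in \<open>auto simp: Sr_def le_diff_conv\<close>)
      moreover have "(\<Sum>v\<in>S. (1 / 2 :: real) ^ d v) = (\<Sum>v\<in>Sl. (1 / 2) ^ d v) + (\<Sum>v\<in>Sr. (1 / 2) ^ d v)"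
        using Suc.prems(1) by (subst sum.union_disjoint[symmetric]) (auto simp: Sl_def Sr_def intro: sum.cong)
      moreover have "(\<Sum>v\<in>Sl. (1 / 2 :: real) ^ d v) = (\<Sum>v\<in>Sl. (1 / 2) ^ (d v - 1)) / 2"
        unfolding sum_divide_distrib by (rule sum.cong) (use half in auto)
      moreover have "(\<Sum>v\<in>Sr. (1 / 2 :: real) ^ d v) = (\<Sum>v\<in>Sr. (1 / 2) ^ (d v - 1)) / 2"
        unfolding sum_divide_distrib by (rule sum.cong) (use half in auto)
      ultimately show ?thesis by linarith
    qed
  qed
qed

lemma (in prob_space) expectation_finite_range:
  fixes g :: "'b \<Rightarrow> real"
  assumes f: "f \<in> M \<rightarrow>\<^sub>M count_space UNIV" and S: "finite S" "f ` space M \<subseteq> S"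
  shows "integrable M (\<lambda>x. g (f x))"
    "(\<integral>x. g (f x) \<partial>M) = (\<Sum>p\<in>S. g p * prob (f -` {p} \<inter> space M))"
proof -
  have m: "f -` {p} \<inter> space M \<in> events" for p
    using measurable_sets[OF f] by simp
  have eq: "g (f x) = (\<Sum>p\<in>S. g p * indicator (f -` {p} \<inter> space M) x)" if "x \<in> space M" for x
  proof -
    have "(\<Sum>p\<in>S. g p * indicator (f -` {p} \<inter> space M) x) = (\<Sum>p\<in>S. if p = f x then g p else 0)"
      by (rule sum.cong) (use that in auto)
    also have "\<dots> = g (f x)" using S that by (simp add: sum.delta image_subset_iff)
    finally show ?thesis ..
  qed
  have int: "integrable M (\<lambda>x. g p * indicator (f -` {p} \<inter> space M) x)" for p
    using m[of p] by (intro integrable_mult_right integrable_real_indicator) (auto simp: emeasure_eq_measure)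
  show "integrable M (\<lambda>x. g (f x))"
    by (subst Bochner_Integration.integrable_cong[OF refl eq]) (use int in auto)
  have "(\<integral>x. g (f x) \<partial>M) = (\<integral>x. (\<Sum>p\<in>S. g p * indicator (f -` {p} \<inter> space M) x) \<partial>M)"
    by (rule Bochner_Integration.integral_cong[OF refl eq])
  also have "\<dots> = (\<Sum>p\<in>S. \<integral>x. g p * indicator (f -` {p} \<inter> space M) x \<partial>M)"
    by (rule Bochner_Integration.integral_sum) (rule int)
  also have "\<dots> = (\<Sum>p\<in>S. g p * prob (f -` {p} \<inter> space M))"
    by (rule sum.cong) (simp_all add: Int_absorb1)
  finally show "(\<integral>x. g (f x) \<partial>M) = (\<Sum>p\<in>S. g p * prob (f -` {p} \<inter> space M))" .
qed

lemma (in prob_space) sum_prob_range: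
  assumes f: "f \<in> M \<rightarrow>\<^sub>M count_space UNIV" and S: "finite S" "f ` space M \<subseteq> S"
  shows "(\<Sum>p\<in>S. prob (f -` {p} \<inter> space M)) = 1"
  using expectation_finite_range(2)[OF assms, of "\<lambda>_. 1"] by (simp add: prob_space)

text \<open>The depth reached under arbitrary tests need not be measurable. The least depth
  \<open>d p\<close> at which \<open>p\<close> is output depends on the permutation alone, bounds
  the reached depth from below and satisfies Kraft's inequality, so \<open>gibbs\<close> applies to
  the weights \<open>(1 / 2) ^ d p\<close>.\<close>

lemma entropy_le_expected_depth:
  assumes D: "coordinate_laws n D" and t: "computes t (space (input_law n D)) (rank_perm n)"
  shows "ennreal (perm_entropy n D) \<le> expected_depth (input_law n D) t"
proof -
  define M where "M = input_law n D"
  interpret prob_space M unfolding M_def using D by (rule prob_space_input_law)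
  define S where "S = rank_perm n ` space M"
  define Pr where "Pr p = prob (rank_perm n -` {p} \<inter> space M)" for p
  have meas: "rank_perm n \<in> M \<rightarrow>\<^sub>M count_space UNIV" unfolding M_def using D by (rule rank_perm_measurable)
  have S: "finite S" "rank_perm n ` space M \<subseteq> S" by (auto simp: S_def finite_range_rank_perm)
  define d where "d p = (LEAST d. \<exists>I\<in>space M. reaches t I p d)" for p
  have reach: "\<exists>I\<in>space M. reaches t I p (d p)" if "p \<in> S" for p
  proof -
    from that t obtain I k where "I \<in> space M" "reaches t I p k"
      by (auto simp: S_def computes_def M_def)
    then have "\<exists>k. \<exists>I\<in>space M. reaches t I p k" by blast
    then show ?thesis unfolding d_def by (rule LeastI_ex)
  qed
  have depth: "d (rank_perm n I) \<le> leaf_depth t I" if "I \<in> space M" for I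
  proof -
    have "\<exists>k. reaches t I (rank_perm n I) k"
      using bspec[OF t[unfolded computes_def] that[unfolded M_def]] .
    then obtain k where k: "reaches t I (rank_perm n I) k" ..
    have "leaf_depth t I = k"
      unfolding leaf_depth_def
    proof (rule the_equality)
      show "\<exists>v. reaches t I v k" by (rule exI) (rule k)
      show "e = k" if "\<exists>v. reaches t I v e" for e
        using that by (auto dest: reaches_unique[OF k])
    qed
    moreover have "d (rank_perm n I) \<le> k" unfolding d_def by (rule Least_le, rule bexI) (rule k, rule that)
    ultimately show ?thesis by simp
  qed
  obtain I where I: "\<And>p. p \<in> S \<Longrightarrow> reaches t (I p) p (d p)" using reach by metis
  have sumP: "(\<Sum>p\<in>S. Pr p) = 1" unfolding Pr_def by (rule sum_prob_range[OF meas S])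
  have "(\<Sum>p\<in>S. Pr p * log 2 ((1 / 2) ^ d p / Pr p)) \<le> 0"
    by (rule gibbs) (use kraft[OF S(1) I] sumP in \<open>auto simp: Pr_def\<close>)
  moreover have "Pr p * log 2 ((1 / 2) ^ d p / Pr p) = Pr p * log 2 (1 / Pr p) - real (d p) * Pr p" for p
  proof (cases "Pr p = 0")
    case False
    then have "0 < Pr p" by (simp add: Pr_def zero_less_measure_iff)
    then have e: "log 2 ((1 / 2) ^ d p / Pr p) = log 2 (1 / Pr p) - real (d p)"
      by (simp add: log_divide log_nat_power)
    show ?thesis unfolding e by (simp add: algebra_simps)
  qed simp
  ultimately have "(\<Sum>p\<in>S. Pr p * log 2 (1 / Pr p)) \<le> (\<Sum>p\<in>S. real (d p) * Pr p)"
    by (simp add: sum_subtractf)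
  then have "perm_entropy n D \<le> (\<integral>x. real (d (rank_perm n x)) \<partial>M)"
    using expectation_finite_range(2)[OF meas S, of "\<lambda>p. real (d p)"]
    unfolding perm_entropy_eq_sum[OF D] by (simp add: S_def Pr_def M_def)
  then have "ennreal (perm_entropy n D) \<le> ennreal (\<integral>x. real (d (rank_perm n x)) \<partial>M)"
    by (rule ennreal_leI)
  also have "\<dots> = (\<integral>\<^sup>+x. ennreal (real (d (rank_perm n x))) \<partial>M)"
    by (rule nn_integral_eq_integral[symmetric])
      (use expectation_finite_range(1)[OF meas S, of "\<lambda>p. real (d p)"] in auto)
  also have "\<dots> \<le> (\<integral>\<^sup>+x. of_nat (leaf_depth t x) \<partial>M)"
    by (rule nn_integral_mono) (use depth in \<open>simp add: ennreal_of_nat_eq_real_of_nat\<close>)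
  finally show ?thesis by (simp add: expected_depth_def M_def)
qed

section \<open>The training inputs\<close>

definition hits :: "(nat \<Rightarrow> nat \<Rightarrow> real) \<Rightarrow> nat set \<Rightarrow> nat set \<Rightarrow> key set \<Rightarrow> nat" where
  "hits J R I A = (\<Sum>r\<in>R. card {i \<in> I. Key (J r i) i \<in> A})"

lemma hits_mono: "finite I \<Longrightarrow> A \<subseteq> B \<Longrightarrow> hits J R I A \<le> hits J R I B"
  unfolding hits_def by (intro sum_mono card_mono) auto

definition convex_keys :: "key set \<Rightarrow> bool" where
  "convex_keys A \<longleftrightarrow> (\<forall>a b c. a \<in> A \<longrightarrow> c \<in> A \<longrightarrow> a \<le> b \<longrightarrow> b \<le> c \<longrightarrow> b \<in> A)"

lemma prod_mono_ennreal:
  fixes f g :: "'a \<Rightarrow> ennreal"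
  assumes "\<And>i. i \<in> A \<Longrightarrow> f i \<le> g i"
  shows "prod f A \<le> prod g A"
  using assms by (induction A rule: infinite_finite_induct) (auto intro!: mult_mono)

lemma nn_integral_PiM_prod:
  assumes "finite I" "\<And>i. i \<in> I \<Longrightarrow> prob_space (M i)" "\<And>i. i \<in> I \<Longrightarrow> f i \<in> borel_measurable (M i)"
  shows "(\<integral>\<^sup>+x. (\<Prod>i\<in>I. f i (x i)) \<partial>(\<Pi>\<^sub>M i\<in>I. M i)) = (\<Prod>i\<in>I. \<integral>\<^sup>+x. f i x \<partial>M i)"
proof -
  \<comment> \<open>Outside \<open>I\<close> the family is continued by a point mass, as the product
    theorem for \<open>product_sigma_finite\<close> speaks of a sigma-finite measure at every
    index.\<close>
  define N where "N i = (if i \<in> I then M i else return (count_space UNIV) undefined)" for i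
  have "sigma_finite_measure (N i)" for i
    using assms(2) by (auto simp: N_def intro!: prob_space_imp_sigma_finite prob_space_return)
  then interpret product_sigma_finite N by (simp add: product_sigma_finite_def)
  have "(\<Pi>\<^sub>M i\<in>I. M i) = (\<Pi>\<^sub>M i\<in>I. N i)" by (rule PiM_cong) (auto simp: N_def)
  moreover have "(\<integral>\<^sup>+x. (\<Prod>i\<in>I. f i (x i)) \<partial>(\<Pi>\<^sub>M i\<in>I. N i)) = (\<Prod>i\<in>I. \<integral>\<^sup>+x. f i x \<partial>N i)"
    by (rule product_nn_integral_prod) (use assms in \<open>auto simp: N_def\<close>)
  moreover have "(\<Prod>i\<in>I. \<integral>\<^sup>+x. f i x \<partial>N i) = (\<Prod>i\<in>I. \<integral>\<^sup>+x. f i x \<partial>M i)"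
    by (rule prod.cong) (auto simp: N_def)
  ultimately show ?thesis by (simp only:)
qed

context
  fixes n T :: nat and D :: "nat \<Rightarrow> real measure"
  assumes D: "coordinate_laws n D"
begin

lemma coordinate: "i < n \<Longrightarrow> prob_space (D i)" "i < n \<Longrightarrow> sets (D i) = sets borel"
  using D by (auto simp: coordinate_laws_def)

lemma prob_space_inputs_law: "prob_space (inputs_law T n D)"
  unfolding inputs_law_def by (rule prob_space_PiM) (rule prob_space_input_law[OF D])

text \<open>Lower tail by an exponential moment. Each hit contributes a factor 1/2 to
  \<open>u\<close>, whose expectation factorises over rounds and coordinates into terms
  \<open>1 - p / 2\<close>, at most \<open>exp (- (p / 2))\<close>. Markov's inequality with
  \<open>c = card R * \<delta> / 4\<close> leaves \<open>2 powr c * exp (- (2 * c))\<close>, which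
  is at most \<open>exp (- c)\<close> for nonnegative \<open>c\<close>; for negative
  \<open>c\<close> the bound exceeds 1.\<close>

lemma chernoff:
  assumes R: "R \<subseteq> {..<T}" and I: "I \<subseteq> {..<n}" and A: "key_measurable A" and \<delta>: "\<delta> \<le> mass D I A"
  defines "F \<equiv> {J \<in> space (inputs_law T n D). real (hits J R I A) \<le> real (card R) * \<delta> / 4}"
  shows "F \<in> sets (inputs_law T n D)" "measure (inputs_law T n D) F \<le> exp (- (real (card R) * \<delta> / 4))"
proof -
  let ?M = "inputs_law T n D"
  interpret prob_space ?M by (rule prob_space_inputs_law)
  define c where "c = real (card R) * \<delta> / 4"
  have finR: "finite R" "finite I" using R I by (auto intro: finite_subset)
  define h where "h i v = (if i \<in> I \<and> Key v i \<in> A then 1 / 2 else 1 :: real)" for i v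
  define g where "g x = (\<Prod>i<n. ennreal (h i (x i)))" for x :: "nat \<Rightarrow> real"
  define G where "G r x = (if r \<in> R then g x else 1)" for r and x :: "nat \<Rightarrow> real"
  define u where "u J = (\<Prod>r<T. G r (J r))" for J :: "nat \<Rightarrow> nat \<Rightarrow> real"
  have h01: "0 \<le> h i v" for i v by (simp add: h_def)
  have hm: "h i \<in> borel_measurable borel" for i
  proof -
    have "{v. i \<in> I \<and> Key v i \<in> A} \<in> sets borel"
      using A by (cases "i \<in> I") (simp_all add: key_measurable_def)
    then show ?thesis unfolding h_def by (intro measurable_If) simp_all
  qed
  have hm': "(\<lambda>v. ennreal (h i v)) \<in> borel_measurable (D i)" if "i < n" for i
    using hm[of i] coordinate(2)[OF that] by (simp cong: measurable_cong_sets)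
  have inth: "(\<integral>\<^sup>+v. ennreal (h i v) \<partial>D i) = ennreal (if i \<in> I then 1 - measure (D i) {v. Key v i \<in> A} / 2 else 1)"
    if i: "i < n" for i
  proof (cases "i \<in> I")
    case True
    interpret Di: prob_space "D i" by (rule coordinate(1)[OF i])
    let ?S = "{v. Key v i \<in> A}"
    have S: "?S \<in> sets (D i)" using A coordinate(2)[OF i] by (simp add: key_measurable_def)
    have "integrable (D i) (\<lambda>v. 1 - indicator ?S v / 2 :: real)"
      using S by (intro Bochner_Integration.integrable_diff) (auto simp: Di.emeasure_eq_measure)
    then have "(\<integral>\<^sup>+v. ennreal (1 - indicator ?S v / 2) \<partial>D i) = ennreal (\<integral>v. 1 - indicator ?S v / 2 \<partial>D i)"
      by (rule nn_integral_eq_integral) (auto simp: indicator_def)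
    also have "(\<integral>v. 1 - indicator ?S v / 2 \<partial>D i) = 1 - measure (D i) ?S / 2"
      using S by (subst Bochner_Integration.integral_diff) (auto simp: Di.emeasure_eq_measure Di.prob_space)
    also have "(\<lambda>v. 1 - indicator ?S v / 2) = h i" using True by (auto simp: h_def indicator_def fun_eq_iff)
    finally show ?thesis using True by simp
  next
    case False
    interpret Di: prob_space "D i" by (rule coordinate(1)[OF i])
    show ?thesis using False by (simp add: h_def Di.emeasure_space_1)
  qed
  have "(\<integral>\<^sup>+x. g x \<partial>input_law n D) = (\<Prod>i<n. \<integral>\<^sup>+v. ennreal (h i v) \<partial>D i)"
    unfolding g_def input_law_def by (rule nn_integral_PiM_prod) (use coordinate(1) hm' in auto)
  also have "\<dots> = (\<Prod>i<n. ennreal (if i \<in> I then 1 - measure (D i) {v. Key v i \<in> A} / 2 else 1))"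
    by (rule prod.cong) (use inth in auto)
  also have "\<dots> \<le> (\<Prod>i<n. ennreal (exp (if i \<in> I then - (measure (D i) {v. Key v i \<in> A} / 2) else 0)))"
  proof (rule prod_mono_ennreal)
    fix i
    have "1 - p / 2 \<le> exp (- (p / 2))" for p :: real using exp_ge_add_one_self[of "- (p / 2)"] by simp
    then show "ennreal (if i \<in> I then 1 - measure (D i) {v. Key v i \<in> A} / 2 else 1) \<le>
      ennreal (exp (if i \<in> I then - (measure (D i) {v. Key v i \<in> A} / 2) else 0))"
      by (intro ennreal_leI) simp
  qed
  also have "\<dots> = ennreal (\<Prod>i<n. exp (if i \<in> I then - (measure (D i) {v. Key v i \<in> A} / 2) else 0))"
    by (rule prod_ennreal) simp
  also have "(\<Prod>i<n. exp (if i \<in> I then - (measure (D i) {v. Key v i \<in> A} / 2) else 0)) =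
      exp (\<Sum>i<n. if i \<in> I then - (measure (D i) {v. Key v i \<in> A} / 2) else 0)"
    by (simp add: exp_sum)
  also have "(\<Sum>i<n. if i \<in> I then - (measure (D i) {v. Key v i \<in> A} / 2) else 0) = - (mass D I A / 2)"
  proof -
    have "(\<Sum>i<n. if i \<in> I then - (measure (D i) {v. Key v i \<in> A} / 2) else 0) =
      (\<Sum>i\<in>I. - (measure (D i) {v. Key v i \<in> A} / 2))"
      using I by (subst sum.inter_restrict[symmetric]) (auto simp: Int_absorb1)
    then show ?thesis by (simp add: mass_def sum_negf sum_divide_distrib)
  qed
  also have "exp (- (mass D I A / 2)) \<le> exp (- (\<delta> / 2))" using \<delta> by simp
  finally have g: "(\<integral>\<^sup>+x. g x \<partial>input_law n D) \<le> ennreal (exp (- (\<delta> / 2)))" by (simp add: ennreal_leI)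
  have gm: "g \<in> borel_measurable (input_law n D)"
    unfolding g_def
  proof (rule borel_measurable_prod_ennreal)
    fix i assume "i \<in> {..<n}"
    then show "(\<lambda>x. ennreal (h i (x i))) \<in> borel_measurable (input_law n D)"
      using measurable_compose[OF component_measurable[OF D] hm[of i]] by simp
  qed
  have Gm: "G r \<in> borel_measurable (input_law n D)" for r
    unfolding G_def using gm by (cases "r \<in> R") simp_all
  interpret il: prob_space "input_law n D" by (rule prob_space_input_law[OF D])
  have "(\<integral>\<^sup>+J. u J \<partial>?M) = (\<Prod>r<T. \<integral>\<^sup>+x. G r x \<partial>input_law n D)"
    unfolding u_def inputs_law_def by (rule nn_integral_PiM_prod) (use il.prob_space_axioms Gm in auto)
  also have "\<dots> \<le> (\<Prod>r<T. if r \<in> R then ennreal (exp (- (\<delta> / 2))) else 1)"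
    using g by (intro prod_mono_ennreal) (auto simp: G_def[abs_def] il.emeasure_space_1)
  also have "\<dots> = (\<Prod>r\<in>R. ennreal (exp (- (\<delta> / 2))))"
    using R by (subst prod.inter_restrict[symmetric]) (auto simp: Int_absorb1)
  also have "\<dots> = ennreal (exp (- (\<delta> / 2)) ^ card R)" by (simp add: ennreal_power)
  also have "exp (- (\<delta> / 2)) ^ card R = exp (- (2 * c))"
    by (simp add: exp_of_nat_mult[symmetric] c_def)
  finally have u: "(\<integral>\<^sup>+J. u J \<partial>?M) \<le> ennreal (exp (- (2 * c)))" .
  have um: "u \<in> borel_measurable ?M"
    unfolding u_def
  proof (rule borel_measurable_prod_ennreal)
    fix r assume "r \<in> {..<T}"
    then have "(\<lambda>J. J r) \<in> ?M \<rightarrow>\<^sub>M input_law n D"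
      unfolding inputs_law_def by (intro measurable_component_singleton)
    then show "(\<lambda>J. G r (J r)) \<in> borel_measurable ?M" by (rule measurable_compose) (rule Gm)
  qed
  have ueq: "u J = ennreal (2 powr (- real (hits J R I A)))" for J
  proof -
    have gx: "g x = ennreal ((1 / 2) ^ card {i \<in> I. Key (x i) i \<in> A})" for x
    proof -
      have "(\<Prod>i<n. h i (x i)) = (\<Prod>i\<in>{i \<in> {..<n}. i \<in> I \<and> Key (x i) i \<in> A}. 1 / 2)"
        unfolding h_def by (subst prod.inter_filter) auto
      also have "{i \<in> {..<n}. i \<in> I \<and> Key (x i) i \<in> A} = {i \<in> I. Key (x i) i \<in> A}" using I by auto
      finally show ?thesis unfolding g_def by (subst prod_ennreal) (simp_all add: h01)
    qed
    have "u J = (\<Prod>r\<in>R. g (J r))"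
      unfolding u_def G_def using R by (subst prod.inter_restrict[symmetric]) (auto simp: Int_absorb1)
    also have "\<dots> = ennreal (\<Prod>r\<in>R. (1 / 2) ^ card {i \<in> I. Key (J r i) i \<in> A})"
      unfolding gx by (rule prod_ennreal) simp
    also have "(\<Prod>r\<in>R. (1 / 2 :: real) ^ card {i \<in> I. Key (J r i) i \<in> A}) = (1 / 2) ^ hits J R I A"
      by (simp add: hits_def power_sum)
    also have "\<dots> = 2 powr (- real (hits J R I A))" by (simp add: powr_minus powr_realpow power_one_over inverse_eq_divide)
    finally show ?thesis .
  qed
  have Feq: "F = {J \<in> space ?M. ennreal (2 powr (- c)) \<le> u J}"
    unfolding F_def ueq by (auto simp: c_def)
  show F: "F \<in> sets ?M" unfolding Feq using um by measurable
  have "emeasure ?M F = (\<integral>\<^sup>+J. indicator F J \<partial>?M)" using F by simp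
  also have "\<dots> \<le> (\<integral>\<^sup>+J. ennreal (2 powr c) * u J \<partial>?M)"
  proof (rule nn_integral_mono)
    fix J
    show "indicator F J \<le> ennreal (2 powr c) * u J"
    proof (cases "J \<in> F")
      case True
      then have "ennreal (2 powr c) * ennreal (2 powr (- c)) \<le> ennreal (2 powr c) * u J"
        unfolding Feq by (intro mult_left_mono) auto
      moreover have "ennreal (2 powr c) * ennreal (2 powr (- c)) = 1"
        by (simp add: ennreal_mult[symmetric] powr_add[symmetric])
      ultimately show ?thesis using True by simp
    qed simp
  qed
  also have "\<dots> = ennreal (2 powr c) * (\<integral>\<^sup>+J. u J \<partial>?M)" by (rule nn_integral_cmult[OF um])
  also have "\<dots> \<le> ennreal (2 powr c) * ennreal (exp (- (2 * c)))" by (rule mult_left_mono[OF u]) simp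
  also have "\<dots> = ennreal (2 powr c * exp (- (2 * c)))" by (simp add: ennreal_mult)
  finally have *: "measure ?M F \<le> 2 powr c * exp (- (2 * c))" by (simp add: emeasure_eq_measure)
  show "measure ?M F \<le> exp (- (real (card R) * \<delta> / 4))"
  proof (cases "0 \<le> c")
    case True
    have "2 powr c * exp (- (2 * c)) = exp (c * ln 2 - 2 * c)" by (simp add: powr_def exp_diff exp_minus field_simps)
    also have "\<dots> \<le> exp (- c)"
      using mult_left_mono[OF _ True, of "ln 2" 1] ln_le_minus_one[of 2] by simp
    finally show ?thesis using * by (simp add: c_def)
  next
    case False
    then have "1 \<le> exp (- c)" by simp
    then show ?thesis using prob_le_1[of F] unfolding c_def[symmetric] by linarith
  qed
qed

text \<open>The exceptional set \<open>F\<close> is made from the cells alone, of which there are at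
  most \<open>card I / \<delta>\<close>. Therefore \<open>A\<close> is quantified after the training
  inputs \<open>J\<close> and may depend on them, as the buckets do.\<close>

lemma bad_cells:
  assumes R: "R \<subseteq> {..<T}" and I: "I \<subseteq> {..<n}" and \<delta>: "0 < \<delta>"
  shows "\<exists>F\<in>sets (inputs_law T n D).
    measure (inputs_law T n D) F \<le> real (card I) / \<delta> * exp (- (real (card R) * \<delta> / 4)) \<and>
    (\<forall>J\<in>space (inputs_law T n D) - F. \<forall>A. key_measurable A \<longrightarrow> convex_keys A \<longrightarrow> 3 * \<delta> \<le> mass D I A \<longrightarrow>
       real (card R) * \<delta> / 4 < real (hits J R I A))"
proof -
  let ?M = "inputs_law T n D"
  interpret prob_space ?M by (rule prob_space_inputs_law)
  have fin: "finite I" using I by (rule finite_subset) simp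
  have "\<exists>(N :: nat) lo hi. real N * \<delta> \<le> real (card I) \<and>
     (\<forall>j<N. lo j \<le> hi j \<and> \<delta> \<le> mass D I {lo j..hi j}) \<and>
     (\<forall>A. key_measurable A \<longrightarrow> (\<forall>a b c. a \<in> A \<longrightarrow> c \<in> A \<longrightarrow> a \<le> b \<longrightarrow> b \<le> c \<longrightarrow> b \<in> A) \<longrightarrow>
        3 * \<delta> \<le> mass D I A \<longrightarrow> (\<exists>j<N. {lo j..hi j} \<subseteq> A))"
    by (rule cells[OF fin _ _ \<delta>]) (use coordinate I in auto)
  then obtain N :: nat and lo hi where N: "real N * \<delta> \<le> real (card I)"
    and m0: "\<forall>j<N. lo j \<le> hi j \<and> \<delta> \<le> mass D I {lo j..hi j}"
    and c0: "\<forall>A. key_measurable A \<longrightarrow> (\<forall>a b c. a \<in> A \<longrightarrow> c \<in> A \<longrightarrow> a \<le> b \<longrightarrow> b \<le> c \<longrightarrow> b \<in> A) \<longrightarrow>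
        3 * \<delta> \<le> mass D I A \<longrightarrow> (\<exists>j<N. {lo j..hi j} \<subseteq> A)"
    by (elim exE conjE) (rule that)
  have m: "\<delta> \<le> mass D I {lo j..hi j}" if "j < N" for j using m0 that by simp
  have cov: "\<exists>j<N. {lo j..hi j} \<subseteq> A" if "key_measurable A" "convex_keys A" "3 * \<delta> \<le> mass D I A" for A
    by (rule c0[THEN spec, THEN mp, OF that(1), THEN mp, OF that(2)[unfolded convex_keys_def], THEN mp, OF that(3)])
  define E where "E j = {J \<in> space ?M. real (hits J R I {lo j..hi j}) \<le> real (card R) * \<delta> / 4}" for j
  have E: "E j \<in> sets ?M" "prob (E j) \<le> exp (- (real (card R) * \<delta> / 4))" if "j < N" for j
    unfolding E_def by (rule chernoff[OF R I _ m[OF that]], simp)+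
  have "prob (\<Union>j<N. E j) \<le> (\<Sum>j<N. prob (E j))"
    by (rule finite_measure_subadditive_finite) (use E in auto)
  also have "\<dots> \<le> (\<Sum>j<N. exp (- (real (card R) * \<delta> / 4)))" by (rule sum_mono) (use E in auto)
  also have "\<dots> = real N * exp (- (real (card R) * \<delta> / 4))" by simp
  also have "\<dots> \<le> real (card I) / \<delta> * exp (- (real (card R) * \<delta> / 4))"
    using N \<delta> by (intro mult_right_mono) (auto simp: pos_le_divide_eq)
  finally have "prob (\<Union>j<N. E j) \<le> real (card I) / \<delta> * exp (- (real (card R) * \<delta> / 4))" .
  moreover have "(\<Union>j<N. E j) \<in> sets ?M" using E by auto
  moreover have "real (card R) * \<delta> / 4 < real (hits J R I A)"
    if J: "J \<in> space ?M - (\<Union>j<N. E j)" and A: "key_measurable A" "convex_keys A" "3 * \<delta> \<le> mass D I A" for J A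
  proof -
    obtain j where j: "j < N" "{lo j..hi j} \<subseteq> A" using cov[OF A] by blast
    have "J \<in> space ?M" "J \<notin> E j" using J j(1) by auto
    then have "real (card R) * \<delta> / 4 < real (hits J R I {lo j..hi j})" unfolding E_def mem_Collect_eq by linarith
    also have "\<dots> \<le> real (hits J R I A)" using hits_mono[OF fin j(2)] by (rule of_nat_mono)
    finally show ?thesis .
  qed
  ultimately show ?thesis
    by (intro bexI[of _ "\<Union>j<N. E j"] conjI ballI allI impI)
qed

text \<open>Two uses of \<open>bad_cells\<close>. With \<delta> = 4 and all coordinates together, a
  convex set of mass 12 receives more than \<open>card R\<close> merged keys, too many for the
  interior of a bucket. With \<delta> = \<open>2^-l\<close> and a single coordinate, the samples
  represent every frequency level down to \<open>2^-K\<close>.\<close>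

lemma good_training:
  assumes L: "n < 2 ^ L" "1 \<le> n" and K: "K \<le> L"
    and R: "R \<subseteq> {..<T}" "card R = 4 * L" and S: "S \<subseteq> {..<T}" "card S = 32 * 2 ^ K * L"
  shows "\<exists>F\<in>sets (inputs_law T n D). measure (inputs_law T n D) F \<le> 1 / real n \<and>
    (\<forall>J\<in>space (inputs_law T n D) - F.
      (\<forall>A. key_measurable A \<longrightarrow> convex_keys A \<longrightarrow> 12 \<le> mass D {..<n} A \<longrightarrow>
         real (card R) < real (hits J R {..<n} A)) \<and>
      (\<forall>i<n. \<forall>l\<le>K. \<forall>A. key_measurable A \<longrightarrow> convex_keys A \<longrightarrow> 3 * (1 / 2) ^ l \<le> mass D {i} A \<longrightarrow>
         real (card S) * (1 / 2) ^ l / 4 < real (hits J S {i} A)))"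
proof -
  let ?M = "inputs_law T n D"
  interpret prob_space ?M by (rule prob_space_inputs_law)
  obtain F0 where F0: "F0 \<in> sets ?M" "prob F0 \<le> real (card {..<n}) / 4 * exp (- (real (card R) * 4 / 4))"
    "\<And>J A. J \<in> space ?M - F0 \<Longrightarrow> key_measurable A \<Longrightarrow> convex_keys A \<Longrightarrow> 3 * 4 \<le> mass D {..<n} A \<Longrightarrow>
       real (card R) * 4 / 4 < real (hits J R {..<n} A)"
    using bad_cells[OF R(1) order_refl, of 4] by (auto simp del: card_lessThan)
  have "\<exists>F\<in>sets ?M. prob F \<le> real (card {i}) / (1 / 2) ^ l * exp (- (real (card S) * (1 / 2) ^ l / 4)) \<and>
    (\<forall>J\<in>space ?M - F. \<forall>A. key_measurable A \<longrightarrow> convex_keys A \<longrightarrow> 3 * (1 / 2) ^ l \<le> mass D {i} A \<longrightarrow>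
       real (card S) * (1 / 2) ^ l / 4 < real (hits J S {i} A))" if "i < n" for i l
    by (rule bad_cells[OF S(1)]) (use that in auto)
  then obtain F where F: "\<And>i l. i < n \<Longrightarrow> F i l \<in> sets ?M"
    "\<And>i l. i < n \<Longrightarrow> prob (F i l) \<le> real (card {i}) / (1 / 2) ^ l * exp (- (real (card S) * (1 / 2) ^ l / 4))"
    "\<And>i l J A. i < n \<Longrightarrow> J \<in> space ?M - F i l \<Longrightarrow> key_measurable A \<Longrightarrow> convex_keys A \<Longrightarrow>
       3 * (1 / 2) ^ l \<le> mass D {i} A \<Longrightarrow> real (card S) * (1 / 2) ^ l / 4 < real (hits J S {i} A)"
    by metis
  \<comment> \<open>\<open>y\<close> is the unit of the estimate: \<open>n * y\<close>,
    \<open>2 ^ L * y\<close> and \<open>2 * y\<close> are at most 1, so each factor \<open>n\<close>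
    or \<open>2 ^ L\<close> of the union bound is paid for by one factor \<open>y\<close>.\<close>
  define y where "y = exp (- real L)"
  have L1: "1 \<le> L" using L by (cases L) auto
  have y0: "0 < y" by (simp add: y_def)
  have y2: "y * 2 ^ L \<le> 1"
  proof -
    have "(2::real) ^ L \<le> exp 1 ^ L" by (rule power_mono) (use exp_ge_add_one_self[of 1] in auto)
    also have "\<dots> = exp (real L)" by (simp add: exp_of_nat_mult[symmetric])
    finally have "y * 2 ^ L \<le> y * exp (real L)" using y0 by (intro mult_left_mono) auto
    then show ?thesis by (simp add: y_def exp_minus)
  qed
  have yn: "real n * y \<le> 1"
  proof -
    have "real n \<le> 2 ^ L" using of_nat_mono[OF less_imp_le[OF L(1)], where 'a = real] by simp
    then have "real n * y \<le> 2 ^ L * y" using y0 by (intro mult_right_mono) auto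
    then show ?thesis using y2 by (simp add: mult.commute)
  qed
  have yh: "y \<le> 1 / 2"
  proof -
    have "2 ^ 1 \<le> (2::real) ^ L" using L1 by (intro power_increasing) auto
    then have "y * 2 \<le> y * 2 ^ L" using y0 by (intro mult_left_mono) auto
    then show ?thesis using y2 by simp
  qed
  have prF: "prob (F i l) \<le> 2 ^ L * y ^ 8" if "i < n" "l \<le> K" for i l
  proof -
    have "(1::real) \<le> 2 ^ K * (1 / 2) ^ l"
    proof -
      have "(2::real) ^ l \<le> 2 ^ K" using that by (intro power_increasing) auto
      then show ?thesis by (simp add: power_one_over field_simps)
    qed
    then have "32 * real L * 1 \<le> 32 * real L * (2 ^ K * (1 / 2) ^ l)" by (intro mult_left_mono) auto
    then have "8 * real L \<le> real (card S) * (1 / 2) ^ l / 4" by (simp add: S(2) algebra_simps)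
    then have "exp (- (real (card S) * (1 / 2) ^ l / 4)) \<le> exp (- (8 * real L))" by simp
    also have "\<dots> = y ^ 8" by (simp add: y_def exp_of_nat_mult[symmetric])
    finally have e: "exp (- (real (card S) * (1 / 2) ^ l / 4)) \<le> y ^ 8" .
    have "real (card {i}) / (1 / 2) ^ l \<le> (2::real) ^ L"
      using that K by (simp add: power_one_over power_increasing)
    then have "real (card {i}) / (1 / 2) ^ l * exp (- (real (card S) * (1 / 2) ^ l / 4)) \<le> 2 ^ L * y ^ 8"
      using e by (intro mult_mono) auto
    then show ?thesis using F(2)[OF that(1), of l] by linarith
  qed
  have pr0: "prob F0 \<le> real n * y ^ 4"
  proof -
    have "exp (- (real (card R) * 4 / 4)) = y ^ 4" by (simp add: R(2) y_def exp_of_nat_mult[symmetric])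
    then have "prob F0 \<le> real n / 4 * y ^ 4" using F0(2) by simp
    also have "\<dots> \<le> real n * y ^ 4" by (intro mult_right_mono) auto
    finally show ?thesis .
  qed
  define FF where "FF = F0 \<union> (\<Union>(i, l)\<in>{..<n} \<times> {..K}. F i l)"
  have FF: "FF \<in> sets ?M" unfolding FF_def using F0(1) F(1) by (intro sets.Un sets.finite_UN) auto
  have "prob FF \<le> prob F0 + prob (\<Union>(i, l)\<in>{..<n} \<times> {..K}. F i l)"
    unfolding FF_def using F0(1) F(1) by (intro measure_Un_le sets.finite_UN) auto
  also have "prob (\<Union>(i, l)\<in>{..<n} \<times> {..K}. F i l) \<le> (\<Sum>(i, l)\<in>{..<n} \<times> {..K}. prob (F i l))"
    using measure_UNION_le[of "{..<n} \<times> {..K}" "\<lambda>z. F (fst z) (snd z)" ?M] F(1)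
    by (auto simp: case_prod_unfold)
  also have "\<dots> \<le> (\<Sum>(i, l)\<in>{..<n} \<times> {..K}. 2 ^ L * y ^ 8)" by (rule sum_mono) (use prF in auto)
  also have "\<dots> = real n * real (K + 1) * (2 ^ L * y ^ 8)" by (simp add: algebra_simps)
  also have "\<dots> \<le> real n * 2 ^ L * (2 ^ L * y ^ 8)"
  proof -
    have "K + 1 \<le> 2 ^ L" using K less_exp[of L] by linarith
    then have "real (K + 1) \<le> 2 ^ L" using of_nat_mono[of "K + 1" "2 ^ L", where 'a = real] by simp
    then show ?thesis using y0 by (intro mult_right_mono mult_left_mono) auto
  qed
  also have "real n * 2 ^ L * (2 ^ L * y ^ 8) = (real n * y) * (y * 2 ^ L) * (y * 2 ^ L) * y ^ 5"
    by (simp add: eval_nat_numeral)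
  also have "\<dots> \<le> 1 * 1 * 1 * y ^ 5" using yn y2 y0 by (intro mult_mono) auto
  finally have "prob FF \<le> real n * y ^ 4 + y ^ 5" using pr0 by simp
  also have "real n * y ^ 4 = (real n * y) * y ^ 3" by (simp add: eval_nat_numeral)
  also have "\<dots> \<le> 1 * y ^ 3" using yn y0 by (intro mult_right_mono) auto
  also have "1 * y ^ 3 + y ^ 5 \<le> y"
  proof -
    have "y ^ 3 \<le> y * (1 / 4)" using mult_left_mono[OF power_mono[OF yh, of 2], of y] y0
      by (simp add: eval_nat_numeral)
    moreover have "y ^ 5 \<le> y * (1 / 16)" using mult_left_mono[OF power_mono[OF yh, of 4], of y] y0
      by (simp add: eval_nat_numeral)
    ultimately show ?thesis using y0 by linarith
  qed
  finally have "prob FF \<le> y" by simp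
  also have "y \<le> 1 / real n" using yn L(2) by (simp add: field_simps)
  finally have "prob FF \<le> 1 / real n" .
  then show ?thesis
  proof (intro bexI[OF _ FF] conjI ballI allI impI)
    fix J A assume J: "J \<in> space ?M - FF" and A: "key_measurable A" "convex_keys A" "12 \<le> mass D {..<n} A"
    show "real (card R) < real (hits J R {..<n} A)"
      using F0(3)[OF _ A(1,2)] J A(3) by (simp add: FF_def)
  next
    fix J i l A assume J: "J \<in> space ?M - FF" and il: "i < n" "l \<le> K"
      and A: "key_measurable A" "convex_keys A" "3 * (1 / 2) ^ l \<le> mass D {i} A"
    have "J \<in> space ?M - F i l" using J il by (auto simp: FF_def)
    then show "real (card S) * (1 / 2) ^ l / 4 < real (hits J S {i} A)"
      by (rule F(3)[OF il(1) _ A])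
  qed
qed

end

section \<open>Buckets\<close>

lemma box_prob:
  assumes D: "coordinate_laws n D" and A: "\<And>i. i < n \<Longrightarrow> key_measurable (A i)"
  shows "measure (input_law n D) {x \<in> space (input_law n D). \<forall>i<n. xkey x i \<in> A i} =
    (\<Prod>i<n. measure (D i) {v. Key v i \<in> A i})"
    "{x \<in> space (input_law n D). \<forall>i<n. xkey x i \<in> A i} \<in> sets (input_law n D)"
proof -
  let ?M = "input_law n D"
  interpret prob_space ?M by (rule prob_space_input_law[OF D])
  let ?E = "{x \<in> space ?M. \<forall>i<n. xkey x i \<in> A i}"
  have Dp: "prob_space (D i)" "sets (D i) = sets borel" if "i < n" for i
    using D that by (auto simp: coordinate_laws_def)
  have S: "{v. Key v i \<in> A i} \<in> sets borel" if "i < n" for i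
    using A[OF that] by (simp add: key_measurable_def)
  have "?E = {x \<in> space ?M. \<forall>i\<in>{..<n}. xkey x i \<in> A i}" by auto
  also have "\<dots> \<in> sets ?M"
  proof (rule sets.sets_Collect_finite_All)
    fix i assume "i \<in> {..<n}"
    then have "(\<lambda>x. x i) -` {v. Key v i \<in> A i} \<inter> space ?M \<in> sets ?M"
      by (intro measurable_sets[OF component_measurable[OF D]] S) auto
    also have "(\<lambda>x. x i) -` {v. Key v i \<in> A i} \<inter> space ?M = {x \<in> space ?M. xkey x i \<in> A i}" by auto
    finally show "{x \<in> space ?M. xkey x i \<in> A i} \<in> sets ?M" .
  qed simp
  finally show E: "?E \<in> sets ?M" .
  have "emeasure ?M ?E = (\<integral>\<^sup>+x. indicator ?E x \<partial>?M)"
    by (rule nn_integral_indicator[OF E, symmetric])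
  also have "\<dots> = (\<integral>\<^sup>+x. (\<Prod>i<n. indicator {v. Key v i \<in> A i} (x i)) \<partial>?M)"
  proof (rule nn_integral_cong)
    fix x assume x: "x \<in> space ?M"
    show "(indicator ?E x :: ennreal) = (\<Prod>i<n. indicator {v. Key v i \<in> A i} (x i))"
    proof (cases "\<forall>i<n. xkey x i \<in> A i")
      case True
      then show ?thesis using x by (simp add: indicator_def)
    next
      case False
      then obtain i where "i < n" "xkey x i \<notin> A i" by blast
      then have "(\<Prod>i<n. indicator {v. Key v i \<in> A i} (x i) :: ennreal) = 0"
        by (intro prod_zero) (auto intro!: bexI[of _ i])
      then show ?thesis using False by simp
    qed
  qed
  also have "\<dots> = (\<Prod>i<n. \<integral>\<^sup>+v. indicator {v. Key v i \<in> A i} v \<partial>D i)"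
    unfolding input_law_def
    by (rule nn_integral_PiM_prod) (use Dp S in \<open>auto intro!: borel_measurable_indicator\<close>)
  also have "\<dots> = (\<Prod>i<n. ennreal (measure (D i) {v. Key v i \<in> A i}))"
  proof (rule prod.cong)
    fix i assume "i \<in> {..<n}"
    then have i: "i < n" by simp
    interpret Di: prob_space "D i" by (rule Dp(1)[OF i])
    show "(\<integral>\<^sup>+v. indicator {v. Key v i \<in> A i} v \<partial>D i) = ennreal (measure (D i) {v. Key v i \<in> A i})"
      using S[OF i] Dp(2)[OF i] by (simp add: Di.emeasure_eq_measure)
  qed simp
  also have "\<dots> = ennreal (\<Prod>i<n. measure (D i) {v. Key v i \<in> A i})" by (rule prod_ennreal) simp
  finally show "prob ?E = (\<Prod>i<n. measure (D i) {v. Key v i \<in> A i})"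
    by (simp add: emeasure_eq_measure prod_nonneg)
qed

text \<open>Given the permutation, a monotone assignment of buckets is determined by the set of the
  numbers bucket plus rank, which increase strictly with the rank.\<close>

lemma bucket_vector_unique:
  fixes \<beta> \<gamma> :: "key \<Rightarrow> nat"
  assumes mono: "mono \<beta>" "mono \<gamma>" and rank: "rank_perm n x = rank_perm n y"
    and same: "(\<lambda>i. \<beta> (xkey x i) + rank_perm n x ! i) ` {..<n} = (\<lambda>i. \<gamma> (xkey y i) + rank_perm n y ! i) ` {..<n}"
    and i: "i < n"
  shows "\<beta> (xkey x i) = \<gamma> (xkey y i)"
proof -
  have rank_less: "rank_perm n x ! i < rank_perm n x ! j" if "xkey x i < xkey x j" "i < n" "j < n" for x i j
  proof -
    have "{k. k < n \<and> xkey x k < xkey x i} \<subset> {k. k < n \<and> xkey x k < xkey x j}"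
    proof (rule psubsetI)
      show "{k. k < n \<and> xkey x k < xkey x i} \<subseteq> {k. k < n \<and> xkey x k < xkey x j}"
        using that(1) by (auto intro: less_trans)
      have "i \<in> {k. k < n \<and> xkey x k < xkey x j}" "i \<notin> {k. k < n \<and> xkey x k < xkey x i}" using that by auto
      then show "{k. k < n \<and> xkey x k < xkey x i} \<noteq> {k. k < n \<and> xkey x k < xkey x j}" by blast
    qed
    then show ?thesis using that by (simp add: rank_perm_nth psubset_card_mono)
  qed
  \<comment> \<open>Bucket plus rank increases strictly with the rank, so the members of the set
    below the value of \<open>i\<close> are as many as the ranks below that of \<open>i\<close>. The
    value is thereby recovered from the set and the rank.\<close>
  have low: "card {t \<in> (\<lambda>i. \<beta> (xkey x i) + rank_perm n x ! i) ` {..<n}. t < \<beta> (xkey x i) + rank_perm n x ! i} =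
      card {j. j < n \<and> rank_perm n x ! j < rank_perm n x ! i}" if mono: "mono \<beta>" and i: "i < n"
    for \<beta> :: "key \<Rightarrow> nat" and x i
  proof -
    let ?g = "\<lambda>i. \<beta> (xkey x i) + rank_perm n x ! i"
    have g: "?g j < ?g k" if "xkey x j < xkey x k" "j < n" "k < n" for j k
      using rank_less[OF that] monoD[OF mono less_imp_le[OF that(1)]] by simp
    have cmp: "xkey x j < xkey x k \<or> j = k \<or> xkey x k < xkey x j" for j k
      using linorder_less_linear[of "xkey x j" "xkey x k"] by auto
    have gl: "?g j < ?g k \<longleftrightarrow> rank_perm n x ! j < rank_perm n x ! k" if "j < n" "k < n" for j k
      using cmp[of j k] g[of j k] g[of k j] rank_less[of x j k] rank_less[of x k j] that by fastforce
    have inj: "inj_on ?g {..<n}"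
    proof (rule inj_onI)
      fix j k assume "j \<in> {..<n}" "k \<in> {..<n}" "?g j = ?g k"
      then show "j = k" using cmp[of j k] g[of j k] g[of k j] by auto
    qed
    have "{t \<in> ?g ` {..<n}. t < ?g i} = ?g ` {j. j < n \<and> rank_perm n x ! j < rank_perm n x ! i}"
      using gl i by auto
    then show ?thesis using card_image[OF inj_on_subset[OF inj, of "{j. j < n \<and> rank_perm n x ! j < rank_perm n x ! i}"]]
      by auto
  qed
  define T where "T = (\<lambda>i. \<beta> (xkey x i) + rank_perm n x ! i) ` {..<n}"
  define s where "s = \<beta> (xkey x i) + rank_perm n x ! i"
  define t where "t = \<gamma> (xkey y i) + rank_perm n x ! i"
  have T: "finite T" "s \<in> T" by (auto simp: T_def s_def i)
  have tT: "t \<in> T" unfolding T_def same using i by (auto simp: t_def rank)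
  have c: "card {u \<in> T. u < s} = card {u \<in> T. u < t}"
    using low[OF mono(1) i, of x] low[OF mono(2) i, of y] unfolding same[symmetric] T_def[symmetric]
    by (simp add: s_def t_def rank)
  have contra: "\<not> s' < t'" if "s' \<in> T" "card {u \<in> T. u < s'} = card {u \<in> T. u < t'}" for s' t'
  proof
    assume "s' < t'"
    then have "insert s' {u \<in> T. u < s'} \<subseteq> {u \<in> T. u < t'}" using that(1) by auto
    then have "card (insert s' {u \<in> T. u < s'}) \<le> card {u \<in> T. u < t'}" by (rule card_mono[rotated]) (use T in simp)
    then show False using that(2) T by simp
  qed
  have "s = t" using contra[OF T(2) c] contra[OF tT c[symmetric]] by simp
  then show ?thesis by (simp add: s_def t_def)
qed

context
  fixes n :: nat and D :: "nat \<Rightarrow> real measure" and \<beta> :: "key \<Rightarrow> nat"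
  assumes D: "coordinate_laws n D" and mono: "mono \<beta>" and le: "\<And>k. \<beta> k \<le> n"
    and meas: "\<And>b. key_measurable {k. \<beta> k = b}"
begin

definition bprob :: "nat \<Rightarrow> nat \<Rightarrow> real" where
  "bprob i b = measure (D i) {v. \<beta> (Key v i) = b}"

interpretation M: prob_space "input_law n D" by (rule prob_space_input_law[OF D])

lemma bprob_eq: "i < n \<Longrightarrow> M.prob {x \<in> space (input_law n D). \<beta> (xkey x i) = b} = bprob i b"
  and bprob_pair: "i < n \<Longrightarrow> j < n \<Longrightarrow> i \<noteq> j \<Longrightarrow>
    M.prob {x \<in> space (input_law n D). \<beta> (xkey x i) = b \<and> \<beta> (xkey x j) = b} = bprob i b * bprob j b"
  and bprob_sets: "i < n \<Longrightarrow> {x \<in> space (input_law n D). \<beta> (xkey x i) = b} \<in> M.events"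
proof -
  have D1: "measure (D i) UNIV = 1" if "i < n" for i
  proof -
    have "prob_space (D i)" "sets (D i) = sets borel" using D that by (auto simp: coordinate_laws_def)
    then show ?thesis using prob_space.prob_space[of "D i"] sets_eq_imp_space_eq[of "D i" borel] by simp
  qed
  have single: "M.prob {x \<in> space (input_law n D). \<forall>k<n. xkey x k \<in> (if k \<in> K then {l. \<beta> l = b} else UNIV)} =
     (\<Prod>k\<in>K. bprob k b)" if "K \<subseteq> {..<n}" for K
  proof -
    have "M.prob {x \<in> space (input_law n D). \<forall>k<n. xkey x k \<in> (if k \<in> K then {l. \<beta> l = b} else UNIV)} =
      (\<Prod>k<n. measure (D k) {v. Key v k \<in> (if k \<in> K then {l. \<beta> l = b} else UNIV)})"
      by (rule box_prob(1)[OF D]) (simp add: meas)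
    also have "\<dots> = (\<Prod>k<n. if k \<in> K then bprob k b else 1)"
      by (rule prod.cong) (auto simp: bprob_def D1)
    also have "\<dots> = (\<Prod>k\<in>K. bprob k b)"
      using that by (subst prod.inter_restrict[symmetric]) (auto simp: Int_absorb1)
    finally show ?thesis .
  qed
  show "M.prob {x \<in> space (input_law n D). \<beta> (xkey x i) = b} = bprob i b" if i: "i < n"
  proof -
    have "{x \<in> space (input_law n D). \<beta> (xkey x i) = b} =
      {x \<in> space (input_law n D). \<forall>k<n. xkey x k \<in> (if k \<in> {i} then {l. \<beta> l = b} else UNIV)}" using i by auto
    then show ?thesis using single[of "{i}"] i by simp
  qed
  show "M.prob {x \<in> space (input_law n D). \<beta> (xkey x i) = b \<and> \<beta> (xkey x j) = b} = bprob i b * bprob j b"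
    if ij: "i < n" "j < n" "i \<noteq> j"
  proof -
    have "{x \<in> space (input_law n D). \<beta> (xkey x i) = b \<and> \<beta> (xkey x j) = b} =
      {x \<in> space (input_law n D). \<forall>k<n. xkey x k \<in> (if k \<in> {i, j} then {l. \<beta> l = b} else UNIV)}" using ij by auto
    then show ?thesis using single[of "{i, j}"] ij by simp
  qed
  show "{x \<in> space (input_law n D). \<beta> (xkey x i) = b} \<in> M.events" if i: "i < n"
  proof -
    have "{x \<in> space (input_law n D). \<beta> (xkey x i) = b} =
      {x \<in> space (input_law n D). \<forall>k<n. xkey x k \<in> (if k = i then {l. \<beta> l = b} else UNIV)}" using i by auto
    moreover have "key_measurable (if k = i then {l. \<beta> l = b} else UNIV)" for k by (simp add: meas)
    ultimately show ?thesis by (simp only: box_prob(2)[OF D])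
  qed
qed

definition bvec :: "(nat \<Rightarrow> real) \<Rightarrow> nat list" where
  "bvec x = map (\<lambda>i. \<beta> (xkey x i)) [0..<n]"

lemma coordinate_bucket_measurable: "i < n \<Longrightarrow> (\<lambda>x. \<beta> (xkey x i)) \<in> input_law n D \<rightarrow>\<^sub>M count_space UNIV"
  by (rule measurable_finite_predicates[where K = "{..n}" and P = "\<lambda>b x. \<beta> (xkey x i) = b"])
    (use le bprob_sets in auto)

lemma joint_measurable: "(\<lambda>x. (bvec x, rank_perm n x)) \<in> input_law n D \<rightarrow>\<^sub>M count_space UNIV"
proof (rule measurable_finite_predicates[where K = "Inl ` ({..<n} \<times> {..n}) \<union> Inr ` (rank_perm n ` space (input_law n D))"
    and P = "\<lambda>z x. case z of Inl (i, b) \<Rightarrow> \<beta> (xkey x i) = b | Inr \<pi> \<Rightarrow> rank_perm n x = \<pi>"])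
  show "finite (Inl ` ({..<n} \<times> {..n}) \<union> Inr ` (rank_perm n ` space (input_law n D)))"
    by (simp add: finite_range_rank_perm)
next
  fix z :: "nat \<times> nat + nat list"
  assume "z \<in> Inl ` ({..<n} \<times> {..n}) \<union> Inr ` (rank_perm n ` space (input_law n D))"
  moreover have "{x \<in> space (input_law n D). rank_perm n x = \<pi>} \<in> M.events" for \<pi>
    using measurable_sets[OF rank_perm_measurable[OF D], of "{\<pi>}"]
    by (simp add: vimage_def Int_def conj_commute)
  ultimately show "{x \<in> space (input_law n D). case z of Inl (i, b) \<Rightarrow> \<beta> (xkey x i) = b | Inr \<pi> \<Rightarrow> rank_perm n x = \<pi>}
      \<in> M.events"
    using bprob_sets by auto
next
  fix x y assume xy: "x \<in> space (input_law n D)" "y \<in> space (input_law n D)"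
    and eq: "\<And>z. z \<in> Inl ` ({..<n} \<times> {..n}) \<union> Inr ` (rank_perm n ` space (input_law n D)) \<Longrightarrow>
      (case z of Inl (i, b) \<Rightarrow> \<beta> (xkey x i) = b | Inr \<pi> \<Rightarrow> rank_perm n x = \<pi>) =
      (case z of Inl (i, b) \<Rightarrow> \<beta> (xkey y i) = b | Inr \<pi> \<Rightarrow> rank_perm n y = \<pi>)"
  have "\<beta> (xkey x i) = \<beta> (xkey y i)" if "i < n" for i
    using eq[of "Inl (i, \<beta> (xkey x i))"] that le by simp
  moreover have "rank_perm n x = rank_perm n y"
    using eq[of "Inr (rank_perm n x)"] xy by simp
  ultimately show "(bvec x, rank_perm n x) = (bvec y, rank_perm n y)" by (simp add: bvec_def)
qed

lemma sum_bprob: "i < n \<Longrightarrow> (\<Sum>b\<le>n. bprob i b) = 1"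
proof -
  assume i: "i < n"
  have "(\<Sum>b\<le>n. M.prob ((\<lambda>x. \<beta> (xkey x i)) -` {b} \<inter> space (input_law n D))) = 1"
    by (rule M.sum_prob_range[OF coordinate_bucket_measurable[OF i]]) (use le in auto)
  moreover have "(\<lambda>x. \<beta> (xkey x i)) -` {b} \<inter> space (input_law n D) = {x \<in> space (input_law n D). \<beta> (xkey x i) = b}" for b
    by auto
  ultimately show ?thesis using bprob_eq[OF i] by simp
qed

lemma expectation_bucket:
  assumes i: "i < n"
  shows "integrable (input_law n D) (\<lambda>x. g (\<beta> (xkey x i)) :: real)"
    "(\<integral>x. g (\<beta> (xkey x i)) \<partial>input_law n D) = (\<Sum>b\<le>n. g b * bprob i b)"
proof -
  have r: "finite {..n}" "(\<lambda>x. \<beta> (xkey x i)) ` space (input_law n D) \<subseteq> {..n}" using le by auto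
  have e: "(\<lambda>x. \<beta> (xkey x i)) -` {b} \<inter> space (input_law n D) = {x \<in> space (input_law n D). \<beta> (xkey x i) = b}" for b
    by auto
  show "integrable (input_law n D) (\<lambda>x. g (\<beta> (xkey x i)))"
    by (rule M.expectation_finite_range(1)[OF coordinate_bucket_measurable[OF i] r])
  show "(\<integral>x. g (\<beta> (xkey x i)) \<partial>input_law n D) = (\<Sum>b\<le>n. g b * bprob i b)"
    using M.expectation_finite_range(2)[OF coordinate_bucket_measurable[OF i] r, of g] by (simp add: e bprob_eq[OF i])
qed

text \<open>By independence the left side is the entropy of the bucket vector. Conditional entropy
  is bypassed by \<open>gibbs\<close> with \<open>Q = P * PP / (N * PB)\<close>: in
  \<open>Q / P\<close> the joint law cancels, and the logarithm splits into a term for \<pi>, a term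
  for the bucket vector and \<open>log 2 N = 2 * n\<close>. The sum of \<open>Q\<close> is at most
  1, because \<open>P \<le> PB\<close> and each \<pi> occurs with at most \<open>N = 4 ^ n\<close>
  vectors.\<close>

lemma bucket_entropy:
  "(\<Sum>i<n. \<Sum>b\<le>n. log 2 (1 / bprob i b) * bprob i b) \<le> perm_entropy n D + 2 * real n"
proof -
  let ?M = "input_law n D"
  let ?W = "\<lambda>x. (bvec x, rank_perm n x)"
  define \<Omega> where "\<Omega> = ?W ` space ?M"
  define P where "P \<omega> = M.prob (?W -` {\<omega>} \<inter> space ?M)" for \<omega>
  define PB where "PB b = (\<Prod>i<n. bprob i (b ! i))" for b
  define PP where "PP \<pi> = M.prob (rank_perm n -` {\<pi>} \<inter> space ?M)" for \<pi>
  define N where "N = (2::real) ^ (2 * n)"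
  have fin: "finite \<Omega>"
  proof (rule finite_subset)
    show "\<Omega> \<subseteq> {xs. List.set xs \<subseteq> {..n} \<and> length xs = n} \<times> rank_perm n ` space ?M"
      using le by (auto simp: \<Omega>_def bvec_def)
    show "finite ({xs. List.set xs \<subseteq> {..n} \<and> length xs = n} \<times> rank_perm n ` space ?M)"
      by (intro finite_cartesian_product finite_lists_length_eq finite_range_rank_perm) simp
  qed
  have r: "finite \<Omega>" "?W ` space ?M \<subseteq> \<Omega>" using fin by (auto simp: \<Omega>_def)
  have sumP: "sum P \<Omega> = 1" unfolding P_def by (rule M.sum_prob_range[OF joint_measurable r])
  have PB: "PB b = M.prob {x \<in> space ?M. \<forall>i<n. \<beta> (xkey x i) = b ! i}" for b
    unfolding PB_def bprob_def using box_prob(1)[OF D, of "\<lambda>i. {k. \<beta> k = b ! i}"] meas by simp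
  have PPB: "P (b, \<pi>) \<le> PB b" for b \<pi>
    unfolding P_def PB
  proof (rule M.finite_measure_mono)
    show "?W -` {(b, \<pi>)} \<inter> space ?M \<subseteq> {x \<in> space ?M. \<forall>i<n. \<beta> (xkey x i) = b ! i}"
      by (auto simp: bvec_def)
    show "{x \<in> space ?M. \<forall>i<n. \<beta> (xkey x i) = b ! i} \<in> M.events"
    proof -
      have "{x \<in> space ?M. \<forall>i<n. xkey x i \<in> {k. \<beta> k = b ! i}} \<in> M.events"
        by (rule box_prob(2)[OF D]) (rule meas)
      then show ?thesis by (simp only: mem_Collect_eq)
    qed
  qed
  have PPP: "P (b, \<pi>) \<le> PP \<pi>" for b \<pi>
    unfolding P_def PP_def
    by (rule M.finite_measure_mono) (use measurable_sets[OF rank_perm_measurable[OF D], of "{\<pi>}"] in auto)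
  have P0: "0 \<le> P \<omega>" "0 \<le> PP \<pi>" "0 \<le> PB b" for \<omega> \<pi> b
    unfolding PB by (simp_all add: P_def PP_def)
  have N0: "0 < N" by (simp add: N_def)
  have cardN: "real (card {b. (b, \<pi>) \<in> \<Omega>}) \<le> N" for \<pi>
  proof -
    let ?s = "\<lambda>b. (\<lambda>i. b ! i + \<pi> ! i) ` {..<n}"
    have "inj_on ?s {b. (b, \<pi>) \<in> \<Omega>}"
    proof (rule inj_onI)
      fix b b' assume "b \<in> {b. (b, \<pi>) \<in> \<Omega>}" "b' \<in> {b. (b, \<pi>) \<in> \<Omega>}" and s: "?s b = ?s b'"
      then obtain x y where x: "b = bvec x" "\<pi> = rank_perm n x" and y: "b' = bvec y" "\<pi> = rank_perm n y"
        by (auto simp: \<Omega>_def)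
      have sx: "?s b = (\<lambda>i. \<beta> (xkey x i) + rank_perm n x ! i) ` {..<n}"
        by (rule image_cong) (simp_all add: x(1) bvec_def x(2)[symmetric])
      have sy: "?s b' = (\<lambda>i. \<beta> (xkey y i) + rank_perm n y ! i) ` {..<n}"
        by (rule image_cong) (simp_all add: y(1) bvec_def y(2)[symmetric])
      have "\<beta> (xkey x i) = \<beta> (xkey y i)" if "i < n" for i
        by (rule bucket_vector_unique[OF mono mono _ _ that]) (use x y s sx sy in auto)
      then show "b = b'" by (simp add: x(1) y(1) bvec_def)
    qed
    \<comment> \<open>Bucket numbers are at most \<open>n\<close> and ranks are below
      \<open>n\<close>, so the sets that encode the vectors are subsets of \<open>2 * n\<close>
      points.\<close>
    moreover have "?s ` {b. (b, \<pi>) \<in> \<Omega>} \<subseteq> Pow {..<2 * n}"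
    proof (rule image_subsetI)
      fix b assume "b \<in> {b. (b, \<pi>) \<in> \<Omega>}"
      then obtain x where x: "b = bvec x" "\<pi> = rank_perm n x" by (auto simp: \<Omega>_def)
      have "b ! i + \<pi> ! i < 2 * n" if i: "i < n" for i
      proof -
        have "{j. j < n \<and> xkey x j < xkey x i} \<subseteq> {..<n} - {i}" by auto
        then have "card {j. j < n \<and> xkey x j < xkey x i} \<le> card ({..<n} - {i})" by (rule card_mono[rotated]) simp
        then have "\<pi> ! i < n" using i by (simp add: x(2) rank_perm_nth)
        moreover have "b ! i \<le> n" using i le by (simp add: x(1) bvec_def)
        ultimately show ?thesis by simp
      qed
      then show "?s b \<in> Pow {..<2 * n}" by auto
    qed
    ultimately have "card {b. (b, \<pi>) \<in> \<Omega>} \<le> card (Pow {..<2 * n})" by (rule card_inj_on_le) simp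
    then have "real (card {b. (b, \<pi>) \<in> \<Omega>}) \<le> real (2 ^ (2 * n))" by (simp add: card_Pow)
    then show ?thesis by (simp add: N_def)
  qed
  define Q where "Q \<omega> = P \<omega> * PP (snd \<omega>) / (N * PB (fst \<omega>))" for \<omega>
  have QP: "Q (b, \<pi>) \<le> PP \<pi> / N" for b \<pi>
  proof (cases "PB b = 0")
    case False
    then have "0 < PB b" using P0(3)[of b] by simp
    then have "P (b, \<pi>) / PB b \<le> 1" using PPB by simp
    then have "P (b, \<pi>) / PB b * (PP \<pi> / N) \<le> 1 * (PP \<pi> / N)"
      using P0 N0 by (intro mult_right_mono) auto
    then show ?thesis by (simp add: Q_def field_simps)
  qed (use P0 N0 in \<open>simp add: Q_def\<close>)
  have "sum Q \<Omega> \<le> (\<Sum>\<omega>\<in>\<Omega>. PP (snd \<omega>) / N)"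
  proof (rule sum_mono)
    fix \<omega>
    show "Q \<omega> \<le> PP (snd \<omega>) / N" using QP[of "fst \<omega>" "snd \<omega>"] by simp
  qed
  also have "\<dots> = (\<Sum>\<pi>\<in>snd ` \<Omega>. \<Sum>\<omega>\<in>{\<omega>\<in>\<Omega>. snd \<omega> = \<pi>}. PP (snd \<omega>) / N)"
    by (rule sum.group[symmetric]) (use fin in auto)
  also have "\<dots> \<le> (\<Sum>\<pi>\<in>snd ` \<Omega>. PP \<pi>)"
  proof (rule sum_mono)
    fix \<pi>
    have "{\<omega>\<in>\<Omega>. snd \<omega> = \<pi>} = (\<lambda>b. (b, \<pi>)) ` {b. (b, \<pi>) \<in> \<Omega>}" by force
    then have "card {\<omega>\<in>\<Omega>. snd \<omega> = \<pi>} = card {b. (b, \<pi>) \<in> \<Omega>}" by (simp add: card_image inj_on_def)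
    then have "(\<Sum>\<omega>\<in>{\<omega>\<in>\<Omega>. snd \<omega> = \<pi>}. PP (snd \<omega>) / N) = real (card {b. (b, \<pi>) \<in> \<Omega>}) * (PP \<pi> / N)" by simp
    also have "\<dots> \<le> N * (PP \<pi> / N)" using cardN P0 N0 by (intro mult_right_mono) auto
    also have "\<dots> = PP \<pi>" using N0 by simp
    finally show "(\<Sum>\<omega>\<in>{\<omega>\<in>\<Omega>. snd \<omega> = \<pi>}. PP (snd \<omega>) / N) \<le> PP \<pi>" .
  qed
  also have "\<dots> = 1"
  proof -
    have "snd ` \<Omega> = rank_perm n ` space ?M" by (force simp: \<Omega>_def)
    then show ?thesis
      unfolding PP_def using M.sum_prob_range[OF rank_perm_measurable[OF D] finite_range_rank_perm order_refl] by simp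
  qed
  finally have sumQ: "sum Q \<Omega> \<le> sum P \<Omega>" using sumP by simp
  have pos: "0 < PP (snd \<omega>) \<and> 0 < PB (fst \<omega>)" if "0 < P \<omega>" for \<omega>
    using that PPB[of "fst \<omega>" "snd \<omega>"] PPP[of "fst \<omega>" "snd \<omega>"] by simp
  have "(\<Sum>\<omega>\<in>\<Omega>. P \<omega> * log 2 (Q \<omega> / P \<omega>)) \<le> 0"
    by (rule gibbs) (use P0 N0 pos sumQ in \<open>auto simp: Q_def intro!: divide_pos_pos mult_pos_pos\<close>)
  moreover have "P \<omega> * log 2 (Q \<omega> / P \<omega>) =
      (\<Sum>i<n. log 2 (1 / bprob i (fst \<omega> ! i))) * P \<omega> - log 2 (1 / PP (snd \<omega>)) * P \<omega> - 2 * real n * P \<omega>" for \<omega>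
  proof (cases "P \<omega> = 0")
    case False
    then have p: "0 < P \<omega>" using P0(1)[of \<omega>] by simp
    have "PB (fst \<omega>) \<noteq> 0" using pos[OF p] by simp
    then have bp: "0 < bprob i (fst \<omega> ! i)" if "i < n" for i
      using that by (auto simp: PB_def bprob_def zero_less_measure_iff)
    have bp0: "bprob i (fst \<omega> ! i) \<noteq> 0" if "i < n" for i using bp[OF that] by simp
    have "(\<Sum>i<n. log 2 (1 / bprob i (fst \<omega> ! i))) = - (\<Sum>i<n. log 2 (bprob i (fst \<omega> ! i)))"
      unfolding sum_negf[symmetric]
    proof (rule sum.cong[OF refl])
      fix i assume "i \<in> {..<n}"
      then have "0 < bprob i (fst \<omega> ! i)" using bp by simp
      then show "log 2 (1 / bprob i (fst \<omega> ! i)) = - log 2 (bprob i (fst \<omega> ! i))" by (simp add: log_divide)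
    qed
    also have "(\<Sum>i<n. log 2 (bprob i (fst \<omega> ! i))) = log 2 (PB (fst \<omega>))"
      unfolding PB_def log_def by (subst ln_prod) (use bp bp0 in \<open>auto simp: sum_divide_distrib\<close>)
    finally have e1: "(\<Sum>i<n. log 2 (1 / bprob i (fst \<omega> ! i))) = - log 2 (PB (fst \<omega>))" .
    have "Q \<omega> / P \<omega> = PP (snd \<omega>) / (N * PB (fst \<omega>))" using p by (simp add: Q_def)
    then have "log 2 (Q \<omega> / P \<omega>) = log 2 (PP (snd \<omega>)) - (log 2 N + log 2 (PB (fst \<omega>)))"
      using pos[OF p] N0 by (simp add: log_divide log_mult)
    also have "log 2 N = 2 * real n" by (simp add: N_def log_nat_power)
    finally have e2: "log 2 (Q \<omega> / P \<omega>) = log 2 (PP (snd \<omega>)) - (2 * real n + log 2 (PB (fst \<omega>)))" .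
    have e3: "log 2 (1 / PP (snd \<omega>)) = - log 2 (PP (snd \<omega>))" using pos[OF p] by (simp add: log_divide)
    show ?thesis unfolding e1 e2 e3 by (simp add: algebra_simps)
  qed simp
  ultimately have "(\<Sum>\<omega>\<in>\<Omega>. (\<Sum>i<n. log 2 (1 / bprob i (fst \<omega> ! i))) * P \<omega>) \<le>
      (\<Sum>\<omega>\<in>\<Omega>. log 2 (1 / PP (snd \<omega>)) * P \<omega>) + 2 * real n * sum P \<Omega>"
    by (simp add: sum_subtractf sum_distrib_left)
  moreover have "(\<Sum>\<omega>\<in>\<Omega>. log 2 (1 / PP (snd \<omega>)) * P \<omega>) = perm_entropy n D"
  proof -
    have "(\<Sum>\<omega>\<in>\<Omega>. log 2 (1 / PP (snd \<omega>)) * P \<omega>) = (\<integral>x. log 2 (1 / PP (rank_perm n x)) \<partial>?M)"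
      using M.expectation_finite_range(2)[OF joint_measurable r, of "\<lambda>\<omega>. log 2 (1 / PP (snd \<omega>))"] by (simp add: P_def)
    also have "\<dots> = (\<Sum>\<pi>\<in>rank_perm n ` space ?M. log 2 (1 / PP \<pi>) * PP \<pi>)"
      using M.expectation_finite_range(2)[OF rank_perm_measurable[OF D] finite_range_rank_perm order_refl,
          of "\<lambda>\<pi>. log 2 (1 / PP \<pi>)"] by (simp add: PP_def)
    also have "\<dots> = perm_entropy n D"
      unfolding perm_entropy_eq_sum[OF D] PP_def by (simp add: mult.commute)
    finally show ?thesis .
  qed
  moreover have "(\<Sum>\<omega>\<in>\<Omega>. (\<Sum>i<n. log 2 (1 / bprob i (fst \<omega> ! i))) * P \<omega>) =
      (\<Sum>i<n. \<Sum>b\<le>n. log 2 (1 / bprob i b) * bprob i b)"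
  proof -
    have "(\<Sum>\<omega>\<in>\<Omega>. (\<Sum>i<n. log 2 (1 / bprob i (fst \<omega> ! i))) * P \<omega>) =
      (\<integral>x. (\<Sum>i<n. log 2 (1 / bprob i (bvec x ! i))) \<partial>?M)"
      using M.expectation_finite_range(2)[OF joint_measurable r, of "\<lambda>\<omega>. \<Sum>i<n. log 2 (1 / bprob i (fst \<omega> ! i))"]
      by (simp add: P_def)
    also have "\<dots> = (\<integral>x. (\<Sum>i<n. log 2 (1 / bprob i (\<beta> (xkey x i)))) \<partial>?M)"
      by (rule Bochner_Integration.integral_cong[OF refl], rule sum.cong) (auto simp: bvec_def)
    also have "\<dots> = (\<Sum>i<n. \<integral>x. log 2 (1 / bprob i (\<beta> (xkey x i))) \<partial>?M)"
      by (rule Bochner_Integration.integral_sum) (use expectation_bucket(1) in auto)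
    also have "\<dots> = (\<Sum>i<n. \<Sum>b\<le>n. log 2 (1 / bprob i b) * bprob i b)"
      by (rule sum.cong) (use expectation_bucket(2)[of _ "\<lambda>b. log 2 (1 / bprob _ b)"] in auto)
    finally show ?thesis .
  qed
  ultimately show ?thesis using sumP by simp
qed

text \<open>The diagonal contributes 1 per coordinate. Off the diagonal, independence gives the
  products \<open>bprob i b * bprob j b\<close>; their sum over \<open>j\<close> is at most
  \<open>B * bprob i b\<close>, and the sum over \<open>b\<close> then at most
  \<open>B\<close>.\<close>

lemma expected_pairs:
  assumes B: "\<And>b. b \<le> n \<Longrightarrow> (\<Sum>j<n. bprob j b) \<le> B"
  shows "integrable (input_law n D) (\<lambda>x. real (\<Sum>i<n. card {j. j < n \<and> \<beta> (xkey x j) = \<beta> (xkey x i)}))"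
    "(\<integral>x. real (\<Sum>i<n. card {j. j < n \<and> \<beta> (xkey x j) = \<beta> (xkey x i)}) \<partial>input_law n D) \<le> (1 + B) * real n"
proof -
  let ?M = "input_law n D"
  define E where "E i j b = {x \<in> space ?M. \<beta> (xkey x i) = b \<and> \<beta> (xkey x j) = b}" for i j b
  have Es: "E i j b \<in> M.events" if "i < n" "j < n" for i j b
  proof -
    have "E i j b = {x \<in> space ?M. \<beta> (xkey x i) = b} \<inter> {x \<in> space ?M. \<beta> (xkey x j) = b}" by (auto simp: E_def)
    then show ?thesis using bprob_sets[OF that(1), of b] bprob_sets[OF that(2), of b] by simp
  qed
  have eq: "real (\<Sum>i<n. card {j. j < n \<and> \<beta> (xkey x j) = \<beta> (xkey x i)}) = (\<Sum>i<n. \<Sum>j<n. \<Sum>b\<le>n. indicator (E i j b) x)"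
    if x: "x \<in> space ?M" for x
  proof -
    have "real (card {j. j < n \<and> \<beta> (xkey x j) = \<beta> (xkey x i)}) = (\<Sum>j<n. if \<beta> (xkey x j) = \<beta> (xkey x i) then 1 else 0)" for i
    proof -
      have "{j. j < n \<and> \<beta> (xkey x j) = \<beta> (xkey x i)} = {j \<in> {..<n}. \<beta> (xkey x j) = \<beta> (xkey x i)}" by auto
      then show ?thesis by (simp add: sum.inter_filter[symmetric])
    qed
    moreover have "(if \<beta> (xkey x j) = \<beta> (xkey x i) then 1 else 0) = (\<Sum>b\<le>n. indicator (E i j b) x :: real)" for i j
    proof -
      have "(\<Sum>b\<le>n. indicator (E i j b) x :: real) = (\<Sum>b\<le>n. if b = \<beta> (xkey x i) then (if \<beta> (xkey x j) = \<beta> (xkey x i) then 1 else 0) else 0)"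
        by (rule sum.cong) (use x in \<open>auto simp: E_def\<close>)
      also have "\<dots> = (if \<beta> (xkey x j) = \<beta> (xkey x i) then 1 else 0)" using le by (subst sum.delta) auto
      finally show ?thesis ..
    qed
    ultimately show ?thesis by simp
  qed
  have int: "integrable ?M (indicator (E i j b) :: _ \<Rightarrow> real)" if "i < n" "j < n" for i j b
    using Es[OF that] by (intro integrable_real_indicator) (auto simp: M.emeasure_eq_measure)
  have int2: "integrable ?M (\<lambda>x. \<Sum>i<n. \<Sum>j<n. \<Sum>b\<le>n. indicator (E i j b) x :: real)"
    by (intro Bochner_Integration.integrable_sum) (use int in auto)
  show "integrable ?M (\<lambda>x. real (\<Sum>i<n. card {j. j < n \<and> \<beta> (xkey x j) = \<beta> (xkey x i)}))"
    by (subst Bochner_Integration.integrable_cong[OF refl eq]) (use int2 in auto)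
  have "(\<integral>x. real (\<Sum>i<n. card {j. j < n \<and> \<beta> (xkey x j) = \<beta> (xkey x i)}) \<partial>?M) =
     (\<integral>x. (\<Sum>i<n. \<Sum>j<n. \<Sum>b\<le>n. indicator (E i j b) x) \<partial>?M)"
    by (rule Bochner_Integration.integral_cong[OF refl eq])
  also have "\<dots> = (\<Sum>i<n. \<integral>x. (\<Sum>j<n. \<Sum>b\<le>n. indicator (E i j b) x) \<partial>?M)"
    by (rule Bochner_Integration.integral_sum) (intro Bochner_Integration.integrable_sum, use int in auto)
  also have "\<dots> = (\<Sum>i<n. \<Sum>j<n. \<integral>x. (\<Sum>b\<le>n. indicator (E i j b) x) \<partial>?M)"
    by (intro sum.cong refl Bochner_Integration.integral_sum Bochner_Integration.integrable_sum) (use int in auto)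
  also have "\<dots> = (\<Sum>i<n. \<Sum>j<n. \<Sum>b\<le>n. \<integral>x. indicator (E i j b) x \<partial>?M)"
    by (intro sum.cong refl Bochner_Integration.integral_sum) (use int in auto)
  also have "\<dots> = (\<Sum>i<n. \<Sum>j<n. \<Sum>b\<le>n. M.prob (E i j b))"
  proof (intro sum.cong refl)
    fix i j b
    have "E i j b \<inter> space ?M = E i j b" by (auto simp: E_def)
    then show "(\<integral>x. indicator (E i j b) x \<partial>?M) = M.prob (E i j b)" by simp
  qed
  also have "\<dots> \<le> (\<Sum>i<n. \<Sum>j<n. \<Sum>b\<le>n. (if i = j then bprob i b else 0) + bprob i b * bprob j b)"
  proof (intro sum_mono)
    fix i j b assume "i \<in> {..<n}" "j \<in> {..<n}"
    then have ij: "i < n" "j < n" by auto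
    show "M.prob (E i j b) \<le> (if i = j then bprob i b else 0) + bprob i b * bprob j b"
    proof (cases "i = j")
      case True
      then have "M.prob (E i j b) = bprob i b" using bprob_eq[OF ij(1), of b] by (simp add: E_def)
      then show ?thesis using True by (simp add: bprob_def)
    next
      case False
      then show ?thesis using bprob_pair[OF ij False, of b] by (simp add: E_def)
    qed
  qed
  also have "\<dots> = (\<Sum>i<n. \<Sum>b\<le>n. bprob i b + bprob i b * (\<Sum>j<n. bprob j b))"
  proof (rule sum.cong[OF refl])
    fix i assume i: "i \<in> {..<n}"
    have "(\<Sum>j<n. \<Sum>b\<le>n. (if i = j then bprob i b else 0) + bprob i b * bprob j b) =
      (\<Sum>b\<le>n. \<Sum>j<n. (if i = j then bprob i b else 0) + bprob i b * bprob j b)" by (rule sum.swap)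
    also have "\<dots> = (\<Sum>b\<le>n. bprob i b + bprob i b * (\<Sum>j<n. bprob j b))"
      by (rule sum.cong) (use i in \<open>auto simp: sum.distrib sum_distrib_left\<close>)
    finally show "(\<Sum>j<n. \<Sum>b\<le>n. (if i = j then bprob i b else 0) + bprob i b * bprob j b) =
      (\<Sum>b\<le>n. bprob i b + bprob i b * (\<Sum>j<n. bprob j b))" .
  qed
  also have "\<dots> \<le> (\<Sum>i<n. \<Sum>b\<le>n. (1 + B) * bprob i b)"
  proof (intro sum_mono)
    fix i b assume "b \<in> {..n}"
    then have "bprob i b * (\<Sum>j<n. bprob j b) \<le> bprob i b * B" using B by (intro mult_left_mono) (auto simp: bprob_def)
    then show "bprob i b + bprob i b * (\<Sum>j<n. bprob j b) \<le> (1 + B) * bprob i b" by (simp add: algebra_simps)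
  qed
  also have "\<dots> = (\<Sum>i<n. (1 + B) * (\<Sum>b\<le>n. bprob i b))" by (simp add: sum_distrib_left)
  also have "\<dots> = (1 + B) * real n" using sum_bprob by simp
  finally show "(\<integral>x. real (\<Sum>i<n. card {j. j < n \<and> \<beta> (xkey x j) = \<beta> (xkey x i)}) \<partial>?M) \<le> (1 + B) * real n" .
qed

end

section \<open>The limiting running time\<close>

lemma key_measurable_empty [simp, intro]: "key_measurable {}"
  by (simp add: key_measurable_def)

lemma key_measurable_Un:
  assumes "key_measurable A" "key_measurable B"
  shows "key_measurable (A \<union> B)"
proof -
  have "{v. Key v i \<in> A \<union> B} = {v. Key v i \<in> A} \<union> {v. Key v i \<in> B}" for i by auto
  then show ?thesis using assms by (simp add: key_measurable_def sets.Un)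
qed

context ram
begin

lemma mono_bk: "mono (bk L)"
proof (rule monoI)
  fix k k' :: key assume "k \<le> k'"
  then show "bk L k \<le> bk L k'" unfolding bk_def by (intro card_mono) auto
qed

definition bucket_above :: "(nat \<Rightarrow> key) \<Rightarrow> nat \<Rightarrow> key set" where
  "bucket_above L b = (if b = n then UNIV else {..<L (b * lam)})"

text \<open>The lower boundary of a bucket may be repeated in the merged list; without it, a bucket
  contains at most \<open>lam\<close> of the merged keys, and as keys carry their coordinate, a single key has
  mass at most 1.\<close>

definition bucket_open :: "(nat \<Rightarrow> key) \<Rightarrow> nat \<Rightarrow> key set" where
  "bucket_open L b = (if b = 0 then UNIV else {L ((b - 1) * lam)<..}) \<inter> bucket_above L b"

lemma bucket_eq:
  assumes "vsorted L" "b \<le> n"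
  shows "{k. bk L k = b} = (if b = 0 then UNIV else {L ((b - 1) * lam)..}) \<inter> bucket_above L b"
proof (rule set_eqI)
  fix k
  have 1: "L ((b - 1) * lam) \<le> k \<longleftrightarrow> b \<le> bk L k" if "0 < b"
  proof -
    have "b - 1 < n" using that assms(2) by linarith
    then have "L ((b - 1) * lam) \<le> k \<longleftrightarrow> b - 1 < bk L k" by (rule bk_iff[OF assms(1)])
    then show ?thesis using that by linarith
  qed
  have 2: "k < L (b * lam) \<longleftrightarrow> bk L k \<le> b" if "b < n"
  proof -
    have "\<not> L (b * lam) \<le> k \<longleftrightarrow> \<not> b < bk L k" using bk_iff[OF assms(1) that, of k] by simp
    then show ?thesis by (simp only: not_le not_less)
  qed
  show "k \<in> {k. bk L k = b} \<longleftrightarrow> k \<in> (if b = 0 then UNIV else {L ((b - 1) * lam)..}) \<inter> bucket_above L b"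
  proof (cases "b = 0"; cases "b = n")
    assume "b \<noteq> 0" "b \<noteq> n"
    then show ?thesis using 1 2 assms(2) by (auto simp: bucket_above_def)
  next
    assume "b \<noteq> 0" "b = n"
    then show ?thesis using 1 bk_le[of L k] by (auto simp: bucket_above_def)
  next
    assume "b = 0" "b \<noteq> n"
    then show ?thesis using 2 assms(2) by (auto simp: bucket_above_def)
  next
    assume "b = 0" "b = n"
    then show ?thesis using n by simp
  qed
qed

lemma bucket_measurable: "vsorted L \<Longrightarrow> key_measurable {k. bk L k = b}"
proof (cases "b \<le> n")
  case False
  then have "{k. bk L k = b} = {}" using bk_le[of L] by auto
  then show ?thesis by simp
qed (simp add: bucket_eq bucket_above_def)

lemma bucket_open_measurable: "key_measurable (bucket_open L b)"
  by (simp add: bucket_open_def bucket_above_def)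

lemma bucket_convex: "convex_keys {k. bk L k = b}"
  unfolding convex_keys_def
proof (intro allI impI)
  fix x y z assume *: "x \<in> {k. bk L k = b}" "z \<in> {k. bk L k = b}" "x \<le> y" "y \<le> z"
  have "bk L x \<le> bk L y" "bk L y \<le> bk L z" by (rule monoD[OF mono_bk *(3)], rule monoD[OF mono_bk *(4)])
  then show "y \<in> {k. bk L k = b}" using * by simp
qed

lemma bucket_open_convex: "convex_keys (bucket_open L b)"
  unfolding convex_keys_def bucket_open_def bucket_above_def
  by (auto intro: less_le_trans le_less_trans)

end

context alg
begin

lemma sample_round_less: "s < t \<Longrightarrow> sample_round s + s < sample_round t"
proof -
  have half: "(a + 2 * b) div 2 = a div 2 + b" for a b :: nat by simp
  assume "s < t"
  then have "(s + 1) * (s + 2) \<le> t * (t + 1)" by (intro mult_mono) auto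
  moreover have "(s + 1) * (s + 2) = s * (s + 1) + 2 * (s + 1)" by simp
  ultimately have "(s * (s + 1) + 2 * (s + 1)) div 2 \<le> t * (t + 1) div 2" by (intro div_le_mono) linarith
  moreover have "(s * (s + 1) + 2 * (s + 1)) div 2 = s * (s + 1) div 2 + (s + 1)"
    by (rule half)
  ultimately have "s * (s + 1) div 2 + (s + 1) \<le> t * (t + 1) div 2" by linarith
  then show ?thesis unfolding sample_round_def by linarith
qed

text \<open>Different samples come from different rounds and are therefore independent; hits over
  the set of these rounds count every sample once.\<close>

lemma inj_sample_round: "inj_on sample_round A"
proof (rule inj_onI)
  fix s t assume "sample_round s = sample_round t"
  then show "s = t" using sample_round_less[of s t] sample_round_less[of t s] by (cases s t rule: linorder_cases) auto
qed

text \<open>In the sorted list, the entries in the interior of bucket \<open>b\<close> occupy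
  positions from \<open>(b - 1) * lam\<close> to below \<open>b * lam\<close>. The property
  \<open>merged\<close>, applied to an indicator, translates hits of the inputs into such
  positions.\<close>

lemma hits_bucket_open:
  assumes "merged J lam p" "b \<le> n"
  shows "hits J {..<lam} {..<n} (bucket_open (lkey p) b) \<le> lam"
proof -
  let ?O = "bucket_open (lkey p) b" and ?f = "\<lambda>k. if k \<in> bucket_open (lkey p) b then 1 else 0 :: nat"
  have srt: "lkey p t \<le> lkey p u" if "t \<le> u" "u < lam * n" for t u
    using assms(1) that unfolding merged_def by (cases "t = u") auto
  have "hits J {..<lam} {..<n} ?O = (\<Sum>r<lam. \<Sum>i<n. ?f (xkey (J r) i))"
    unfolding hits_def by (intro sum.cong refl) (simp add: sum.inter_filter[symmetric])
  also have "\<dots> = (\<Sum>t<lam * n. ?f (lkey p t))"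
    using assms(1) unfolding merged_def by (elim conjE allE[of _ ?f]) simp
  also have "\<dots> = card {t \<in> {..<lam * n}. lkey p t \<in> ?O}" by (simp add: sum.inter_filter[symmetric])
  also have "\<dots> \<le> card {(b - 1) * lam..<b * lam}"
  proof (rule card_mono)
    show "{t \<in> {..<lam * n}. lkey p t \<in> ?O} \<subseteq> {(b - 1) * lam..<b * lam}"
    proof
      fix t assume t: "t \<in> {t \<in> {..<lam * n}. lkey p t \<in> ?O}"
      have "(b - 1) * lam \<le> t"
      proof (rule ccontr)
        assume c: "\<not> (b - 1) * lam \<le> t"
        then have b: "b \<noteq> 0" by (cases b) auto
        have "(b - 1) * lam < n * lam" using b assms(2) Lg_pos by (intro mult_strict_right_mono) (auto simp: lam)
        then have "lkey p t \<le> lkey p ((b - 1) * lam)" using c by (intro srt) (auto simp: mult.commute)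
        moreover have "lkey p ((b - 1) * lam) < lkey p t" using t b by (simp add: bucket_open_def)
        ultimately show False by order
      qed
      moreover have "t < b * lam"
      proof (cases "b = n")
        case True
        then show ?thesis using t by (simp add: mult.commute)
      next
        case False
        show ?thesis
        proof (rule ccontr)
          assume c: "\<not> t < b * lam"
          then have "lkey p (b * lam) \<le> lkey p t" using t by (intro srt) auto
          moreover have "lkey p t < lkey p (b * lam)" using t False by (simp add: bucket_open_def bucket_above_def)
          ultimately show False by order
        qed
      qed
      ultimately show "t \<in> {(b - 1) * lam..<b * lam}" by simp
    qed
  qed simp
  also have "\<dots> \<le> lam" by (cases b) (simp_all add: algebra_simps)
  finally show ?thesis .
qed

lemma hits_bucket:
  assumes "sampled J ms 0 p" "i < n"
  shows "hits J (sample_round ` {..<ms}) {i} {k. bk (lkey p) k = b} = card {a. a < ms \<and> row p i a = b}"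
proof -
  let ?f = "\<lambda>v. if v = b then 1 else 0 :: nat"
  have "hits J (sample_round ` {..<ms}) {i} {k. bk (lkey p) k = b} =
      (\<Sum>t<ms. card {i' \<in> {i}. bk (lkey p) (Key (J (sample_round t) i') i') = b})"
    unfolding hits_def by (subst sum.reindex[OF inj_sample_round]) simp
  also have "\<dots> = (\<Sum>t<ms. ?f (bk (lkey p) (xkey (J (sample_round t)) i)))"
  proof (rule sum.cong[OF refl])
    fix t
    have "{i' \<in> {i}. bk (lkey p) (Key (J (sample_round t) i') i') = b} =
      (if bk (lkey p) (xkey (J (sample_round t)) i) = b then {i} else {})" by auto
    then show "card {i' \<in> {i}. bk (lkey p) (Key (J (sample_round t) i') i') = b} =
      ?f (bk (lkey p) (xkey (J (sample_round t)) i))" by simp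
  qed
  also have "\<dots> = (\<Sum>a<ms. ?f (row p i a))" by (rule sampled_sum[OF assms, symmetric])
  also have "\<dots> = card {a. a < ms \<and> row p i a = b}"
  proof -
    have "{a. a < ms \<and> row p i a = b} = {a \<in> {..<ms}. row p i a = b}" by auto
    then show ?thesis by (simp add: sum.inter_filter[symmetric])
  qed
  finally show ?thesis .
qed

definition search_cost :: "mem \<Rightarrow> nat \<Rightarrow> nat \<Rightarrow> nat" where
  "search_cost p i b = 150 * search_depth (card {a. a < ms \<and> row p i a = b}) +
     (if card {a. a < ms \<and> row p i a = b} = 0 then 100 * Lg + 100 else 0)"

text \<open>Frequent buckets are found early in the sorted sample; for the others the full
  binary search is affordable, as their entropy contribution is already of order \<open>log n / Q\<close>.\<close>

lemma search_cost_le: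
  assumes P: "0 < P" "P \<le> 1" and Q0: "Q = 4 * q" "1 \<le> q"
    and freq: "\<And>l. l \<le> Lg div Q \<Longrightarrow> 3 * (1 / 2) ^ l \<le> P \<Longrightarrow>
      real ms * (1 / 2) ^ l / 4 < real (card {a. a < ms \<and> row p i a = b})"
  shows "real (search_cost p i b) \<le> 1600 * real q * (log 2 (1 / P) + 4)"
proof -
  define C where "C = card {a. a < ms \<and> row p i a = b}"
  define K where "K = Lg div Q"
  have log0: "0 \<le> log 2 (1 / P)" using P by (simp add: zero_le_log_cancel_iff)
  have q1: "1 \<le> real q" using Q0 by simp
  \<comment> \<open>The summand 2 comes from \<open>3 < 4 = 2 ^ 2\<close>.\<close>
  have small: "real l < log 2 (1 / P) + 2" if "P < 3 * (1 / 2) ^ l" for l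
  proof -
    have "2 ^ l < 3 / P" using that P by (simp add: power_one_over field_simps)
    also have "\<dots> < 4 * (1 / P)" using P by (simp add: field_simps)
    finally have "log 2 (2 ^ l) < log 2 (4 * (1 / P))" using P by (subst log_less_cancel_iff) auto
    also have "\<dots> = log 2 4 + log 2 (1 / P)" using P by (subst log_mult) auto
    also have "log 2 4 = (2 :: real)" using log_nat_power[of 2 2 2] by simp
    finally show ?thesis by (simp add: log_nat_power)
  qed
  show ?thesis
  proof (cases "3 * (1 / 2) ^ K \<le> P")
    case True
    \<comment> \<open>The smallest level that \<open>P\<close> passes is positive because
      \<open>P \<le> 1 < 3\<close>. Failure at level \<open>l - 1\<close> bounds \<open>l\<close> by
      \<open>log 2 (1 / P) + 3\<close>, and \<open>freq\<close> at level \<open>l\<close> bounds the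
      search depth by \<open>l + 2\<close>.\<close>
    define l where "l = (LEAST l. 3 * (1 / 2) ^ l \<le> P)"
    have l: "3 * (1 / 2) ^ l \<le> P" unfolding l_def by (rule LeastI) (rule True)
    have lK: "l \<le> K" unfolding l_def by (rule Least_le) (rule True)
    have "l \<noteq> 0"
    proof
      assume "l = 0"
      then have "3 \<le> P" using l by simp
      then show False using P by simp
    qed
    then have "l - 1 < l" by simp
    then have "\<not> 3 * (1 / 2) ^ (l - 1) \<le> P" unfolding l_def by (rule not_less_Least)
    then have "real (l - 1) < log 2 (1 / P) + 2" by (intro small) simp
    then have ll: "real l < log 2 (1 / P) + 3" using \<open>l \<noteq> 0\<close> by simp
    have C: "real ms * (1 / 2) ^ l / 4 < real C" unfolding C_def by (rule freq) (use lK l in \<open>simp_all add: K_def\<close>)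
    then have "real ms < real C * (4 * 2 ^ l)" by (simp add: power_one_over field_simps)
    also have "\<dots> = real (C * 2 ^ (l + 2))" by (simp add: power_add)
    finally have ms: "ms < C * 2 ^ (l + 2)" by (rule of_nat_less_imp_less)
    then have C0: "C \<noteq> 0" by (cases C) auto
    have "search_depth C \<le> l + 2"
      unfolding search_depth_def by (rule Least_le) (use ms C0 in \<open>simp add: max_def\<close>)
    then have "search_cost p i b \<le> 150 * (l + 2)" unfolding search_cost_def C_def[symmetric] using C0 by simp
    then have "real (search_cost p i b) \<le> real (150 * (l + 2))" by (rule of_nat_mono)
    also have "\<dots> \<le> 1600 * 1 * (log 2 (1 / P) + 4)" using ll log0 by simp
    also have "\<dots> \<le> 1600 * real q * (log 2 (1 / P) + 4)" using q1 log0 by (intro mult_right_mono mult_left_mono) auto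
    finally show ?thesis .
  next
    case False
    then have K: "real K < log 2 (1 / P) + 2" by (intro small) simp
    \<comment> \<open>\<open>K\<close> is \<open>Lg\<close> divided by \<open>4 * q\<close>. As
      level \<open>K\<close> fails, \<open>Lg\<close> is less than
      \<open>4 * q * (log 2 (1 / P) + 3)\<close>, and the cost of a full search, linear in
      \<open>Lg\<close>, is covered.\<close>
    have "Lg \<le> 4 * q * (K + 1)"
    proof -
      have "Lg = Lg div Q * Q + Lg mod Q" by simp
      moreover have "Lg mod Q < Q" using Q0 by (intro mod_less_divisor) simp
      ultimately have "Lg \<le> K * Q + Q" unfolding K_def by linarith
      then show ?thesis by (simp add: Q0 algebra_simps)
    qed
    then have Lq: "real Lg \<le> real (4 * q * (K + 1))" by (rule of_nat_mono)
    define w where "w = real q * (real K + 1)"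
    have Lw: "real Lg \<le> 4 * w" using Lq by (simp add: w_def algebra_simps)
    have "search_cost p i b \<le> 150 * (2 * Lg + 6) + (100 * Lg + 100)"
      unfolding search_cost_def using search_depth_le[of "card {a. a < ms \<and> row p i a = b}"] by simp
    then have "real (search_cost p i b) \<le> real (150 * (2 * Lg + 6) + (100 * Lg + 100))" by (rule of_nat_mono)
    also have "\<dots> = 400 * real Lg + 1000" by simp
    also have "\<dots> \<le> 400 * (4 * w) + 1000 * real q" using Lw q1 by linarith
    also have "\<dots> = 400 * (4 * real q * (real K + 1)) + 1000 * real q" by (simp add: w_def)
    also have "\<dots> = real q * (1600 * (real K + 1) + 1000)" by (simp add: algebra_simps)
    also have "\<dots> \<le> real q * (1600 * (log 2 (1 / P) + 4))" using K q1 by (intro mult_left_mono) auto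
    finally show ?thesis by (simp add: algebra_simps)
  qed
qed

end

text \<open>A key names its coordinate, so at most one summand is nonzero, even where distributions
  have atoms in common.\<close>

lemma mass_point_le:
  assumes "finite I" "\<And>i. i \<in> I \<Longrightarrow> prob_space (D i)"
  shows "mass D I {k..k} \<le> 1"
proof -
  have "mass D I {k..k} \<le> (\<Sum>i\<in>I. if i = kidx k then 1 else 0)"
    unfolding mass_def
  proof (rule sum_mono)
    fix i assume i: "i \<in> I"
    have "{v. Key v i \<in> {k..k}} = {}" if "i \<noteq> kidx k" using that by (cases k) auto
    then show "measure (D i) {v. Key v i \<in> {k..k}} \<le> (if i = kidx k then 1 else 0)"
      using prob_space.prob_le_1[OF assms(2)[OF i]] by auto
  qed
  also have "\<dots> \<le> 1" using assms(1) by (simp add: sum.delta)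
  finally show ?thesis .
qed

section \<open>Expected time with trained data structures\<close>

lemma perm_entropy_nonneg:
  assumes D: "coordinate_laws n D"
  shows "0 \<le> perm_entropy n D"
proof -
  interpret prob_space "input_law n D" by (rule prob_space_input_law[OF D])
  show ?thesis
    unfolding perm_entropy_eq_sum[OF D]
  proof (intro sum_nonneg mult_nonneg_nonneg)
    fix \<pi>
    let ?P = "prob (rank_perm n -` {\<pi>} \<inter> space (input_law n D))"
    show "0 \<le> log 2 (1 / ?P)"
    proof (cases "?P = 0")
      case False
      then have "0 < ?P" "?P \<le> 1" by (simp_all add: zero_less_measure_iff)
      then show ?thesis by (simp add: zero_le_log_cancel_iff)
    qed (simp add: log_def)
  qed simp
qed

lemma limiting_time:
  assumes n: "1 \<le> n" and q: "1 \<le> q" and D: "coordinate_laws n D"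
  shows "training_failure_le (self_sorter q) (training q n) n D
     (40000 * real q * (real n + perm_entropy n D)) (1 / real n)"
proof -
  interpret alg n "4 * q + 60" "capacity (self_sorter q) n" "batch n" "samples q n" "lg n"
     "bound q n" "Suc n ^ (4 * q + 60)" "4 * q"
    by (rule alg_self_sorter[OF n])
  interpret M: prob_space "input_law n D" by (rule prob_space_input_law[OF D])
  let ?T = "training q n" and ?S = "sample_round ` {..<samples q n}" and ?K = "lg n div (4 * q)"
  have Dn: "prob_space (D i)" "sets (D i) = sets borel" if "i < n" for i
    using D that by (auto simp: coordinate_laws_def)
  have ST: "?S \<subseteq> {..<?T}"
  proof
    fix r assume "r \<in> ?S"
    then obtain t where t: "t < samples q n" "r = sample_round t" by auto
    then have "r < sample_round (samples q n)" using sample_round_less[of t "samples q n"] by linarith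
    then show "r \<in> {..<?T}" by (simp add: sample_round_def training_def)
  qed
  have "card ?S = 32 * 2 ^ ?K * lg n" using card_image[OF inj_sample_round] by (simp add: samples_def)
  moreover have "{..<batch n} \<subseteq> {..<?T}" by (auto simp: training_def)
  moreover have "card {..<batch n} = 4 * lg n" by (simp add: batch_def)
  ultimately have "\<exists>F\<in>sets (inputs_law ?T n D). measure (inputs_law ?T n D) F \<le> 1 / real n \<and>
    (\<forall>J\<in>space (inputs_law ?T n D) - F.
      (\<forall>A. key_measurable A \<longrightarrow> convex_keys A \<longrightarrow> 12 \<le> mass D {..<n} A \<longrightarrow>
         real (card {..<batch n}) < real (hits J {..<batch n} {..<n} A)) \<and>
      (\<forall>i<n. \<forall>l\<le>?K. \<forall>A. key_measurable A \<longrightarrow> convex_keys A \<longrightarrow> 3 * (1 / 2) ^ l \<le> mass D {i} A \<longrightarrow>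
         real (card ?S) * (1 / 2) ^ l / 4 < real (hits J ?S {i} A)))"
    by (intro good_training[OF D lg n div_le_dividend _ _ ST])
  then obtain F where F: "F \<in> sets (inputs_law ?T n D)" "measure (inputs_law ?T n D) F \<le> 1 / real n"
    and good: "\<forall>J\<in>space (inputs_law ?T n D) - F.
      (\<forall>A. key_measurable A \<longrightarrow> convex_keys A \<longrightarrow> 12 \<le> mass D {..<n} A \<longrightarrow>
         real (card {..<batch n}) < real (hits J {..<batch n} {..<n} A)) \<and>
      (\<forall>i<n. \<forall>l\<le>?K. \<forall>A. key_measurable A \<longrightarrow> convex_keys A \<longrightarrow> 3 * (1 / 2) ^ l \<le> mass D {i} A \<longrightarrow>
         real (card ?S) * (1 / 2) ^ l / 4 < real (hits J ?S {i} A))"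
    by (elim bexE conjE) (rule that)
  have lim: "limiting_time_le (self_sorter q) n D (store (self_sorter q) n J ?T)
      (40000 * real q * (real n + perm_entropy n D))" if J: "J \<in> space (inputs_law ?T n D) - F" for J
  proof -
    define p where "p = store (self_sorter q) n J ?T"
    define L where "L = lkey p"
    note tr = self_sorter_trained[where J = J and q = q, OF n, folded p_def]
    have srt: "vsorted L" unfolding L_def by (rule merged_vsorted[OF tr(1)])
    have goodV: "real (card {..<batch n}) < real (hits J {..<batch n} {..<n} A)"
      if "key_measurable A" "convex_keys A" "12 \<le> mass D {..<n} A" for A
      using bspec[OF good J, THEN conjunct1, THEN spec, THEN mp, OF that(1), THEN mp, OF that(2), THEN mp, OF that(3)] .
    have goodS: "real (card ?S) * (1 / 2) ^ l / 4 < real (hits J ?S {i} A)"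
      if "i < n" "l \<le> ?K" "key_measurable A" "convex_keys A" "3 * (1 / 2) ^ l \<le> mass D {i} A" for i l A
      using bspec[OF good J, THEN conjunct2, THEN spec, THEN mp, OF that(1), THEN spec, THEN mp, OF that(2),
          THEN spec, THEN mp, OF that(3), THEN mp, OF that(4), THEN mp, OF that(5)] .
    let ?\<beta> = "bk L"
    let ?P = "bprob D ?\<beta>"
    note bucket = D mono_bk[of L] bk_le[of L] bucket_measurable[OF srt]
    \<comment> \<open>13 is composed of 12 for the interior of the bucket, three times the cell mass
      4, and 1 for the key on its lower boundary.\<close>
    have massB: "(\<Sum>j<n. ?P j b) \<le> 13" if b: "b \<le> n" for b
    proof -
      have "(\<Sum>j<n. ?P j b) = mass D {..<n} {k. ?\<beta> k = b}" by (simp add: mass_def bprob_def[OF bucket])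
      also have "\<dots> \<le> mass D {..<n} (bucket_open L b) + 1"
      proof (cases "b = 0")
        case True
        have "mass D {..<n} {k. ?\<beta> k = b} \<le> mass D {..<n} (bucket_open L b)"
        proof (rule mass_mono)
          show "{k. ?\<beta> k = b} \<subseteq> bucket_open L b"
            unfolding bucket_eq[OF srt b] bucket_open_def using True by simp
        qed (use Dn bucket_open_measurable in auto)
        then show ?thesis by linarith
      next
        case False
        let ?k = "L ((b - 1) * batch n)"
        have "mass D {..<n} {k. ?\<beta> k = b} \<le> mass D {..<n} (bucket_open L b \<union> {?k..?k})"
        proof (rule mass_mono)
          have "{?k..} \<subseteq> {?k<..} \<union> {?k..?k}"
          proof
            fix x assume "x \<in> {?k..}"
            then have "?k < x \<or> ?k = x" by (simp only: atLeast_iff le_less)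
            then show "x \<in> {?k<..} \<union> {?k..?k}" by (elim disjE) simp_all
          qed
          then show "{k. ?\<beta> k = b} \<subseteq> bucket_open L b \<union> {?k..?k}"
            unfolding bucket_eq[OF srt b] bucket_open_def if_not_P[OF False] by blast
          show "key_measurable (bucket_open L b \<union> {?k..?k})"
            by (rule key_measurable_Un[OF bucket_open_measurable key_measurable_intros(5)])
        qed (use Dn in auto)
        also have "\<dots> = mass D {..<n} (bucket_open L b) + mass D {..<n} {?k..?k}"
        proof (rule mass_Un)
          show "bucket_open L b \<inter> {?k..?k} = {}" using False by (simp add: bucket_open_def)
          show "key_measurable {?k..?k}" by (rule key_measurable_intros(5))
        qed (use Dn bucket_open_measurable in auto)
        also have "mass D {..<n} {?k..?k} \<le> 1" by (rule mass_point_le) (use Dn in auto)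
        finally show ?thesis by linarith
      qed
      also have "mass D {..<n} (bucket_open L b) < 12"
      proof (rule ccontr)
        assume "\<not> mass D {..<n} (bucket_open L b) < 12"
        then have "real (card {..<batch n}) < real (hits J {..<batch n} {..<n} (bucket_open L b))"
          by (intro goodV bucket_open_measurable bucket_open_convex) simp
        moreover have "hits J {..<batch n} {..<n} (bucket_open L b) \<le> batch n"
          unfolding L_def by (rule hits_bucket_open[OF tr(1) b])
        ultimately show False by simp
      qed
      finally show ?thesis by linarith
    qed
    have cost: "real (search_cost p i b) * ?P i b \<le> 1600 * real q * (log 2 (1 / ?P i b) * ?P i b + 4 * ?P i b)"
      if i: "i < n" for i b
    proof (cases "?P i b = 0")
      case False
      interpret Di: prob_space "D i" by (rule Dn(1)[OF i])
      have P: "0 < ?P i b" "?P i b \<le> 1" using False by (simp_all add: bprob_def[OF bucket] zero_less_measure_iff)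
      have "real (search_cost p i b) \<le> 1600 * real q * (log 2 (1 / ?P i b) + 4)"
      proof (rule search_cost_le[OF P refl q])
        fix l assume l: "l \<le> ?K" "3 * (1 / 2) ^ l \<le> ?P i b"
        have "real (card ?S) * (1 / 2) ^ l / 4 < real (hits J ?S {i} {k. ?\<beta> k = b})"
          by (rule goodS[OF i l(1) bucket_measurable[OF srt] bucket_convex])
            (use l(2) in \<open>simp add: mass_def bprob_def[OF bucket]\<close>)
        then show "real (samples q n) * (1 / 2) ^ l / 4 < real (card {a. a < samples q n \<and> row p i a = b})"
          unfolding L_def hits_bucket[OF tr(2) i] by (simp add: card_image[OF inj_sample_round])
      qed
      then have "real (search_cost p i b) * ?P i b \<le> 1600 * real q * (log 2 (1 / ?P i b) + 4) * ?P i b"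
        using P by (intro mult_right_mono) auto
      then show ?thesis by (simp add: algebra_simps)
    qed simp
    let ?pairs = "\<lambda>x. real (\<Sum>i<n. card {j. j < n \<and> ?\<beta> (xkey x j) = ?\<beta> (xkey x i)})"
    let ?G = "\<lambda>x. 2000 * real n + (\<Sum>i<n. real (search_cost p i (?\<beta> (xkey x i)))) + 2000 * ?pairs x"
    have bound: "real (run_time (self_sorter q) n p x) \<le> ?G x" for x
    proof -
      have "run_time (self_sorter q) n p x \<le> stationary_time p x" by (rule tr(3))
      also have "\<dots> \<le> 2000 * n + (\<Sum>i<n. search_cost p i (?\<beta> (xkey x i))) +
          2000 * (\<Sum>i<n. card {j. j < n \<and> ?\<beta> (xkey x j) = ?\<beta> (xkey x i)})"
        unfolding stationary_time_def search_cost_def L_def ct_def by simp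
      finally have "real (run_time (self_sorter q) n p x) \<le> real (2000 * n + (\<Sum>i<n. search_cost p i (?\<beta> (xkey x i))) +
          2000 * (\<Sum>i<n. card {j. j < n \<and> ?\<beta> (xkey x j) = ?\<beta> (xkey x i)}))" by (rule of_nat_mono)
      then show ?thesis by simp
    qed
    have meas: "run_time (self_sorter q) n p \<in> input_law n D \<rightarrow>\<^sub>M count_space UNIV"
      by (rule run_time_measurable[OF D]) (use finite_reals_store[OF n] tr(4) in \<open>auto simp: p_def\<close>)
    have measr: "(\<lambda>x. real (run_time (self_sorter q) n p x)) \<in> borel_measurable (input_law n D)"
      by (rule measurable_compose[OF meas]) simp
    have int: "integrable (input_law n D) (\<lambda>x. real (run_time (self_sorter q) n p x))"
    proof (rule M.integrable_const_bound[OF _ measr, where B = "real (4000 * (n * (lg n + 1)))"])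
      have "run_time (self_sorter q) n p x \<le> 4000 * (n * (lg n + 1))" for x
        using tr(3)[of x] stationary_time_le[of p x] by linarith
      then have "norm (real (run_time (self_sorter q) n p x)) \<le> real (4000 * (n * (lg n + 1)))" for x
        by (simp only: real_norm_def abs_of_nat of_nat_le_iff)
      then show "AE x in input_law n D. norm (real (run_time (self_sorter q) n p x)) \<le> real (4000 * (n * (lg n + 1)))"
        by simp
    qed
    have ints: "integrable (input_law n D) (\<lambda>x. real (search_cost p i (?\<beta> (xkey x i))))" if "i < n" for i
      by (rule expectation_bucket(1)[OF bucket that])
    have intS: "integrable (input_law n D) (\<lambda>x. \<Sum>i<n. real (search_cost p i (?\<beta> (xkey x i))))"
      by (rule Bochner_Integration.integrable_sum) (use ints in simp)
    note pairs = expected_pairs[OF bucket massB]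
    have intG: "integrable (input_law n D) ?G"
      by (intro Bochner_Integration.integrable_add integrable_mult_right intS pairs(1)) simp
    have "(\<integral>x. real (run_time (self_sorter q) n p x) \<partial>input_law n D) \<le> (\<integral>x. ?G x \<partial>input_law n D)"
      by (rule integral_mono[OF int intG bound])
    also have "\<dots> = 2000 * real n + (\<integral>x. (\<Sum>i<n. real (search_cost p i (?\<beta> (xkey x i)))) \<partial>input_law n D) +
        2000 * (\<integral>x. ?pairs x \<partial>input_law n D)"
      using intS pairs(1) by (simp add: M.prob_space del: of_nat_sum)
    also have "(\<integral>x. (\<Sum>i<n. real (search_cost p i (?\<beta> (xkey x i)))) \<partial>input_law n D) =
        (\<Sum>i<n. \<integral>x. real (search_cost p i (?\<beta> (xkey x i))) \<partial>input_law n D)"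
      by (rule Bochner_Integration.integral_sum) (use ints in simp)
    also have "\<dots> = (\<Sum>i<n. \<Sum>b\<le>n. real (search_cost p i b) * ?P i b)"
      by (rule sum.cong[OF refl]) (use expectation_bucket(2)[OF bucket] in simp)
    also have "\<dots> \<le> (\<Sum>i<n. \<Sum>b\<le>n. 1600 * real q * (log 2 (1 / ?P i b) * ?P i b + 4 * ?P i b))"
      by (intro sum_mono) (use cost in simp)
    also have "\<dots> = 1600 * real q * ((\<Sum>i<n. \<Sum>b\<le>n. log 2 (1 / ?P i b) * ?P i b) + 4 * (\<Sum>i<n. \<Sum>b\<le>n. ?P i b))"
      by (simp add: sum.distrib sum_distrib_left distrib_left)
    also have "(\<Sum>i<n. \<Sum>b\<le>n. ?P i b) = real n" using sum_bprob[OF bucket] by simp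
    also have "1600 * real q * ((\<Sum>i<n. \<Sum>b\<le>n. log 2 (1 / ?P i b) * ?P i b) + 4 * real n) \<le>
        1600 * real q * ((perm_entropy n D + 2 * real n) + 4 * real n)"
      by (intro mult_left_mono add_right_mono bucket_entropy[OF bucket]) simp
    also have "2000 * (\<integral>x. ?pairs x \<partial>input_law n D) \<le> 2000 * ((1 + 13) * real n)"
      by (intro mult_left_mono pairs(2)) simp_all
    finally have E: "(\<integral>x. real (run_time (self_sorter q) n p x) \<partial>input_law n D) \<le>
        2000 * real n + 1600 * real q * ((perm_entropy n D + 2 * real n) + 4 * real n) + 2000 * ((1 + 13) * real n)"
      by simp
    \<comment> \<open>The coefficient of \<open>n\<close> is \<open>30000 + 9600 * q\<close>, which
      is at most \<open>39600 * q\<close>.\<close>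
    also have "\<dots> \<le> 40000 * real q * (real n + perm_entropy n D)"
    proof -
      have "1 * real n \<le> real q * real n" using q by (intro mult_right_mono) auto
      moreover have "0 \<le> real q * perm_entropy n D" using perm_entropy_nonneg[OF D] by simp
      ultimately show ?thesis by (simp add: algebra_simps)
    qed
    finally show ?thesis using int unfolding limiting_time_le_def p_def by simp
  qed
  show ?thesis
    unfolding training_failure_le_def
  proof (intro bexI[OF _ F(1)] conjI F(2) subsetI)
    fix J
    assume J: "J \<in> {J \<in> space (inputs_law ?T n D). \<not> limiting_time_le (self_sorter q) n D
      (store (self_sorter q) n J ?T) (40000 * real q * (real n + perm_entropy n D))}"
    show "J \<in> F"
    proof (rule ccontr)
      assume "J \<notin> F"
      then have "J \<in> space (inputs_law ?T n D) - F" using J by simp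
      then show False using lim[of J] J by simp
    qed
  qed
qed

lemma training_failure_le_mono:
  assumes "training_failure_le A T n D B q" "B \<le> B'"
  shows "training_failure_le A T n D B' q"
proof -
  have "limiting_time_le A n D p B'" if "limiting_time_le A n D p B" for p
    using that assms(2) unfolding limiting_time_le_def by (auto intro: order_trans)
  then have "{J \<in> space (inputs_law T n D). \<not> limiting_time_le A n D (store A n J T) B'} \<subseteq>
      {J \<in> space (inputs_law T n D). \<not> limiting_time_le A n D (store A n J T) B}" by auto
  then show ?thesis using assms(1) unfolding training_failure_le_def by (meson order_trans)
qed

theorem theorem1p1:
  shows
    "(\<exists>(A :: algorithm) (T :: nat \<Rightarrow> nat) (C :: real).
        self_improving_sorter A T \<and>
        (\<forall>n\<ge>2. worst_case_time_le A n (C * (real n * log 2 (real n)))) \<and>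
        (\<forall>n\<ge>1. \<forall>D. coordinate_laws n D \<longrightarrow>
           training_failure_le A (T n) n D (C * (real n + perm_entropy n D)) (1 / real n)))
     \<and>
     (\<forall>(n :: nat) D (t :: (nat \<Rightarrow> real, nat list) ctree).
        coordinate_laws n D \<and> computes t (space (input_law n D)) (rank_perm n) \<longrightarrow>
        ennreal (perm_entropy n D) \<le> expected_depth (input_law n D) t)
     \<and>
     (\<exists>C :: real. \<forall>\<epsilon> :: real. \<epsilon> > 0 \<longrightarrow>
        (\<exists>(A :: algorithm) (T :: nat \<Rightarrow> nat) (K :: real).
           self_improving_sorter A T \<and>
           (\<forall>n\<ge>2. worst_case_time_le A n (K * (real n * log 2 (real n)))) \<and>
           (\<forall>n\<ge>1. real (storage A n) \<le> K * real n powr (1 + \<epsilon>)) \<and>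
           (\<forall>n\<ge>1. real (T n) \<le> K * real n powr \<epsilon>) \<and>
           (\<forall>n\<ge>1. \<forall>D. coordinate_laws n D \<longrightarrow>
              training_failure_le A (T n) n D
                (C * (max 1 (1 / \<epsilon>) * (real n + perm_entropy n D))) (1 / real n))))"
proof (intro conjI)
  have "training_failure_le (self_sorter 1) (training 1 n) n D (40000 * (real n + perm_entropy n D)) (1 / real n)"
    if "1 \<le> n" "coordinate_laws n D" for n D
    using limiting_time[OF that(1) _ that(2), of 1] by simp
  then show "\<exists>(A :: algorithm) (T :: nat \<Rightarrow> nat) (C :: real).
        self_improving_sorter A T \<and>
        (\<forall>n\<ge>2. worst_case_time_le A n (C * (real n * log 2 (real n)))) \<and>
        (\<forall>n\<ge>1. \<forall>D. coordinate_laws n D \<longrightarrow>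
           training_failure_le A (T n) n D (C * (real n + perm_entropy n D)) (1 / real n))"
    using self_improving[of 1] worst_case[of _ 40000 1]
    by (intro exI[of _ "self_sorter 1"] exI[of _ "training 1"] exI[of _ 40000]) simp
next
  show "\<forall>(n :: nat) D (t :: (nat \<Rightarrow> real, nat list) ctree).
        coordinate_laws n D \<and> computes t (space (input_law n D)) (rank_perm n) \<longrightarrow>
        ennreal (perm_entropy n D) \<le> expected_depth (input_law n D) t"
    using entropy_le_expected_depth by blast
next
  show "\<exists>C :: real. \<forall>\<epsilon> :: real. \<epsilon> > 0 \<longrightarrow>
        (\<exists>(A :: algorithm) (T :: nat \<Rightarrow> nat) (K :: real).
           self_improving_sorter A T \<and>
           (\<forall>n\<ge>2. worst_case_time_le A n (K * (real n * log 2 (real n)))) \<and>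
           (\<forall>n\<ge>1. real (storage A n) \<le> K * real n powr (1 + \<epsilon>)) \<and>
           (\<forall>n\<ge>1. real (T n) \<le> K * real n powr \<epsilon>) \<and>
           (\<forall>n\<ge>1. \<forall>D. coordinate_laws n D \<longrightarrow>
              training_failure_le A (T n) n D
                (C * (max 1 (1 / \<epsilon>) * (real n + perm_entropy n D))) (1 / real n)))"
  proof (intro exI[of _ 80000] allI impI)
    fix \<epsilon> :: real assume \<epsilon>: "0 < \<epsilon>"
    \<comment> \<open>The least integer with \<open>1 / q \<le> \<epsilon>\<close>. It is 1 for
      large \<epsilon>, whence \<open>max 1 (1 / \<epsilon>)\<close>, and rounding up costs at most
      a factor 2, which turns 40000 into 80000.\<close>
    define q where "q = nat \<lceil>1 / \<epsilon>\<rceil>"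
    have q0: "1 / \<epsilon> \<le> real q" unfolding q_def by (rule real_nat_ceiling_ge)
    have "0 < 1 / \<epsilon>" using \<epsilon> by simp
    then have q: "1 \<le> q" using q0 by (cases q) auto
    have "real q \<le> 1 / \<epsilon> + 1" unfolding q_def using \<open>0 < 1 / \<epsilon>\<close> by linarith
    then have q2: "real q \<le> 2 * max 1 (1 / \<epsilon>)" by linarith
    have qe: "1 / real q \<le> \<epsilon>" using q0 q \<epsilon> by (simp add: field_simps)
    define K1 where "K1 = 40 * (70 * (1 + 8 * real q) + 8)"
    define K2 where "K2 = 4 * (1 + 8 * real q) + (64 * (1 + 8 * real q))\<^sup>2"
    define K where "K = 12000 + K1 + K2"
    have K: "12000 \<le> K" "K1 \<le> K" "K2 \<le> K" by (simp_all add: K_def K1_def K2_def)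
    have pw: "real n powr (1 / real q) \<le> real n powr \<epsilon>" if "1 \<le> n" for n
      using that qe by (intro powr_mono) auto
    show "\<exists>(A :: algorithm) (T :: nat \<Rightarrow> nat) (K :: real).
           self_improving_sorter A T \<and>
           (\<forall>n\<ge>2. worst_case_time_le A n (K * (real n * log 2 (real n)))) \<and>
           (\<forall>n\<ge>1. real (storage A n) \<le> K * real n powr (1 + \<epsilon>)) \<and>
           (\<forall>n\<ge>1. real (T n) \<le> K * real n powr \<epsilon>) \<and>
           (\<forall>n\<ge>1. \<forall>D. coordinate_laws n D \<longrightarrow>
              training_failure_le A (T n) n D
                (80000 * (max 1 (1 / \<epsilon>) * (real n + perm_entropy n D))) (1 / real n))"
    proof (intro exI[of _ "self_sorter q"] exI[of _ "training q"] exI[of _ K] conjI allI impI)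
      show "self_improving_sorter (self_sorter q) (training q)" by (rule self_improving)
    next
      fix n :: nat assume "2 \<le> n"
      then show "worst_case_time_le (self_sorter q) n (K * (real n * log 2 (real n)))" by (rule worst_case) (rule K)
    next
      fix n :: nat assume n: "1 \<le> n"
      have "real (storage (self_sorter q) n) \<le> K1 * real n powr (1 + 1 / real q)"
        unfolding K1_def by (rule storage_le[OF n q])
      also have "\<dots> \<le> K * real n powr (1 + \<epsilon>)"
        using K n qe by (intro mult_mono powr_mono) auto
      finally show "real (storage (self_sorter q) n) \<le> K * real n powr (1 + \<epsilon>)" .
      have "real (training q n) \<le> K2 * real n powr (1 / real q)"
        unfolding K2_def by (rule training_le[OF n q])
      also have "\<dots> \<le> K * real n powr \<epsilon>" using K pw[OF n] by (intro mult_mono) auto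
      finally show "real (training q n) \<le> K * real n powr \<epsilon>" .
    next
      fix n :: nat and D assume n: "1 \<le> n" and D: "coordinate_laws n D"
      have "40000 * real q * (real n + perm_entropy n D) \<le> 80000 * (max 1 (1 / \<epsilon>) * (real n + perm_entropy n D))"
        using mult_right_mono[OF q2, of "real n + perm_entropy n D"] perm_entropy_nonneg[OF D] by simp
      then show "training_failure_le (self_sorter q) (training q n) n D
                (80000 * (max 1 (1 / \<epsilon>) * (real n + perm_entropy n D))) (1 / real n)"
        by (rule training_failure_le_mono[OF limiting_time[OF n q D]])
    qed
  qed
qed

end
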